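(* Let $\mathcal{I}$ be a quasi-convex definition of energy. Then the corresponding definition of area $\mu^{\mathcal{I}}$ is quasi-convex as well.
   Context: $D\subset\mathbb{R}^2$ is the open Euclidean unit disc, $S^1$ its boundary. $\mathfrak{S}_2$ is the space of seminorms on $\mathbb{R}^2$ with distance $d(s,s')=\max_{v\in S^1}|s(v)-s'(v)|$; $s_0$ is the Euclidean norm. A definition of energy is a continuous map $\mathcal{I}:\mathfrak{S}_2\to[0,\infty)$ such that: (1) $\mathcal{I}(s)\ge\mathcal{I}(s')$ whenever $s\ge s'$; (2) $\mathcal{I}(\lambda s)=\lambda^2\mathcal{I}(s)$ for $\lambda\ge0$; (3) $\mathcal{I}(s\circ T)=\mathcal{I}(s)$ for $T\in\mathrm{SO}_2$; (4) $\mathcal{I}^{-1}([0,1])$ is compact. The corresponding definition of area $\mu^{\mathcal{I}}$ is given by its Jacobian $\mathbf{J}^{\mathcal{I}}(s)=\lambda_{\mathcal{I}}\cdot\hat J(s)$, where $\hat J(s)=\inf\{\mathcal{I}(s\circ T): T\in\mathrm{SL}_2\}$ and $\lambda_{\mathcal{I}}=1/\hat J(s_0)$. Let $Y$ be a finite-dimensional normed space with norm $|\cdot|$. For a smooth map $\psi:\bar D\to Y$ and $z\in D$ let $s_z(v)=|D_z\psi(v)|$, a seminorm on $\mathbb{R}^2$; put $E_{\mathcal{I}}(\psi)=\int_D\mathcal{I}(s_z)\,dz$ and $\operatorname{Area}_{\mu^{\mathcal{I}}}(\psi)=\int_D\mathbf{J}^{\mathcal{I}}(s_z)\,dz$. The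 definition of energy $\mathcal{I}$ (resp. the definition of area $\mu^{\mathcal{I}}$) is quasi-convex if for every finite-dimensional normed space $Y$, every linear map $L:\mathbb{R}^2\to Y$, and every smooth immersion $\psi:\bar D\to Y$ with $\psi|_{\partial D}=L|_{\partial D}$ one has $E_{\mathcal{I}}(L|_D)\le E_{\mathcal{I}}(\psi)$ (resp. $\operatorname{Area}_{\mu^{\mathcal{I}}}(L|_D)\le\operatorname{Area}_{\mu^{\mathcal{I}}}(\psi)$). *)

theory Defs
  imports "HOL-Analysis.Analysis"
begin

subsection \<open>Seminorms on the plane\<close>

definition seminorms :: "(real^2 \<Rightarrow> real) set" where
  "seminorms = {s. (\<forall>v. 0 \<le> s v) \<and> (\<forall>c v. s (c *\<^sub>R v) = \<bar>c\<bar> * s v) \<and>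
                   (\<forall>v w. s (v + w) \<le> s v + s w)}"

text \<open>The supremum over the unit circle is a maximum, see \<open>seminorm_dist_attained\<close> below.
  Outside \<^const>\<open>seminorms\<close> the distance is set to 0 because the library's \<open>Metric_space\<close> wants a
  function that is nonnegative everywhere.\<close>

definition seminorm_dist :: "(real^2 \<Rightarrow> real) \<Rightarrow> (real^2 \<Rightarrow> real) \<Rightarrow> real" where
  "seminorm_dist s s' =
     (if s \<in> seminorms \<and> s' \<in> seminorms then SUP v\<in>sphere 0 1. \<bar>s v - s' v\<bar> else 0)"

lemma seminorm_continuous:
  assumes "s \<in> seminorms" shows "continuous_on A s"
proof -
  have "convex_on UNIV s"
  proof (rule convex_onI)
    fix t x y assume t: "0 < (t::real)" "t < 1"
    have hom: "s (c *\<^sub>R v) = \<bar>c\<bar> * s v" and add: "s (v + w) \<le> s v + s w" for c v w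
      using assms by (auto simp: seminorms_def)
    show "s ((1 - t) *\<^sub>R x + t *\<^sub>R y) \<le> (1 - t) * s x + t * s y"
      using add[of "(1 - t) *\<^sub>R x" "t *\<^sub>R y"] t unfolding hom by simp
  qed simp
  then have "continuous_on UNIV s"
    by (intro convex_on_continuous) auto
  then show ?thesis
    by (rule continuous_on_subset) simp
qed

lemma unit_circle_nonempty: "sphere (0::real^2) 1 \<noteq> {}"
  by simp

lemma seminorm_dist_attained:
  assumes "s \<in> seminorms" "s' \<in> seminorms"
  shows "\<exists>v\<in>sphere 0 1. seminorm_dist s s' = \<bar>s v - s' v\<bar> \<and>
           (\<forall>w\<in>sphere 0 1. \<bar>s w - s' w\<bar> \<le> \<bar>s v - s' v\<bar>)"
proof -
  have "continuous_on (sphere 0 1) (\<lambda>v. \<bar>s v - s' v\<bar>)"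
    by (intro continuous_intros seminorm_continuous assms)
  then obtain v where v: "v \<in> sphere 0 1" "\<forall>w\<in>sphere 0 1. \<bar>s w - s' w\<bar> \<le> \<bar>s v - s' v\<bar>"
    using continuous_attains_sup[OF compact_sphere unit_circle_nonempty] by blast
  then have "(SUP v\<in>sphere 0 1. \<bar>s v - s' v\<bar>) = \<bar>s v - s' v\<bar>"
    by (intro cSup_eq_maximum) auto
  then show ?thesis using v assms by (auto simp: seminorm_dist_def)
qed

lemma seminorm_eq_if_eq_on_circle:
  assumes "s \<in> seminorms" "s' \<in> seminorms" "\<forall>v\<in>sphere 0 1. s v = s' v"
  shows "s = s'"
proof
  fix v :: "real^2"
  have hom: "s (c *\<^sub>R u) = \<bar>c\<bar> * s u" "s' (c *\<^sub>R u) = \<bar>c\<bar> * s' u" for c u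
    using assms by (auto simp: seminorms_def)
  show "s v = s' v"
  proof (cases "v = 0")
    case True
    then show ?thesis using hom[of 0 0] by simp
  next
    case False
    have "s (sgn v) = s' (sgn v)" using False assms(3) by (auto simp: norm_sgn)
    then have "s (norm v *\<^sub>R sgn v) = s' (norm v *\<^sub>R sgn v)" unfolding hom by simp
    then show ?thesis using False by (simp add: sgn_div_norm)
  qed
qed

interpretation S2: Metric_space seminorms seminorm_dist
proof
  fix s s' :: "real^2 \<Rightarrow> real"
  show "0 \<le> seminorm_dist s s'"
  proof (cases "s \<in> seminorms \<and> s' \<in> seminorms")
    case True
    then obtain v where "seminorm_dist s s' = \<bar>s v - s' v\<bar>"
      using seminorm_dist_attained by blast
    then show ?thesis by simp
  qed (auto simp: seminorm_dist_def)
  show "seminorm_dist s s' = seminorm_dist s' s"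
    by (auto simp: seminorm_dist_def abs_minus_commute)
next
  fix s s' assume s: "s \<in> seminorms" "s' \<in> seminorms"
  obtain v where v: "seminorm_dist s s' = \<bar>s v - s' v\<bar>"
      "\<forall>w\<in>sphere 0 1. \<bar>s w - s' w\<bar> \<le> \<bar>s v - s' v\<bar>"
    using seminorm_dist_attained[OF s] by blast
  show "seminorm_dist s s' = 0 \<longleftrightarrow> s = s'"
  proof
    assume "seminorm_dist s s' = 0"
    then have "\<forall>w\<in>sphere 0 1. s w = s' w" using v by simp
    then show "s = s'" by (rule seminorm_eq_if_eq_on_circle[OF s])
  qed (use v(1) in simp)
next
  fix s s' s'' assume s: "s \<in> seminorms" "s' \<in> seminorms" "s'' \<in> seminorms"
  obtain v where v: "v \<in> sphere 0 1" "seminorm_dist s s'' = \<bar>s v - s'' v\<bar>"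
    using seminorm_dist_attained[OF s(1,3)] by blast
  have "\<bar>s v - s' v\<bar> \<le> seminorm_dist s s'" "\<bar>s' v - s'' v\<bar> \<le> seminorm_dist s' s''"
    using v(1) seminorm_dist_attained[OF s(1,2)] seminorm_dist_attained[OF s(2,3)] by metis+
  then show "seminorm_dist s s'' \<le> seminorm_dist s s' + seminorm_dist s' s''"
    using v(2) by linarith
qed

subsection \<open>Definitions of energy and the corresponding Jacobians\<close>

text \<open>Only the values of \<open>I\<close> on \<^const>\<open>seminorms\<close> matter in what follows.\<close>

definition definition_of_energy :: "((real^2 \<Rightarrow> real) \<Rightarrow> real) \<Rightarrow> bool" where
  "definition_of_energy I \<longleftrightarrow>
     continuous_map S2.mtopology (top_of_set {0..}) I \<and>
     (\<forall>s\<in>seminorms. \<forall>s'\<in>seminorms. (\<forall>v. s' v \<le> s v) \<longrightarrow> I s' \<le> I s) \<and>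
     (\<forall>s\<in>seminorms. \<forall>c\<ge>0. I (\<lambda>v. c * s v) = c\<^sup>2 * I s) \<and>
     (\<forall>s\<in>seminorms. \<forall>T::real^2^2. rotation_matrix T \<longrightarrow> I (\<lambda>v. s (T *v v)) = I s) \<and>
     compactin S2.mtopology {s \<in> seminorms. I s \<in> {0..1}}"

definition reduced_jacobian :: "((real^2 \<Rightarrow> real) \<Rightarrow> real) \<Rightarrow> (real^2 \<Rightarrow> real) \<Rightarrow> real" where
  "reduced_jacobian I s = Inf {I (\<lambda>v. s (T *v v)) | T::real^2^2. det T = 1}"

definition area_jacobian :: "((real^2 \<Rightarrow> real) \<Rightarrow> real) \<Rightarrow> (real^2 \<Rightarrow> real) \<Rightarrow> real" where
  "area_jacobian I s = (1 / reduced_jacobian I norm) * reduced_jacobian I s"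

subsection \<open>Finite-dimensional normed spaces and smooth maps\<close>

text \<open>Quasi-convexity quantifies over all finite-dimensional normed spaces, of every dimension, inside
  a formula, so these spaces cannot be types.  Such a space is taken to be \<open>\<real>\<^sup>n\<close> with an
  arbitrary norm \<open>N\<close>, where \<open>\<real>\<^sup>n\<close> consists of the sequences that vanish from index \<open>n\<close> on.\<close>

definition Rn :: "nat \<Rightarrow> (nat \<Rightarrow> real) set" where
  "Rn n = {y. \<forall>i\<ge>n. y i = 0}"

definition norm_on_Rn :: "nat \<Rightarrow> ((nat \<Rightarrow> real) \<Rightarrow> real) \<Rightarrow> bool" where
  "norm_on_Rn n N \<longleftrightarrow>
     (\<forall>x\<in>Rn n. 0 \<le> N x \<and> (N x = 0 \<longleftrightarrow> x = (\<lambda>i. 0))) \<and>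
     (\<forall>x\<in>Rn n. \<forall>c. N (\<lambda>i. c * x i) = \<bar>c\<bar> * N x) \<and>
     (\<forall>x\<in>Rn n. \<forall>y\<in>Rn n. N (\<lambda>i. x i + y i) \<le> N x + N y)"

definition linear_Rn :: "nat \<Rightarrow> (real^2 \<Rightarrow> nat \<Rightarrow> real) \<Rightarrow> bool" where
  "linear_Rn n L \<longleftrightarrow> (\<forall>z. L z \<in> Rn n) \<and> (\<forall>i. linear (\<lambda>z. L z i))"

primrec Ck_on :: "nat \<Rightarrow> (real^2 \<Rightarrow> real) \<Rightarrow> (real^2) set \<Rightarrow> bool" where
  "Ck_on 0 f U \<longleftrightarrow> continuous_on U f"
| "Ck_on (Suc k) f U \<longleftrightarrow>
     (\<forall>x\<in>U. f differentiable (at x)) \<and>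
     (\<forall>v. Ck_on k (\<lambda>x. frechet_derivative f (at x) v) U)"

text \<open>Smoothness on the closed disc means smoothness on an open neighbourhood of it; the values
  of \<open>\<psi>\<close> away from that neighbourhood are irrelevant.  All norms on \<open>\<real>\<^sup>n\<close> are equivalent, so smoothness
  and derivatives can be taken coordinatewise.\<close>

definition smooth_on_disc :: "nat \<Rightarrow> (real^2 \<Rightarrow> nat \<Rightarrow> real) \<Rightarrow> bool" where
  "smooth_on_disc n \<psi> \<longleftrightarrow>
     (\<exists>U. open U \<and> cball 0 1 \<subseteq> U \<and> (\<forall>z\<in>U. \<psi> z \<in> Rn n) \<and> (\<forall>i k. Ck_on k (\<lambda>z. \<psi> z i) U))"

definition differential :: "(real^2 \<Rightarrow> nat \<Rightarrow> real) \<Rightarrow> real^2 \<Rightarrow> real^2 \<Rightarrow> nat \<Rightarrow> real" where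
  "differential \<psi> z v = (\<lambda>i. frechet_derivative (\<lambda>x. \<psi> x i) (at z) v)"

definition immersion_on_disc :: "nat \<Rightarrow> (real^2 \<Rightarrow> nat \<Rightarrow> real) \<Rightarrow> bool" where
  "immersion_on_disc n \<psi> \<longleftrightarrow>
     smooth_on_disc n \<psi> \<and> (\<forall>z\<in>cball 0 1. inj (differential \<psi> z))"

subsection \<open>Quasi-convexity\<close>

text \<open>For \<open>F\<close> a definition of energy this integral is the energy of \<open>\<psi>\<close>, for \<open>F\<close> the Jacobian of a
  definition of area it is the area.\<close>

definition disc_integral ::
    "((real^2 \<Rightarrow> real) \<Rightarrow> real) \<Rightarrow> ((nat \<Rightarrow> real) \<Rightarrow> real) \<Rightarrow> (real^2 \<Rightarrow> nat \<Rightarrow> real) \<Rightarrow> real" where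
  "disc_integral F N \<psi> = (LINT z:ball 0 1|lborel. F (\<lambda>v. N (differential \<psi> z v)))"

definition quasi_convex :: "((real^2 \<Rightarrow> real) \<Rightarrow> real) \<Rightarrow> bool" where
  "quasi_convex F \<longleftrightarrow>
     (\<forall>n N L \<psi>. norm_on_Rn n N \<longrightarrow> linear_Rn n L \<longrightarrow> immersion_on_disc n \<psi> \<longrightarrow>
        (\<forall>z\<in>sphere 0 1. \<psi> z = L z) \<longrightarrow> disc_integral F N L \<le> disc_integral F N \<psi>)"

end

theory Submission
  imports Defs "HOL-Complex_Analysis.Complex_Analysis" "HOL-Real_Asymp.Real_Asymp"
begin

text \<open>
  Reparametrizing a map with differential \<open>s\<close> by a homeomorphism \<open>f\<close> with Beltrami coefficient \<open>m\<close> turns its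
  energy density, per unit of area in the old domain, into \<open>qd s (- m)\<close>, and the infimum of \<open>qd s\<close> over all
  coefficients is the area density \<open>jac s\<close>.  Given \<open>\<psi>\<close> with boundary values \<open>L\<close>, let \<open>T\<close> be linear of
  determinant 1 such that the energy of \<open>L \<circ> T\<close> equals its area, and let \<open>\<Omega>\<close> be the preimage of the
  disc under \<open>T\<close>.  Instead of solving the Beltrami equation, one composes finitely many explicit modifications
  of conformal maps on small discs, which by Vitali's covering theorem and Koebe distortion exhaust \<open>\<Omega>\<close>
  up to small area.  This yields a homeomorphism \<open>f\<close> of the plane, conformal off a compact subset of \<open>\<Omega>\<close> and
  tangent to the identity at infinity, for which the energy of \<open>\<psi> \<circ> T \<circ> inv f\<close> exceeds the area of \<open>\<psi>\<close> by at
  most \<open>\<epsilon>\<close>.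

  Extend \<open>\<psi> \<circ> T\<close> by \<open>L \<circ> T\<close> to the plane and compose with \<open>inv f\<close>.  On the circle of radius \<open>R\<close> one has
  \<open>inv f w = w + (\<alpha> / R\<^sup>2) * cnj w + O(1 / R\<^sup>2)\<close>, so up to a negligible correction the boundary values are again
  linear.  Quasi-convexity of the energy, extended from smooth immersions to Lipschitz maps, applied on the disc
  of radius \<open>R\<close> then gives the inequality for the areas as \<open>R\<close> tends to infinity.
\<close>

subsection \<open>Seminorms and energies on the complex plane\<close>

text \<open>Quasi-convexity speaks only of discs and linear boundary values, but \<open>f\<close>
  maps the domain neither onto a disc nor compatibly with linear boundary values. Near infinity both
  defects fade, since \<open>f\<close> is almost the identity there. The price is that energies on
  the disc of radius \<open>R\<close> grow like \<open>R^2\<close>, so every relative error has to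
  be o(1 / \<open>R^2\<close>). The term \<open>\<alpha> / w\<close> is linear on the circle and
  affects the energy in a controlled way, because \<open>L \<circ> T\<close> already minimizes the
  energy among its compositions with maps of determinant 1; the remaining correction costs a
  relative error of order \<open>1 / R^3\<close>.

  Polynomial kernels produce polynomials, whose smoothness is immediate, and two additional
  coordinates of small weight turn every polynomial map into an immersion.

  Near-minimizing coefficients need not depend continuously on the point. They are therefore kept
  constant up to a small rotation on each small disc, which is what modifying a conformal map on a
  disc achieves.\<close>

definition cseminorms :: "(complex \<Rightarrow> real) set" where
  "cseminorms = {s. (\<forall>v. 0 \<le> s v) \<and> (\<forall>c v. s (c *\<^sub>R v) = \<bar>c\<bar> * s v) \<and>
                    (\<forall>v w. s (v + w) \<le> s v + s w)}"

lemma cseminormsI: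
  assumes "\<And>v. 0 \<le> s v" "\<And>c v. s (c *\<^sub>R v) = \<bar>c\<bar> * s v" "\<And>v w. s (v + w) \<le> s v + s w"
  shows "s \<in> cseminorms"
  using assms by (auto simp: cseminorms_def)

lemma cseminorm_nonneg: "s \<in> cseminorms \<Longrightarrow> 0 \<le> s v"
  and cseminorm_scale: "s \<in> cseminorms \<Longrightarrow> s (c *\<^sub>R v) = \<bar>c\<bar> * s v"
  and cseminorm_add: "s \<in> cseminorms \<Longrightarrow> s (v + w) \<le> s v + s w"
  by (auto simp: cseminorms_def)

lemma cseminorm_scale_complex: "s \<in> cseminorms \<Longrightarrow> s (complex_of_real c * v) = \<bar>c\<bar> * s v"
  using cseminorm_scale[of s c v] by (simp add: scaleR_conv_of_real)

lemma cseminorm_zero: "s \<in> cseminorms \<Longrightarrow> s 0 = 0"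
  using cseminorm_scale[of s 0 0] by simp

lemma cseminorm_minus: "s \<in> cseminorms \<Longrightarrow> s (- v) = s v"
  using cseminorm_scale[of s "-1" v] by simp

lemma cseminorm_diff:
  assumes "s \<in> cseminorms" shows "\<bar>s v - s w\<bar> \<le> s (v - w)"
  using cseminorm_add[OF assms, of w "v - w"] cseminorm_add[OF assms, of v "w - v"]
    cseminorm_minus[OF assms, of "v - w"]
  by simp

lemma cseminorm_bound:
  assumes "s \<in> cseminorms" shows "s v \<le> (s 1 + s \<i>) * cmod v"
proof -
  have "s v = s (Re v *\<^sub>R 1 + Im v *\<^sub>R \<i>)"
    by (rule arg_cong[of _ _ s]) (simp add: complex_eq_iff)
  also have "\<dots> \<le> \<bar>Re v\<bar> * s 1 + \<bar>Im v\<bar> * s \<i>"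
    by (metis assms cseminorm_add cseminorm_scale)
  also have "\<dots> \<le> cmod v * s 1 + cmod v * s \<i>"
    by (intro add_mono mult_right_mono abs_Re_le_cmod abs_Im_le_cmod cseminorm_nonneg assms)
  finally show ?thesis by (simp add: algebra_simps)
qed

lemma cseminorm_linear:
  assumes "s \<in> cseminorms" "linear A" shows "(\<lambda>v. s (A v)) \<in> cseminorms"
  using assms by (auto simp: cseminorms_def linear_add linear_cmul)

lemma cseminorm_cmult: "0 \<le> c \<Longrightarrow> s \<in> cseminorms \<Longrightarrow> (\<lambda>v. c * s v) \<in> cseminorms"
  by (auto simp: cseminorms_def distrib_left[symmetric] intro: mult_left_mono)

lemma cseminorm_norm: "cmod \<in> cseminorms"
  by (auto simp: cseminorms_def norm_triangle_ineq)

lemma cseminorm_plus: "s \<in> cseminorms \<Longrightarrow> s' \<in> cseminorms \<Longrightarrow> (\<lambda>v. s v + s' v) \<in> cseminorms"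
  by (intro cseminormsI)
    (auto simp: cseminorm_nonneg cseminorm_scale distrib_left
      intro: order_trans[OF add_mono[OF cseminorm_add cseminorm_add]])

lemma linear_beltrami: "linear (\<lambda>v. a * v + b * cnj v)"
  by (auto intro!: linearI simp: algebra_simps)

lemma linear_beltrami': "linear (\<lambda>v. v + b * cnj v)"
  by (auto intro!: linearI simp: algebra_simps)

lemma cseminorm_beltrami:
  assumes "s \<in> cseminorms"
  shows "(\<lambda>v. s (v + b * cnj v)) \<in> cseminorms" "(\<lambda>v. s (a * v + b * cnj v)) \<in> cseminorms"
  by (rule cseminorm_linear[OF assms linear_beltrami'] cseminorm_linear[OF assms linear_beltrami])+

text \<open>Convergence at 1 and \<i> alone bounds the Lipschitz constants of all late
  \<open>X k\<close> by \<open>M\<close>, so it suffices to control a finite \<open>d\<close>-net of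
  the unit circle; homogeneity does the rest.\<close>

lemma cseminorm_uniform_convergence:
  assumes X: "\<And>k. X k \<in> cseminorms" and s: "s \<in> cseminorms"
    and lim: "\<And>v. (\<lambda>k. X k v) \<longlonglongrightarrow> s v" and "0 < e"
  shows "\<forall>\<^sub>F k in sequentially. \<forall>v. \<bar>X k v - s v\<bar> \<le> e * cmod v"
proof -
  define M where "M = s 1 + s \<i> + 1"
  have M1: "M \<ge> 1" using cseminorm_nonneg[OF s] by (simp add: M_def)
  have "(\<lambda>k. X k 1 + X k \<i>) \<longlonglongrightarrow> s 1 + s \<i>" by (intro tendsto_add lim)
  then have evM: "\<forall>\<^sub>F k in sequentially. X k 1 + X k \<i> < M"
    by (rule order_tendstoD) (simp add: M_def)
  define d where "d = e / (3 * M)"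
  have d: "d > 0" using M1 \<open>0 < e\<close> by (simp add: d_def)
  have "compact (sphere (0::complex) 1)" by simp
  then obtain K where K: "finite K" "K \<subseteq> sphere 0 1" "sphere (0::complex) 1 \<subseteq> (\<Union>x\<in>K. ball x d)"
    by (rule compactE_image[of _ "sphere 0 1" "\<lambda>x. ball x d"]) (use d in auto)
  have "\<forall>\<^sub>F k in sequentially. \<forall>x\<in>K. \<bar>X k x - s x\<bar> < e / 3"
  proof (intro eventually_ball_finite ballI K)
    fix x
    have "(\<lambda>k. \<bar>X k x - s x\<bar>) \<longlonglongrightarrow> \<bar>s x - s x\<bar>" by (intro tendsto_intros lim)
    then show "\<forall>\<^sub>F k in sequentially. \<bar>X k x - s x\<bar> < e / 3"
      by (rule order_tendstoD) (use \<open>0 < e\<close> in simp)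
  qed
  with evM show ?thesis
  proof eventually_elim
    case (elim k)
    have unit: "\<bar>X k v - s v\<bar> \<le> e" if "cmod v = 1" for v
    proof -
      from that K(3) obtain x where x: "x \<in> K" "dist x v < d" by (auto simp: subset_iff)
      then have xv: "cmod (v - x) \<le> d" by (simp add: dist_norm norm_minus_commute)
      have "\<bar>X k v - X k x\<bar> \<le> M * d"
        using cseminorm_diff[OF X, of k v x] cseminorm_bound[OF X, of k "v - x"] xv elim(1) M1 d
        by (smt (verit) mult_mono cseminorm_nonneg[OF X] norm_ge_zero)
      moreover have "\<bar>s v - s x\<bar> \<le> M * d"
        using cseminorm_diff[OF s, of v x] cseminorm_bound[OF s, of "v - x"] xv M1 d
        unfolding M_def
        by (smt (verit) mult_mono cseminorm_nonneg[OF s] norm_ge_zero)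
      moreover have "\<bar>X k x - s x\<bar> < e / 3" using elim(2) x by auto
      moreover have "M * d = e / 3" using M1 by (simp add: d_def)
      ultimately show ?thesis by linarith
    qed
    show ?case
    proof
      fix v show "\<bar>X k v - s v\<bar> \<le> e * cmod v"
      proof (cases "v = 0")
        case True then show ?thesis by (simp add: cseminorm_zero X s)
      next
        case False
        have "X k v = cmod v * X k (sgn v)" "s v = cmod v * s (sgn v)"
          using cseminorm_scale[OF X, of k "cmod v" "sgn v"] cseminorm_scale[OF s, of "cmod v" "sgn v"] False
          by (simp_all add: sgn_div_norm)
        then have "\<bar>X k v - s v\<bar> = cmod v * \<bar>X k (sgn v) - s (sgn v)\<bar>"
          by (metis abs_mult abs_norm_cancel right_diff_distrib)
        also have "\<dots> \<le> cmod v * e"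
          by (intro mult_left_mono unit) (use False in \<open>auto simp: norm_sgn\<close>)
        finally show ?thesis by (simp add: mult.commute)
      qed
    qed
  qed
qed

lemma cnorm_lower_bound:
  assumes s: "s \<in> cseminorms" and pos: "\<And>v. v \<noteq> 0 \<Longrightarrow> 0 < s v"
  obtains m where "m > 0" "\<And>v. m * cmod v \<le> s v"
proof -
  have "continuous_on (sphere 0 1) s"
  proof (rule continuous_onI)
    fix x e assume "x \<in> sphere (0::complex) 1" "(0::real) < e"
    define M where "M = s 1 + s \<i> + 1"
    have M: "M > 0" using cseminorm_nonneg[OF s] by (simp add: M_def add_nonneg_pos)
    have "dist (s y) (s x) \<le> e" if "dist y x < e / M" for y
    proof -
      have "\<bar>s y - s x\<bar> \<le> (s 1 + s \<i>) * cmod (y - x)"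
        using cseminorm_diff[OF s, of y x] cseminorm_bound[OF s, of "y - x"] by linarith
      also have "\<dots> \<le> M * cmod (y - x)" by (intro mult_right_mono) (auto simp: M_def)
      also have "\<dots> \<le> M * (e / M)" using that M by (intro mult_left_mono) (auto simp: dist_norm)
      finally show ?thesis using M by (simp add: dist_real_def)
    qed
    then show "\<exists>d>0. \<forall>x'\<in>sphere 0 1. dist x' x < d \<longrightarrow> dist (s x') (s x) \<le> e"
      using M \<open>0 < e\<close> by (intro exI[of _ "e / M"]) auto
  qed
  then obtain w where w: "w \<in> sphere 0 1" "\<And>v. v \<in> sphere 0 1 \<Longrightarrow> s w \<le> s v"
    using continuous_attains_inf[of "sphere 0 1" s] by auto
  show ?thesis
  proof
    show "s w > 0" using w(1) by (intro pos) auto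
    fix v show "s w * cmod v \<le> s v"
    proof (cases "v = 0")
      case False
      have "s v = cmod v * s (sgn v)"
        using cseminorm_scale[OF s, of "cmod v" "sgn v"] False by (simp add: sgn_div_norm)
      then show ?thesis using w(2)[of "sgn v"] False by (auto simp: norm_sgn)
    qed (simp add: cseminorm_zero s)
  qed
qed

lemma cseminorm_tendsto_compose:
  assumes X: "\<And>k. X k \<in> cseminorms" and s: "s \<in> cseminorms"
    and lim: "\<And>v. (\<lambda>k. X k v) \<longlonglongrightarrow> s v" and w: "w \<longlonglongrightarrow> w0"
  shows "(\<lambda>k. X k (w k)) \<longlonglongrightarrow> s w0"
proof -
  have "(\<lambda>k. X k (w k) - X k w0) \<longlonglongrightarrow> 0"
  proof (rule Lim_null_comparison)
    show "\<forall>\<^sub>F k in sequentially. norm (X k (w k) - X k w0) \<le> (X k 1 + X k \<i>) * cmod (w k - w0)"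
      using cseminorm_diff[OF X] cseminorm_bound[OF X]
      by (intro always_eventually allI) (metis order_trans real_norm_def)
    have "(\<lambda>k. (X k 1 + X k \<i>) * cmod (w k - w0)) \<longlonglongrightarrow> (s 1 + s \<i>) * cmod (w0 - w0)"
      by (intro tendsto_intros lim w)
    then show "(\<lambda>k. (X k 1 + X k \<i>) * cmod (w k - w0)) \<longlonglongrightarrow> 0" by simp
  qed
  from tendsto_add[OF this lim[of w0]] show ?thesis by simp
qed

lemma continuous_on_cseminorm_compose:
  fixes s :: "'x::metric_space \<Rightarrow> complex \<Rightarrow> real"
  assumes "\<And>x. x \<in> S \<Longrightarrow> s x \<in> cseminorms" "\<And>v. continuous_on S (\<lambda>x. s x v)"
    and "continuous_on S w"
  shows "continuous_on S (\<lambda>x. s x (w x))"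
  unfolding continuous_on_sequentially
proof (intro allI ballI impI, elim conjE)
  fix x a assume a: "a \<in> S" and x: "\<forall>n. x n \<in> S" "x \<longlonglongrightarrow> a"
  have "(\<lambda>n. s (x n) v) \<longlonglongrightarrow> s a v" "(\<lambda>n. w (x n)) \<longlonglongrightarrow> w a" for v
    using assms(2)[of v] assms(3) a x unfolding continuous_on_sequentially o_def by blast+
  show "((\<lambda>x. s x (w x)) \<circ> x) \<longlonglongrightarrow> s a (w a)"
    unfolding o_def
  proof (rule cseminorm_tendsto_compose[where X="\<lambda>n. s (x n)"])
    show "s (x n) \<in> cseminorms" for n using assms(1) x(1) by simp
    show "s a \<in> cseminorms" using assms(1) a .
  qed fact+
qed

text \<open>An energy in complex notation. Since \<open>c\<close> is an arbitrary complex number, \<open>conformal\<close> comprises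
  both the invariance under rotations and the homogeneity of degree two.\<close>

locale plane_energy =
  fixes J :: "(complex \<Rightarrow> real) \<Rightarrow> real"
  assumes nonneg: "s \<in> cseminorms \<Longrightarrow> 0 \<le> J s"
    and mono: "s \<in> cseminorms \<Longrightarrow> s' \<in> cseminorms \<Longrightarrow> (\<And>v. s' v \<le> s v) \<Longrightarrow> J s' \<le> J s"
    and conformal: "s \<in> cseminorms \<Longrightarrow> J (\<lambda>v. s (c * v)) = (cmod c)\<^sup>2 * J s"
    and sequentially_continuous:
      "(\<And>k. X k \<in> cseminorms) \<Longrightarrow> s \<in> cseminorms \<Longrightarrow> (\<And>v. (\<lambda>k. X k v) \<longlonglongrightarrow> s v)
         \<Longrightarrow> (\<lambda>k::nat. J (X k)) \<longlonglongrightarrow> J s"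
    and pos: "s \<in> cseminorms \<Longrightarrow> s v \<noteq> 0 \<Longrightarrow> 0 < J s"
begin

text \<open>The energy density, per unit of area in the domain, of a map with differential \<open>s\<close> after
  reparametrization by a homeomorphism with Beltrami coefficient \<open>- \<mu>\<close>.\<close>

definition qd :: "(complex \<Rightarrow> real) \<Rightarrow> complex \<Rightarrow> real" where
  "qd s \<mu> = J (\<lambda>v. s (v + \<mu> * cnj v)) / (1 - (cmod \<mu>)\<^sup>2)"

text \<open>This is \<open>reduced_jacobian\<close> in complex notation: every real-linear map of
  the plane has the form \<open>a * v + b * cnj v\<close>, and its determinant is
  \<open>(cmod a)^2 - (cmod b)^2\<close>.\<close>

definition jac :: "(complex \<Rightarrow> real) \<Rightarrow> real" where
  "jac s = Inf {J (\<lambda>v. s (a * v + b * cnj v)) | a b. (cmod a)\<^sup>2 - (cmod b)\<^sup>2 = 1}"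

section \<open>Elementary properties of the energy and of the area density\<close>

lemma scale: "s \<in> cseminorms \<Longrightarrow> J (\<lambda>v. c * s v) = c\<^sup>2 * J s" if "0 \<le> c"
  using conformal[of s "complex_of_real c"] that by (simp add: cseminorm_scale_complex)

lemma mono_scale:
  assumes "s \<in> cseminorms" "s' \<in> cseminorms" "\<And>v. s' v \<le> c * s v" "0 \<le> c"
  shows "J s' \<le> c\<^sup>2 * J s"
  using mono[OF cseminorm_cmult[OF assms(4,1)] assms(2,3)] scale[OF assms(4,1)] by simp

lemma J_bound: "s \<in> cseminorms \<Longrightarrow> J s \<le> (s 1 + s \<i>)\<^sup>2 * J cmod"
  by (intro mono_scale cseminorm_norm cseminorm_bound add_nonneg_nonneg cseminorm_nonneg)

lemma J_bound':
  assumes "s \<in> cseminorms" "s 1 \<le> B" "s \<i> \<le> B" shows "J s \<le> (2 * B)\<^sup>2 * J cmod"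
proof -
  have "(s 1 + s \<i>)\<^sup>2 \<le> (2 * B)\<^sup>2"
    using assms cseminorm_nonneg[OF assms(1)] by (intro power_mono) (auto simp: add_nonneg_nonneg)
  then show ?thesis
    using J_bound[OF assms(1)] nonneg[OF cseminorm_norm] by (meson mult_right_mono order_trans)
qed

lemma continuous_on_J:
  fixes s :: "'x::metric_space \<Rightarrow> complex \<Rightarrow> real"
  assumes "\<And>x. x \<in> S \<Longrightarrow> s x \<in> cseminorms" "\<And>v. continuous_on S (\<lambda>x. s x v)"
  shows "continuous_on S (\<lambda>x. J (s x))"
  unfolding continuous_on_sequentially
proof (intro allI ballI impI, elim conjE)
  fix x a assume a: "a \<in> S" and x: "\<forall>n. x n \<in> S" "x \<longlonglongrightarrow> a"
  have "(\<lambda>n. s (x n) v) \<longlonglongrightarrow> s a v" for v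
    using assms(2)[of v] a x unfolding continuous_on_sequentially o_def by blast
  show "((\<lambda>x. J (s x)) \<circ> x) \<longlonglongrightarrow> J (s a)"
    unfolding o_def
  proof (rule sequentially_continuous[where X="\<lambda>n. s (x n)"])
    show "s (x n) \<in> cseminorms" for n using assms(1) x(1) by simp
    show "s a \<in> cseminorms" using assms(1) a .
  qed fact
qed

lemma continuous_on_qd:
  fixes s :: "'x::metric_space \<Rightarrow> complex \<Rightarrow> real"
  assumes s: "\<And>x. x \<in> S \<Longrightarrow> s x \<in> cseminorms" "\<And>v. continuous_on S (\<lambda>x. s x v)"
    and \<mu>: "continuous_on S \<mu>" "\<And>x. x \<in> S \<Longrightarrow> cmod (\<mu> x) < 1"
  shows "continuous_on S (\<lambda>x. qd (s x) (\<mu> x))"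
proof -
  have "continuous_on S (\<lambda>x. J (\<lambda>v. s x (v + \<mu> x * cnj v)))"
  proof (rule continuous_on_J)
    show "(\<lambda>v. s x (v + \<mu> x * cnj v)) \<in> cseminorms" if "x \<in> S" for x
      using s(1)[OF that] by (rule cseminorm_beltrami)
    fix v show "continuous_on S (\<lambda>x. s x (v + \<mu> x * cnj v))"
      by (rule continuous_on_cseminorm_compose[OF s]) (auto intro!: continuous_intros \<mu>(1))
  qed
  moreover have "continuous_on S (\<lambda>x. 1 - (cmod (\<mu> x))\<^sup>2)"
    by (intro continuous_intros \<mu>(1))
  moreover have "\<forall>x\<in>S. 1 - (cmod (\<mu> x))\<^sup>2 \<noteq> 0"
  proof
    fix x assume "x \<in> S"
    then have "(cmod (\<mu> x))\<^sup>2 < 1" using abs_square_less_1[of "cmod (\<mu> x)"] \<mu>(2) by simp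
    then show "1 - (cmod (\<mu> x))\<^sup>2 \<noteq> 0" by linarith
  qed
  ultimately show ?thesis
    unfolding qd_def by (rule continuous_on_divide)
qed

lemma qd_nonneg: "s \<in> cseminorms \<Longrightarrow> cmod \<mu> < 1 \<Longrightarrow> 0 \<le> qd s \<mu>"
  unfolding qd_def
  using nonneg[OF cseminorm_beltrami(1)] abs_square_less_1[of "cmod \<mu>"] by simp

lemma qd_0: "qd s 0 = J s"
  by (simp add: qd_def)

text \<open>Substituting \<open>w = a * v\<close> turns \<open>a * v + b * cnj v\<close> into
  \<open>w + (b / cnj a) * cnj w\<close>, and \<open>conformal\<close> pulls the factor
  \<open>a\<close> out of \<open>J\<close>. With this normalization of the coefficient, dividing by
  \<open>cnj a\<close> and not by \<open>a\<close>, the inverse of a map with coefficient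
  \<open>m\<close> gets exactly \<open>- m\<close>.\<close>

lemma J_beltrami:
  assumes s: "s \<in> cseminorms" and ab: "cmod b < cmod a"
  shows "J (\<lambda>v. s (a * v + b * cnj v)) = ((cmod a)\<^sup>2 - (cmod b)\<^sup>2) * qd s (b / cnj a)"
    and "cmod (b / cnj a) < 1"
proof -
  have a0: "a \<noteq> 0" using ab by auto
  show lt: "cmod (b / cnj a) < 1" using ab a0 by (simp add: norm_divide)
  have "J (\<lambda>v. s (a * v + b * cnj v)) = J (\<lambda>v. (\<lambda>v. s (v + b / cnj a * cnj v)) (a * v))"
    using a0 by simp
  also have "\<dots> = (cmod a)\<^sup>2 * J (\<lambda>v. s (v + b / cnj a * cnj v))"
    by (rule conformal[OF cseminorm_beltrami(1)[OF s]])
  also have "\<dots> = (cmod a)\<^sup>2 * ((1 - (cmod (b / cnj a))\<^sup>2) * qd s (b / cnj a))"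
    using abs_square_less_1[of "cmod (b / cnj a)"] lt by (simp add: qd_def del: abs_norm_cancel)
  also have "(cmod a)\<^sup>2 * ((1 - (cmod (b / cnj a))\<^sup>2) * qd s (b / cnj a)) =
      ((cmod a)\<^sup>2 - (cmod b)\<^sup>2) * qd s (b / cnj a)"
    using a0 by (simp add: norm_divide field_simps)
  finally show "J (\<lambda>v. s (a * v + b * cnj v)) = ((cmod a)\<^sup>2 - (cmod b)\<^sup>2) * qd s (b / cnj a)" .
qed

lemma qd_eq_J:
  assumes "s \<in> cseminorms" "cmod \<mu> < 1"
  defines "r \<equiv> complex_of_real (1 / sqrt (1 - (cmod \<mu>)\<^sup>2))"
  shows "qd s \<mu> = J (\<lambda>v. s (r * v + r * \<mu> * cnj v))" "(cmod r)\<^sup>2 - (cmod (r * \<mu>))\<^sup>2 = 1"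
proof -
  have p: "1 - (cmod \<mu>)\<^sup>2 > 0" using assms(2) by (simp add: abs_square_less_1)
  have r0: "r \<noteq> 0" using p by (simp add: r_def)
  have r2: "(cmod r)\<^sup>2 = 1 / (1 - (cmod \<mu>)\<^sup>2)" using p by (simp add: r_def power_divide norm_divide)
  show 1: "(cmod r)\<^sup>2 - (cmod (r * \<mu>))\<^sup>2 = 1"
    using p by (simp add: norm_mult power_mult_distrib r2 field_simps)
  have "cmod (r * \<mu>) < cmod r" using assms(2) r0 by (simp add: norm_mult)
  from J_beltrami(1)[OF assms(1) this] 1 r0
  show "qd s \<mu> = J (\<lambda>v. s (r * v + r * \<mu> * cnj v))" by (simp add: r_def)
qed

text \<open>Maps of determinant 1 that differ by a rotation of the domain have the same energy, so
  the infimum over all of them is one over the disc of coefficients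
  \<open>b / cnj a\<close>.\<close>

lemma jac_eq_Inf_qd: "s \<in> cseminorms \<Longrightarrow> jac s = Inf (qd s ` ball 0 1)"
proof -
  assume s: "s \<in> cseminorms"
  have "{J (\<lambda>v. s (a * v + b * cnj v)) | a b. (cmod a)\<^sup>2 - (cmod b)\<^sup>2 = 1} = qd s ` ball 0 1"
  proof (intro equalityI subsetI)
    fix x assume "x \<in> {J (\<lambda>v. s (a * v + b * cnj v)) | a b. (cmod a)\<^sup>2 - (cmod b)\<^sup>2 = 1}"
    then obtain a b where x: "x = J (\<lambda>v. s (a * v + b * cnj v))" and ab: "(cmod a)\<^sup>2 - (cmod b)\<^sup>2 = 1"
      by auto
    have "(cmod b)\<^sup>2 < (cmod a)\<^sup>2" using ab by linarith
    then have "cmod b < cmod a" by (rule power_less_imp_less_base) simp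
    from J_beltrami[OF s this] ab x show "x \<in> qd s ` ball 0 1" by auto
  next
    fix x assume "x \<in> qd s ` ball 0 1"
    then obtain \<mu> where "cmod \<mu> < 1" "x = qd s \<mu>" by auto
    with qd_eq_J[OF s, of \<mu>]
    show "x \<in> {J (\<lambda>v. s (a * v + b * cnj v)) | a b. (cmod a)\<^sup>2 - (cmod b)\<^sup>2 = 1}" by blast
  qed
  then show ?thesis by (simp add: jac_def)
qed

lemma jac_nonneg: "s \<in> cseminorms \<Longrightarrow> 0 \<le> jac s"
  by (simp add: jac_eq_Inf_qd, rule cInf_greatest) (auto simp: qd_nonneg)

lemma jac_le_qd:
  assumes "s \<in> cseminorms" "cmod \<mu> < 1" shows "jac s \<le> qd s \<mu>"
  unfolding jac_eq_Inf_qd[OF assms(1)]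
proof (rule cInf_lower)
  show "bdd_below (qd s ` ball 0 1)"
    by (rule bdd_belowI2[of _ 0]) (use assms qd_nonneg in auto)
qed (use assms in auto)

lemma jac_le_J: "s \<in> cseminorms \<Longrightarrow> jac s \<le> J s"
  using jac_le_qd[of s 0] by (simp add: qd_0)

lemma jac_approx:
  assumes "s \<in> cseminorms" "0 < e" obtains \<mu> where "cmod \<mu> < 1" "qd s \<mu> < jac s + e"
proof -
  have "\<exists>x\<in>qd s ` ball 0 1. x < jac s + e"
    by (rule cInf_lessD) (use assms in \<open>auto simp: jac_eq_Inf_qd\<close>)
  then show ?thesis using that by auto
qed

lemma jac_mono_scale:
  assumes "s \<in> cseminorms" "s' \<in> cseminorms" "\<And>v. s' v \<le> c * s v" "0 \<le> c"
  shows "jac s' \<le> c\<^sup>2 * jac s"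
proof (cases "c = 0")
  case True
  then have "J s' \<le> 0" using mono_scale[OF assms] by simp
  then show ?thesis using jac_le_J[OF assms(2)] True by simp
next
  case False
  have "jac s' / c\<^sup>2 \<le> jac s"
    unfolding jac_eq_Inf_qd[OF assms(1)]
  proof (rule cInf_greatest, clarsimp, safe)
    fix \<mu> :: complex assume \<mu>: "\<mu> \<in> ball 0 1"
    then have d: "0 < 1 - (cmod \<mu>)\<^sup>2" by (simp add: abs_square_less_1)
    have "jac s' \<le> qd s' \<mu>" using jac_le_qd[OF assms(2)] \<mu> by simp
    also have "\<dots> \<le> c\<^sup>2 * qd s \<mu>"
      unfolding qd_def times_divide_eq_right
      by (intro divide_right_mono mono_scale cseminorm_beltrami(1)[OF assms(1)] cseminorm_beltrami(1)[OF assms(2)] assms(3,4) less_imp_le[OF d])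
    finally show "jac s' / c\<^sup>2 \<le> qd s \<mu>" using False by (simp add: field_simps)
  qed
  then show ?thesis using False by (simp add: field_simps)
qed

text \<open>A norm dominates a multiple of \<open>cmod\<close>, so convergence to \<open>s a\<close>
  becomes the multiplicative bound \<open>(1 - t) * s a \<le> s (x n) \<le> (1 + t) * s a\<close>,
  which \<open>jac_mono_scale\<close> transfers to \<open>jac\<close>. Being an infimum of
  continuous functions would give upper semicontinuity only.\<close>

lemma jac_continuous_on:
  fixes s :: "'x::metric_space \<Rightarrow> complex \<Rightarrow> real"
  assumes s: "\<And>x. x \<in> S \<Longrightarrow> s x \<in> cseminorms" "\<And>v. continuous_on S (\<lambda>x. s x v)"
    and norm: "\<And>x v. x \<in> S \<Longrightarrow> v \<noteq> 0 \<Longrightarrow> 0 < s x v"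
  shows "continuous_on S (\<lambda>x. jac (s x))"
  unfolding continuous_on_sequentially
proof (intro allI ballI impI, elim conjE)
  fix x a assume a: "a \<in> S" and x: "\<forall>n. x n \<in> S" "x \<longlonglongrightarrow> a"
  have lim: "(\<lambda>n. s (x n) v) \<longlonglongrightarrow> s a v" for v
    using assms(2)[of v] a x unfolding continuous_on_sequentially o_def by blast
  obtain m where m: "m > 0" "\<And>v. m * cmod v \<le> s a v"
    using cnorm_lower_bound[OF s(1)[OF a] norm[OF a]] by blast
  have sx: "s (x n) \<in> cseminorms" for n using s x by auto
  have *: "\<forall>\<^sub>F n in sequentially. (1 - t)\<^sup>2 * jac (s a) \<le> jac (s (x n)) \<and>
      jac (s (x n)) \<le> (1 + t)\<^sup>2 * jac (s a)" if t: "0 < t" "t < 1" for t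
  proof -
    have "\<forall>\<^sub>F n in sequentially. \<forall>v. \<bar>s (x n) v - s a v\<bar> \<le> (t * m) * cmod v"
      by (rule cseminorm_uniform_convergence[OF sx s(1)[OF a] lim]) (use m t in simp)
    then show ?thesis
    proof eventually_elim
      case (elim n)
      have b: "\<bar>s (x n) v - s a v\<bar> \<le> t * s a v" for v
      proof -
        have "(t * m) * cmod v \<le> t * s a v" using m(2)[of v] t by simp
        then show ?thesis using elim by (meson order_trans)
      qed
      have "jac (s (x n)) \<le> (1 + t)\<^sup>2 * jac (s a)"
        by (rule jac_mono_scale[OF s(1)[OF a] sx]) (use b t in \<open>auto simp: algebra_simps abs_le_iff\<close>)
      moreover have "jac (s a) \<le> (1 / (1 - t))\<^sup>2 * jac (s (x n))"
      proof (rule jac_mono_scale[OF sx s(1)[OF a]])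
        fix v show "s a v \<le> 1 / (1 - t) * s (x n) v"
          using b[of v] t by (auto simp: field_simps abs_le_iff)
      qed (use t in auto)
      then have "(1 - t)\<^sup>2 * jac (s a) \<le> jac (s (x n))" using t by (simp add: field_simps power_divide)
      ultimately show ?case by simp
    qed
  qed
  show "((\<lambda>x. jac (s x)) \<circ> x) \<longlonglongrightarrow> jac (s a)"
    unfolding o_def
  proof (rule order_tendstoI)
    fix y assume y: "y < jac (s a)"
    have "((\<lambda>t. (1 - t)\<^sup>2 * jac (s a)) \<longlongrightarrow> (1 - 0)\<^sup>2 * jac (s a)) (at_right 0)"
      by (intro tendsto_intros)
    then have "\<forall>\<^sub>F t in at_right 0. y < (1 - t)\<^sup>2 * jac (s a)"
      using y by (intro order_tendstoD(1)) auto
    moreover have "\<forall>\<^sub>F t in at_right (0::real). t \<in> {0<..<1}"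
      by (rule eventually_at_right_real) simp
    ultimately obtain t where "0 < t" "t < 1" "y < (1 - t)\<^sup>2 * jac (s a)"
      using eventually_happens[OF eventually_conj] trivial_limit_at_right_real
      by (metis (mono_tags, lifting) greaterThanLessThan_iff)
    with *[of t] show "\<forall>\<^sub>F n in sequentially. y < jac (s (x n))"
      by (auto elim!: eventually_mono)
  next
    fix y assume y: "jac (s a) < y"
    have "((\<lambda>t. (1 + t)\<^sup>2 * jac (s a)) \<longlongrightarrow> (1 + 0)\<^sup>2 * jac (s a)) (at_right 0)"
      by (intro tendsto_intros)
    then have "\<forall>\<^sub>F t in at_right 0. (1 + t)\<^sup>2 * jac (s a) < y"
      using y by (intro order_tendstoD(2)) auto
    moreover have "\<forall>\<^sub>F t in at_right (0::real). t \<in> {0<..<1}"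
      by (rule eventually_at_right_real) simp
    ultimately obtain t where "0 < t" "t < 1" "(1 + t)\<^sup>2 * jac (s a) < y"
      using eventually_happens[OF eventually_conj] trivial_limit_at_right_real
      by (metis (mono_tags, lifting) greaterThanLessThan_iff)
    with *[of t] show "\<forall>\<^sub>F n in sequentially. jac (s (x n)) < y"
      by (auto elim!: eventually_mono)
  qed
qed

text \<open>After rotation by a square root of \<open>sgn \<mu>\<close> the coefficient is a
  nonnegative real number, and then real parts are stretched by \<open>1 + cmod \<mu>\<close>. So
  there is always a direction without contraction, however close \<open>cmod \<mu>\<close> is to
  1.\<close>

lemma cmod_beltrami_ge:
  obtains \<omega> where "cmod \<omega> = 1" "\<And>v. \<bar>Re (\<omega> * v)\<bar> \<le> cmod (v + \<mu> * cnj v)"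
proof -
  obtain z where z: "z\<^sup>2 = sgn \<mu>" using power2_csqrt by blast
  define w where "w = (if \<mu> = 0 then 1 else z)"
  have w1: "cmod w = 1"
  proof (cases "\<mu> = 0")
    case False
    then have "(cmod z)\<^sup>2 = 1" using z by (metis norm_power norm_sgn)
    then show ?thesis using False by (simp add: w_def power2_eq_1_iff) (smt (verit) norm_ge_zero)
  qed (simp add: w_def)
  have \<mu>: "\<mu> = of_real (cmod \<mu>) * w\<^sup>2"
    using z by (simp add: w_def sgn_div_norm scaleR_conv_of_real)
  have ww: "w * cnj w = 1" using w1 by (metis complex_norm_square mult.right_neutral of_real_1 power_one)
  have "\<bar>Re (cnj w * v)\<bar> \<le> cmod (v + \<mu> * cnj v)" for v
  proof -
    define x where "x = cnj w * v"
    have v: "v = w * x" using ww by (simp add: x_def mult.assoc[symmetric])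
    have "v + \<mu> * cnj v = w * (x + of_real (cmod \<mu>) * cnj x)"
    proof -
      have "\<mu> * cnj v = of_real (cmod \<mu>) * w * (w * cnj w) * cnj x"
        by (subst \<mu>) (simp add: v power2_eq_square mult_ac)
      then show ?thesis using ww by (simp add: v algebra_simps)
    qed
    then have "cmod (v + \<mu> * cnj v) = cmod (x + of_real (cmod \<mu>) * cnj x)"
      by (simp add: norm_mult w1)
    also have "\<dots> \<ge> \<bar>Re (x + of_real (cmod \<mu>) * cnj x)\<bar>" by (rule abs_Re_le_cmod)
    also have "Re (x + of_real (cmod \<mu>) * cnj x) = (1 + cmod \<mu>) * Re x" by (simp add: algebra_simps)
    also have "\<bar>(1 + cmod \<mu>) * Re x\<bar> \<ge> 1 * \<bar>Re x\<bar>"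
      unfolding abs_mult by (intro mult_right_mono) auto
    finally show ?thesis by (simp add: x_def)
  qed
  with that[of "cnj w"] w1 show ?thesis by simp
qed

text \<open>The numerator of \<open>qd s \<mu>\<close> stays above a positive constant by
  \<open>cmod_beltrami_ge\<close>, while the denominator tends to 0 at the unit circle. So
  \<open>qd s\<close> blows up there, and its minimum on a smaller closed disc is global.\<close>

lemma jac_attained:
  assumes s: "s \<in> cseminorms" and norm: "\<And>v. v \<noteq> 0 \<Longrightarrow> 0 < s v"
  obtains \<mu> where "cmod \<mu> < 1" "qd s \<mu> = jac s"
proof -
  obtain m where m: "m > 0" "\<And>v. m * cmod v \<le> s v" using cnorm_lower_bound[OF s norm] by blast
  have Re_s: "(\<lambda>v. \<bar>Re v\<bar>) \<in> cseminorms"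
    by (auto simp: cseminorms_def abs_mult)
  define c where "c = m\<^sup>2 * J (\<lambda>v. \<bar>Re v\<bar>)"
  have c: "c > 0" using m pos[OF Re_s, of 1] by (simp add: c_def)
  have low: "c \<le> J (\<lambda>v. s (v + \<mu> * cnj v))" for \<mu>
  proof -
    obtain \<omega> where \<omega>: "cmod \<omega> = 1" "\<And>v. \<bar>Re (\<omega> * v)\<bar> \<le> cmod (v + \<mu> * cnj v)"
      using cmod_beltrami_ge by blast
    have r: "(\<lambda>v. \<bar>Re (\<omega> * v)\<bar>) \<in> cseminorms"
      by (rule cseminorm_linear[OF Re_s]) (auto intro!: linearI simp: algebra_simps)
    have "c = m\<^sup>2 * J (\<lambda>v. \<bar>Re (\<omega> * v)\<bar>)"
      using conformal[OF Re_s, of \<omega>] \<omega> by (simp add: c_def)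
    also have "\<dots> = J (\<lambda>v. m * \<bar>Re (\<omega> * v)\<bar>)" using scale[OF _ r, of m] m by simp
    also have "\<dots> \<le> J (\<lambda>v. s (v + \<mu> * cnj v))"
    proof (intro mono cseminorm_beltrami(1)[OF s] cseminorm_cmult r)
      fix v show "m * \<bar>Re (\<omega> * v)\<bar> \<le> s (v + \<mu> * cnj v)"
        using \<omega>(2)[of v] m by (meson mult_left_mono less_imp_le order_trans)
    qed (use m in auto)
    finally show ?thesis .
  qed
  have Jp: "J s > 0" using pos[OF s, of 1] norm[of 1] by simp
  \<comment> \<open>Chosen so that \<open>cmod \<mu> > k\<close> forces
    \<open>1 - (cmod \<mu>)^2 \<le> c / J s\<close> and hence
    \<open>qd s \<mu> \<ge> J s = qd s 0\<close>.\<close>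
  define k where "k = sqrt (max 0 (1 - c / J s))"
  have k: "0 \<le> k" "k < 1" using c Jp by (auto simp: k_def max_def)
  have "continuous_on (cball 0 k) (qd s)"
    by (rule continuous_on_qd[where s="\<lambda>_. s" and \<mu>="\<lambda>x. x"]) (use s k in \<open>auto intro!: continuous_intros\<close>)
  then obtain \<mu>0 where \<mu>0: "\<mu>0 \<in> cball 0 k" "\<And>\<mu>. \<mu> \<in> cball 0 k \<Longrightarrow> qd s \<mu>0 \<le> qd s \<mu>"
    using continuous_attains_inf[of "cball 0 k" "qd s"] k by auto
  have le: "qd s \<mu>0 \<le> qd s \<mu>" if \<mu>: "cmod \<mu> < 1" for \<mu>
  proof (cases "cmod \<mu> \<le> k")
    case False
    then have "k\<^sup>2 < (cmod \<mu>)\<^sup>2" using k by (intro power_strict_mono) auto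
    moreover have "k\<^sup>2 \<ge> 1 - c / J s" by (simp add: k_def)
    ultimately have "1 - (cmod \<mu>)\<^sup>2 \<le> c / J s" by linarith
    moreover have p: "0 < 1 - (cmod \<mu>)\<^sup>2" using \<mu> by (simp add: abs_square_less_1)
    ultimately have "J s \<le> c / (1 - (cmod \<mu>)\<^sup>2)" using Jp by (simp add: field_simps)
    also have "\<dots> \<le> qd s \<mu>" unfolding qd_def by (intro divide_right_mono low) (use p in simp)
    finally show ?thesis using \<mu>0(2)[of 0] k by (simp add: qd_0)
  qed (use \<mu>0 in simp)
  show ?thesis
  proof
    show "cmod \<mu>0 < 1" using \<mu>0 k by simp
    show "qd s \<mu>0 = jac s"
    proof (rule antisym)
      show "qd s \<mu>0 \<le> jac s" unfolding jac_eq_Inf_qd[OF s] by (rule cInf_greatest) (use le in auto)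
    qed (use jac_le_qd[OF s] \<open>cmod \<mu>0 < 1\<close> in simp)
  qed
qed

text \<open>For \<open>\<mu> = t * u^2\<close> the kernel direction \<open>u\<close> is stretched by
  \<open>1 + t\<close>, which \<open>s\<close> does not notice, and \<open>\<i> * u\<close> is
  contracted by \<open>1 - t\<close>. The density is then of order
  \<open>(1 - t)^2 / (1 - t^2)\<close>, which vanishes as \<open>t\<close> tends to 1.\<close>

lemma jac_degenerate:
  assumes s: "s \<in> cseminorms" and v0: "v0 \<noteq> 0" "s v0 = 0"
  shows "jac s = 0"
proof -
  define u where "u = sgn v0"
  have "s u = \<bar>inverse (cmod v0)\<bar> * s v0"
    unfolding u_def sgn_div_norm by (rule cseminorm_scale[OF s])
  then have u: "cmod u = 1" "s u = 0" using v0 by (simp_all add: u_def norm_sgn)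
  have uu: "u * cnj u = 1" using u by (metis complex_norm_square mult.right_neutral of_real_1 power_one)
  define C where "C = (s (\<i> * u))\<^sup>2 * J cmod"
  have le: "jac s \<le> (1 - t) * C" if t: "0 < t" "t < 1" for t :: real
  proof -
    define \<mu> where "\<mu> = complex_of_real t * u\<^sup>2"
    have \<mu>: "cmod \<mu> = t" using t by (simp add: \<mu>_def norm_mult norm_power u)
    have b: "s (v + \<mu> * cnj v) \<le> ((1 - t) * s (\<i> * u)) * cmod v" for v
    proof -
      define x where "x = cnj u * v"
      have v: "v = u * x" using uu by (simp add: x_def mult.assoc[symmetric])
      have "\<mu> * cnj v = of_real t * u * (u * cnj u) * cnj x"
        by (simp add: \<mu>_def v power2_eq_square mult_ac)
      then have "v + \<mu> * cnj v = u * (x + of_real t * cnj x)" using uu by (simp add: v algebra_simps)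
      also have "\<dots> = ((1 + t) * Re x) *\<^sub>R u + ((1 - t) * Im x) *\<^sub>R (\<i> * u)"
        by (simp add: complex_eq_iff algebra_simps)
      finally have "s (v + \<mu> * cnj v) \<le> \<bar>(1 + t) * Re x\<bar> * s u + \<bar>(1 - t) * Im x\<bar> * s (\<i> * u)"
        by (metis s cseminorm_add cseminorm_scale)
      also have "\<dots> = (1 - t) * s (\<i> * u) * \<bar>Im x\<bar>" using u t by (simp add: abs_mult)
      also have "\<dots> \<le> (1 - t) * s (\<i> * u) * cmod x"
        using t cseminorm_nonneg[OF s] by (intro mult_left_mono abs_Im_le_cmod) auto
      also have "cmod x = cmod v" by (simp add: x_def norm_mult u)
      finally show ?thesis .
    qed
    have "jac s \<le> qd s \<mu>" by (rule jac_le_qd) (use s t \<mu> in auto)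
    also have "\<dots> \<le> (((1 - t) * s (\<i> * u))\<^sup>2 * J cmod) / (1 - t\<^sup>2)"
      unfolding qd_def \<mu>
      by (intro divide_right_mono mono_scale cseminorm_norm cseminorm_beltrami(1)[OF s] b)
        (use t cseminorm_nonneg[OF s] abs_square_less_1[of t] in auto)
    also have "\<dots> = (1 - t) * C / (1 + t)"
    proof -
      have "1 - t\<^sup>2 = (1 - t) * (1 + t)" by (simp add: power2_eq_square algebra_simps)
      then show ?thesis using t by (simp add: C_def power_mult_distrib power2_eq_square)
    qed
    also have "\<dots> \<le> (1 - t) * C"
    proof -
      have "0 \<le> (1 - t) * C" using t nonneg[OF cseminorm_norm] by (simp add: C_def)
      then have "(1 - t) * C / (1 + t) \<le> (1 - t) * C / 1"
        using t by (intro divide_left_mono) auto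
      then show ?thesis by simp
    qed
    finally show ?thesis .
  qed
  have "((\<lambda>t. (1 - t) * C) \<longlongrightarrow> (1 - 1) * C) (at_left 1)" by (intro tendsto_intros)
  moreover have "\<forall>\<^sub>F t in at_left (1::real). jac s \<le> (1 - t) * C"
    using eventually_at_left_real[of 0 1] by (auto elim!: eventually_mono intro!: le)
  ultimately have "jac s \<le> (1 - 1) * C"
    by (intro tendsto_lowerbound[of _ _ "at_left 1"]) (auto simp: trivial_limit_at_left_real)
  then show ?thesis using jac_nonneg[OF s] by simp
qed

text \<open>The maps of determinant 1 form a group, so precomposition with one of them only permutes
  the competitors. The auxiliary fact \<open>comp\<close> is the multiplicativity of the
  determinant.\<close>

lemma jac_unimodular:
  assumes s: "s \<in> cseminorms" and ab: "(cmod a)\<^sup>2 - (cmod b)\<^sup>2 = 1"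
  shows "jac (\<lambda>v. s (a * v + b * cnj v)) = jac s"
proof -
  have comp: "(cmod (a * c + b * cnj d))\<^sup>2 - (cmod (a * d + b * cnj c))\<^sup>2 = 1"
    if "(cmod a)\<^sup>2 - (cmod b)\<^sup>2 = 1" "(cmod c)\<^sup>2 - (cmod d)\<^sup>2 = 1" for a b c d
  proof -
    have "complex_of_real ((cmod (a * c + b * cnj d))\<^sup>2 - (cmod (a * d + b * cnj c))\<^sup>2) =
        complex_of_real (((cmod a)\<^sup>2 - (cmod b)\<^sup>2) * ((cmod c)\<^sup>2 - (cmod d)\<^sup>2))"
      by (simp only: of_real_diff of_real_mult complex_norm_square complex_cnj_add complex_cnj_mult
          complex_cnj_cnj) (simp only: algebra_simps)
    then have "(cmod (a * c + b * cnj d))\<^sup>2 - (cmod (a * d + b * cnj c))\<^sup>2 =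
        ((cmod a)\<^sup>2 - (cmod b)\<^sup>2) * ((cmod c)\<^sup>2 - (cmod d)\<^sup>2)"
      by (simp only: of_real_eq_iff)
    then show ?thesis using that by simp
  qed
  have "{J (\<lambda>v. s (a * (c * v + d * cnj v) + b * cnj (c * v + d * cnj v))) | c d. (cmod c)\<^sup>2 - (cmod d)\<^sup>2 = 1}
     = {J (\<lambda>v. s (c * v + d * cnj v)) | c d. (cmod c)\<^sup>2 - (cmod d)\<^sup>2 = 1}" (is "?A = ?B")
  proof (intro equalityI subsetI)
    fix x assume "x \<in> ?A"
    then obtain c d where cd: "(cmod c)\<^sup>2 - (cmod d)\<^sup>2 = 1"
      and x: "x = J (\<lambda>v. s (a * (c * v + d * cnj v) + b * cnj (c * v + d * cnj v)))" by blast
    have "x = J (\<lambda>v. s ((a * c + b * cnj d) * v + (a * d + b * cnj c) * cnj v))"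
      unfolding x by (simp add: algebra_simps)
    with comp[OF ab cd] show "x \<in> ?B" unfolding mem_Collect_eq by (intro exI conjI)
  next
    fix x assume "x \<in> ?B"
    then obtain c d where cd: "(cmod c)\<^sup>2 - (cmod d)\<^sup>2 = 1"
      and x: "x = J (\<lambda>v. s (c * v + d * cnj v))" by blast
    have aa: "a * cnj a - b * cnj b = 1"
      using arg_cong[OF ab, of complex_of_real] by (simp only: of_real_diff complex_norm_square of_real_1)
    \<comment> \<open>The inverse of \<open>a * v + b * cnj v\<close> has the coefficients
      \<open>cnj a\<close> and \<open>- b\<close>.\<close>
    have "(cmod (cnj a))\<^sup>2 - (cmod (- b))\<^sup>2 = 1" using ab by simp
    from comp[OF this cd]
    have cd': "(cmod (cnj a * c - b * cnj d))\<^sup>2 - (cmod (cnj a * d - b * cnj c))\<^sup>2 = 1" by simp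
    have "a * ((cnj a * c - b * cnj d) * v + (cnj a * d - b * cnj c) * cnj v) +
        b * cnj ((cnj a * c - b * cnj d) * v + (cnj a * d - b * cnj c) * cnj v)
       = (a * cnj a - b * cnj b) * (c * v + d * cnj v)" for v
      by (simp add: algebra_simps)
    then have "x = J (\<lambda>v. s (a * ((cnj a * c - b * cnj d) * v + (cnj a * d - b * cnj c) * cnj v) +
        b * cnj ((cnj a * c - b * cnj d) * v + (cnj a * d - b * cnj c) * cnj v)))"
      unfolding x aa by simp
    with cd' show "x \<in> ?A" unfolding mem_Collect_eq by (intro exI conjI)
  qed
  then show ?thesis by (simp add: jac_def)
qed

end

subsection \<open>A weak Koebe theorem\<close>

text \<open>If \<open>cmod (f z) > cmod w\<close> on the whole circle of radius \<open>r\<close>,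
  the disc of radius \<open>cmod w\<close> misses the frontier of the image of
  \<open>ball 0 r\<close> but contains \<open>f 0 = 0\<close>. By connectedness it lies in the
  image, so \<open>w\<close> would be attained.\<close>

lemma injective_holomorphic_omitted_value:
  assumes holf: "f holomorphic_on ball 0 1" and inj: "inj_on f (ball 0 1)" and f0: "f 0 = 0"
    and w: "w \<notin> f ` ball 0 1" and r: "0 < r" "r < 1"
  shows "\<exists>z. cmod z = r \<and> cmod (f z) \<le> cmod w"
proof (rule ccontr)
  assume "\<not> ?thesis"
  then have big: "cmod w < cmod (f z)" if "cmod z = r" for z using that by force
  have sub: "cball (0::complex) r \<subseteq> ball 0 1" using r by auto
  define V where "V = f ` ball 0 r"
  have "closure V \<subseteq> f ` cball 0 r"
  proof (rule closure_minimal)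
    show "V \<subseteq> f ` cball 0 r" by (auto simp: V_def)
    show "closed (f ` cball 0 r)"
      by (intro compact_imp_closed compact_continuous_image holomorphic_on_imp_continuous_on
          holomorphic_on_subset[OF holf sub]) simp
  qed
  moreover have "open V"
    unfolding V_def
  proof (rule open_mapping_thm3)
    show "f holomorphic_on ball 0 r" by (rule holomorphic_on_subset[OF holf]) (use sub in auto)
    show "inj_on f (ball 0 r)" by (rule inj_on_subset[OF inj]) (use sub in auto)
  qed simp
  ultimately have "frontier V \<subseteq> f ` cball 0 r - f ` ball 0 r"
    by (auto simp: frontier_def interior_open V_def)
  also have "\<dots> \<subseteq> f ` (cball 0 r - ball 0 r)" by blast
  finally have fr: "frontier V \<subseteq> f ` sphere 0 r"
    by (simp add: cball_diff_eq_sphere)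
  have "cball 0 (cmod w) \<inter> frontier V = {}"
    using fr big by fastforce
  moreover have "f 0 \<in> V" unfolding V_def by (rule imageI) (use r in simp)
  then have "0 \<in> cball 0 (cmod w) \<inter> V" using f0 by simp
  then have "cball 0 (cmod w) \<inter> V \<noteq> {}" by blast
  ultimately have "cball 0 (cmod w) \<subseteq> V"
    using connected_Int_frontier[of "cball 0 (cmod w)" V] connected_cball by blast
  then have "w \<in> V" by auto
  then show False using w r by (auto simp: V_def)
qed

text \<open>A weak form of Koebe's quarter theorem.  On a small circle \<open>f\<close> takes some value of modulus at most
  \<open>cmod w\<close>; as \<open>f / w\<close> omits 0 and 1 off the origin, Schottky's theorem in logarithmic coordinates
  bounds it on the whole circle.\<close>

lemma weak_koebe_unit:
  obtains C where "C > 0"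
    "\<And>f w. f holomorphic_on ball 0 1 \<Longrightarrow> inj_on f (ball 0 1) \<Longrightarrow> f 0 = 0 \<Longrightarrow> w \<notin> f ` ball 0 1
       \<Longrightarrow> cmod (deriv f 0) \<le> C * cmod w"
proof
  \<comment> \<open>The bound of \<open>Schottky\<close> for functions of modulus at most 1 at the
    centre, at points of modulus at most \<open>8/9\<close>.\<close>
  define M where "M = exp (pi * exp (pi * (2 + 2 * 1 + 12 * (8/9) / (1 - 8/9))))"
  show "M * exp 5 > 0" by (simp add: M_def)
  fix f w assume holf: "f holomorphic_on ball 0 1" and inj: "inj_on f (ball 0 1)" and f0: "f 0 = 0"
    and w: "w \<notin> f ` ball 0 1"
  have w0: "w \<noteq> 0" using w f0 by force
  define r :: real where "r = exp (-5)"
  have r: "0 < r" "r < 1" by (auto simp: r_def)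
  obtain z1 where z1: "cmod z1 = r" "cmod (f z1) \<le> cmod w"
    using injective_holomorphic_omitted_value[OF holf inj f0 w r] by blast
  have z10: "z1 \<noteq> 0" using z1 r by auto
  define \<zeta>1 where "\<zeta>1 = Ln z1"
  have \<zeta>1: "exp \<zeta>1 = z1" "Re \<zeta>1 = -5" using z10 z1 by (auto simp: \<zeta>1_def r_def)
  \<comment> \<open>For \<open>cmod \<zeta> \<le> 1\<close> the exponent has real part at most
    \<open>-5 + 9/2 < 0\<close>, so its exponential stays in the unit disc. Every point of the
    circle of radius \<open>exp (-5)\<close> has a logarithm within
    \<open>pi < 4 = 9/2 * 8/9\<close> of \<open>\<zeta>1\<close>, hence is reached with
    \<open>cmod \<zeta> \<le> 8/9\<close>.\<close>
  define Q where "Q = (\<lambda>\<zeta>. f (exp (\<zeta>1 + 9/2 * \<zeta>)) / w)"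
  have inb: "exp (\<zeta>1 + 9/2 * \<zeta>) \<in> ball 0 1" if "\<zeta> \<in> cball 0 1" for \<zeta>
  proof -
    have "Re (9/2 * \<zeta>) \<le> 9/2"
      using that complex_Re_le_cmod[of \<zeta>] by simp
    then show ?thesis using \<zeta>1 by simp
  qed
  have bound: "cmod (f z) \<le> M * cmod w" if z: "cmod z = r" for z
  proof -
    define d where "d = Ln (z / z1)"
    have zz: "z / z1 \<noteq> 0" "cmod (z / z1) = 1" using z z1 r z10 by (auto simp: norm_divide)
    have "Re d = 0" using zz by (simp add: d_def)
    moreover have "\<bar>Im d\<bar> \<le> pi" using mpi_less_Im_Ln[OF zz(1)] Im_Ln_le_pi[OF zz(1)] by (auto simp: d_def)
    ultimately have d: "cmod d \<le> pi" by (simp add: cmod_def)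
    have ed: "exp (\<zeta>1 + d) = z" using zz z10 by (simp add: exp_add \<zeta>1 d_def)
    have "norm (Q (2/9 * d)) \<le> M"
      unfolding M_def
    proof (rule Schottky[where f=Q])
      have "(\<lambda>\<zeta>. f (exp (\<zeta>1 + 9/2 * \<zeta>))) holomorphic_on cball 0 1"
        by (rule holomorphic_on_compose_gen[OF _ holf, unfolded o_def])
          (use inb in \<open>auto intro!: holomorphic_intros\<close>)
      then show "Q holomorphic_on cball 0 1"
        unfolding Q_def by (intro holomorphic_on_divide holomorphic_on_const) (use w0 in auto)
      show "norm (Q 0) \<le> 1" using z1 w0 \<zeta>1 by (simp add: Q_def norm_divide divide_le_eq)
      show "\<not> (Q z = 0 \<or> Q z = 1)" if "z \<in> cball 0 1" for z
      proof -
        have "f (exp (\<zeta>1 + 9/2 * z)) \<noteq> 0"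
          using inj_onD[OF inj, of "exp (\<zeta>1 + 9/2 * z)" 0] f0 inb[OF that] by auto
        moreover have "f (exp (\<zeta>1 + 9/2 * z)) \<noteq> w" using w inb[OF that] by auto
        ultimately show ?thesis using w0 by (simp add: Q_def)
      qed
      show "norm (2/9 * d) \<le> 8/9" using d pi_less_4 by (simp add: norm_mult)
    qed auto
    then show ?thesis using ed w0 by (simp add: Q_def norm_divide divide_le_eq)
  qed
  have sub: "cball (0::complex) r \<subseteq> ball 0 1" using r by auto
  have "norm ((deriv ^^ 1) f 0) \<le> fact 1 * (M * cmod w) / r ^ 1"
  proof (rule Cauchy_inequality)
    show "f holomorphic_on ball 0 r" by (rule holomorphic_on_subset[OF holf]) (use r in auto)
    show "continuous_on (cball 0 r) f"
      by (rule holomorphic_on_imp_continuous_on[OF holomorphic_on_subset[OF holf sub]])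
  qed (use r bound in auto)
  then show "cmod (deriv f 0) \<le> M * exp 5 * cmod w"
    by (simp add: r_def exp_minus field_simps)
qed

lemma weak_koebe:
  obtains c where "c > 0"
    "\<And>f a r. f holomorphic_on ball a r \<Longrightarrow> inj_on f (ball a r) \<Longrightarrow> 0 < r
       \<Longrightarrow> ball (f a) (c * (r * cmod (deriv f a))) \<subseteq> f ` ball a r"
proof -
  obtain C where C: "C > 0"
    "\<And>f w. f holomorphic_on ball 0 1 \<Longrightarrow> inj_on f (ball 0 1) \<Longrightarrow> f 0 = 0 \<Longrightarrow> w \<notin> f ` ball 0 1
       \<Longrightarrow> cmod (deriv f 0) \<le> C * cmod w"
    using weak_koebe_unit by blast
  show ?thesis
  proof
    show "1 / C > 0" using C by simp
    fix f :: "complex \<Rightarrow> complex" and a r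
    assume holf: "f holomorphic_on ball a r" and inj: "inj_on f (ball a r)" and r: "(0::real) < r"
    define g where "g z = f (a + of_real r * z) - f a" for z
    have inb: "a + of_real r * z \<in> ball a r" if "z \<in> ball 0 1" for z
      using that r by (simp add: dist_norm norm_mult)
    have holg: "g holomorphic_on ball 0 1"
      unfolding g_def
      by (intro holomorphic_on_diff holomorphic_on_const
          holomorphic_on_compose_gen[OF _ holf, unfolded o_def, of "\<lambda>z. a + of_real r * z"])
        (use inb in \<open>auto intro!: holomorphic_intros\<close>)
    have injg: "inj_on g (ball 0 1)"
    proof (rule inj_onI)
      fix x y assume "x \<in> ball 0 1" "y \<in> ball 0 1" "g x = g y"
      then show "x = y" using inj_onD[OF inj _ inb inb, of x y] r by (auto simp: g_def)
    qed
    have df: "(f has_field_derivative deriv f a) (at a)"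
      using holf r by (intro holomorphic_derivI[of _ "ball a r"]) auto
    have "(g has_field_derivative deriv f a * of_real r) (at 0)"
    proof -
      have "((\<lambda>z. a + of_real r * z) has_field_derivative of_real r) (at 0)"
        by (auto intro!: derivative_eq_intros)
      from DERIV_chain2[of f "deriv f a" "\<lambda>z. a + of_real r * z", OF _ this] df
      have "((\<lambda>z. f (a + of_real r * z)) has_field_derivative deriv f a * of_real r) (at 0)" by simp
      from DERIV_diff[OF this DERIV_const[of "f a"]] show ?thesis by (simp add: g_def[abs_def])
    qed
    then have dg: "deriv g 0 = deriv f a * of_real r" by (rule DERIV_imp_deriv)
    show "ball (f a) (1 / C * (r * cmod (deriv f a))) \<subseteq> f ` ball a r"
    proof
      fix y assume y: "y \<in> ball (f a) (1 / C * (r * cmod (deriv f a)))"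
      show "y \<in> f ` ball a r"
      proof (rule ccontr)
        assume "y \<notin> f ` ball a r"
        then have "y - f a \<notin> g ` ball 0 1" using inb by (auto simp: g_def)
        from C(2)[OF holg injg _ this] have "r * cmod (deriv f a) \<le> C * cmod (y - f a)"
          using r by (simp add: g_def dg norm_mult mult.commute)
        then show False using y C(1) by (simp add: dist_norm norm_minus_commute field_simps)
      qed
    qed
  qed
qed

subsection \<open>Change of variables in complex notation\<close>

definition cx :: "real^2 \<Rightarrow> complex" where "cx v = Complex (v $ 1) (v $ 2)"
definition xc :: "complex \<Rightarrow> real^2" where "xc z = vector [Re z, Im z]"

lemma Re_cx [simp]: "Re (cx v) = v $ 1" and Im_cx [simp]: "Im (cx v) = v $ 2"
  by (auto simp: cx_def)

lemma xc_nth [simp]: "xc z $ 1 = Re z" "xc z $ 2 = Im z"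
  by (auto simp: xc_def)

lemma cx_xc [simp]: "cx (xc z) = z" by (simp add: complex_eq_iff)
lemma xc_cx [simp]: "xc (cx v) = v" by (simp add: vec_eq_iff forall_2)

lemma bounded_linear_cx: "bounded_linear cx"
  by (intro linear_conv_bounded_linear[THEN iffD1] linearI) (auto simp: complex_eq_iff)

lemma bounded_linear_xc: "bounded_linear xc"
  by (intro linear_conv_bounded_linear[THEN iffD1] linearI) (auto simp: vec_eq_iff forall_2)

lemma norm_cx [simp]: "cmod (cx v) = norm v"
  by (simp add: cmod_def norm_vec_def L2_set_def sum_2)

lemma norm_xc [simp]: "norm (xc z) = cmod z"
  by (metis cx_xc norm_cx)

lemma inj_cx: "inj cx" and inj_xc: "inj xc"
  by (metis injI xc_cx, metis injI cx_xc)

lemma xc_image_eq: "xc ` S = cx -` S"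
  by (auto simp: image_iff) (metis xc_cx)

lemma cx_image_eq: "cx ` S = xc -` S"
  by (auto simp: image_iff) (metis cx_xc)

lemma cx_cbox: "cx ` cbox u v = cbox (cx u) (cx v)"
  unfolding cx_image_eq by (auto simp: mem_box_cart forall_2 Basis_complex_def mem_box)

lemma xc_cbox: "xc ` cbox u v = cbox (xc u) (xc v)"
  unfolding xc_image_eq by (auto simp: mem_box_cart forall_2 Basis_complex_def mem_box)

lemma xc_ball: "xc ` ball 0 r = ball 0 r" and cx_ball: "cx ` ball 0 r = ball 0 r"
  unfolding xc_image_eq cx_image_eq by auto

lemma content_cx: "measure lborel (cx ` cbox u v) = measure lborel (cbox u v)"
proof -
  have "(\<Prod>i\<in>Basis. cx v \<bullet> i - cx u \<bullet> i) = (\<Prod>i\<in>UNIV. v $ i - u $ i)"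
    by (simp add: Basis_complex_def UNIV_2 inner_complex_def)
  moreover have "cbox (cx u) (cx v) = {} \<longleftrightarrow> cbox u v = {}"
    using cx_cbox[of u v] by auto
  ultimately show ?thesis by (simp add: cx_cbox content_cbox_if[of "cx u" "cx v"] content_cbox_if_cart)
qed

lemma content_xc: "measure lborel (xc ` cbox u v) = measure lborel (cbox u v)"
  using content_cx[of "xc u" "xc v"] by (simp add: cx_cbox xc_cbox)

text \<open>\<open>cx\<close> and \<open>xc\<close> exchange boxes of equal content, so integrals
  over boxes transfer by \<open>has_integral_twiddle\<close>; the characterization of the integral
  by large boxes extends this to arbitrary sets.\<close>

lemma has_integral_cx_imp:
  fixes f :: "complex \<Rightarrow> real"
  assumes "(f has_integral y) S" shows "((\<lambda>x. f (cx x)) has_integral y) (xc ` S)"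
  unfolding has_integral'[of _ _ "xc ` S"]
proof (intro allI impI)
  fix e :: real assume "e > 0"
  then obtain B where B: "B > 0" "\<And>a b. ball 0 B \<subseteq> cbox a b \<Longrightarrow>
     \<exists>z. ((\<lambda>x. if x \<in> S then f x else 0) has_integral z) (cbox a b) \<and> norm (z - y) < e"
    using assms unfolding has_integral'[of f] by blast
  have "\<exists>z. ((\<lambda>x. if x \<in> xc ` S then f (cx x) else 0) has_integral z) (cbox a b) \<and> norm (z - y) < e"
    if sub: "ball 0 B \<subseteq> cbox a b" for a b
  proof -
    have "ball 0 B \<subseteq> cbox (cx a) (cx b)"
      using image_mono[OF sub, of cx] by (simp add: cx_ball cx_cbox)
    then obtain z where z: "((\<lambda>x. if x \<in> S then f x else 0) has_integral z) (cbox (cx a) (cx b))"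
      "norm (z - y) < e" using B(2) by blast
    have "((\<lambda>x. if cx x \<in> S then f (cx x) else 0) has_integral (1/1) *\<^sub>R z) (xc ` cbox (cx a) (cx b))"
    proof (rule has_integral_twiddle[where g = cx and h = xc, OF _ _ _ _ _ _ _ z(1)])
      show "\<exists>w z. cx ` cbox u v = cbox w z" for u v by (auto simp: cx_cbox)
      show "\<exists>w z. xc ` cbox u v = cbox w z" for u v by (auto simp: xc_cbox)
    qed (auto simp: content_cx intro!: linear_continuous_at bounded_linear_cx)
    then have "((\<lambda>x. if x \<in> xc ` S then f (cx x) else 0) has_integral z) (cbox a b)"
      unfolding xc_cbox xc_cx by (simp add: xc_image_eq)
    with z(2) show ?thesis by blast
  qed
  with B(1) show "\<exists>B>0. \<forall>a b. ball 0 B \<subseteq> cbox a b \<longrightarrow>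
    (\<exists>z. ((\<lambda>x. if x \<in> xc ` S then f (cx x) else 0) has_integral z) (cbox a b) \<and> norm (z - y) < e)"
    by blast
qed

lemma has_integral_xc_imp:
  fixes f :: "real^2 \<Rightarrow> real"
  assumes "(f has_integral y) S" shows "((\<lambda>x. f (xc x)) has_integral y) (cx ` S)"
  unfolding has_integral'[of _ _ "cx ` S"]
proof (intro allI impI)
  fix e :: real assume "e > 0"
  then obtain B where B: "B > 0" "\<And>a b. ball 0 B \<subseteq> cbox a b \<Longrightarrow>
     \<exists>z. ((\<lambda>x. if x \<in> S then f x else 0) has_integral z) (cbox a b) \<and> norm (z - y) < e"
    using assms unfolding has_integral'[of f] by blast
  have "\<exists>z. ((\<lambda>x. if x \<in> cx ` S then f (xc x) else 0) has_integral z) (cbox a b) \<and> norm (z - y) < e"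
    if sub: "ball 0 B \<subseteq> cbox a b" for a b
  proof -
    have "ball 0 B \<subseteq> cbox (xc a) (xc b)"
      using image_mono[OF sub, of xc] by (simp add: xc_ball xc_cbox)
    then obtain z where z: "((\<lambda>x. if x \<in> S then f x else 0) has_integral z) (cbox (xc a) (xc b))"
      "norm (z - y) < e" using B(2) by blast
    have "((\<lambda>x. if xc x \<in> S then f (xc x) else 0) has_integral (1/1) *\<^sub>R z) (cx ` cbox (xc a) (xc b))"
    proof (rule has_integral_twiddle[where g = xc and h = cx, OF _ _ _ _ _ _ _ z(1)])
      show "\<exists>w z. cx ` cbox u v = cbox w z" for u v by (auto simp: cx_cbox)
      show "\<exists>w z. xc ` cbox u v = cbox w z" for u v by (auto simp: xc_cbox)
    qed (auto simp: content_xc intro!: linear_continuous_at bounded_linear_xc)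
    then have "((\<lambda>x. if x \<in> cx ` S then f (xc x) else 0) has_integral z) (cbox a b)"
      unfolding cx_cbox cx_xc by (simp add: cx_image_eq)
    with z(2) show ?thesis by blast
  qed
  with B(1) show "\<exists>B>0. \<forall>a b. ball 0 B \<subseteq> cbox a b \<longrightarrow>
    (\<exists>z. ((\<lambda>x. if x \<in> cx ` S then f (xc x) else 0) has_integral z) (cbox a b) \<and> norm (z - y) < e)"
    by blast
qed

lemma has_integral_cx_iff:
  fixes f :: "complex \<Rightarrow> real"
  shows "((\<lambda>x. f (cx x)) has_integral y) (xc ` S) \<longleftrightarrow> (f has_integral y) S"
  using has_integral_cx_imp[of f y S] has_integral_xc_imp[of "\<lambda>x. f (cx x)" y "xc ` S"]
  by (auto simp: image_image)

lemma absolutely_integrable_cx_iff: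
  fixes f :: "complex \<Rightarrow> real"
  shows "(\<lambda>x. f (cx x)) absolutely_integrable_on (xc ` S) \<longleftrightarrow> f absolutely_integrable_on S"
  using has_integral_cx_iff[of f _ S] has_integral_cx_iff[of "\<lambda>x. norm (f x)" _ S]
  by (simp add: absolutely_integrable_on_def integrable_on_def)

lemma integral_cx:
  fixes f :: "complex \<Rightarrow> real"
  shows "integral (xc ` S) (\<lambda>x. f (cx x)) = integral S f"
  unfolding integral_def integrable_on_def using has_integral_cx_iff[of f _ S] by simp

text \<open>The theorem for \<open>real^2\<close> is transported along \<open>cx\<close> and
  \<open>xc\<close>; the determinant of \<open>a * v + b * cnj v\<close> is
  \<open>(cmod a)^2 - (cmod b)^2\<close>.\<close>

lemma absolutely_integrable_change_of_variables_complex: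
  fixes \<phi> :: "complex \<Rightarrow> real" and g :: "complex \<Rightarrow> complex"
  assumes S: "S \<in> sets lebesgue"
    and der: "\<And>x. x \<in> S \<Longrightarrow> (g has_derivative (\<lambda>v. a x * v + b x * cnj v)) (at x within S)"
    and inj: "inj_on g S"
  shows "(\<lambda>x. \<bar>(cmod (a x))\<^sup>2 - (cmod (b x))\<^sup>2\<bar> * \<phi> (g x)) absolutely_integrable_on S \<and>
      integral S (\<lambda>x. \<bar>(cmod (a x))\<^sup>2 - (cmod (b x))\<^sup>2\<bar> * \<phi> (g x)) = c
    \<longleftrightarrow> \<phi> absolutely_integrable_on g ` S \<and> integral (g ` S) \<phi> = c"
proof -
  define G where "G = (\<lambda>x. xc (g (cx x)))"
  define G' where "G' = (\<lambda>x v. xc (a (cx x) * cx v + b (cx x) * cnj (cx v)))"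
  define T where "T = xc ` S"
  have cxT: "cx ` T = S" by (simp add: T_def image_image)
  have GT: "G ` T = xc ` g ` S" by (simp add: T_def G_def image_image)
  have T: "T \<in> sets lebesgue"
    unfolding T_def by (rule differentiable_image_in_sets_lebesgue[OF S])
      (auto intro!: bounded_linear_imp_differentiable_on bounded_linear_xc)
  have det: "\<bar>det (matrix (G' x))\<bar> = \<bar>(cmod (a (cx x)))\<^sup>2 - (cmod (b (cx x)))\<^sup>2\<bar>" for x
    unfolding cmod_power2 G'_def
    by (simp add: det_2 matrix_def axis_def power2_eq_square algebra_simps)
  \<comment> \<open>The scalar integrand is wrapped into \<open>real^1\<close>, because the change
    of variables is stated for vector-valued integrands.\<close>
  have "(\<lambda>x. \<bar>det (matrix (G' x))\<bar> *\<^sub>R (vec (\<phi> (cx (G x))) :: real^1)) absolutely_integrable_on T \<and>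
      integral T (\<lambda>x. \<bar>det (matrix (G' x))\<bar> *\<^sub>R (vec (\<phi> (cx (G x))) :: real^1)) = vec c
    \<longleftrightarrow> (\<lambda>x. vec (\<phi> (cx x)) :: real^1) absolutely_integrable_on G ` T \<and>
      integral (G ` T) (\<lambda>x. vec (\<phi> (cx x)) :: real^1) = vec c"
  proof (rule has_absolute_integral_change_of_variables[OF T])
    fix x assume x: "x \<in> T"
    have "((\<lambda>x. g (cx x)) has_derivative (\<lambda>v. a (cx x) * cx v + b (cx x) * cnj (cx v))) (at x within T)"
      by (rule has_derivative_in_compose[of cx cx, unfolded cxT])
        (use x cxT der[of "cx x"] in \<open>auto intro!: bounded_linear_imp_has_derivative bounded_linear_cx\<close>)
    then show "(G has_derivative G' x) (at x within T)"
      unfolding G_def G'_def by (rule bounded_linear.has_derivative[OF bounded_linear_xc])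
  next
    show "inj_on G T"
      unfolding G_def T_def
      by (rule inj_onI) (auto dest!: injD[OF inj_xc] inj_onD[OF inj])
  qed
  moreover have "(vec c :: real^1) $ 1 = c" for c by simp
  ultimately have "(\<lambda>x. \<bar>(cmod (a (cx x)))\<^sup>2 - (cmod (b (cx x)))\<^sup>2\<bar> * \<phi> (g (cx x))) absolutely_integrable_on T \<and>
      integral T (\<lambda>x. \<bar>(cmod (a (cx x)))\<^sup>2 - (cmod (b (cx x)))\<^sup>2\<bar> * \<phi> (g (cx x))) = c
    \<longleftrightarrow> (\<lambda>x. \<phi> (cx x)) absolutely_integrable_on G ` T \<and> integral (G ` T) (\<lambda>x. \<phi> (cx x)) = c"
    unfolding det
    by (simp add: absolutely_integrable_on_1_iff integral_on_1_eq vec_eq_iff forall_1 G_def)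
  then show ?thesis
    unfolding GT unfolding T_def absolutely_integrable_cx_iff integral_cx
    using absolutely_integrable_cx_iff[where S = S and f = "\<lambda>x. \<bar>(cmod (a x))\<^sup>2 - (cmod (b x))\<^sup>2\<bar> * \<phi> (g x)"]
      integral_cx[where S = S and f = "\<lambda>x. \<bar>(cmod (a x))\<^sup>2 - (cmod (b x))\<^sup>2\<bar> * \<phi> (g x)"]
    by simp
qed

subsection \<open>Modifying a conformal map on a disc\<close>

text \<open>On the unit circle \<open>1 / z = cnj z\<close>, so conjugation is continued past the
  circle by a holomorphic function.\<close>

definition cnj_ext :: "complex \<Rightarrow> complex" where
  "cnj_ext z = (if cmod z \<le> 1 then cnj z else 1 / z)"

text \<open>After clearing the denominator and squaring, the difference of the two sides is
  \<open>((cmod w)^2 - 1) * ((cmod w)^2 + 1 - 2 * p)\<close>, and \<open>p \<le> cmod w\<close>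
  makes the last factor at least \<open>(cmod w - 1)^2\<close>.\<close>

lemma cnj_ext_mixed:
  assumes "cmod z \<le> 1" "1 < cmod w"
  shows "cmod (cnj z - 1 / w) \<le> cmod (z - w)"
proof -
  define p where "p = Re (cnj z * w)"
  have w0: "w \<noteq> 0" using assms by auto
  have p: "p \<le> cmod w"
  proof -
    have "p \<le> cmod (cnj z * w)" unfolding p_def by (rule complex_Re_le_cmod)
    also have "\<dots> \<le> 1 * cmod w" unfolding norm_mult by (rule mult_right_mono) (use assms in auto)
    finally show ?thesis by simp
  qed
  have 1: "(cmod (cnj z * w - 1))\<^sup>2 = (cmod z)\<^sup>2 * (cmod w)\<^sup>2 - 2 * p + 1"
    unfolding p_def cmod_power2 by (simp add: power2_eq_square algebra_simps)
  have 2: "(cmod (z - w))\<^sup>2 = (cmod z)\<^sup>2 - 2 * p + (cmod w)\<^sup>2"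
    unfolding p_def cmod_power2 by (simp add: power2_eq_square algebra_simps)
  have 3: "0 \<le> ((cmod w)\<^sup>2 - 1) * ((cmod w)\<^sup>2 + 1 - 2 * p)"
  proof (intro mult_nonneg_nonneg)
    have "0 \<le> (cmod w - 1)\<^sup>2" by simp
    then show "0 \<le> (cmod w)\<^sup>2 + 1 - 2 * p" using p by (simp add: power2_eq_square algebra_simps)
  qed (use assms in auto)
  have "(cmod w)\<^sup>2 * ((cmod z)\<^sup>2 - 2 * p + (cmod w)\<^sup>2) - ((cmod z)\<^sup>2 * (cmod w)\<^sup>2 - 2 * p + 1)
      = ((cmod w)\<^sup>2 - 1) * ((cmod w)\<^sup>2 + 1 - 2 * p)"
    by (simp only: algebra_simps)
  with 3 have "(cmod (cnj z * w - 1))\<^sup>2 \<le> (cmod w)\<^sup>2 * (cmod (z - w))\<^sup>2"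
    unfolding 1 2 by linarith
  then have "cmod (cnj z * w - 1) \<le> cmod w * cmod (z - w)"
    by (simp add: power_mult_distrib[symmetric] power_mono_iff)
  moreover have "cnj z - 1 / w = (cnj z * w - 1) / w" using w0 by (simp add: field_simps)
  ultimately show ?thesis using w0 by (simp add: norm_divide divide_le_eq mult.commute)
qed

lemma cnj_ext_lipschitz: "cmod (cnj_ext z - cnj_ext w) \<le> cmod (z - w)"
proof (cases "cmod z \<le> 1"; cases "cmod w \<le> 1")
  assume "cmod z \<le> 1" "cmod w \<le> 1"
  then show ?thesis by (simp add: cnj_ext_def flip: complex_cnj_diff)
next
  assume "cmod z \<le> 1" "\<not> cmod w \<le> 1"
  then show ?thesis using cnj_ext_mixed[of z w] by (simp add: cnj_ext_def)
next
  assume "\<not> cmod z \<le> 1" "cmod w \<le> 1"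
  then show ?thesis using cnj_ext_mixed[of w z] by (simp add: cnj_ext_def norm_minus_commute)
next
  assume zw: "\<not> cmod z \<le> 1" "\<not> cmod w \<le> 1"
  then have "z \<noteq> 0" "w \<noteq> 0" by auto
  then have "1 / z - 1 / w = (w - z) / (z * w)" by (simp add: field_simps)
  then have "cmod (1 / z - 1 / w) = cmod (z - w) / (cmod z * cmod w)"
    by (simp add: norm_divide norm_mult norm_minus_commute)
  also have "\<dots> \<le> cmod (z - w) / 1"
    using zw mult_mono[of 1 "cmod z" 1 "cmod w"] by (intro divide_left_mono) auto
  finally show ?thesis using zw by (simp add: cnj_ext_def)
qed

text \<open>The homeomorphism of the plane that has constant Beltrami coefficient \<open>\<nu>\<close> inside a disc and is
  conformal outside it: for the unit disc it is \<open>z + \<nu> * cnj z\<close> inside and \<open>z + \<nu> / z\<close> outside.\<close>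

definition dmap :: "complex \<Rightarrow> real \<Rightarrow> complex \<Rightarrow> complex \<Rightarrow> complex" where
  "dmap c r \<nu> z = z + \<nu> * (of_real r * cnj_ext ((z - c) / of_real r))"

context
  fixes c :: complex and r :: real and \<nu> :: complex
  assumes r: "0 < r" and \<nu>: "cmod \<nu> < 1"
begin

lemma dmap_aux:
  "cmod (\<nu> * (of_real r * cnj_ext ((z - c) / of_real r)) - \<nu> * (of_real r * cnj_ext ((w - c) / of_real r)))
     \<le> cmod \<nu> * cmod (z - w)"
proof -
  have "cmod (cnj_ext ((z - c) / of_real r) - cnj_ext ((w - c) / of_real r)) \<le> cmod (z - w) / r"
    using cnj_ext_lipschitz[of "(z - c) / of_real r" "(w - c) / of_real r"] r
    by (simp add: norm_divide flip: diff_divide_distrib)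
  then have "cmod (\<nu> * of_real r) * cmod (cnj_ext ((z - c) / of_real r) - cnj_ext ((w - c) / of_real r))
      \<le> cmod (\<nu> * of_real r) * (cmod (z - w) / r)"
    by (rule mult_left_mono) simp
  moreover have "\<nu> * (of_real r * x) - \<nu> * (of_real r * y) = (\<nu> * of_real r) * (x - y)" for x y
    by (simp add: algebra_simps)
  ultimately show ?thesis using r by (simp add: norm_mult)
qed

lemma dmap_upper: "cmod (dmap c r \<nu> z - dmap c r \<nu> w) \<le> 2 * cmod (z - w)"
proof -
  have "dmap c r \<nu> z - dmap c r \<nu> w = (z - w) +
    (\<nu> * (of_real r * cnj_ext ((z - c) / of_real r)) - \<nu> * (of_real r * cnj_ext ((w - c) / of_real r)))"
    by (simp add: dmap_def)
  also have "cmod \<dots> \<le> cmod (z - w) + cmod \<nu> * cmod (z - w)"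
    by (rule order_trans[OF norm_triangle_ineq add_left_mono[OF dmap_aux]])
  also have "\<dots> \<le> cmod (z - w) + 1 * cmod (z - w)"
    using \<nu> by (intro add_left_mono mult_right_mono) auto
  finally show ?thesis by simp
qed

lemma dmap_lower: "(1 - cmod \<nu>) * cmod (z - w) \<le> cmod (dmap c r \<nu> z - dmap c r \<nu> w)"
proof -
  have "z - w = (dmap c r \<nu> z - dmap c r \<nu> w) -
    (\<nu> * (of_real r * cnj_ext ((z - c) / of_real r)) - \<nu> * (of_real r * cnj_ext ((w - c) / of_real r)))"
    by (simp add: dmap_def)
  also have "cmod \<dots> \<le> cmod (dmap c r \<nu> z - dmap c r \<nu> w) + cmod \<nu> * cmod (z - w)"
    by (rule order_trans[OF norm_triangle_ineq4 add_left_mono[OF dmap_aux]])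
  finally show ?thesis by (simp add: algebra_simps)
qed

lemma bij_dmap: "bij (dmap c r \<nu>)"
proof (rule bijI)
  show "inj (dmap c r \<nu>)"
  proof (rule injI)
    fix z w assume "dmap c r \<nu> z = dmap c r \<nu> w"
    then have "(1 - cmod \<nu>) * cmod (z - w) \<le> 0" using dmap_lower[of z w] by simp
    then show "z = w" using \<nu> by (simp add: mult_le_0_iff)
  qed
  show "surj (dmap c r \<nu>)"
  proof (rule surjI)
    fix w
    \<comment> \<open>The preimages of \<open>w\<close> under \<open>dmap\<close> are the fixed
      points of a contraction with constant \<open>cmod \<nu>\<close>.\<close>
    have "\<exists>!z. w - \<nu> * (of_real r * cnj_ext ((z - c) / of_real r)) = z"
    proof (rule banach_fix_type)
      show "\<forall>x y. dist (w - \<nu> * (of_real r * cnj_ext ((x - c) / of_real r)))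
          (w - \<nu> * (of_real r * cnj_ext ((y - c) / of_real r))) \<le> cmod \<nu> * dist x y"
        using dmap_aux by (simp add: dist_norm norm_minus_commute)
    qed (use \<nu> in auto)
    then have "\<exists>z. dmap c r \<nu> z = w" unfolding dmap_def by (metis diff_add_cancel)
    then show "dmap c r \<nu> (SOME z. dmap c r \<nu> z = w) = w" by (rule someI_ex)
  qed
qed

lemma dmap_inside: "cmod (z - c) < r \<Longrightarrow> dmap c r \<nu> z = z + \<nu> * cnj (z - c)"
  using r by (simp add: dmap_def cnj_ext_def norm_divide)

lemma dmap_outside: "r < cmod (z - c) \<Longrightarrow> dmap c r \<nu> z = z + \<nu> * of_real r ^ 2 / (z - c)"
  using r by (simp add: dmap_def cnj_ext_def norm_divide power2_eq_square)

lemma dmap_has_derivative_inside: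
  assumes "z \<in> ball c r"
  shows "(dmap c r \<nu> has_derivative (\<lambda>v. v + \<nu> * cnj v)) (at z)"
proof (rule has_derivative_transform_within_open[where s="ball c r"])
  show "((\<lambda>z. z + \<nu> * cnj (z - c)) has_derivative (\<lambda>v. v + \<nu> * cnj v)) (at z)"
    by (auto intro!: derivative_eq_intros)
qed (use assms dmap_inside in \<open>auto simp: dist_norm norm_minus_commute\<close>)

lemma dmap_holomorphic_outside: "dmap c r \<nu> holomorphic_on - cball c r"
proof (rule holomorphic_transform)
  show "(\<lambda>z. z + \<nu> * of_real r ^ 2 / (z - c)) holomorphic_on - cball c r"
    by (intro holomorphic_intros) (use r in auto)
qed (use dmap_outside in \<open>auto simp: dist_norm norm_minus_commute\<close>)

lemma dmap_asymptotic: "((\<lambda>z. dmap c r \<nu> z - z) \<longlongrightarrow> 0) at_infinity"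
proof (rule Lim_transform_eventually)
  have "filterlim (\<lambda>z::complex. z - c) at_infinity at_infinity"
    using tendsto_add_filterlim_at_infinity[OF tendsto_const[of "- c"] filterlim_ident] by simp
  then show "((\<lambda>z. \<nu> * of_real r ^ 2 / (z - c)) \<longlongrightarrow> 0) at_infinity"
    by (rule tendsto_divide_0[OF tendsto_const])
  show "\<forall>\<^sub>F z in at_infinity. \<nu> * of_real r ^ 2 / (z - c) = dmap c r \<nu> z - z"
    unfolding eventually_at_infinity
  proof (intro exI allI impI)
    fix z assume "cmod c + r + 1 \<le> cmod z"
    then have "r < cmod (z - c)" using norm_triangle_ineq2[of z c] by linarith
    then show "\<nu> * of_real r ^ 2 / (z - c) = dmap c r \<nu> z - z" by (simp add: dmap_outside)
  qed
qed

end

text \<open>By \<open>weak_koebe\<close> the inverse of \<open>f\<close> is defined on a disc of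
  radius comparable to \<open>r * cmod (deriv f a)\<close>, and its values lie in
  \<open>ball a r\<close>. Cauchy's inequality then bounds its second derivative, so on a disc
  smaller by the factor \<open>t\<close> its first derivative is almost constant. All constants are
  independent of \<open>f\<close>, which the iteration over discs requires.\<close>

lemma koebe_distortion:
  assumes "0 < e"
  obtains \<tau> where "0 < \<tau>" 
    "\<And>f a r. f holomorphic_on ball a r \<Longrightarrow> inj_on f (ball a r) \<Longrightarrow> 0 < r \<Longrightarrow>
       cball (f a) (\<tau> * (r * cmod (deriv f a))) \<subseteq> f ` ball a r \<and>
       (\<forall>z\<in>ball a r. f z \<in> cball (f a) (\<tau> * (r * cmod (deriv f a))) \<longrightarrow> cmod (deriv f a / deriv f z - 1) \<le> e)"
proof -
  obtain k where k: "k > 0"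
    "\<And>f a r. f holomorphic_on ball a r \<Longrightarrow> inj_on f (ball a r) \<Longrightarrow> 0 < r
       \<Longrightarrow> ball (f a) (k * (r * cmod (deriv f a))) \<subseteq> f ` ball a r"
    using weak_koebe by blast
  \<comment> \<open>The rescaled inverse \<phi> is bounded by \<open>r\<close> on the unit disc.
    Cauchy's inequality on discs of radius \<open>1/4\<close> about points of
    \<open>cball 0 (1/2)\<close> bounds its second derivative by
    \<open>2 * r / (1/4)^2 = 32 * r\<close>; the final error is \<open>32 * t / k\<close>.\<close>
  define t where "t = min (1/2) (k * e / 32)"
  have t: "0 < t" "t \<le> 1/2" "32 * t \<le> k * e" using k(1) assms by (auto simp: t_def)
  show ?thesis
  proof (rule that[of "k * t"], intro mult_pos_pos k t, intro conjI ballI impI)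
    fix f :: "complex \<Rightarrow> complex" and a r
    assume hol: "f holomorphic_on ball a r" and inj: "inj_on f (ball a r)" and r: "0 < r"
    define D where "D = deriv f a"
    have D: "D \<noteq> 0" unfolding D_def by (rule holomorphic_injective_imp_regular[OF hol _ inj]) (use r in auto)
    define \<rho> where "\<rho> = k * (r * cmod D)"
    have \<rho>: "\<rho> > 0" using k r D by (simp add: \<rho>_def)
    have kb: "ball (f a) \<rho> \<subseteq> f ` ball a r" using k(2)[OF hol inj r] by (simp add: \<rho>_def D_def)
    have sub: "cball (f a) (k * t * (r * cmod D)) \<subseteq> ball (f a) \<rho>"
    proof -
      have "t * \<rho> \<le> 1/2 * \<rho>" using t \<rho> by (intro mult_right_mono) auto
      then have "k * t * (r * cmod D) < \<rho>" using \<rho> by (simp add: \<rho>_def algebra_simps)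
      then show ?thesis by auto
    qed
    then show "cball (f a) (k * t * (r * cmod (deriv f a))) \<subseteq> f ` ball a r" using kb by (simp add: D_def)
    obtain g where g: "g holomorphic_on f ` ball a r"
        "\<And>z. z \<in> ball a r \<Longrightarrow> deriv f z * deriv g (f z) = 1 \<and> g (f z) = z"
      using holomorphic_has_inverse[OF hol open_ball inj] by metis
    fix z assume z: "z \<in> ball a r" "f z \<in> cball (f a) (k * t * (r * cmod (deriv f a)))"
    define \<phi> where "\<phi> u = g (f a + of_real \<rho> * u) - a" for u
    have inb: "f a + of_real \<rho> * u \<in> f ` ball a r" if "u \<in> ball 0 1" for u
      using that \<rho> kb by (intro subsetD[OF kb]) (simp add: dist_norm norm_mult)
    have hol\<phi>: "\<phi> holomorphic_on ball 0 1"
      unfolding \<phi>_def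
      by (intro holomorphic_on_diff holomorphic_on_const
          holomorphic_on_compose_gen[OF _ g(1), unfolded o_def, of "\<lambda>z. f a + of_real \<rho> * z"])
        (use inb in \<open>auto intro!: holomorphic_intros\<close>)
    have bd: "cmod (\<phi> u) \<le> r" if "u \<in> ball 0 1" for u
      using inb[OF that] g(2) by (auto simp: \<phi>_def dist_norm norm_minus_commute)
    have d\<phi>: "deriv \<phi> u = deriv g (f a + of_real \<rho> * u) * of_real \<rho>" if u: "u \<in> ball 0 1" for u
    proof (rule DERIV_imp_deriv)
      have "open (f ` ball a r)" by (rule open_mapping_thm3[OF hol open_ball inj])
      then have "(g has_field_derivative deriv g (f a + of_real \<rho> * u)) (at (f a + of_real \<rho> * u))"
        using g(1) inb[OF u] by (intro holomorphic_derivI) auto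
      moreover have "((\<lambda>u. f a + of_real \<rho> * u) has_field_derivative of_real \<rho>) (at u)"
        by (auto intro!: derivative_eq_intros)
      ultimately have "((\<lambda>u. g (f a + of_real \<rho> * u)) has_field_derivative deriv g (f a + of_real \<rho> * u) * of_real \<rho>) (at u)"
        by (rule DERIV_chain2)
      from DERIV_diff[OF this DERIV_const[of a]]
      show "(\<phi> has_field_derivative deriv g (f a + of_real \<rho> * u) * of_real \<rho>) (at u)"
        by (simp add: \<phi>_def[abs_def])
    qed
    define u where "u = (f z - f a) / of_real \<rho>"
    have u: "cmod u \<le> t"
    proof -
      have "cmod (f z - f a) \<le> t * \<rho>" using z(2) by (simp add: dist_norm norm_minus_commute D_def \<rho>_def algebra_simps)
      then show ?thesis using \<rho> by (simp add: u_def norm_divide field_simps)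
    qed
    have "cmod (deriv \<phi> u - deriv \<phi> 0) \<le> (32 * r) * cmod (u - 0)"
    proof (rule field_differentiable_bound[where S="cball 0 (1/2)" and f'="deriv (deriv \<phi>)"])
      fix v :: complex assume v: "v \<in> cball 0 (1/2)"
      have "deriv \<phi> holomorphic_on ball 0 1" by (rule holomorphic_deriv[OF hol\<phi>]) simp
      then show "(deriv \<phi> has_field_derivative deriv (deriv \<phi>) v) (at v within cball 0 (1/2))"
        using v by (intro has_field_derivative_at_within[OF holomorphic_derivI[of _ "ball 0 1"]]) auto
      have sb: "cball v (1/4) \<subseteq> ball 0 1"
      proof
        fix y assume "y \<in> cball v (1/4)"
        then show "y \<in> ball 0 1" using v norm_triangle_ineq[of v "y - v"] by (simp add: dist_norm norm_minus_commute)
      qed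
      have "norm ((deriv ^^ 2) \<phi> v) \<le> fact 2 * r / (1/4) ^ 2"
      proof (rule Cauchy_inequality)
        show "\<phi> holomorphic_on ball v (1/4)"
          by (rule holomorphic_on_subset[OF hol\<phi>]) (use sb in auto)
        show "continuous_on (cball v (1/4)) \<phi>"
          by (rule holomorphic_on_imp_continuous_on[OF holomorphic_on_subset[OF hol\<phi> sb]])
        show "norm (\<phi> x) \<le> r" if "norm (v - x) = 1/4" for x
          by (rule bd, rule subsetD[OF sb]) (use that in \<open>simp add: dist_norm\<close>)
      qed simp
      then show "cmod (deriv (deriv \<phi>) v) \<le> 32 * r"
        by (simp add: numeral_2_eq_2 power2_eq_square)
    qed (use u t in auto)
    moreover have fz: "f a + of_real \<rho> * u = f z" using \<rho> by (simp add: u_def)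
    moreover have "u \<in> ball 0 1" using u t by simp
    ultimately have 1: "cmod (deriv g (f z) * of_real \<rho> - deriv g (f a) * of_real \<rho>) \<le> 32 * r * cmod u"
      using d\<phi>[of u] d\<phi>[of 0] by simp
    have "deriv f z * deriv g (f z) = 1" and ga: "D * deriv g (f a) = 1"
      using g(2)[OF z(1)] g(2)[of a] r by (auto simp: D_def)
    then have "deriv g (f z) = 1 / deriv f z" by (metis mult_eq_0_iff nonzero_mult_div_cancel_left zero_neq_one)
    then have "D / deriv f z - 1 = D * deriv g (f z) - D * deriv g (f a)"
      using ga by simp
    also have "\<dots> = D / of_real \<rho> * (deriv g (f z) * of_real \<rho> - deriv g (f a) * of_real \<rho>)"
      using \<rho> by (simp add: field_simps)
    also have "cmod \<dots> = cmod D / \<rho> * cmod (deriv g (f z) * of_real \<rho> - deriv g (f a) * of_real \<rho>)"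
      using \<rho> by (simp add: norm_mult norm_divide)
    also have "\<dots> \<le> cmod D / \<rho> * (32 * r * t)"
    proof (rule mult_left_mono)
      have "32 * r * cmod u \<le> 32 * r * t" using u r by simp
      then show "cmod (deriv g (f z) * of_real \<rho> - deriv g (f a) * of_real \<rho>) \<le> 32 * r * t"
        using 1 by linarith
    qed (use \<rho> in simp)
    also have "\<dots> = 32 * t / k" using D r k(1) by (simp add: \<rho>_def)
    also have "\<dots> \<le> e" using t(3) k(1) by (simp add: field_simps)
    finally show "cmod (deriv f a / deriv f z - 1) \<le> e" by (simp add: D_def)
  qed
qed

text \<open>\<open>K\<close> is the region modified so far, \<open>Z\<close> a null set that
  contains all points where \<open>f\<close> may fail to be differentiable, and \<open>m\<close> the
  Beltrami coefficient, normalized with the derivative factor \<open>a\<close> outside. The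
  asymptotics at infinity are a normalization that is preserved when \<open>dmap\<close> is composed
  on the left.\<close>

definition qcmap :: "(complex \<Rightarrow> complex) \<Rightarrow> complex set \<Rightarrow> complex set \<Rightarrow> (complex \<Rightarrow> complex)
    \<Rightarrow> (complex \<Rightarrow> complex) \<Rightarrow> bool" where
  "qcmap f K Z a m \<longleftrightarrow>
     bij f \<and> (\<exists>M>0. \<forall>x y. dist (f x) (f y) \<le> M * dist x y \<and> dist x y \<le> M * dist (f x) (f y)) \<and>
     compact K \<and> closed Z \<and> negligible Z \<and> Z \<subseteq> K \<and> f holomorphic_on - K \<and>
     (\<forall>z. z \<notin> Z \<longrightarrow> (f has_derivative (\<lambda>v. a z * (v + m z * cnj v))) (at z) \<and> a z \<noteq> 0 \<and> cmod (m z) < 1) \<and>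
     continuous_on (- Z) a \<and> continuous_on (- Z) m \<and> (\<forall>z. z \<notin> K \<longrightarrow> m z = 0) \<and>
     ((\<lambda>z. f z - z) \<longlongrightarrow> 0) at_infinity"

lemma qcmapD:
  assumes "qcmap f K Z a m"
  shows "bij f" "\<exists>M>0. \<forall>x y. dist (f x) (f y) \<le> M * dist x y \<and> dist x y \<le> M * dist (f x) (f y)"
    "compact K" "closed Z" "negligible Z" "Z \<subseteq> K" "f holomorphic_on - K"
    "\<And>z. z \<notin> Z \<Longrightarrow> (f has_derivative (\<lambda>v. a z * (v + m z * cnj v))) (at z)"
    "\<And>z. z \<notin> Z \<Longrightarrow> a z \<noteq> 0" "\<And>z. z \<notin> Z \<Longrightarrow> cmod (m z) < 1"
    "continuous_on (- Z) a" "continuous_on (- Z) m" "\<And>z. z \<notin> K \<Longrightarrow> m z = 0"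
    "((\<lambda>z. f z - z) \<longlongrightarrow> 0) at_infinity"
  using assms unfolding qcmap_def by auto

lemma qcmap_id: "qcmap (\<lambda>z. z) {} {} (\<lambda>_. 1) (\<lambda>_. 0)"
  unfolding qcmap_def by (auto intro!: exI[of _ 1] simp: bij_id[unfolded id_def] holomorphic_on_ident)

lemma lipschitz_continuous_on:
  fixes f :: "'a::metric_space \<Rightarrow> 'b::metric_space"
  assumes "\<And>x y. dist (f x) (f y) \<le> M * dist x y"
  shows "continuous_on S f"
proof -
  have "(\<bar>M\<bar>)-lipschitz_on S f"
    using assms by (intro lipschitz_onI) (auto intro: order_trans[OF _ mult_right_mono[of M "\<bar>M\<bar>"]])
  then show ?thesis by (rule lipschitz_on_continuous_on)
qed

lemma negligible_lipschitz_preimage: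
  fixes f :: "'a::euclidean_space \<Rightarrow> 'a"
  assumes "bij f" "\<And>x y. dist x y \<le> M * dist (f x) (f y)" "negligible S"
  shows "negligible (f -` S)"
proof -
  have "negligible (inv f ` S)"
  proof (rule negligible_locally_Lipschitz_image[OF _ assms(3)])
    fix x assume "x \<in> S"
    have "norm (inv f y - inv f x) \<le> M * norm (y - x)" for y
      using assms(2)[of "inv f y" "inv f x"] assms(1)
      by (simp add: dist_norm bij_is_surj surj_f_inv_f)
    then show "\<exists>T B. open T \<and> x \<in> T \<and> (\<forall>y\<in>S \<inter> T. norm (inv f y - inv f x) \<le> B * norm (y - x))"
      by (intro exI[of _ UNIV] exI[of _ M]) auto
  qed simp
  also have "inv f ` S = f -` S" using assms(1) by (simp add: bij_vimage_eq_inv_image)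
  finally show ?thesis .
qed

lemma tendsto_0_filterlim_at_infinity:
  fixes f :: "'a::real_normed_vector \<Rightarrow> 'a"
  assumes "((\<lambda>z. f z - z) \<longlongrightarrow> 0) at_infinity"
  shows "filterlim f at_infinity at_infinity"
  using tendsto_add_filterlim_at_infinity[OF assms filterlim_ident] by simp

text \<open>Composing with a conformal map rotates a Beltrami coefficient by the quotient of its
  conjugated derivative and its derivative. Relative to the centre of a disc the rotation is
  \<open>s / cnj s\<close>, where \<open>s\<close> is the ratio of the derivatives at the centre and
  at the point.\<close>

lemma unimodular_quotient:
  assumes s: "cmod (s - 1) \<le> e" "e \<le> 1/2"
  shows "cmod (s / cnj s) = 1" "cmod (s / cnj s - 1) \<le> 4 * e"
proof -
  have "1 \<le> cmod s + cmod (s - 1)" using norm_triangle_ineq[of s "1 - s"] by (simp add: norm_minus_commute)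
  then have s2: "1/2 \<le> cmod s" using s by linarith
  then have s0: "s \<noteq> 0" by auto
  show "cmod (s / cnj s) = 1" using s0 by (simp add: norm_divide)
  have e0: "0 \<le> e" using s(1) norm_ge_zero order_trans by blast
  have "s / cnj s - 1 = ((s - 1) - cnj (s - 1)) / cnj s" using s0 by (simp add: field_simps)
  then have "cmod (s / cnj s - 1) = cmod ((s - 1) - cnj (s - 1)) / cmod s" by (simp add: norm_divide)
  also have "\<dots> \<le> (e + e) / (1/2)"
    using s s2 e0 by (intro frac_le order_trans[OF norm_triangle_ineq4 add_mono]) (auto simp del: complex_cnj_diff)
  finally show "cmod (s / cnj s - 1) \<le> 4 * e" by simp
qed

lemma measure_cball_complex: "0 \<le> r \<Longrightarrow> measure lebesgue (cball (c::complex) r) = pi * r\<^sup>2"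
  by (simp add: content_cball unit_ball_vol_2)

lemma measure_conformal_preimage_ge:
  assumes hol: "f holomorphic_on U" "open U" and inj: "inj_on f U" and W: "compact W" "W \<subseteq> U"
    and bound: "\<And>z. z \<in> W \<Longrightarrow> cmod (deriv f z) \<le> B"
  shows "measure lebesgue (f ` W) \<le> B\<^sup>2 * measure lebesgue W"
proof -
  have der: "(f has_derivative (\<lambda>v. deriv f x * v + 0 * cnj v)) (at x within W)" if "x \<in> W" for x
  proof -
    have "(f has_field_derivative deriv f x) (at x)"
      using that W by (intro holomorphic_derivI[OF hol]) auto
    then show ?thesis
      unfolding has_field_derivative_def by (auto intro: has_derivative_at_withinI)
  qed
  have Wm: "W \<in> lmeasurable" using W by (simp add: lmeasurable_compact)
  have "compact (f ` W)"
    by (intro compact_continuous_image holomorphic_on_imp_continuous_on holomorphic_on_subset[OF hol(1)] W)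
  then have fW: "f ` W \<in> lmeasurable" by (simp add: lmeasurable_compact)
  then have "(\<lambda>x. 1::real) absolutely_integrable_on (f ` W) \<and> integral (f ` W) (\<lambda>x. 1::real) = measure lebesgue (f ` W)"
    by (auto simp: lmeasure_integral lmeasurable_iff_integrable_on intro!: nonnegative_absolutely_integrable_1)
  then have *: "(\<lambda>x. \<bar>(cmod (deriv f x))\<^sup>2 - (cmod 0)\<^sup>2\<bar> * 1) absolutely_integrable_on W \<and>
      integral W (\<lambda>x. \<bar>(cmod (deriv f x))\<^sup>2 - (cmod 0)\<^sup>2\<bar> * 1) = measure lebesgue (f ` W)"
    by (subst absolutely_integrable_change_of_variables_complex[where \<phi>="\<lambda>_. 1", OF _ der])
      (use Wm inj_on_subset[OF inj W(2)] in auto)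
  then have "measure lebesgue (f ` W) = integral W (\<lambda>x. (cmod (deriv f x))\<^sup>2)" by simp
  also have "\<dots> \<le> integral W (\<lambda>x. B\<^sup>2 * 1)"
  proof (rule integral_le)
    show "(\<lambda>x. (cmod (deriv f x))\<^sup>2) integrable_on W"
      using * by (auto simp: absolutely_integrable_on_def)
    show "(\<lambda>x. B\<^sup>2 * 1) integrable_on W"
      using integrable_cmul[of "\<lambda>x. 1::real" W "B\<^sup>2"] Wm
      by (simp add: lmeasurable_iff_integrable_on)
    show "(cmod (deriv f x))\<^sup>2 \<le> B\<^sup>2 * 1" if "x \<in> W" for x
      using bound[OF that] by (simp add: power_mono)
  qed
  also have "\<dots> = B\<^sup>2 * measure lebesgue W"
    using lmeasure_integral[OF Wm] by (simp only: integral_mult_right)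
  finally show ?thesis .
qed

text \<open>Inside \<open>cball c r\<close> the map \<open>f\<close> is conformal, and its image
  contains \<open>cball (f c) \<rho>\<close>. Composing with \<open>dmap\<close> on this round disc
  gives \<open>z\<close> the coefficient \<open>\<nu> * cnj (deriv f z) / deriv f z\<close> on the
  preimage \<open>W\<close>, which by \<open>koebe_distortion\<close> is nearly constant, and
  changes nothing but the conformal factor elsewhere. The fraction \<gamma> of the area that is
  gained does not depend on \<open>f\<close>.\<close>

lemma disc_step:
  assumes "0 < \<kappa>"
  obtains \<gamma> where "0 < \<gamma>"
    "\<And>f K Z a m c r \<mu>. qcmap f K Z a m \<Longrightarrow> 0 < r \<Longrightarrow> cball c r \<inter> K = {} \<Longrightarrow> cmod \<mu> < 1 \<Longrightarrow>
      \<exists>f' K' Z' a' m'. qcmap f' K' Z' a' m' \<and> K \<subseteq> K' \<and> K' \<subseteq> K \<union> cball c r \<and> Z \<subseteq> Z' \<and>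
        (\<forall>z\<in>K - Z'. m' z = m z) \<and> (\<forall>z\<in>K' - K - Z'. \<exists>\<omega>. cmod \<omega> = 1 \<and> cmod (\<omega> - 1) \<le> \<kappa> \<and> m' z = \<mu> * \<omega>) \<and>
        \<gamma> * measure lebesgue (cball c r) \<le> measure lebesgue (K' - K)"
proof -
  \<comment> \<open>\<open>unimodular_quotient\<close> turns the distortion \<open>e\<close> into a
    rotation error \<open>4 * e\<close>, and \<open>e \<le> 1/2\<close> ensures
    \<open>cmod (deriv f z) \<le> 2 * cmod D\<close> on \<open>W\<close>.\<close>
  define e where "e = min (1/2) (\<kappa> / 4)"
  have e: "0 < e" "e \<le> 1/2" "4 * e \<le> \<kappa>" using assms by (auto simp: e_def)
  obtain \<tau> where \<tau>: "0 < \<tau>" 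
    "\<And>f a r. f holomorphic_on ball a r \<Longrightarrow> inj_on f (ball a r) \<Longrightarrow> 0 < r \<Longrightarrow>
       cball (f a) (\<tau> * (r * cmod (deriv f a))) \<subseteq> f ` ball a r \<and>
       (\<forall>z\<in>ball a r. f z \<in> cball (f a) (\<tau> * (r * cmod (deriv f a))) \<longrightarrow> cmod (deriv f a / deriv f z - 1) \<le> e)"
    using koebe_distortion[OF e(1)] by blast
  show thesis
  \<comment> \<open>The image of \<open>W\<close> has area
    \<open>pi * \<rho>^2 = pi * (\<tau> * r * cmod D)^2\<close>, and \<open>f\<close> enlarges areas
    in \<open>W\<close> by at most \<open>(2 * cmod D)^2\<close>.\<close>
  proof (rule that[of "\<tau>\<^sup>2 / 4"])
    show "0 < \<tau>\<^sup>2 / 4" using \<tau> by simp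
    fix f K Z a m c r \<mu>
    assume qc: "qcmap f K Z a m" and r: "0 < r" and disj: "cball c r \<inter> K = {}" and \<mu>: "cmod \<mu> < 1"
    note qc = qcmapD[OF qc]
    obtain M where M: "M > 0" "\<And>x y. dist (f x) (f y) \<le> M * dist x y" "\<And>x y. dist x y \<le> M * dist (f x) (f y)"
      using qc(2) by blast
    have cont: "continuous_on S f" for S by (rule lipschitz_continuous_on[OF M(2)])
    have inj: "inj f" using qc(1) by (rule bij_is_inj)
    have sub: "ball c r \<subseteq> - K" using disj ball_subset_cball[of c r] by blast
    have hol: "f holomorphic_on ball c r" by (rule holomorphic_on_subset[OF qc(7) sub])
    have injb: "inj_on f (ball c r)" using inj by (rule inj_on_subset) simp
    have fder: "(f has_field_derivative deriv f z) (at z)" if "z \<in> ball c r" for z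
      by (rule holomorphic_derivI[OF hol open_ball that])
    have dnz: "deriv f z \<noteq> 0" if "z \<in> ball c r" for z
      by (rule holomorphic_injective_imp_regular[OF hol open_ball injb that])
    define D where "D = deriv f c"
    have D: "D \<noteq> 0" using dnz[of c] r by (simp add: D_def)
    define \<rho> where "\<rho> = \<tau> * (r * cmod D)"
    have \<rho>: "0 < \<rho>" using \<tau>(1) r D by (simp add: \<rho>_def)
    have kb: "cball (f c) \<rho> \<subseteq> f ` ball c r"
      and dist: "\<And>z. z \<in> ball c r \<Longrightarrow> f z \<in> cball (f c) \<rho> \<Longrightarrow> cmod (D / deriv f z - 1) \<le> e"
      using \<tau>(2)[OF hol injb r] by (auto simp: \<rho>_def D_def)
    define W where "W = f -` cball (f c) \<rho>"
    have Wsub: "W \<subseteq> ball c r"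
    proof
      fix z assume "z \<in> W"
      then have "f z \<in> f ` ball c r" using kb by (auto simp: W_def)
      then show "z \<in> ball c r" using inj by (simp add: inj_image_mem_iff)
    qed
    have "closed W" unfolding W_def by (rule closed_vimage[OF closed_cball]) (use cont in auto)
    then have cW: "compact W" using Wsub by (meson bounded_ball bounded_subset compact_eq_bounded_closed)
    have fW: "f ` W = cball (f c) \<rho>"
      using kb by (auto simp: W_def)
    \<comment> \<open>The rotation compensates the one caused by \<open>f\<close> at the centre, so
      that the composition has coefficient exactly \<mu> at \<open>c\<close>.\<close>
    define \<nu> where "\<nu> = \<mu> * (D / cnj D)"
    have \<nu>: "cmod \<nu> < 1" using \<mu> D by (simp add: \<nu>_def norm_mult norm_divide)
    define \<delta> where "\<delta> = dmap (f c) \<rho> \<nu>"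
    have \<delta>hol: "\<delta> holomorphic_on - cball (f c) \<rho>"
      unfolding \<delta>_def by (rule dmap_holomorphic_outside[OF \<rho> \<nu>])
    have \<delta>bij: "bij \<delta>" unfolding \<delta>_def by (rule bij_dmap[OF \<rho> \<nu>])
    have \<delta>nz: "deriv \<delta> w \<noteq> 0" if "w \<in> - cball (f c) \<rho>" for w
      by (rule holomorphic_injective_imp_regular[OF \<delta>hol _ _ that])
        (use \<delta>bij in \<open>auto simp: bij_def intro: inj_on_subset\<close>)
    define f' where "f' = (\<lambda>z. \<delta> (f z))"
    define K' where "K' = K \<union> W"
    define Z' where "Z' = Z \<union> f -` sphere (f c) \<rho>"
    define A where "A = f -` ball (f c) \<rho>"
    define a' where "a' = (\<lambda>z. if z \<in> A then deriv f z else deriv \<delta> (f z) * a z)"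
    define m' where "m' = (\<lambda>z. if z \<in> A then \<nu> * cnj (deriv f z) / deriv f z else m z)"
    have AW: "A \<subseteq> W" by (auto simp: A_def W_def)
    have openA: "open A" unfolding A_def by (rule open_vimage[OF open_ball]) (use cont in auto)
    have WA: "W \<subseteq> A \<union> Z'" by (auto simp: A_def W_def Z'_def)
    have WK: "W \<inter> K = {}" using Wsub sub by blast
    have outA: "f z \<in> - cball (f c) \<rho>" if "z \<notin> A" "z \<notin> Z'" for z
      using that by (auto simp: A_def Z'_def)
    have der': "(f' has_derivative (\<lambda>v. a' z * (v + m' z * cnj v))) (at z)" if z: "z \<notin> Z'" for z
    proof (cases "z \<in> A")
      case True
      then have zb: "z \<in> ball c r" using AW Wsub by blast
      have "(\<delta> has_derivative (\<lambda>v. v + \<nu> * cnj v)) (at (f z))"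
        unfolding \<delta>_def by (rule dmap_has_derivative_inside[OF \<rho> \<nu>]) (use True in \<open>simp add: A_def\<close>)
      from has_derivative_compose[OF fder[OF zb, unfolded has_field_derivative_def] this]
      have "(f' has_derivative (\<lambda>v. deriv f z * v + \<nu> * cnj (deriv f z * v))) (at z)"
        by (simp add: f'_def)
      moreover have "deriv f z * v + \<nu> * cnj (deriv f z * v) = a' z * (v + m' z * cnj v)" for v
        using True dnz[OF zb] by (simp add: a'_def m'_def field_simps)
      ultimately show ?thesis by simp
    next
      case False
      have "(\<delta> has_field_derivative deriv \<delta> (f z)) (at (f z))"
        by (rule holomorphic_derivI[OF \<delta>hol _ outA]) (use False z in auto)
      moreover have "z \<notin> Z" using z by (simp add: Z'_def)
      ultimately have "(f' has_derivative (\<lambda>v. deriv \<delta> (f z) * (a z * (v + m z * cnj v)))) (at z)"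
        unfolding f'_def has_field_derivative_def
        by (intro has_derivative_compose[OF qc(8)]) auto
      then show ?thesis using False by (simp add: a'_def m'_def mult.assoc)
    qed
    have a'nz: "a' z \<noteq> 0" if z: "z \<notin> Z'" for z
      using dnz[of z] AW Wsub \<delta>nz[OF outA[of z]] qc(9)[of z] z
      by (auto simp: a'_def Z'_def)
    have m'lt: "cmod (m' z) < 1" if z: "z \<notin> Z'" for z
      using dnz[of z] AW Wsub \<nu> qc(10)[of z] z
      by (auto simp: m'_def Z'_def norm_mult norm_divide)
    define B where "B = - Z \<inter> f -` (- cball (f c) \<rho>)"
    have openB: "open B"
      unfolding B_def using qc(4) cont by (intro open_Int open_vimage) auto
    have split: "- Z' \<subseteq> A \<union> B" using outA by (auto simp: B_def Z'_def)
    have BA: "B \<inter> A = {}" by (auto simp: B_def A_def)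
    have contd: "continuous_on A (deriv f)"
      by (rule holomorphic_on_imp_continuous_on[OF holomorphic_on_subset[OF holomorphic_deriv[OF hol]]])
        (use AW Wsub in auto)
    have "continuous_on (A \<union> B) a'"
    proof (rule continuous_on_open_Un[OF openA openB])
      show "continuous_on A a'"
        using contd by (rule continuous_on_eq) (simp add: a'_def)
      have "continuous_on B (\<lambda>z. deriv \<delta> (f z) * a z)"
      proof (rule continuous_on_mult)
        show "continuous_on B (\<lambda>z. deriv \<delta> (f z))"
          by (rule continuous_on_compose2[OF holomorphic_on_imp_continuous_on[OF holomorphic_deriv[OF \<delta>hol]] cont])
            (auto simp: B_def)
        show "continuous_on B a" by (rule continuous_on_subset[OF qc(11)]) (auto simp: B_def)
      qed
      then show "continuous_on B a'"
        by (rule continuous_on_eq) (use BA in \<open>auto simp: a'_def\<close>)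
    qed
    then have conta: "continuous_on (- Z') a'" using split by (rule continuous_on_subset)
    have "continuous_on (A \<union> B) m'"
    proof (rule continuous_on_open_Un[OF openA openB])
      have "continuous_on A (\<lambda>z. \<nu> * cnj (deriv f z) / deriv f z)"
        by (intro continuous_intros contd) (use dnz AW Wsub in auto)
      then show "continuous_on A m'"
        by (rule continuous_on_eq) (simp add: m'_def)
      have "continuous_on B m" by (rule continuous_on_subset[OF qc(12)]) (auto simp: B_def)
      then show "continuous_on B m'"
        by (rule continuous_on_eq) (use BA in \<open>auto simp: m'_def\<close>)
    qed
    then have contm: "continuous_on (- Z') m'" using split by (rule continuous_on_subset)
    have qc': "qcmap f' K' Z' a' m'"
      unfolding qcmap_def
    proof (intro conjI allI impI der' a'nz m'lt conta contm)
      show "bij f'" unfolding f'_def using bij_comp[OF qc(1) \<delta>bij] by (simp add: o_def)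
      show "\<exists>M>0. \<forall>x y. dist (f' x) (f' y) \<le> M * dist x y \<and> dist x y \<le> M * dist (f' x) (f' y)"
      proof (intro exI[of _ "2 * M + M / (1 - cmod \<nu>)"] conjI allI)
        show "0 < 2 * M + M / (1 - cmod \<nu>)" using M(1) \<nu> by (simp add: add_pos_pos)
        fix x y
        have "dist (f' x) (f' y) \<le> 2 * dist (f x) (f y)"
          using dmap_upper[OF \<rho> \<nu>, of "f c" "f x" "f y"] by (simp add: f'_def \<delta>_def dist_norm)
        also have "\<dots> \<le> 2 * M * dist x y" using M(2)[of x y] by simp
        also have "\<dots> \<le> (2 * M + M / (1 - cmod \<nu>)) * dist x y" using M(1) \<nu> by (intro mult_right_mono) auto
        finally show "dist (f' x) (f' y) \<le> (2 * M + M / (1 - cmod \<nu>)) * dist x y" .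
        have "(1 - cmod \<nu>) * dist (f x) (f y) \<le> dist (f' x) (f' y)"
          using dmap_lower[OF \<rho> \<nu>, of "f x" "f y" "f c"] by (simp add: f'_def \<delta>_def dist_norm)
        then have "dist (f x) (f y) \<le> dist (f' x) (f' y) / (1 - cmod \<nu>)"
          using \<nu> by (simp add: field_simps)
        then have "M * dist (f x) (f y) \<le> M * (dist (f' x) (f' y) / (1 - cmod \<nu>))"
          by (rule mult_left_mono) (use M(1) in simp)
        then have "dist x y \<le> M / (1 - cmod \<nu>) * dist (f' x) (f' y)"
          using M(3)[of x y] by simp
        also have "\<dots> \<le> (2 * M + M / (1 - cmod \<nu>)) * dist (f' x) (f' y)"
          using M(1) by (intro mult_right_mono) auto
        finally show "dist x y \<le> (2 * M + M / (1 - cmod \<nu>)) * dist (f' x) (f' y)" .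
      qed
      show "compact K'" unfolding K'_def using qc(3) cW by (rule compact_Un)
      show "closed Z'" unfolding Z'_def using qc(4) cont by (intro closed_Un closed_vimage) auto
      show "negligible Z'"
        unfolding Z'_def using qc(5) negligible_lipschitz_preimage[OF qc(1) M(3) negligible_sphere]
        by (intro negligible_Un)
      show "Z' \<subseteq> K'" using qc(6) by (auto simp: Z'_def K'_def W_def)
      show "f' holomorphic_on - K'"
        unfolding f'_def
        by (rule holomorphic_on_compose_gen[OF holomorphic_on_subset[OF qc(7)] \<delta>hol, unfolded o_def])
          (auto simp: K'_def W_def)
      show "m' z = 0" if "z \<notin> K'" for z
        using that AW qc(13)[of z] by (auto simp: m'_def K'_def)
      have "((\<lambda>z. \<delta> (f z) - f z) \<longlongrightarrow> 0) at_infinity"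
        unfolding \<delta>_def
        by (rule filterlim_compose[OF dmap_asymptotic[OF \<rho> \<nu>] tendsto_0_filterlim_at_infinity[OF qc(14)]])
      from tendsto_add[OF this qc(14)] show "((\<lambda>z. f' z - z) \<longlongrightarrow> 0) at_infinity"
        by (simp add: f'_def)
    qed
    have mK: "m' z = m z" if "z \<in> K - Z'" for z using that AW WK by (auto simp: m'_def)
    have mW: "\<exists>\<omega>. cmod \<omega> = 1 \<and> cmod (\<omega> - 1) \<le> \<kappa> \<and> m' z = \<mu> * \<omega>" if "z \<in> K' - K - Z'" for z
    proof -
      have z: "z \<in> A" "z \<in> W" "z \<in> ball c r" using that WA Wsub by (auto simp: K'_def)
      define s where "s = D / deriv f z"
      have s: "cmod (s - 1) \<le> e" unfolding s_def using dist[OF z(3)] z(2) by (simp add: W_def)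
      have "m' z = \<mu> * (s / cnj s)" using z(1) by (simp add: m'_def s_def \<nu>_def mult_ac)
      moreover have "cmod (s / cnj s - 1) \<le> \<kappa>" using unimodular_quotient(2)[OF s e(2)] e(3) by linarith
      ultimately show ?thesis using unimodular_quotient(1)[OF s e(2)] by blast
    qed
    have meas: "\<tau>\<^sup>2 / 4 * measure lebesgue (cball c r) \<le> measure lebesgue (K' - K)"
    proof -
      have "cmod (deriv f z) \<le> 2 * cmod D" if "z \<in> W" for z
      proof -
        define s where "s = D / deriv f z"
        have zb: "z \<in> ball c r" using that Wsub by blast
        have "cmod (s - 1) \<le> e" unfolding s_def using dist[OF zb] that by (simp add: W_def)
        moreover have "1 \<le> cmod s + cmod (s - 1)"
          using norm_triangle_ineq[of s "1 - s"] by (simp add: norm_minus_commute)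
        ultimately have "1/2 \<le> cmod s" using e by linarith
        then show ?thesis using dnz[OF zb] by (simp add: s_def norm_divide field_simps)
      qed
      then have "measure lebesgue (f ` W) \<le> (2 * cmod D)\<^sup>2 * measure lebesgue W"
        by (rule measure_conformal_preimage_ge[OF hol open_ball injb cW Wsub])
      then have "pi * \<rho>\<^sup>2 \<le> (2 * cmod D)\<^sup>2 * measure lebesgue W"
        using measure_cball_complex[of \<rho> "f c"] \<rho> unfolding fW by linarith
      moreover have "pi * \<rho>\<^sup>2 = (cmod D)\<^sup>2 * (\<tau>\<^sup>2 * (pi * r\<^sup>2))"
        by (simp add: \<rho>_def power_mult_distrib)
      moreover have "(2 * cmod D)\<^sup>2 * measure lebesgue W = (cmod D)\<^sup>2 * (4 * measure lebesgue W)"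
        by (simp add: power_mult_distrib)
      ultimately have "(cmod D)\<^sup>2 * (\<tau>\<^sup>2 * (pi * r\<^sup>2)) \<le> (cmod D)\<^sup>2 * (4 * measure lebesgue W)"
        by linarith
      then have "\<tau>\<^sup>2 * (pi * r\<^sup>2) \<le> 4 * measure lebesgue W"
        by (rule mult_left_le_imp_le) (use D in simp)
      moreover have "measure lebesgue (cball c r) = pi * r\<^sup>2"
        using r by (intro measure_cball_complex) simp
      moreover have "K' - K = W" using WK by (auto simp: K'_def)
      ultimately show ?thesis by simp
    qed
    have "K \<subseteq> K'" "K' \<subseteq> K \<union> cball c r" "Z \<subseteq> Z'"
      using Wsub ball_subset_cball[of c r] unfolding K'_def Z'_def by blast+
    moreover have "\<forall>z\<in>K - Z'. m' z = m z" using mK by (rule ballI)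
    moreover have "\<forall>z\<in>K' - K - Z'. \<exists>\<omega>. cmod \<omega> = 1 \<and> cmod (\<omega> - 1) \<le> \<kappa> \<and> m' z = \<mu> * \<omega>"
      using mW by (rule ballI)
    ultimately show "\<exists>f' K' Z' a' m'. qcmap f' K' Z' a' m' \<and> K \<subseteq> K' \<and> K' \<subseteq> K \<union> cball c r \<and> Z \<subseteq> Z' \<and>
        (\<forall>z\<in>K - Z'. m' z = m z) \<and> (\<forall>z\<in>K' - K - Z'. \<exists>\<omega>. cmod \<omega> = 1 \<and> cmod (\<omega> - 1) \<le> \<kappa> \<and> m' z = \<mu> * \<omega>) \<and>
        \<tau>\<^sup>2 / 4 * measure lebesgue (cball c r) \<le> measure lebesgue (K' - K)"
      using qc' meas
      by (intro exI[of _ f'] exI[of _ K'] exI[of _ Z'] exI[of _ a'] exI[of _ m'] conjI)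
  qed
qed

subsection \<open>Exhaustion by discs\<close>

text \<open>\<open>P z \<mu>\<close> expresses that the coefficient \<mu> is acceptable at
  \<open>z\<close>. Nothing is asked off \<open>K\<close>, where the map is conformal, or on the
  null set \<open>Z\<close>.\<close>

definition good_qcmap :: "(complex \<Rightarrow> complex \<Rightarrow> bool) \<Rightarrow> complex set \<Rightarrow> bool" where
  "good_qcmap P K \<longleftrightarrow> (\<exists>f Z a m. qcmap f K Z a m \<and> (\<forall>z\<in>K - Z. P z (m z)))"

lemma good_qcmap_compact: "good_qcmap P K \<Longrightarrow> compact K"
  by (auto simp: good_qcmap_def qcmap_def)

text \<open>The discs are treated one after another. A new modification keeps the coefficients on
  the part already treated, and the fraction \<gamma> of \<open>disc_step\<close> is the same for
  every map, so nothing deteriorates along the way. All rotations \<open>\<omega>\<close> near 1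
  have to be acceptable because \<open>disc_step\<close> attains \<mu> only up to such a
  rotation.\<close>

lemma disc_family_step:
  assumes "0 < \<kappa>"
  obtains \<gamma> where "0 < \<gamma>"
    "\<And>P K C. finite C \<Longrightarrow> good_qcmap P K \<Longrightarrow> 
       pairwise (\<lambda>i j. disjnt (cball (fst i) (snd i)) (cball (fst j) (snd j))) C \<Longrightarrow>
       (\<forall>c r. (c, r) \<in> C \<longrightarrow> 0 < r \<and> cball c r \<inter> K = {} \<and> 
          (\<exists>\<mu>. cmod \<mu> < 1 \<and> (\<forall>z\<in>cball c r. \<forall>\<omega>. cmod \<omega> = 1 \<longrightarrow> cmod (\<omega> - 1) \<le> \<kappa> \<longrightarrow> P z (\<mu> * \<omega>)))) \<Longrightarrow>
       \<exists>K'. good_qcmap P K' \<and> K \<subseteq> K' \<and> K' \<subseteq> K \<union> (\<Union>(c, r)\<in>C. cball c r) \<and>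
         \<gamma> * measure lebesgue (\<Union>(c, r)\<in>C. cball c r) \<le> measure lebesgue (K' - K)"
proof -
  obtain \<gamma> where \<gamma>: "0 < \<gamma>"
    "\<And>f K Z a m c r \<mu>. qcmap f K Z a m \<Longrightarrow> 0 < r \<Longrightarrow> cball c r \<inter> K = {} \<Longrightarrow> cmod \<mu> < 1 \<Longrightarrow>
      \<exists>f' K' Z' a' m'. qcmap f' K' Z' a' m' \<and> K \<subseteq> K' \<and> K' \<subseteq> K \<union> cball c r \<and> Z \<subseteq> Z' \<and>
        (\<forall>z\<in>K - Z'. m' z = m z) \<and> (\<forall>z\<in>K' - K - Z'. \<exists>\<omega>. cmod \<omega> = 1 \<and> cmod (\<omega> - 1) \<le> \<kappa> \<and> m' z = \<mu> * \<omega>) \<and>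
        \<gamma> * measure lebesgue (cball c r) \<le> measure lebesgue (K' - K)"
    by (rule disc_step[OF assms]) (rule that)
  show thesis
  proof (rule that[OF \<gamma>(1)])
    fix P K C
    assume "finite C" and K: "good_qcmap P K"
      and "pairwise (\<lambda>i j. disjnt (cball (fst i) (snd i)) (cball (fst j) (snd j))) C"
      and "\<forall>c r. (c, r) \<in> C \<longrightarrow> 0 < r \<and> cball c r \<inter> K = {} \<and> 
          (\<exists>\<mu>. cmod \<mu> < 1 \<and> (\<forall>z\<in>cball c r. \<forall>\<omega>. cmod \<omega> = 1 \<longrightarrow> cmod (\<omega> - 1) \<le> \<kappa> \<longrightarrow> P z (\<mu> * \<omega>)))"
    then show "\<exists>K'. good_qcmap P K' \<and> K \<subseteq> K' \<and> K' \<subseteq> K \<union> (\<Union>(c, r)\<in>C. cball c r) \<and>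
         \<gamma> * measure lebesgue (\<Union>(c, r)\<in>C. cball c r) \<le> measure lebesgue (K' - K)"
    proof (induction C rule: finite_induct)
      case empty
      then show ?case by (intro exI[of _ K]) auto
    next
      case (insert x C)
      obtain c r where x: "x = (c, r)" by (cases x)
      have "\<exists>K'. good_qcmap P K' \<and> K \<subseteq> K' \<and> K' \<subseteq> K \<union> (\<Union>(c, r)\<in>C. cball c r) \<and>
         \<gamma> * measure lebesgue (\<Union>(c, r)\<in>C. cball c r) \<le> measure lebesgue (K' - K)"
      proof (rule insert.IH[OF insert.prems(1)])
        show "pairwise (\<lambda>i j. disjnt (cball (fst i) (snd i)) (cball (fst j) (snd j))) C"
          using insert.prems(2) by (rule pairwise_subset) auto
      qed (use insert.prems(3) in simp)
      then obtain K1 where K1: "good_qcmap P K1" "K \<subseteq> K1" "K1 \<subseteq> K \<union> (\<Union>(c, r)\<in>C. cball c r)"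
        "\<gamma> * measure lebesgue (\<Union>(c, r)\<in>C. cball c r) \<le> measure lebesgue (K1 - K)" by blast
      obtain f Z a m where q: "qcmap f K1 Z a m" and good: "\<forall>z\<in>K1 - Z. P z (m z)"
        using K1(1) unfolding good_qcmap_def by blast
      note prems = insert.prems(3)[rule_format, of c r, unfolded x, OF insertI1]
      have xr: "0 < r" "cball c r \<inter> K = {}" using prems by blast+
      obtain \<mu> where \<mu>: "cmod \<mu> < 1"
        "\<And>z \<omega>. z \<in> cball c r \<Longrightarrow> cmod \<omega> = 1 \<Longrightarrow> cmod (\<omega> - 1) \<le> \<kappa> \<Longrightarrow> P z (\<mu> * \<omega>)"
        using prems by blast
      have disj: "cball c r \<inter> (\<Union>(c, r)\<in>C. cball c r) = {}"
      proof -
        have "disjnt (cball c r) (cball c' r')" if "(c', r') \<in> C" for c' r'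
          using pairwiseD[OF insert.prems(2), of x "(c', r')"] that insert.hyps(2) by (auto simp: x)
        then show ?thesis by (auto simp: disjnt_iff)
      qed
      have "cball c r \<inter> K1 = {}" using disj xr(2) K1(3) by blast
      from \<gamma>(2)[OF q xr(1) this \<mu>(1)]
      obtain f' K2 Z' a' m' where q': "qcmap f' K2 Z' a' m'" and K2: "K1 \<subseteq> K2" "K2 \<subseteq> K1 \<union> cball c r"
        and Z': "Z \<subseteq> Z'" and m1: "\<And>z. z \<in> K1 - Z' \<Longrightarrow> m' z = m z"
        and m2: "\<And>z. z \<in> K2 - K1 - Z' \<Longrightarrow> \<exists>\<omega>. cmod \<omega> = 1 \<and> cmod (\<omega> - 1) \<le> \<kappa> \<and> m' z = \<mu> * \<omega>"
        and meas: "\<gamma> * measure lebesgue (cball c r) \<le> measure lebesgue (K2 - K1)"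
        by metis
      have "P z (m' z)" if z: "z \<in> K2 - Z'" for z
      proof (cases "z \<in> K1")
        case True
        then show ?thesis using good Z' m1[of z] z by auto
      next
        case False
        then obtain \<omega> where "cmod \<omega> = 1" "cmod (\<omega> - 1) \<le> \<kappa>" "m' z = \<mu> * \<omega>" using m2[of z] z by blast
        moreover have "z \<in> cball c r" using False z K2(2) by blast
        ultimately show ?thesis using \<mu>(2)[of z \<omega>] by simp
      qed
      then have gK2: "good_qcmap P K2" unfolding good_qcmap_def using q' by blast
      have lm: "K \<in> lmeasurable" "K1 \<in> lmeasurable" "K2 \<in> lmeasurable"
        using good_qcmap_compact K K1(1) gK2 by (auto simp: lmeasurable_compact)
      have U: "(\<Union>(c, r)\<in>C. cball c r) \<in> lmeasurable"
        using insert.hyps(1) by (intro fmeasurable.finite_UN) auto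
      have "\<gamma> * measure lebesgue (cball c r \<union> (\<Union>(c, r)\<in>C. cball c r)) \<le>
        \<gamma> * (measure lebesgue (cball c r) + measure lebesgue (\<Union>(c, r)\<in>C. cball c r))"
        using \<gamma>(1) U by (intro mult_left_mono measure_Un_le) (auto intro: fmeasurableD)
      also have "\<dots> \<le> measure lebesgue (K2 - K1) + measure lebesgue (K1 - K)"
        using meas K1(4) by (simp add: algebra_simps)
      also have "\<dots> = measure lebesgue ((K2 - K1) \<union> (K1 - K))"
      proof -
        have "(K2 - K1) \<inter> (K1 - K) = {}" by blast
        then show ?thesis
          using measure_Un3[of "K2 - K1" lebesgue "K1 - K"] lm by (simp add: fmeasurable.Diff)
      qed
      also have "(K2 - K1) \<union> (K1 - K) = K2 - K" using K1(2) K2(1) by blast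
      finally have "\<gamma> * measure lebesgue (\<Union>(c, r)\<in>insert x C. cball c r) \<le> measure lebesgue (K2 - K)"
        by (simp add: x)
      moreover have "K2 \<subseteq> K \<union> (\<Union>(c, r)\<in>insert x C. cball c r)" using K2(2) K1(3) by (auto simp: x)
      moreover have "K \<subseteq> K2" using K1(2) K2(1) by (rule subset_trans)
      ultimately show ?case using gK2 by (intro exI[of _ K2] conjI)
    qed
  qed
qed

text \<open>Vitali's theorem fills the open set \<open>\<Omega> - K\<close> with small disjoint
  discs up to a null set. Finitely many of them carry half of its measure, and a fixed fraction of
  these can be treated, so each stage shrinks the untreated measure by the factor
  \<open>1 - \<gamma> / 2\<close>.\<close>

lemma good_qcmap_exhaustion:
  assumes \<Omega>: "open \<Omega>" "bounded \<Omega>" and \<kappa>: "0 < \<kappa>" and \<rho>: "0 < \<rho>" and e: "0 < e"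
    and P: "\<And>c. c \<in> \<Omega> \<Longrightarrow> \<exists>\<mu>. cmod \<mu> < 1 \<and>
      (\<forall>z\<in>\<Omega> \<inter> ball c \<rho>. \<forall>\<omega>. cmod \<omega> = 1 \<longrightarrow> cmod (\<omega> - 1) \<le> \<kappa> \<longrightarrow> P z (\<mu> * \<omega>))"
  obtains K where "good_qcmap P K" "K \<subseteq> \<Omega>" "measure lebesgue (\<Omega> - K) < e"
proof -
  obtain \<gamma>0 where \<gamma>0: "0 < \<gamma>0"
    "\<And>P K C. finite C \<Longrightarrow> good_qcmap P K \<Longrightarrow> 
       pairwise (\<lambda>i j. disjnt (cball (fst i) (snd i)) (cball (fst j) (snd j))) C \<Longrightarrow>
       (\<forall>c r. (c, r) \<in> C \<longrightarrow> 0 < r \<and> cball c r \<inter> K = {} \<and> 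
          (\<exists>\<mu>. cmod \<mu> < 1 \<and> (\<forall>z\<in>cball c r. \<forall>\<omega>. cmod \<omega> = 1 \<longrightarrow> cmod (\<omega> - 1) \<le> \<kappa> \<longrightarrow> P z (\<mu> * \<omega>)))) \<Longrightarrow>
       \<exists>K'. good_qcmap P K' \<and> K \<subseteq> K' \<and> K' \<subseteq> K \<union> (\<Union>(c, r)\<in>C. cball c r) \<and>
         \<gamma>0 * measure lebesgue (\<Union>(c, r)\<in>C. cball c r) \<le> measure lebesgue (K' - K)"
    by (rule disc_family_step[OF \<kappa>]) (rule that)
  \<comment> \<open>The minimum with 1 makes \<open>1 - \<gamma> / 2\<close> a number in
    \<open>[1/2, 1)\<close>, so the estimates can be iterated.\<close>
  define \<gamma> where "\<gamma> = min 1 \<gamma>0"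
  have \<gamma>: "0 < \<gamma>" "\<gamma> \<le> 1" "\<gamma> \<le> \<gamma>0" using \<gamma>0(1) by (auto simp: \<gamma>_def)
  have \<Omega>m: "\<Omega> \<in> lmeasurable" using \<Omega> by (simp add: lmeasurable_open)
  have stage: "\<exists>K'. good_qcmap P K' \<and> K' \<subseteq> \<Omega> \<and> 
      measure lebesgue (\<Omega> - K') \<le> (1 - \<gamma> / 2) * measure lebesgue (\<Omega> - K)"
    if K: "good_qcmap P K" "K \<subseteq> \<Omega>" for K
  proof (cases "measure lebesgue (\<Omega> - K) = 0")
    case True
    then show ?thesis using K by (intro exI[of _ K]) auto
  next
    case False
    have cK: "compact K" using good_qcmap_compact[OF K(1)] .
    define U where "U = \<Omega> - K"
    have U: "open U" unfolding U_def using \<Omega>(1) cK by (intro open_Diff compact_imp_closed)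
    have Um: "U \<in> lmeasurable"
      unfolding U_def using \<Omega>m cK by (simp add: fmeasurable.Diff lmeasurable_compact)
    have mU: "0 < measure lebesgue U" using False by (simp add: U_def zero_less_measure_iff)
    define I where "I = {(c, r). 0 < r \<and> r < \<rho> \<and> cball c r \<subseteq> U}"
    have cover: "\<exists>i. i \<in> I \<and> x \<in> cball (fst i) (snd i) \<and> snd i < d" if x: "x \<in> U" and d: "0 < d" for x d
    proof -
      obtain t where t: "0 < t" "cball x t \<subseteq> U" using U x open_contains_cball by blast
      define r where "r = min t (min (\<rho> / 2) (d / 2))"
      have "0 < r" "r < \<rho>" "r < d" "r \<le> t" using t \<rho> d by (auto simp: r_def)
      moreover have "cball x r \<subseteq> U" using t \<open>r \<le> t\<close> subset_cball by blast
      ultimately show ?thesis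
        by (intro exI[of _ "(x, r)"]) (auto simp: I_def)
    qed
    have pos: "0 < snd i" if "i \<in> I" for i using that by (auto simp: I_def)
    obtain C where C: "countable C" "C \<subseteq> I"
      "pairwise (\<lambda>i j. disjnt (cball (fst i) (snd i)) (cball (fst j) (snd j))) C"
      "negligible (U - (\<Union>i\<in>C. cball (fst i) (snd i)))"
      using Vitali_covering_theorem_cballs[OF pos cover] by blast
    define cb where "cb = (\<lambda>i::complex \<times> real. cball (fst i) (snd i))"
    have sub: "(\<Union>i\<in>C'. cb i) \<subseteq> U" if "C' \<subseteq> C" for C'
      using that C(2) by (fastforce simp: I_def cb_def)
    have cntb: "countable (cb ` C)" using C(1) by simp
    have le: "measure lebesgue (\<Union>D') \<le> measure lebesgue U" if "D' \<subseteq> cb ` C" "finite D'" for D'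
    proof (rule measure_mono_fmeasurable)
      show "\<Union>D' \<subseteq> U" using that sub[of C] by blast
      show "\<Union>D' \<in> sets lebesgue" using that by (intro sets.finite_Union) (auto simp: cb_def)
    qed (rule Um)
    have lm_cb: "d \<in> lmeasurable" if "d \<in> cb ` C" for d using that by (auto simp: cb_def)
    \<comment> \<open>\<open>disc_family_step\<close> handles finite families only, hence the
      passage to a finite subfamily with more than half of the measure of \<open>U\<close>.\<close>
    have "0 < measure lebesgue U / 2" using mU by simp
    then obtain D where D: "D \<subseteq> cb ` C" "finite D"
      "measure lebesgue (\<Union>(cb ` C)) - measure lebesgue U / 2 < measure lebesgue (\<Union>D)"
      using measure_countable_Union_approachable[OF cntb _ lm_cb le] by blast
    obtain C' where C': "C' \<subseteq> C" "finite C'" "D = cb ` C'"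
      using D(1,2) by (meson finite_subset_image)
    have "measure lebesgue (\<Union>(cb ` C)) = measure lebesgue U"
    proof (rule measure_negligible_symdiff[OF Um])
      have "(U - \<Union>(cb ` C)) \<union> (\<Union>(cb ` C) - U) = U - (\<Union>i\<in>C. cball (fst i) (snd i))"
        using sub[of C] unfolding cb_def by blast
      then show "negligible ((U - \<Union>(cb ` C)) \<union> (\<Union>(cb ` C) - U))" using C(4) by simp
    qed
    then have half: "measure lebesgue U / 2 < measure lebesgue (\<Union>(cb ` C'))" using D(3) C'(3) by simp
    have eq: "(\<Union>(c, r)\<in>C'. cball c r) = \<Union>(cb ` C')" by (auto simp: cb_def)
    have "\<exists>K'. good_qcmap P K' \<and> K \<subseteq> K' \<and> K' \<subseteq> K \<union> (\<Union>(c, r)\<in>C'. cball c r) \<and>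
         \<gamma>0 * measure lebesgue (\<Union>(c, r)\<in>C'. cball c r) \<le> measure lebesgue (K' - K)"
    proof (rule \<gamma>0(2)[OF C'(2) K(1) pairwise_subset[OF C(3) C'(1)]], intro allI impI)
      fix c r assume "(c, r) \<in> C'"
      then have cr: "0 < r" "r < \<rho>" "cball c r \<subseteq> U" using C(2) C'(1) by (auto simp: I_def)
      then have "c \<in> cball c r" by simp
      then have "c \<in> \<Omega>" using cr(3) unfolding U_def by blast
      from P[OF this] obtain \<mu> where \<mu>: "cmod \<mu> < 1"
        "\<forall>z\<in>\<Omega> \<inter> ball c \<rho>. \<forall>\<omega>. cmod \<omega> = 1 \<longrightarrow> cmod (\<omega> - 1) \<le> \<kappa> \<longrightarrow> P z (\<mu> * \<omega>)" by blast
      have "cball c r \<subseteq> ball c \<rho>" using cr(2) by auto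
      then have "cball c r \<subseteq> \<Omega> \<inter> ball c \<rho>" "cball c r \<inter> K = {}" using cr(3) unfolding U_def by blast+
      with \<mu> cr(1) show "0 < r \<and> cball c r \<inter> K = {} \<and> 
          (\<exists>\<mu>. cmod \<mu> < 1 \<and> (\<forall>z\<in>cball c r. \<forall>\<omega>. cmod \<omega> = 1 \<longrightarrow> cmod (\<omega> - 1) \<le> \<kappa> \<longrightarrow> P z (\<mu> * \<omega>)))"
        by (intro conjI exI[of _ \<mu>]) blast+
    qed
    then obtain K' where K': "good_qcmap P K'" "K \<subseteq> K'" "K' \<subseteq> K \<union> \<Union>(cb ` C')"
      "\<gamma>0 * measure lebesgue (\<Union>(cb ` C')) \<le> measure lebesgue (K' - K)" unfolding eq by blast
    have K'\<Omega>: "K' \<subseteq> \<Omega>" using K'(3) sub[OF C'(1)] K(2) by (auto simp: U_def)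
    have lm: "K \<in> lmeasurable" "K' \<in> lmeasurable"
      using good_qcmap_compact K(1) K'(1) by (auto simp: lmeasurable_compact)
    have "\<gamma> / 2 * measure lebesgue U \<le> \<gamma>0 * measure lebesgue (\<Union>(cb ` C'))"
      using mult_mono[OF \<gamma>(3) less_imp_le[OF half]] \<gamma> \<gamma>0(1) mU by simp
    also have "\<dots> \<le> measure lebesgue (K' - K)" by (rule K'(4))
    finally have "\<gamma> / 2 * measure lebesgue U \<le> measure lebesgue (K' - K)" .
    moreover have "measure lebesgue (U - (K' - K)) = measure lebesgue U - measure lebesgue (K' - K)"
      by (rule measurable_measure_Diff[OF Um]) (use lm K'\<Omega> in \<open>auto simp: U_def\<close>)
    moreover have "U - (K' - K) = \<Omega> - K'" using K'(2) by (auto simp: U_def)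
    ultimately show ?thesis using K'(1) K'\<Omega> by (intro exI[of _ K']) (auto simp: U_def algebra_simps)
  qed
  have iter: "\<exists>K. good_qcmap P K \<and> K \<subseteq> \<Omega> \<and> measure lebesgue (\<Omega> - K) \<le> (1 - \<gamma> / 2) ^ n * measure lebesgue \<Omega>" for n
  proof (induction n)
    case 0
    have "good_qcmap P {}" unfolding good_qcmap_def using qcmap_id by blast
    then show ?case by (intro exI[of _ "{}"]) auto
  next
    case (Suc n)
    then obtain K where K: "good_qcmap P K" "K \<subseteq> \<Omega>"
      "measure lebesgue (\<Omega> - K) \<le> (1 - \<gamma> / 2) ^ n * measure lebesgue \<Omega>" by blast
    from stage[OF K(1,2)] obtain K' where K': "good_qcmap P K'" "K' \<subseteq> \<Omega>"
      "measure lebesgue (\<Omega> - K') \<le> (1 - \<gamma> / 2) * measure lebesgue (\<Omega> - K)" by blast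
    have "(1 - \<gamma> / 2) * measure lebesgue (\<Omega> - K) \<le> (1 - \<gamma> / 2) * ((1 - \<gamma> / 2) ^ n * measure lebesgue \<Omega>)"
      using K(3) \<gamma> by (intro mult_left_mono) auto
    then show ?case using K' by (intro exI[of _ K']) auto
  qed
  have "(\<lambda>n. (1 - \<gamma> / 2) ^ n * measure lebesgue \<Omega>) \<longlonglongrightarrow> 0 * measure lebesgue \<Omega>"
    by (intro tendsto_mult LIMSEQ_power_zero tendsto_const) (use \<gamma> in auto)
  then have "\<forall>\<^sub>F n in sequentially. (1 - \<gamma> / 2) ^ n * measure lebesgue \<Omega> < e"
    by (rule order_tendstoD) (use e in simp)
  then obtain n where "(1 - \<gamma> / 2) ^ n * measure lebesgue \<Omega> < e"
    using eventually_happens trivial_limit_sequentially by blast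
  with iter[of n] that show thesis by fastforce
qed

lemma bounded_continuous_absolutely_integrable:
  fixes \<phi> :: "'a::euclidean_space \<Rightarrow> real"
  assumes "S \<in> lmeasurable" "continuous_on S \<phi>" "\<And>x. x \<in> S \<Longrightarrow> \<bar>\<phi> x\<bar> \<le> B"
  shows "\<phi> absolutely_integrable_on S"
proof (rule measurable_bounded_by_integrable_imp_absolutely_integrable[where g="\<lambda>_. B"])
  show "\<phi> \<in> borel_measurable (lebesgue_on S)"
    using assms(1,2) by (intro continuous_imp_measurable_on_sets_lebesgue) auto
  show "(\<lambda>_. B) integrable_on S"
    using integrable_cmul[of "\<lambda>x. 1::real" S B] assms(1) by (simp add: lmeasurable_iff_integrable_on)
qed (use assms in auto)

lemma has_integral_Diff_negligible:
  fixes f :: "'a::euclidean_space \<Rightarrow> 'b::euclidean_space"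
  assumes "negligible Z"
  shows "(f has_integral y) (S - Z) \<longleftrightarrow> (f has_integral y) S"
    and "f absolutely_integrable_on (S - Z) \<longleftrightarrow> f absolutely_integrable_on S"
    and "integral (S - Z) f = integral S f"
proof -
  have 1: "negligible {x \<in> (S - Z) - S. f x \<noteq> 0}" by (rule negligible_subset[OF assms]) auto
  have 2: "negligible {x \<in> S - (S - Z). f x \<noteq> 0}"
    using assms by (rule negligible_subset) auto
  show "(f has_integral y) (S - Z) \<longleftrightarrow> (f has_integral y) S" for y
    by (rule has_integral_spike_set_eq[OF 1 2])
  then show "integral (S - Z) f = integral S f" by (simp add: integral_def integrable_on_def)
  show "f absolutely_integrable_on (S - Z) \<longleftrightarrow> f absolutely_integrable_on S"
    by (rule absolutely_integrable_spike_set_eq[OF 1 2])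
qed

lemma has_integral_measure_lebesgue:
  "S \<in> lmeasurable \<Longrightarrow> ((\<lambda>x. 1::real) has_integral measure lebesgue S) S"
  using integrable_integral[of "\<lambda>x. 1::real" S]
  by (simp add: lmeasure_integral lmeasurable_iff_integrable_on)

section \<open>Near-minimizing coefficients and the resulting reparametrization\<close>

context plane_energy
begin

text \<open>For a near-minimizer chosen at one point, continuity of \<open>qd - jac\<close> keeps
  the inequality for neighbouring points and for slightly rotated coefficients. Compactness makes
  the size of these neighbourhoods uniform.\<close>

lemma uniform_near_minimizers:
  fixes s :: "complex \<Rightarrow> complex \<Rightarrow> real"
  assumes X: "compact X" and s: "\<And>z. z \<in> X \<Longrightarrow> s z \<in> cseminorms" "\<And>v. continuous_on X (\<lambda>z. s z v)"
    and norm: "\<And>z v. z \<in> X \<Longrightarrow> v \<noteq> 0 \<Longrightarrow> 0 < s z v" and e: "0 < e"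
  obtains \<kappa> where "0 < \<kappa>"
    "\<And>c. c \<in> X \<Longrightarrow> \<exists>\<mu>. cmod \<mu> < 1 \<and> (\<forall>z\<in>X \<inter> ball c \<kappa>. \<forall>\<omega>. cmod \<omega> = 1 \<longrightarrow> cmod (\<omega> - 1) \<le> \<kappa> \<longrightarrow>
       qd (s z) (- (\<mu> * \<omega>)) \<le> jac (s z) + e)"
proof -
  have "\<exists>\<mu> d. 0 < d \<and> cmod \<mu> < 1 \<and> (\<forall>z\<in>X. \<forall>\<omega>. cmod \<omega> = 1 \<longrightarrow> cmod (\<omega> - 1) < d \<longrightarrow> dist z c < d \<longrightarrow>
      qd (s z) (- (\<mu> * \<omega>)) \<le> jac (s z) + e)" if c: "c \<in> X" for c
  proof -
    obtain \<nu> where \<nu>: "cmod \<nu> < 1" "qd (s c) \<nu> < jac (s c) + e" using jac_approx[OF s(1)[OF c] e] by blast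
    \<comment> \<open>The energy density is that of the inverse homeomorphism, whose coefficient is
      the negative of the one prescribed here.\<close>
    define \<mu> where "\<mu> = - \<nu>"
    define \<Phi> where "\<Phi> = (\<lambda>p. qd (s (fst p)) (- (\<mu> * snd p)) - jac (s (fst p)))"
    have cX: "continuous_on (X \<times> sphere 0 1) (\<lambda>p. f (fst p))" if "continuous_on X f" for f :: "complex \<Rightarrow> real"
      by (rule continuous_on_compose2[OF that]) (auto intro!: continuous_intros)
    have "continuous_on (X \<times> sphere 0 1) \<Phi>"
      unfolding \<Phi>_def
    proof (intro continuous_on_diff)
      show "continuous_on (X \<times> sphere 0 1) (\<lambda>p. qd (s (fst p)) (- (\<mu> * snd p)))"
      proof (rule continuous_on_qd)
        show "continuous_on (X \<times> sphere 0 1) (\<lambda>x. s (fst x) v)" for v by (rule cX[OF s(2)])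
      qed (use s(1) \<nu>(1) in \<open>auto simp: norm_mult \<mu>_def intro!: continuous_intros\<close>)
      show "continuous_on (X \<times> sphere 0 1) (\<lambda>p. jac (s (fst p)))"
        by (rule cX[OF jac_continuous_on[OF s norm]])
    qed
    moreover have "(c, 1::complex) \<in> X \<times> sphere 0 1" using c by simp
    moreover have "0 < e - \<Phi> (c, 1)" using \<nu>(2) by (simp add: \<Phi>_def \<mu>_def)
    ultimately obtain d where d: "0 < d"
      "\<And>p. p \<in> X \<times> sphere 0 1 \<Longrightarrow> dist p (c, 1) < d \<Longrightarrow> dist (\<Phi> p) (\<Phi> (c, 1)) < e - \<Phi> (c, 1)"
      unfolding continuous_on_iff by metis
    have "qd (s z) (- (\<mu> * \<omega>)) \<le> jac (s z) + e"
      if "z \<in> X" "cmod \<omega> = 1" "cmod (\<omega> - 1) < d / 2" "dist z c < d / 2" for z \<omega>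
    proof -
      have "dist (z, \<omega>) (c, 1) \<le> dist z c + dist \<omega> 1"
        unfolding dist_Pair_Pair by (rule sqrt_sum_squares_le_sum) auto
      also have "\<dots> < d" using that by (simp add: dist_norm)
      finally have "dist (\<Phi> (z, \<omega>)) (\<Phi> (c, 1)) < e - \<Phi> (c, 1)" using d(2)[of "(z, \<omega>)"] that by simp
      then show ?thesis unfolding dist_real_def by (simp add: \<Phi>_def)
    qed
    moreover have "cmod \<mu> < 1" using \<nu> by (simp add: \<mu>_def)
    ultimately show ?thesis using d(1) by (intro exI[of _ \<mu>] exI[of _ "d / 2"]) auto
  qed
  then obtain \<mu> d where *: "\<And>c. c \<in> X \<Longrightarrow> 0 < d c \<and> cmod (\<mu> c) < 1 \<and> (\<forall>z\<in>X. \<forall>\<omega>. cmod \<omega> = 1 \<longrightarrow>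
      cmod (\<omega> - 1) < d c \<longrightarrow> dist z c < d c \<longrightarrow> qd (s z) (- (\<mu> c * \<omega>)) \<le> jac (s z) + e)"
    by metis
  obtain Y where Y: "Y \<subseteq> X" "finite Y" "X \<subseteq> (\<Union>c\<in>Y. ball c (d c / 2))"
    by (rule compactE_image[OF X, of X "\<lambda>c. ball c (d c / 2)"]) (use * in auto)
  \<comment> \<open>Half radii: a point within \<kappa> of \<open>c\<close>, where \<open>c\<close>
    is within \<open>d y / 2\<close> of \<open>y\<close>, lies within \<open>d y\<close> of
    \<open>y\<close>.\<close>
  define \<kappa> where "\<kappa> = Min (insert 1 ((\<lambda>c. d c / 2) ` Y))"
  have \<kappa>: "0 < \<kappa>" "\<And>c. c \<in> Y \<Longrightarrow> \<kappa> \<le> d c / 2"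
  proof -
    show "0 < \<kappa>" unfolding \<kappa>_def using Y(1,2) * by (subst Min_gr_iff) auto
    show "\<kappa> \<le> d c / 2" if "c \<in> Y" for c unfolding \<kappa>_def using Y(2) that by (intro Min_le) auto
  qed
  show thesis
  proof (rule that[OF \<kappa>(1)])
    fix c assume "c \<in> X"
    then obtain y where y: "y \<in> Y" "dist y c < d y / 2" using Y(3) by auto
    then have yX: "y \<in> X" using Y(1) by blast
    show "\<exists>\<mu>. cmod \<mu> < 1 \<and> (\<forall>z\<in>X \<inter> ball c \<kappa>. \<forall>\<omega>. cmod \<omega> = 1 \<longrightarrow> cmod (\<omega> - 1) \<le> \<kappa> \<longrightarrow>
       qd (s z) (- (\<mu> * \<omega>)) \<le> jac (s z) + e)"
    proof (intro exI[of _ "\<mu> y"] conjI ballI allI impI)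
      fix z \<omega> assume z: "z \<in> X \<inter> ball c \<kappa>" and \<omega>: "cmod \<omega> = 1" "cmod (\<omega> - 1) \<le> \<kappa>"
      have "dist z y < d y"
        using z y(2) \<kappa>(2)[OF y(1)] dist_triangle[of z y c] by (simp add: dist_commute)
      moreover have "cmod (\<omega> - 1) < d y" using \<omega> \<kappa>(2)[OF y(1)] *[OF yX] by auto
      ultimately show "qd (s z) (- (\<mu> y * \<omega>)) \<le> jac (s z) + e" using *[OF yX] z \<omega> by auto
    qed (use *[OF yX] in auto)
  qed
qed

text \<open>On \<open>K\<close> the density exceeds \<open>jac\<close> by at most \<open>E\<close>
  except on a null set. Off \<open>K\<close> the coefficient is 0, so there the density is
  \<open>J (s z) \<le> B\<close>, and this region has small area.\<close>

lemma almost_conformal_reparametrization: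
  fixes s :: "complex \<Rightarrow> complex \<Rightarrow> real"
  assumes \<Omega>: "open \<Omega>" "bounded \<Omega>"
    and s: "\<And>z. z \<in> closure \<Omega> \<Longrightarrow> s z \<in> cseminorms" "\<And>v. continuous_on (closure \<Omega>) (\<lambda>z. s z v)"
    and norm: "\<And>z v. z \<in> closure \<Omega> \<Longrightarrow> v \<noteq> 0 \<Longrightarrow> 0 < s z v" and e: "0 < e"
  obtains f K Z a m where "qcmap f K Z a m" "K \<subseteq> \<Omega>"
    "(\<lambda>z. qd (s z) (- m z)) absolutely_integrable_on (\<Omega> - Z)"
    "integral (\<Omega> - Z) (\<lambda>z. qd (s z) (- m z)) \<le> integral \<Omega> (\<lambda>z. jac (s z)) + e"
proof -
  define X where "X = closure \<Omega>"
  have X: "compact X" using \<Omega> by (simp add: X_def compact_closure)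
  have \<Omega>X: "\<Omega> \<subseteq> X" by (simp add: X_def closure_subset)
  have \<Omega>m: "\<Omega> \<in> lmeasurable" using \<Omega> by (simp add: lmeasurable_open)
  obtain B where B: "0 < B" "\<And>z. z \<in> X \<Longrightarrow> J (s z) \<le> B"
  proof -
    have "compact ((\<lambda>z. J (s z)) ` X)"
      by (rule compact_continuous_image[OF continuous_on_J X]) (use s in \<open>auto simp: X_def\<close>)
    then have "bounded ((\<lambda>z. J (s z)) ` X)" by (rule compact_imp_bounded)
    then obtain b where "0 < b" "\<forall>x\<in>(\<lambda>z. J (s z)) ` X. norm x \<le> b" unfolding bounded_pos by blast
    then show thesis by (intro that[of b]) (auto simp: abs_le_iff)
  qed
  define A where "A = measure lebesgue \<Omega> + 1"
  define E where "E = e / (2 * A)"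
  have E: "0 < E" "E * measure lebesgue \<Omega> \<le> e / 2"
  proof -
    have p: "0 < A" by (simp add: A_def add_nonneg_pos)
    then show "0 < E" using e by (simp add: E_def)
    have "E * measure lebesgue \<Omega> \<le> E * A" using \<open>0 < E\<close> by (simp add: A_def)
    also have "\<dots> = e / 2" using p by (simp add: E_def)
    finally show "E * measure lebesgue \<Omega> \<le> e / 2" .
  qed
  define P where "P = (\<lambda>z \<mu>. qd (s z) (- \<mu>) \<le> jac (s z) + E)"
  obtain \<kappa> where \<kappa>: "0 < \<kappa>"
    "\<And>c. c \<in> X \<Longrightarrow> \<exists>\<mu>. cmod \<mu> < 1 \<and> (\<forall>z\<in>X \<inter> ball c \<kappa>. \<forall>\<omega>. cmod \<omega> = 1 \<longrightarrow> cmod (\<omega> - 1) \<le> \<kappa> \<longrightarrow>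
       qd (s z) (- (\<mu> * \<omega>)) \<le> jac (s z) + E)"
    using uniform_near_minimizers[OF X s[folded X_def] norm[folded X_def] E(1)] by blast
  have hyp: "\<exists>\<mu>. cmod \<mu> < 1 \<and> (\<forall>z\<in>\<Omega> \<inter> ball c \<kappa>. \<forall>\<omega>. cmod \<omega> = 1 \<longrightarrow> cmod (\<omega> - 1) \<le> \<kappa> \<longrightarrow> P z (\<mu> * \<omega>))"
    if "c \<in> \<Omega>" for c
  proof -
    have "c \<in> X" using that \<Omega>X by blast
    then obtain \<mu> where "cmod \<mu> < 1" "\<forall>z\<in>X \<inter> ball c \<kappa>. \<forall>\<omega>. cmod \<omega> = 1 \<longrightarrow> cmod (\<omega> - 1) \<le> \<kappa> \<longrightarrow>
       qd (s z) (- (\<mu> * \<omega>)) \<le> jac (s z) + E" using \<kappa>(2) by blast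
    then show ?thesis using \<Omega>X unfolding P_def by (intro exI[of _ \<mu>]) blast
  qed
  \<comment> \<open>The budget \<open>e\<close> is split evenly: \<open>E\<close> times the area of
    \<Omega> uses one half, \<open>B\<close> times the untreated area the other.\<close>
  have "0 < e / (2 * B)" using e B by simp
  then obtain K where K: "good_qcmap P K" "K \<subseteq> \<Omega>" "measure lebesgue (\<Omega> - K) < e / (2 * B)"
    using good_qcmap_exhaustion[OF \<Omega> \<kappa>(1) \<kappa>(1) _ hyp] by blast
  then obtain f Z a m where q: "qcmap f K Z a m" and good: "\<And>z. z \<in> K - Z \<Longrightarrow> P z (m z)"
    unfolding good_qcmap_def by blast
  note qc = qcmapD[OF q]
  have ZN: "negligible Z" by (rule qc(5))
  have Sm: "\<Omega> - Z \<in> lmeasurable"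
    using \<Omega>m ZN by (simp add: fmeasurable_Diff negligible_imp_sets)
  have le: "qd (s z) (- m z) \<le> jac (s z) + E + (if z \<in> K then 0 else B)" if z: "z \<in> \<Omega> - Z" for z
  proof (cases "z \<in> K")
    case True
    then show ?thesis using good[of z] z by (simp add: P_def)
  next
    case False
    have zX: "z \<in> X" using z \<Omega>X by blast
    then have "0 \<le> jac (s z)" using s(1)[of z] by (intro jac_nonneg) (simp add: X_def)
    then show ?thesis using False qc(13)[OF False] B(2)[OF zX] E(1) by (simp add: qd_0)
  qed
  have jacB: "0 \<le> jac (s z)" "jac (s z) \<le> B" if "z \<in> \<Omega>" for z
  proof -
    have zX: "z \<in> X" using that \<Omega>X by blast
    then have "s z \<in> cseminorms" using s(1) by (simp add: X_def)
    then show "0 \<le> jac (s z)" "jac (s z) \<le> B"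
      using jac_nonneg[of "s z"] jac_le_J[of "s z"] B(2)[OF zX] by linarith+
  qed
  have int: "(\<lambda>z. qd (s z) (- m z)) absolutely_integrable_on (\<Omega> - Z)"
  proof (rule bounded_continuous_absolutely_integrable[OF Sm])
    show "continuous_on (\<Omega> - Z) (\<lambda>z. qd (s z) (- m z))"
    proof (rule continuous_on_qd)
      show "s z \<in> cseminorms" if "z \<in> \<Omega> - Z" for z using that s(1) \<Omega>X by (auto simp: X_def)
      show "continuous_on (\<Omega> - Z) (\<lambda>z. s z v)" for v
        by (rule continuous_on_subset[OF s(2)]) (use \<Omega>X in \<open>auto simp: X_def\<close>)
      show "continuous_on (\<Omega> - Z) (\<lambda>z. - m z)"
        by (intro continuous_on_minus continuous_on_subset[OF qc(12)]) auto
    qed (use qc(10) in auto)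
    fix z assume z: "z \<in> \<Omega> - Z"
    then have "s z \<in> cseminorms" using s(1)[of z] \<Omega>X by (auto simp: X_def)
    then have "0 \<le> qd (s z) (- m z)" using qc(10)[of z] z by (intro qd_nonneg) auto
    moreover have "qd (s z) (- m z) \<le> B + E + B" using le[OF z] jacB[of z] z B(1) by (auto split: if_splits)
    ultimately show "\<bar>qd (s z) (- m z)\<bar> \<le> B + E + B" by simp
  qed
  have Km: "K \<in> lmeasurable" using qc(3) by (rule lmeasurable_compact)
  have jint: "(\<lambda>z. jac (s z)) absolutely_integrable_on \<Omega>"
  proof (rule bounded_continuous_absolutely_integrable[OF \<Omega>m])
    show "continuous_on \<Omega> (\<lambda>z. jac (s z))"
      by (rule continuous_on_subset[OF jac_continuous_on[OF s norm] closure_subset])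
  qed (use jacB in auto)
  have ind: "((\<lambda>z. if z \<in> \<Omega> - K then B * 1 else 0) has_integral B * measure lebesgue (\<Omega> - K)) \<Omega>"
  proof -
    have "\<Omega> - K \<in> lmeasurable" using \<Omega>m Km by (simp add: fmeasurable.Diff)
    then have "((\<lambda>z. 1::real) has_integral measure lebesgue (\<Omega> - K)) (\<Omega> - K)"
      by (rule has_integral_measure_lebesgue)
    from has_integral_mult_right[OF this, of B] show ?thesis
      by (subst has_integral_restrict) auto
  qed
  have cint: "((\<lambda>z. E * 1) has_integral E * measure lebesgue \<Omega>) \<Omega>"
    using \<Omega>m by (intro has_integral_mult_right has_integral_measure_lebesgue)
  have "((\<lambda>z. jac (s z) + E * 1 + (if z \<in> \<Omega> - K then B * 1 else 0)) has_integral
      integral \<Omega> (\<lambda>z. jac (s z)) + E * measure lebesgue \<Omega> + B * measure lebesgue (\<Omega> - K)) \<Omega>"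
    by (intro has_integral_add ind cint integrable_integral)
      (use jint in \<open>auto simp: absolutely_integrable_on_def\<close>)
  then have big: "((\<lambda>z. jac (s z) + E * 1 + (if z \<in> \<Omega> - K then B * 1 else 0)) has_integral
      integral \<Omega> (\<lambda>z. jac (s z)) + E * measure lebesgue \<Omega> + B * measure lebesgue (\<Omega> - K)) (\<Omega> - Z)"
    by (simp only: has_integral_Diff_negligible(1)[OF ZN])
  have "integral (\<Omega> - Z) (\<lambda>z. qd (s z) (- m z)) \<le>
      integral \<Omega> (\<lambda>z. jac (s z)) + E * measure lebesgue \<Omega> + B * measure lebesgue (\<Omega> - K)"
  proof (rule has_integral_le[OF integrable_integral big])
    show "(\<lambda>z. qd (s z) (- m z)) integrable_on \<Omega> - Z"
      using int by (auto simp: absolutely_integrable_on_def)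
    show "qd (s z) (- m z) \<le> jac (s z) + E * 1 + (if z \<in> \<Omega> - K then B * 1 else 0)" if "z \<in> \<Omega> - Z" for z
      using le[OF that] that by (auto split: if_splits)
  qed
  also have "\<dots> \<le> integral \<Omega> (\<lambda>z. jac (s z)) + e"
    using E(2) K(3) B(1) by (simp add: field_simps)
  finally show thesis using that[OF q K(2) int] by blast
qed

end

subsection \<open>Energies of maps into normed spaces\<close>

definition to_plane :: "((real^2 \<Rightarrow> real) \<Rightarrow> real) \<Rightarrow> (complex \<Rightarrow> real) \<Rightarrow> real" where
  "to_plane I s = I (\<lambda>v. s (cx v))"

lemma linear_cx: "linear cx" and linear_xc: "linear xc"
  using bounded_linear_cx bounded_linear_xc by (auto intro: bounded_linear.linear)

lemma seminorms_cx: "s \<in> cseminorms \<Longrightarrow> (\<lambda>v. s (cx v)) \<in> seminorms"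
  by (auto simp: cseminorms_def seminorms_def linear_add[OF linear_cx] linear_cmul[OF linear_cx])

definition matrix_of :: "complex \<Rightarrow> complex \<Rightarrow> real^2^2" where
  "matrix_of a b = vector [vector [Re a + Re b, Im b - Im a], vector [Im a + Im b, Re a - Re b]]"

lemma cx_matrix_of: "cx (matrix_of a b *v v) = a * cx v + b * cnj (cx v)"
  by (simp add: complex_eq_iff matrix_of_def matrix_vector_mult_def sum_2 algebra_simps)

lemma det_matrix_of: "det (matrix_of a b) = (cmod a)\<^sup>2 - (cmod b)\<^sup>2"
  unfolding cmod_power2 by (simp add: det_2 matrix_of_def power2_eq_square algebra_simps)

lemma ex_matrix_of:
  fixes T :: "real^2^2"
  shows "\<exists>a b. T = matrix_of a b"
proof (intro exI)
  define p where "p = (\<lambda>i j. T $ i $ j)"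
  show "T = matrix_of (Complex ((p 1 1 + p 2 2) / 2) ((p 2 1 - p 1 2) / 2))
      (Complex ((p 1 1 - p 2 2) / 2) ((p 2 1 + p 1 2) / 2))"
    by (simp add: vec_eq_iff forall_2 matrix_of_def p_def add_divide_distrib diff_divide_distrib)
qed

lemma rotation_matrix_of:
  assumes "cmod u = 1" shows "rotation_matrix (matrix_of u 0)"
proof -
  have u: "Re u * Re u + Im u * Im u = 1"
    using assms by (simp add: cmod_def power2_eq_square)
  have "transpose (matrix_of u 0) ** matrix_of u 0 = mat 1"
    using u by (simp add: vec_eq_iff forall_2 matrix_of_def transpose_def matrix_matrix_mult_def sum_2 mat_def algebra_simps)
  then show ?thesis
    using assms by (simp add: rotation_matrix_def orthogonal_matrix det_matrix_of)
qed

section \<open>From a definition of energy to \<open>plane_energy\<close>\<close>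

context
  fixes I :: "(real^2 \<Rightarrow> real) \<Rightarrow> real"
  assumes energy: "definition_of_energy I"
begin

lemma energy_nonneg: "s \<in> seminorms \<Longrightarrow> 0 \<le> I s"
  using energy unfolding definition_of_energy_def continuous_map_def by (auto simp: Pi_iff)

lemma energy_mono: "s \<in> seminorms \<Longrightarrow> s' \<in> seminorms \<Longrightarrow> (\<And>v. s' v \<le> s v) \<Longrightarrow> I s' \<le> I s"
  using energy unfolding definition_of_energy_def by blast

lemma energy_scale: "s \<in> seminorms \<Longrightarrow> 0 \<le> c \<Longrightarrow> I (\<lambda>v. c * s v) = c\<^sup>2 * I s"
  using energy unfolding definition_of_energy_def by blast

lemma energy_rotation: "s \<in> seminorms \<Longrightarrow> rotation_matrix T \<Longrightarrow> I (\<lambda>v. s (T *v v)) = I s"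
  using energy unfolding definition_of_energy_def by blast

lemma seminorm_dist_le:
  assumes "s \<in> seminorms" "s' \<in> seminorms" "\<And>v. norm v = 1 \<Longrightarrow> \<bar>s v - s' v\<bar> \<le> e"
  shows "seminorm_dist s s' \<le> e"
  using seminorm_dist_attained[OF assms(1,2)] assms(3) by auto

lemma seminorm_dist_ge:
  assumes "s \<in> seminorms" "s' \<in> seminorms" "norm v = 1"
  shows "\<bar>s v - s' v\<bar> \<le> seminorm_dist s s'"
  using seminorm_dist_attained[OF assms(1,2)] assms(3) by force

text \<open>If a nonzero \<open>s\<close> had energy 0, all multiples \<open>k * s\<close> would
  have energy 0 and lie in the sublevel set, which is compact and hence bounded.\<close>

lemma energy_pos:
  assumes s: "s \<in> seminorms" and v: "s v \<noteq> 0"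
  shows "0 < I s"
proof (rule ccontr)
  assume "\<not> 0 < I s"
  then have I0: "I s = 0" using energy_nonneg[OF s] by simp
  have hom: "s (c *\<^sub>R w) = \<bar>c\<bar> * s w" for c w using s by (auto simp: seminorms_def)
  have v0: "v \<noteq> 0" using v hom[of 0 0] by auto
  define u where "u = sgn v"
  have u: "norm u = 1" using v0 by (simp add: u_def norm_sgn)
  have "s (norm v *\<^sub>R u) = s v" using v0 by (simp add: u_def sgn_div_norm)
  then have su: "0 < s u" using v s unfolding hom by (auto simp: seminorms_def less_le)
  have ks: "(\<lambda>w. k * s w) \<in> seminorms" if "0 \<le> k" for k
    using s that by (auto simp: seminorms_def mult.left_commute distrib_left[symmetric] intro: mult_left_mono)
  have "compactin S2.mtopology {s \<in> seminorms. I s \<in> {0..1}}"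
    using energy unfolding definition_of_energy_def by blast
  then have "S2.mbounded {s \<in> seminorms. I s \<in> {0..1}}" by (rule S2.compactin_imp_mbounded)
  then obtain B where B: "\<forall>x\<in>{s \<in> seminorms. I s \<in> {0..1}}. \<forall>y\<in>{s \<in> seminorms. I s \<in> {0..1}}. seminorm_dist x y \<le> B"
    unfolding S2.mbounded_alt by blast
  have mem: "(\<lambda>w. k * s w) \<in> {s \<in> seminorms. I s \<in> {0..1}}" if "0 \<le> k" for k
    using ks[OF that] energy_scale[OF s that] I0 by simp
  define k where "k = (\<bar>B\<bar> + 1) / s u"
  have k: "0 \<le> k" using su by (simp add: k_def)
  have "\<bar>k * s u - 0 * s u\<bar> \<le> seminorm_dist (\<lambda>w. k * s w) (\<lambda>w. 0 * s w)"
    by (rule seminorm_dist_ge[OF ks[OF k] ks[OF order_refl] u])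
  also have "\<dots> \<le> B" using B mem[OF k] mem[OF order_refl] by blast
  finally show False using su k by (simp add: k_def)
qed

text \<open>The factor \<open>c\<close> in \<open>conformal\<close> is split into its modulus,
  handled by homogeneity, and a unit number, handled by rotation invariance. For continuity,
  pointwise convergence of seminorms is upgraded to convergence in
  \<open>seminorm_dist\<close>.\<close>

lemma plane_energy_to_plane: "plane_energy (to_plane I)"
proof
  fix s assume s: "s \<in> cseminorms"
  show "0 \<le> to_plane I s" unfolding to_plane_def by (rule energy_nonneg[OF seminorms_cx[OF s]])
  show "to_plane I s' \<le> to_plane I s" if "s' \<in> cseminorms" "\<And>v. s' v \<le> s v" for s'
    unfolding to_plane_def by (rule energy_mono[OF seminorms_cx[OF s] seminorms_cx[OF that(1)] that(2)])
  show "0 < to_plane I s" if "s v \<noteq> 0" for v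
    unfolding to_plane_def by (rule energy_pos[OF seminorms_cx[OF s], of "xc v"]) (use that in simp)
  show "to_plane I (\<lambda>v. s (c * v)) = (cmod c)\<^sup>2 * to_plane I s" for c
  proof -
    define u where "u = (if c = 0 then 1 else sgn c)"
    have u1: "cmod u = 1" by (simp add: u_def norm_sgn)
    have "c = of_real (cmod c) * u" by (simp add: u_def sgn_div_norm scaleR_conv_of_real)
    note u = u1 this
    have "s (c * cx v) = cmod c * s (cx (matrix_of u 0 *v v))" for v
    proof -
      have "c * cx v = of_real (cmod c) * (u * cx v)" using u(2) by (metis mult.assoc)
      then have "s (c * cx v) = s (of_real (cmod c) * (u * cx v))" by (rule arg_cong)
      also have "\<dots> = cmod c * s (u * cx v)"
        using cseminorm_scale_complex[OF s, of "cmod c" "u * cx v"] by simp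
      finally show ?thesis by (simp add: cx_matrix_of)
    qed
    then have "to_plane I (\<lambda>v. s (c * v)) = I (\<lambda>v. cmod c * s (cx (matrix_of u 0 *v v)))"
      by (simp add: to_plane_def)
    also have "\<dots> = (cmod c)\<^sup>2 * I (\<lambda>v. s (cx (matrix_of u 0 *v v)))"
    proof (rule energy_scale)
      have "(\<lambda>v. s (u * v)) \<in> cseminorms"
        by (rule cseminorm_linear[OF s]) (auto intro!: linearI simp: algebra_simps)
      from seminorms_cx[OF this] show "(\<lambda>v. s (cx (matrix_of u 0 *v v))) \<in> seminorms"
        by (simp add: cx_matrix_of)
    qed simp
    also have "I (\<lambda>v. s (cx (matrix_of u 0 *v v))) = I (\<lambda>v. s (cx v))"
      using energy_rotation[OF seminorms_cx[OF s] rotation_matrix_of[OF u(1)]] by simp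
    finally show ?thesis by (simp add: to_plane_def)
  qed
next
  fix X s assume X: "\<And>k. X k \<in> cseminorms" and s: "s \<in> cseminorms"
    and lim: "\<And>v. (\<lambda>k::nat. X k v) \<longlonglongrightarrow> s v"
  have lim': "limitin S2.mtopology (\<lambda>k v. X k (cx v)) (\<lambda>v. s (cx v)) sequentially"
    unfolding S2.limitin_metric
  proof (intro conjI allI impI)
    fix e :: real assume "0 < e"
    then have "\<forall>\<^sub>F k in sequentially. \<forall>v. \<bar>X k v - s v\<bar> \<le> (e / 2) * cmod v"
      by (intro cseminorm_uniform_convergence X s lim) simp
    then show "\<forall>\<^sub>F k in sequentially. (\<lambda>v. X k (cx v)) \<in> seminorms \<and>
        seminorm_dist (\<lambda>v. X k (cx v)) (\<lambda>v. s (cx v)) < e"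
    proof eventually_elim
      case (elim k)
      have "seminorm_dist (\<lambda>v. X k (cx v)) (\<lambda>v. s (cx v)) \<le> e / 2"
      proof (rule seminorm_dist_le[OF seminorms_cx[OF X] seminorms_cx[OF s]])
        fix v :: "real^2" assume "norm v = 1"
        then show "\<bar>X k (cx v) - s (cx v)\<bar> \<le> e / 2" using elim[rule_format, of "cx v"] by simp
      qed
      then show ?case using seminorms_cx[OF X] \<open>0 < e\<close> by simp
    qed
  qed (rule seminorms_cx[OF s])
  have cont: "continuous_map S2.mtopology (top_of_set {0..}) I"
    using energy unfolding definition_of_energy_def by blast
  have "limitin (top_of_set {0..}) (I \<circ> (\<lambda>k v. X k (cx v))) (I (\<lambda>v. s (cx v))) sequentially"
    by (rule continuous_map_limit[OF cont lim'])
  then show "(\<lambda>k. to_plane I (X k)) \<longlonglongrightarrow> to_plane I s"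
    by (simp add: limitin_subtopology o_def to_plane_def)
qed

lemma reduced_jacobian_eq: 
  assumes "s \<in> cseminorms"
  shows "reduced_jacobian I (\<lambda>v. s (cx v)) = plane_energy.jac (to_plane I) s"
proof -
  have "{I (\<lambda>v. s (cx (T *v v))) | T::real^2^2. det T = 1} =
      {to_plane I (\<lambda>v. s (a * v + b * cnj v)) | a b. (cmod a)\<^sup>2 - (cmod b)\<^sup>2 = 1}" (is "?A = ?B")
  proof (intro equalityI subsetI)
    fix x assume "x \<in> ?A"
    then obtain T :: "real^2^2" where T: "x = I (\<lambda>v. s (cx (T *v v)))" "det T = 1" by blast
    obtain a b where "T = matrix_of a b" using ex_matrix_of by blast
    with T show "x \<in> ?B"
      by (intro CollectI exI[of _ a] exI[of _ b]) (simp add: cx_matrix_of to_plane_def det_matrix_of)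
  next
    fix x assume "x \<in> ?B"
    then obtain a b where "x = to_plane I (\<lambda>v. s (a * v + b * cnj v))" "(cmod a)\<^sup>2 - (cmod b)\<^sup>2 = 1" by blast
    then show "x \<in> ?A"
      by (intro CollectI exI[of _ "matrix_of a b"]) (simp add: cx_matrix_of to_plane_def det_matrix_of)
  qed
  then show ?thesis
    unfolding reduced_jacobian_def plane_energy.jac_def[OF plane_energy_to_plane] by simp
qed

end

section \<open>Norms on R^n pulled back along coordinate families\<close>

definition trunc :: "nat \<Rightarrow> (nat \<Rightarrow> real) \<Rightarrow> nat \<Rightarrow> real" where
  "trunc n y = (\<lambda>i. if i < n then y i else 0)"

lemma trunc_Rn: "trunc n y \<in> Rn n"
  by (simp add: trunc_def Rn_def)

lemma trunc_id: "y \<in> Rn n \<Longrightarrow> trunc n y = y"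
  by (auto simp: trunc_def Rn_def)

lemma trunc_Rn_mono: "m \<le> n \<Longrightarrow> trunc m y \<in> Rn n"
  by (simp add: trunc_def Rn_def)

text \<open>Truncation places every family of coordinate functions in \<open>Rn n\<close>, so that
  assumptions on the coordinates below \<open>n\<close> suffice throughout.\<close>

definition pull_norm :: "nat \<Rightarrow> ((nat \<Rightarrow> real) \<Rightarrow> real) \<Rightarrow> (nat \<Rightarrow> complex \<Rightarrow> real) \<Rightarrow> complex \<Rightarrow> real" where
  "pull_norm n N X v = N (trunc n (\<lambda>i. X i v))"

context
  fixes n N assumes N: "norm_on_Rn n N"
begin

lemma norm_Rn_nonneg: "x \<in> Rn n \<Longrightarrow> 0 \<le> N x"
  and norm_Rn_eq_0: "x \<in> Rn n \<Longrightarrow> N x = 0 \<longleftrightarrow> x = (\<lambda>i. 0)"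
  and norm_Rn_scale: "x \<in> Rn n \<Longrightarrow> N (\<lambda>i. c * x i) = \<bar>c\<bar> * N x"
  and norm_Rn_triangle: "x \<in> Rn n \<Longrightarrow> y \<in> Rn n \<Longrightarrow> N (\<lambda>i. x i + y i) \<le> N x + N y"
  using N unfolding norm_on_Rn_def by blast+

lemma trunc_nonneg: "0 \<le> N (trunc n y)"
  by (rule norm_Rn_nonneg[OF trunc_Rn])

lemma trunc_scale: "N (trunc n (\<lambda>i. c * y i)) = \<bar>c\<bar> * N (trunc n y)"
proof -
  have "trunc n (\<lambda>i. c * y i) = (\<lambda>i. c * trunc n y i)" by (auto simp: trunc_def)
  then show ?thesis using norm_Rn_scale[OF trunc_Rn] by simp
qed

lemma trunc_add: "N (trunc n (\<lambda>i. x i + y i)) \<le> N (trunc n x) + N (trunc n y)"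
proof -
  have "trunc n (\<lambda>i. x i + y i) = (\<lambda>i. trunc n x i + trunc n y i)" by (auto simp: trunc_def)
  then show ?thesis using norm_Rn_triangle[OF trunc_Rn trunc_Rn] by simp
qed

lemma trunc_eq_0: "N (trunc n y) = 0 \<longleftrightarrow> (\<forall>i<n. y i = 0)"
  unfolding norm_Rn_eq_0[OF trunc_Rn] by (auto simp: trunc_def fun_eq_iff)

lemma pull_norm_cseminorm:
  assumes "\<And>i. i < n \<Longrightarrow> linear (X i)" shows "pull_norm n N X \<in> cseminorms"
proof (rule cseminormsI)
  fix c v w
  show "0 \<le> pull_norm n N X v" unfolding pull_norm_def by (rule trunc_nonneg)
  have "trunc n (\<lambda>i. X i (c *\<^sub>R v)) = trunc n (\<lambda>i. c * X i v)"
    using assms by (auto simp: trunc_def linear_cmul)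
  then show "pull_norm n N X (c *\<^sub>R v) = \<bar>c\<bar> * pull_norm n N X v" unfolding pull_norm_def using trunc_scale by simp
  have "trunc n (\<lambda>i. X i (v + w)) = trunc n (\<lambda>i. X i v + X i w)"
    using assms by (auto simp: trunc_def linear_add)
  then show "pull_norm n N X (v + w) \<le> pull_norm n N X v + pull_norm n N X w" unfolding pull_norm_def using trunc_add by simp
qed

text \<open>The upper half of the equivalence of norms, obtained by splitting off one coordinate
  vector at a time. It reduces continuity and boundedness to the coordinates.\<close>

lemma trunc_bound: "N (trunc n y) \<le> (\<Sum>i<n. \<bar>y i\<bar> * N (\<lambda>j. if j = i then 1 else 0))"
proof -
  have "N (trunc m y) \<le> (\<Sum>i<m. \<bar>y i\<bar> * N (\<lambda>j. if j = i then 1 else 0))" if "m \<le> n" for m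
    using that
  proof (induction m)
    case 0
    have "trunc 0 y = (\<lambda>i. 0)" by (simp add: trunc_def)
    then show ?case using norm_Rn_eq_0[of "\<lambda>i. 0"] by (simp add: Rn_def)
  next
    case (Suc m)
    have e: "(\<lambda>j. if j = m then 1 else (0::real)) \<in> Rn n" using Suc.prems by (auto simp: Rn_def)
    then have ye: "(\<lambda>j. y m * (if j = m then 1 else 0)) \<in> Rn n" by (auto simp: Rn_def)
    have "trunc (Suc m) y = (\<lambda>j. trunc m y j + y m * (if j = m then 1 else 0))"
      by (auto simp: trunc_def fun_eq_iff less_Suc_eq)
    then have "N (trunc (Suc m) y) \<le> N (trunc m y) + \<bar>y m\<bar> * N (\<lambda>j. if j = m then 1 else 0)"
      using norm_Rn_triangle[OF trunc_Rn_mono ye, of m y] norm_Rn_scale[OF e, of "y m"] Suc.prems by simp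
    then show ?case using Suc by simp
  qed
  then show ?thesis by simp
qed

lemma trunc_diff:
  "\<bar>N (trunc n x) - N (trunc n y)\<bar> \<le> (\<Sum>i<n. \<bar>x i - y i\<bar> * N (\<lambda>j. if j = i then 1 else 0))"
proof -
  have "N (trunc n x) \<le> N (trunc n y) + N (trunc n (\<lambda>i. x i - y i))" 
    using trunc_add[of y "\<lambda>i. x i - y i"] by simp
  moreover have "N (trunc n y) \<le> N (trunc n x) + N (trunc n (\<lambda>i. y i - x i))" 
    using trunc_add[of x "\<lambda>i. y i - x i"] by simp
  ultimately show ?thesis
    using trunc_bound[of "\<lambda>i. x i - y i"] trunc_bound[of "\<lambda>i. y i - x i"]
    by (simp add: abs_minus_commute)
qed

lemma tendsto_trunc:
  assumes "\<And>i. i < n \<Longrightarrow> ((\<lambda>x. y x i) \<longlongrightarrow> l i) F"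
  shows "((\<lambda>x. N (trunc n (y x))) \<longlongrightarrow> N (trunc n l)) F"
proof -
  have "((\<lambda>x. N (trunc n (y x)) - N (trunc n l)) \<longlongrightarrow> 0) F"
  proof (rule Lim_null_comparison)
    show "\<forall>\<^sub>F x in F. norm (N (trunc n (y x)) - N (trunc n l)) \<le>
        (\<Sum>i<n. \<bar>y x i - l i\<bar> * N (\<lambda>j. if j = i then 1 else 0))"
      using trunc_diff by simp
    have "((\<lambda>x. \<Sum>i<n. \<bar>y x i - l i\<bar> * N (\<lambda>j. if j = i then 1 else 0)) \<longlongrightarrow>
        (\<Sum>i<n. \<bar>l i - l i\<bar> * N (\<lambda>j. if j = i then 1 else 0))) F"
      by (intro tendsto_intros assms) simp
    then show "((\<lambda>x. \<Sum>i<n. \<bar>y x i - l i\<bar> * N (\<lambda>j. if j = i then 1 else 0)) \<longlongrightarrow> 0) F" by simp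
  qed
  then show ?thesis by (rule Lim_null[THEN iffD2])
qed

lemma continuous_on_trunc:
  assumes "\<And>i. i < n \<Longrightarrow> continuous_on S (\<lambda>x. y x i)"
  shows "continuous_on S (\<lambda>x. N (trunc n (y x)))"
  using assms unfolding continuous_on_def by (intro ballI tendsto_trunc) blast

lemma continuous_on_pull_norm:
  assumes "\<And>i. i < n \<Longrightarrow> continuous_on S (\<lambda>x. X x i v)"
  shows "continuous_on S (\<lambda>x. pull_norm n N (X x) v)"
  unfolding pull_norm_def by (rule continuous_on_trunc[OF assms])

lemma pull_norm_bound:
  assumes "\<And>i. i < n \<Longrightarrow> \<bar>X i v\<bar> \<le> B"
  shows "pull_norm n N X v \<le> B * (\<Sum>i<n. N (\<lambda>j. if j = i then 1 else 0))"
proof -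
  have "pull_norm n N X v \<le> (\<Sum>i<n. \<bar>X i v\<bar> * N (\<lambda>j. if j = i then 1 else 0))"
    unfolding pull_norm_def by (rule trunc_bound)
  also have "\<dots> \<le> (\<Sum>i<n. B * N (\<lambda>j. if j = i then 1 else 0))"
    by (intro sum_mono mult_right_mono assms norm_Rn_nonneg) (auto simp: Rn_def)
  finally show ?thesis by (simp add: sum_distrib_left)
qed

end

section \<open>Quasi-convexity for polynomial maps\<close>

lemma real_polynomial_function_derivative:
  fixes p :: "'a::real_normed_vector \<Rightarrow> real"
  assumes "real_polynomial_function p"
  shows "\<exists>D. (\<forall>z. (p has_derivative D z) (at z)) \<and> (\<forall>v. real_polynomial_function (\<lambda>z. D z v))"
  using assms
proof (induction rule: real_polynomial_function.induct)
  case (linear f)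
  then show ?case
    by (intro exI[of _ "\<lambda>_. f"]) (auto simp: bounded_linear_imp_has_derivative)
next
  case (const c)
  then show ?case by (intro exI[of _ "\<lambda>_ _. 0"]) auto
next
  case (add f g)
  then obtain D E where "\<forall>z. (f has_derivative D z) (at z)" "\<forall>v. real_polynomial_function (\<lambda>z. D z v)"
    "\<forall>z. (g has_derivative E z) (at z)" "\<forall>v. real_polynomial_function (\<lambda>z. E z v)" by blast
  then show ?case
    by (intro exI[of _ "\<lambda>z v. D z v + E z v"] conjI allI has_derivative_add
        real_polynomial_function.intros(3)) blast+
next
  case (mult f g)
  then obtain D E where "\<forall>z. (f has_derivative D z) (at z)" "\<forall>v. real_polynomial_function (\<lambda>z. D z v)"
    "\<forall>z. (g has_derivative E z) (at z)" "\<forall>v. real_polynomial_function (\<lambda>z. E z v)" by blast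
  then show ?case using mult.hyps
    by (intro exI[of _ "\<lambda>z v. f z * E z v + D z v * g z"] conjI allI has_derivative_mult
        real_polynomial_function.intros(3,4)) blast+
qed

text \<open>Directional derivatives of polynomials are polynomials again, so the induction on the
  order closes.\<close>

lemma Ck_on_real_polynomial_function:
  "real_polynomial_function p \<Longrightarrow> Ck_on k p U"
proof (induction k arbitrary: p)
  case 0
  then show ?case
    using continuous_real_polymonial_function by (auto intro: continuous_at_imp_continuous_on)
next
  case (Suc k)
  obtain D where D: "\<And>z. (p has_derivative D z) (at z)" "\<And>v. real_polynomial_function (\<lambda>z. D z v)"
    using real_polynomial_function_derivative[OF Suc.prems] by blast
  have "frechet_derivative p (at x) = D x" for x
    using frechet_derivative_at[OF D(1)] by simp
  then show ?case using D Suc.IH[OF D(2)] by (auto simp: differentiable_def)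
qed

lemma bounded_convergence:
  fixes f :: "nat \<Rightarrow> 'a::euclidean_space \<Rightarrow> real"
  assumes "S \<in> lmeasurable" "\<And>k. f k integrable_on S" "\<And>k x. x \<in> S \<Longrightarrow> \<bar>f k x\<bar> \<le> B"
    "\<And>x. x \<in> S \<Longrightarrow> (\<lambda>k. f k x) \<longlonglongrightarrow> g x"
  shows "g integrable_on S" "(\<lambda>k. integral S (f k)) \<longlonglongrightarrow> integral S g"
proof -
  have B: "(\<lambda>_. B) integrable_on S"
    using integrable_cmul[of "\<lambda>x. 1::real" S B] assms(1) by (simp add: lmeasurable_iff_integrable_on)
  have bd: "\<And>k x. x \<in> S \<Longrightarrow> norm (f k x) \<le> B" using assms(3) by simp
  show "g integrable_on S" by (rule dominated_convergence(1)[OF assms(2) B bd assms(4)])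
  show "(\<lambda>k. integral S (f k)) \<longlonglongrightarrow> integral S g"
    by (rule dominated_convergence(2)[OF assms(2) B bd assms(4)])
qed

text \<open>\<open>disc_integral\<close> is a Lebesgue integral on \<open>real^2\<close>, while the
  estimates use gauge integrals on the complex plane. Continuity on the closed disc provides the
  integrability under which they agree.\<close>

lemma set_lebesgue_integral_disc:
  fixes \<phi> :: "complex \<Rightarrow> real"
  assumes "continuous_on (cball 0 1) \<phi>"
  shows "(LINT z:ball 0 1|lborel. \<phi> (cx z)) = integral (ball 0 1) \<phi>"
proof -
  have "continuous_on (cball 0 1) (\<lambda>z. \<phi> (cx z))"
    by (rule continuous_on_compose2[OF assms linear_continuous_on[OF bounded_linear_cx]]) auto
  then have "integrable lborel (\<lambda>z. indicator (cball 0 1) z *\<^sub>R \<phi> (cx z))"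
    by (intro borel_integrable_compact) auto
  then have "set_integrable lborel (cball 0 1) (\<lambda>z. \<phi> (cx z))" by (simp add: set_integrable_def)
  then have "set_integrable lborel (ball 0 1) (\<lambda>z. \<phi> (cx z))" by (rule set_integrable_subset) auto
  then have "(LINT z:ball 0 1|lborel. \<phi> (cx z)) = integral (ball 0 1) (\<lambda>z. \<phi> (cx z))"
    by (rule set_borel_integral_eq_integral(2))
  also have "\<dots> = integral (ball 0 1) \<phi>" using integral_cx[of "ball 0 1" \<phi>] by (simp add: xc_ball)
  finally show ?thesis .
qed

lemma measure_ball_complex: "0 \<le> r \<Longrightarrow> measure lebesgue (ball (c::complex) r) = pi * r\<^sup>2"
  by (simp add: content_ball unit_ball_vol_2)

text \<open>A polynomial map may fail to be an immersion. Adjoining the two coordinates of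
  \<open>z\<close> makes its differential injective, and giving them the weight \<open>e\<close> in
  the norm makes their contribution vanish as \<open>e\<close> tends to 0.\<close>

lemma quasi_convex_polynomial:
  assumes energy: "definition_of_energy I" and qc: "quasi_convex I" and N: "norm_on_Rn n N"
    and l: "\<And>i. i < n \<Longrightarrow> linear (l i)" and P: "\<And>i. i < n \<Longrightarrow> real_polynomial_function (P i)"
    and bd: "\<And>i z. i < n \<Longrightarrow> cmod z = 1 \<Longrightarrow> P i z = l i z"
    and D: "\<And>i z. i < n \<Longrightarrow> (P i has_derivative D i z) (at z)"
  shows "pi * to_plane I (pull_norm n N l) \<le> integral (ball 0 1) (\<lambda>z. to_plane I (pull_norm n N (\<lambda>i. D i z)))"
proof -
  interpret plane_energy "to_plane I" by (rule plane_energy_to_plane[OF energy])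
  define r where "r = (\<lambda>v. \<bar>Re v\<bar> + \<bar>Im v\<bar>)"
  have r: "r \<in> cseminorms" unfolding r_def
    by (intro cseminormsI) (auto simp: abs_mult distrib_left abs_triangle_ineq intro: order_trans[OF add_mono[OF abs_triangle_ineq abs_triangle_ineq]])
  define Sl where "Sl = (\<lambda>e v. pull_norm n N l v + e * r v)"
  define SD where "SD = (\<lambda>e z v. pull_norm n N (\<lambda>i. D i z) v + e * r v)"
  have linD: "linear (D i z)" if "i < n" for i z using has_derivative_linear[OF D[OF that]] .
  have csl: "pull_norm n N l \<in> cseminorms" by (rule pull_norm_cseminorm[OF N l])
  have csD: "pull_norm n N (\<lambda>i. D i z) \<in> cseminorms" for z by (rule pull_norm_cseminorm[OF N linD])
  have cSl: "Sl e \<in> cseminorms" if "0 \<le> e" for e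
    unfolding Sl_def by (rule cseminorm_plus[OF csl cseminorm_cmult[OF that r]])
  have cSD: "SD e z \<in> cseminorms" if "0 \<le> e" for e z
    unfolding SD_def by (rule cseminorm_plus[OF csD cseminorm_cmult[OF that r]])
  have contD: "continuous_on S (\<lambda>z. D i z v)" if i: "i < n" for i v S
  proof -
    obtain E where E: "\<And>z. (P i has_derivative E z) (at z)" "\<And>v. real_polynomial_function (\<lambda>z. E z v)"
      using real_polynomial_function_derivative[OF P[OF i]] by blast
    have "D i z = E z" for z using has_derivative_unique[OF D[OF i] E(1)] .
    then show ?thesis
      using continuous_real_polymonial_function[OF E(2)] by (auto intro: continuous_at_imp_continuous_on)
  qed
  have contSD: "continuous_on S (\<lambda>z. SD e z v)" for S e v
    unfolding SD_def by (intro continuous_intros continuous_on_pull_norm[OF N] contD)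
  have contJ: "continuous_on S (\<lambda>z. to_plane I (SD e z))" if "0 \<le> e" for S e
    by (rule continuous_on_J[OF cSD[OF that] contSD])
  have main: "pi * to_plane I (Sl e) \<le> integral (ball 0 1) (\<lambda>z. to_plane I (SD e z))" if e: "0 < e" for e
  proof -
    \<comment> \<open>The weight must be positive, as otherwise \<open>N'\<close> would not separate
      points of \<open>Rn (n + 2)\<close>.\<close>
    define N' where "N' = (\<lambda>y. N (trunc n y) + e * (\<bar>y n\<bar> + \<bar>y (Suc n)\<bar>))"
    define ext :: "(nat \<Rightarrow> real) \<Rightarrow> real^2 \<Rightarrow> nat \<Rightarrow> real" where
      "ext = (\<lambda>y z i. if i < n then y i else if i = n then Re (cx z) else if i = Suc n then Im (cx z) else 0)"
    define \<psi> where "\<psi> = (\<lambda>z. ext (\<lambda>i. P i (cx z)) z)"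
    define L where "L = (\<lambda>z. ext (\<lambda>i. l i (cx z)) z)"
    have ext_Rn: "ext y z \<in> Rn (n + 2)" for y z by (auto simp: ext_def Rn_def)
    have N'ext: "N' (ext y v) = N (trunc n y) + e * r (cx v)" for y v
    proof -
      have "trunc n (ext y v) = trunc n y" by (auto simp: trunc_def ext_def)
      then show ?thesis by (simp add: N'_def r_def) (simp add: ext_def)
    qed
    have N': "norm_on_Rn (n + 2) N'"
      unfolding norm_on_Rn_def
    proof (intro conjI ballI allI)
      fix x y c assume x: "x \<in> Rn (n + 2)"
      have nn: "0 \<le> N (trunc n x)" "0 \<le> e * (\<bar>x n\<bar> + \<bar>x (Suc n)\<bar>)" 
        using trunc_nonneg[OF N] e by auto
      then show "0 \<le> N' x" by (simp add: N'_def)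
      have "N' x = 0 \<longleftrightarrow> N (trunc n x) = 0 \<and> e * (\<bar>x n\<bar> + \<bar>x (Suc n)\<bar>) = 0"
        using nn by (auto simp: N'_def add_nonneg_eq_0_iff)
      also have "\<dots> \<longleftrightarrow> (\<forall>i<n. x i = 0) \<and> x n = 0 \<and> x (Suc n) = 0"
        using e by (auto simp: trunc_eq_0[OF N] add_nonneg_eq_0_iff)
      also have "\<dots> \<longleftrightarrow> x = (\<lambda>i. 0)"
      proof
        assume *: "(\<forall>i<n. x i = 0) \<and> x n = 0 \<and> x (Suc n) = 0"
        have "x i = 0" for i
        proof -
          consider "i < n" | "i = n" | "i = Suc n" | "i \<ge> n + 2" by linarith
          then show ?thesis using * x by cases (auto simp: Rn_def)
        qed
        then show "x = (\<lambda>i. 0)" by blast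
      qed auto
      finally show "N' x = 0 \<longleftrightarrow> x = (\<lambda>i. 0)" .
      show "N' (\<lambda>i. c * x i) = \<bar>c\<bar> * N' x"
        using trunc_scale[OF N, of c x] by (simp add: N'_def abs_mult algebra_simps)
      assume y: "y \<in> Rn (n + 2)"
      have "e * (\<bar>x n + y n\<bar> + \<bar>x (Suc n) + y (Suc n)\<bar>) \<le> e * ((\<bar>x n\<bar> + \<bar>x (Suc n)\<bar>) + (\<bar>y n\<bar> + \<bar>y (Suc n)\<bar>))"
        using e by (intro mult_left_mono) auto
      then show "N' (\<lambda>i. x i + y i) \<le> N' x + N' y"
        using trunc_add[OF N, of x y] by (simp add: N'_def distrib_left)
    qed
    have L: "linear_Rn (n + 2) L"
    proof -
      have "linear (\<lambda>z. L z i)" for i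
      proof (cases "i < n")
        case True
        then have "(\<lambda>z. L z i) = l i \<circ> cx" by (auto simp: L_def ext_def)
        then show ?thesis using linear_compose[OF linear_cx l[OF True]] by simp
      next
        case False
        then show ?thesis by (auto simp: L_def ext_def intro!: linearI)
      qed
      then show ?thesis using ext_Rn by (simp add: linear_Rn_def L_def)
    qed
    have poly\<psi>: "real_polynomial_function (\<lambda>z. \<psi> z i)" for i
    proof (cases "i < n")
      case True
      have "polynomial_function cx"
        using bounded_linear_cx by (rule polynomial_function_bounded_linear)
      from real_polynomial_function_compose[OF this P[OF True]] show ?thesis
        using True by (simp add: \<psi>_def ext_def o_def)
    next
      case False
      have "real_polynomial_function (\<lambda>z. Re (cx z))" "real_polynomial_function (\<lambda>z. Im (cx z))"
        by (auto intro!: real_polynomial_function.intros(1) bounded_linear_intros bounded_linear_cx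
            bounded_linear_compose[OF bounded_linear_Re] bounded_linear_compose[OF bounded_linear_Im])
      then show ?thesis
        using False by (cases "i = n"; cases "i = Suc n")
          (simp_all add: \<psi>_def ext_def real_polynomial_function.intros(2))
    qed
    have dRe: "((\<lambda>z. Re (cx z)) has_derivative (\<lambda>v. Re (cx v))) (at z)"
      and dIm: "((\<lambda>z. Im (cx z)) has_derivative (\<lambda>v. Im (cx v))) (at z)" for z
      by (rule bounded_linear_imp_has_derivative bounded_linear_compose[OF bounded_linear_Re bounded_linear_cx]
          bounded_linear_compose[OF bounded_linear_Im bounded_linear_cx])+
    have d\<psi>: "differential \<psi> z v = ext (\<lambda>i. D i (cx z) (cx v)) v" for z v
    proof
      fix i
      have "((\<lambda>x. \<psi> x i) has_derivative (\<lambda>v. ext (\<lambda>i. D i (cx z) (cx v)) v i)) (at z)"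
      proof (cases "i < n")
        case True
        from has_derivative_compose[OF bounded_linear_imp_has_derivative[OF bounded_linear_cx] D[OF True]] True
        show ?thesis by (simp add: \<psi>_def ext_def)
      next
        case False
        then show ?thesis using dRe dIm
          by (cases "i = n"; cases "i = Suc n") (simp_all add: \<psi>_def ext_def)
      qed
      from fun_cong[OF frechet_derivative_at[OF this], of v]
      show "differential \<psi> z v i = ext (\<lambda>i. D i (cx z) (cx v)) v i"
        unfolding differential_def by (rule sym)
    qed
    have dL: "differential L z v = ext (\<lambda>i. l i (cx v)) v" for z v
    proof
      fix i
      have "((\<lambda>x. L x i) has_derivative (\<lambda>v. L v i)) (at z)"
        using L by (intro bounded_linear_imp_has_derivative) (auto simp: linear_Rn_def linear_conv_bounded_linear)
      from fun_cong[OF frechet_derivative_at[OF this], of v]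
      show "differential L z v i = ext (\<lambda>i. l i (cx v)) v i"
        unfolding differential_def by (simp add: L_def)
    qed
    have "immersion_on_disc (n + 2) \<psi>"
      unfolding immersion_on_disc_def
    proof (intro conjI ballI)
      show "smooth_on_disc (n + 2) \<psi>"
        unfolding smooth_on_disc_def
        by (intro exI[of _ UNIV] conjI allI ballI Ck_on_real_polynomial_function poly\<psi>)
          (simp_all add: \<psi>_def ext_Rn del: add_2_eq_Suc')
      fix z show "inj (differential \<psi> z)"
      proof (rule injI)
        fix v w assume "differential \<psi> z v = differential \<psi> z w"
        from fun_cong[OF this, of n] fun_cong[OF this, of "Suc n"]
        have "cx v = cx w" unfolding d\<psi> by (simp add: ext_def complex_eq_iff)
        then show "v = w" using inj_cx by (simp add: inj_eq)
      qed
    qed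
    moreover have "\<forall>z\<in>sphere 0 1. \<psi> z = L z"
      using bd by (auto simp: \<psi>_def L_def ext_def fun_eq_iff)
    ultimately have "disc_integral I N' L \<le> disc_integral I N' \<psi>"
      using qc N' L unfolding quasi_convex_def by blast
    also have "disc_integral I N' \<psi> = (LINT z:ball 0 1|lborel. to_plane I (SD e (cx z)))"
      by (simp add: disc_integral_def d\<psi> N'ext to_plane_def SD_def pull_norm_def)
    also have "\<dots> = integral (ball 0 1) (\<lambda>z. to_plane I (SD e z))"
      by (rule set_lebesgue_integral_disc[OF contJ]) (use e in simp)
    also have "disc_integral I N' L = (LINT z:ball 0 1|lborel. (\<lambda>_. to_plane I (Sl e)) (cx z))"
      by (simp add: disc_integral_def dL N'ext to_plane_def Sl_def pull_norm_def)
    also have "\<dots> = integral (ball 0 1) (\<lambda>z::complex. to_plane I (Sl e))"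
      by (rule set_lebesgue_integral_disc) auto
    also have "\<dots> = pi * to_plane I (Sl e)"
      using has_integral_mult_right[OF has_integral_measure_lebesgue, of "ball (0::complex) 1" "to_plane I (Sl e)"]
      by (simp add: measure_ball_complex[of 1 0, simplified] integral_unique)
    finally show ?thesis .
  qed
  \<comment> \<open>All weights lie in \<open>(0, 1]\<close>, so the seminorms
    \<open>SD (ek k) z\<close> are dominated by \<open>SD 1 z\<close> and bounded convergence
    applies.\<close>
  define ek where "ek = (\<lambda>k::nat. 1 / real (Suc k))"
  have ek: "0 < ek k" "ek k \<le> 1" for k by (auto simp: ek_def)
  have ek0: "ek \<longlonglongrightarrow> 0" unfolding ek_def by (rule LIMSEQ_Suc[OF lim_1_over_n])
  have lim1: "(\<lambda>k. pi * to_plane I (Sl (ek k))) \<longlonglongrightarrow> pi * to_plane I (pull_norm n N l)"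
  proof (intro tendsto_mult tendsto_const sequentially_continuous cSl csl less_imp_le ek)
    fix v
    have "(\<lambda>k. pull_norm n N l v + ek k * r v) \<longlonglongrightarrow> pull_norm n N l v + 0 * r v" by (intro tendsto_intros ek0)
    then show "(\<lambda>k. Sl (ek k) v) \<longlonglongrightarrow> pull_norm n N l v" by (simp add: Sl_def)
  qed
  have bnd: "\<exists>B. \<forall>z\<in>ball 0 1. SD 1 z v \<le> B" for v
  proof -
    have "compact ((\<lambda>z. SD 1 z v) ` cball 0 1)" by (intro compact_continuous_image contSD) simp
    then obtain B where "\<forall>x\<in>(\<lambda>z. SD 1 z v) ` cball 0 1. norm x \<le> B"
      using compact_imp_bounded bounded_iff by blast
    then show ?thesis by (intro exI[of _ B]) (auto simp: abs_le_iff)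
  qed
  obtain B1 B2 where B1: "\<And>z. z \<in> ball 0 1 \<Longrightarrow> SD 1 z 1 \<le> B1" and B2: "\<And>z. z \<in> ball 0 1 \<Longrightarrow> SD 1 z \<i> \<le> B2"
    using bnd[of 1] bnd[of \<i>] by blast
  have bd: "\<bar>to_plane I (SD (ek k) z)\<bar> \<le> (2 * max B1 B2)\<^sup>2 * to_plane I cmod" if z: "z \<in> ball 0 1" for k z
  proof -
    have le: "SD (ek k) z v \<le> SD 1 z v" for v
      using ek[of k] cseminorm_nonneg[OF r, of v] by (simp add: SD_def mult_left_le_one_le)
    have "to_plane I (SD (ek k) z) \<le> (2 * max B1 B2)\<^sup>2 * to_plane I cmod"
      by (rule J_bound'[OF cSD]) (use ek[of k] le[of 1] le[of \<i>] B1[OF z] B2[OF z] in auto)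
    then show ?thesis using nonneg[OF cSD[of "ek k" z]] ek[of k] by simp
  qed
  have "(\<lambda>k. integral (ball 0 1) (\<lambda>z. to_plane I (SD (ek k) z))) \<longlonglongrightarrow>
      integral (ball 0 1) (\<lambda>z. to_plane I (pull_norm n N (\<lambda>i. D i z)))"
  proof (rule bounded_convergence(2)[OF _ _ bd])
    fix k
    have "(\<lambda>z. to_plane I (SD (ek k) z)) absolutely_integrable_on ball 0 1"
      by (rule bounded_continuous_absolutely_integrable[OF _ contJ bd]) (use ek[of k] in auto)
    then show "(\<lambda>z. to_plane I (SD (ek k) z)) integrable_on ball 0 1"
      by (simp add: absolutely_integrable_on_def)
  next
    fix z
    show "(\<lambda>k. to_plane I (SD (ek k) z)) \<longlonglongrightarrow> to_plane I (pull_norm n N (\<lambda>i. D i z))"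
    proof (intro sequentially_continuous cSD csD less_imp_le ek)
      fix v
      have "(\<lambda>k. pull_norm n N (\<lambda>i. D i z) v + ek k * r v) \<longlonglongrightarrow> pull_norm n N (\<lambda>i. D i z) v + 0 * r v"
        by (intro tendsto_intros ek0)
      then show "(\<lambda>k. SD (ek k) z v) \<longlonglongrightarrow> pull_norm n N (\<lambda>i. D i z) v" by (simp add: SD_def)
    qed
  qed simp
  from LIMSEQ_le[OF lim1 this] main[OF ek(1)] show ?thesis by blast
qed

subsection \<open>Mollification by Landau kernels\<close>

text \<open>A polynomial in the coordinates of \<open>y\<close>, so that convolution with it
  produces polynomials. The radius 3 is such that \<open>cmod (w - y) \<le> 3\<close> for
  \<open>cmod w < 2\<close> and \<open>y\<close> in the unit disc, where the kernel is
  nonnegative.\<close>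

definition landau :: "nat \<Rightarrow> complex \<Rightarrow> real" where
  "landau k y = (1 - (cmod y)\<^sup>2 / 9) ^ k"

definition landau_mass :: "nat \<Rightarrow> real" where
  "landau_mass k = integral (cball 0 3) (landau k)"

lemma continuous_on_landau: "continuous_on S (landau k)"
  unfolding landau_def by (intro continuous_intros) auto

lemma landau_nonneg: "cmod y \<le> 3 \<Longrightarrow> 0 \<le> landau k y"
  unfolding landau_def using power_mono[of "cmod y" 3 2] by (intro zero_le_power) simp

lemma landau_le_1: "cmod y \<le> 3 \<Longrightarrow> landau k y \<le> 1"
  unfolding landau_def using power_mono[of "cmod y" 3 2] by (intro power_le_one) auto

lemma landau_integrable: "landau k absolutely_integrable_on cball 0 3"
  by (rule bounded_continuous_absolutely_integrable[OF _ continuous_on_landau, where B=1])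
    (use landau_nonneg[of _ k] landau_le_1[of _ k] in auto)

text \<open>Only the disc of radius \<open>\<delta> / 2\<close> is counted, where the kernel is at
  least \<open>(1 - \<delta>^2 / 36)^k\<close>. This beats its values outside radius \<delta>, which
  are at most \<open>(1 - \<delta>^2 / 9)^k\<close>.\<close>

lemma landau_mass_ge:
  assumes "0 < \<delta>" "\<delta> \<le> 3"
  shows "(1 - \<delta>\<^sup>2 / 36) ^ k * (pi * (\<delta>\<^sup>2 / 4)) \<le> landau_mass k"
proof -
  have sub: "cball (0::complex) (\<delta> / 2) \<subseteq> cball 0 3" using assms by auto
  have "(1 - \<delta>\<^sup>2 / 36) ^ k * (pi * (\<delta>\<^sup>2 / 4)) = integral (cball (0::complex) (\<delta> / 2)) (\<lambda>_. (1 - \<delta>\<^sup>2 / 36) ^ k * 1)"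
    using lmeasure_integral[of "cball (0::complex) (\<delta> / 2)"] measure_cball_complex[of "\<delta> / 2" 0] assms
    by (simp only: integral_mult_right lmeasurable_cball) (simp add: power_divide)
  also have "\<dots> \<le> integral (cball (0::complex) (\<delta> / 2)) (landau k)"
  proof (rule integral_le)
    show "(\<lambda>_. (1 - \<delta>\<^sup>2 / 36) ^ k * 1) integrable_on cball (0::complex) (\<delta> / 2)"
      using integrable_cmul[of "\<lambda>x. 1::real" "cball (0::complex) (\<delta> / 2)" "(1 - \<delta>\<^sup>2 / 36) ^ k"]
      by (simp add: lmeasurable_iff_integrable_on[symmetric])
    show "landau k integrable_on cball 0 (\<delta> / 2)"
      using set_integrable_subset[OF landau_integrable _ sub] by (auto simp: absolutely_integrable_on_def)
    fix y :: complex assume "y \<in> cball 0 (\<delta> / 2)"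
    then have "(cmod y)\<^sup>2 \<le> (\<delta> / 2)\<^sup>2" by (intro power_mono) auto
    moreover have "\<delta>\<^sup>2 \<le> 3\<^sup>2" using assms by (intro power_mono) auto
    ultimately show "(1 - \<delta>\<^sup>2 / 36) ^ k * 1 \<le> landau k y"
      unfolding landau_def mult_1_right by (intro power_mono) (auto simp: power_divide)
  qed
  also have "\<dots> \<le> landau_mass k"
    unfolding landau_mass_def
  proof (rule integral_subset_le[OF sub])
    show "landau k integrable_on cball 0 (\<delta> / 2)"
      using set_integrable_subset[OF landau_integrable _ sub] by (auto simp: absolutely_integrable_on_def)
    show "landau k integrable_on cball 0 3"
      using landau_integrable by (simp add: absolutely_integrable_on_def)
  qed (use landau_nonneg in auto)
  finally show ?thesis .
qed

lemma landau_mass_pos: "0 < landau_mass k"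
  using landau_mass_ge[of 3 k] by (rule less_le_trans[rotated]) (auto intro!: mult_pos_pos)

text \<open>The kernels \<open>landau k / landau_mass k\<close> are an approximate identity on the disc of radius 3.\<close>

lemma landau_approximate_identity:
  fixes \<phi> :: "complex \<Rightarrow> real"
  assumes Z: "negligible Z" and cont: "continuous_on (cball 0 3 - Z) \<phi>"
    and bd: "\<And>y. y \<in> cball 0 3 - Z \<Longrightarrow> \<bar>\<phi> y\<bar> \<le> C"
    and lim: "\<And>e. 0 < e \<Longrightarrow> \<exists>\<delta>>0. \<forall>y\<in>cball 0 3 - Z. cmod y < \<delta> \<longrightarrow> \<bar>\<phi> y - L\<bar> \<le> e"
  shows "(\<lambda>k. integral (cball 0 3 - Z) (\<lambda>y. \<phi> y * landau k y) / landau_mass k) \<longlonglongrightarrow> L"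
proof (rule LIMSEQ_I)
  fix e :: real assume "0 < e"
  define S where "S = cball (0::complex) 3 - Z"
  have S: "S \<in> lmeasurable" unfolding S_def using Z by (intro fmeasurable_Diff) (auto simp: negligible_imp_sets)
  have S3: "cmod y \<le> 3" if "y \<in> S" for y using that by (simp add: S_def)
  have mS: "measure lebesgue S = 9 * pi"
  proof -
    have "measure lebesgue S = measure lebesgue (cball (0::complex) 3)"
      unfolding S_def using Z by (intro measure_Diff_null_set) (auto simp: negligible_iff_null_sets)
    then show ?thesis using measure_cball_complex[of 3 0] by simp
  qed
  obtain \<delta>0 where \<delta>0: "0 < \<delta>0" "\<forall>y\<in>S. cmod y < \<delta>0 \<longrightarrow> \<bar>\<phi> y - L\<bar> \<le> e / 2"
    using lim[of "e / 2"] \<open>0 < e\<close> unfolding S_def by auto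
  define \<delta> where "\<delta> = min \<delta>0 3"
  have \<delta>: "0 < \<delta>" "\<delta> \<le> 3" "\<forall>y\<in>S. cmod y < \<delta> \<longrightarrow> \<bar>\<phi> y - L\<bar> \<le> e / 2"
    using \<delta>0 by (auto simp: \<delta>_def)
  \<comment> \<open>The ratio of the upper bound for the kernel outside radius \<delta> to the lower
    bound inside \<open>\<delta> / 2\<close>; its being less than 1 makes the outer mass
    negligible.\<close>
  define \<rho> where "\<rho> = (1 - \<delta>\<^sup>2 / 9) / (1 - \<delta>\<^sup>2 / 36)"
  have d9: "\<delta>\<^sup>2 \<le> 9" using \<delta> power_mono[of \<delta> 3 2] by simp
  have dpos: "0 < \<delta>\<^sup>2" using \<delta> by simp
  have \<rho>: "0 \<le> \<rho>" "\<rho> < 1" using d9 dpos by (auto simp: \<rho>_def)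
  define B where "B = \<bar>C\<bar> + \<bar>L\<bar>"
  define A where "A = B * (4 / (pi * \<delta>\<^sup>2))"
  have int0: "(\<lambda>y. landau k y) absolutely_integrable_on S" for k
    unfolding S_def using landau_integrable has_integral_Diff_negligible(2)[OF Z] by blast
  have mass: "integral S (landau k) = landau_mass k" for k
    unfolding S_def landau_mass_def by (rule has_integral_Diff_negligible(3)[OF Z])
  have int1: "(\<lambda>y. \<phi> y * landau k y) absolutely_integrable_on S" for k
  proof (rule bounded_continuous_absolutely_integrable[OF S, where B="\<bar>C\<bar>"])
    show "continuous_on S (\<lambda>y. \<phi> y * landau k y)"
      unfolding S_def by (intro continuous_on_mult cont continuous_on_landau)
    fix y assume y: "y \<in> S"
    have "\<bar>\<phi> y\<bar> * landau k y \<le> \<bar>C\<bar> * 1"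
      using bd[of y] y landau_nonneg[OF S3[OF y], of k] landau_le_1[OF S3[OF y], of k]
      by (intro mult_mono) (auto simp: S_def)
    then show "\<bar>\<phi> y * landau k y\<bar> \<le> \<bar>C\<bar>"
      using landau_nonneg[OF S3[OF y], of k] by (simp add: abs_mult)
  qed
  have est: "\<bar>integral S (\<lambda>y. \<phi> y * landau k y) / landau_mass k - L\<bar> \<le> e / 2 + A * \<rho> ^ k * (9 * pi)" for k
  proof -
    have pw: "\<bar>(\<phi> y - L) * landau k y\<bar> \<le> e / 2 * landau k y + A * \<rho> ^ k * landau_mass k" if y: "y \<in> S" for y
    proof (cases "cmod y < \<delta>")
      case True
      have "\<bar>\<phi> y - L\<bar> * landau k y \<le> e / 2 * landau k y"
        using \<delta>(3) y True landau_nonneg[OF S3[OF y], of k] by (intro mult_right_mono) auto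
      moreover have "0 \<le> A * \<rho> ^ k * landau_mass k"
        using \<rho>(1) landau_mass_pos[of k] by (simp add: A_def B_def)
      ultimately show ?thesis using landau_nonneg[OF S3[OF y], of k] by (simp add: abs_mult)
    next
      case False
      have "\<delta>\<^sup>2 \<le> (cmod y)\<^sup>2" using False \<delta>(1) by (intro power_mono) auto
      moreover have "(cmod y)\<^sup>2 \<le> 3\<^sup>2" using S3[OF y] by (intro power_mono) auto
      ultimately have "landau k y \<le> (1 - \<delta>\<^sup>2 / 9) ^ k" unfolding landau_def by (intro power_mono) auto
      also have "\<dots> = \<rho> ^ k * (1 - \<delta>\<^sup>2 / 36) ^ k"
        using d9 by (simp add: \<rho>_def flip: power_mult_distrib)
      also have "\<dots> \<le> \<rho> ^ k * (landau_mass k * (4 / (pi * \<delta>\<^sup>2)))"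
        using landau_mass_ge[OF \<delta>(1,2), of k] \<rho>(1) dpos by (intro mult_left_mono) (auto simp: field_simps)
      finally have 1: "landau k y \<le> \<rho> ^ k * (landau_mass k * (4 / (pi * \<delta>\<^sup>2)))" .
      have "\<bar>\<phi> y - L\<bar> \<le> B" using bd[of y] y by (auto simp: S_def B_def)
      then have "\<bar>\<phi> y - L\<bar> * landau k y \<le> B * (\<rho> ^ k * (landau_mass k * (4 / (pi * \<delta>\<^sup>2))))"
        using 1 landau_nonneg[OF S3[OF y], of k] by (intro mult_mono) (auto simp: B_def)
      also have "\<dots> = A * \<rho> ^ k * landau_mass k" by (simp add: A_def)
      finally have "\<bar>\<phi> y - L\<bar> * landau k y \<le> A * \<rho> ^ k * landau_mass k" .
      moreover have "0 \<le> e / 2 * landau k y" using landau_nonneg[OF S3[OF y], of k] \<open>0 < e\<close> by simp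
      ultimately have "\<bar>\<phi> y - L\<bar> * landau k y \<le> e / 2 * landau k y + A * \<rho> ^ k * landau_mass k" by linarith
      then show ?thesis using landau_nonneg[OF S3[OF y], of k] by (simp add: abs_mult)
    qed
    have i0: "landau k integrable_on S" and i1: "(\<lambda>y. \<phi> y * landau k y) integrable_on S"
      using int0[of k] int1[of k] by (auto simp: absolutely_integrable_on_def)
    have diff: "((\<lambda>y. \<phi> y * landau k y - L * landau k y) has_integral
        integral S (\<lambda>y. \<phi> y * landau k y) - L * landau_mass k) S"
      unfolding mass[symmetric]
      by (intro has_integral_diff has_integral_mult_right integrable_integral i0 i1)
    have up: "((\<lambda>y. e / 2 * landau k y + (A * \<rho> ^ k * landau_mass k) * 1) has_integral
        e / 2 * landau_mass k + (A * \<rho> ^ k * landau_mass k) * (9 * pi)) S"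
      unfolding mass[symmetric] mS[symmetric]
      by (intro has_integral_add has_integral_mult_right integrable_integral i0 has_integral_measure_lebesgue S)
    have "\<bar>integral S (\<lambda>y. \<phi> y * landau k y) - L * landau_mass k\<bar> \<le>
        e / 2 * landau_mass k + (A * \<rho> ^ k * landau_mass k) * (9 * pi)"
    proof -
      have "norm (integral S (\<lambda>y. \<phi> y * landau k y - L * landau k y)) \<le>
          integral S (\<lambda>y. e / 2 * landau k y + (A * \<rho> ^ k * landau_mass k) * 1)"
        by (rule integral_norm_bound_integral)
          (use diff up pw in \<open>auto simp: has_integral_iff left_diff_distrib\<close>)
      then show ?thesis unfolding integral_unique[OF diff] integral_unique[OF up] by simp
    qed
    also have "\<dots> = (e / 2 + A * \<rho> ^ k * (9 * pi)) * landau_mass k" by (simp add: algebra_simps)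
    finally have "\<bar>integral S (\<lambda>y. \<phi> y * landau k y) - L * landau_mass k\<bar> / landau_mass k \<le>
        e / 2 + A * \<rho> ^ k * (9 * pi)"
      using landau_mass_pos[of k] by (simp add: divide_le_eq)
    moreover have "\<bar>integral S (\<lambda>y. \<phi> y * landau k y) - L * landau_mass k\<bar> / landau_mass k =
        \<bar>integral S (\<lambda>y. \<phi> y * landau k y) / landau_mass k - L\<bar>"
    proof -
      have "integral S (\<lambda>y. \<phi> y * landau k y) / landau_mass k - L =
          (integral S (\<lambda>y. \<phi> y * landau k y) - L * landau_mass k) / landau_mass k"
        using landau_mass_pos[of k] by (simp add: field_simps)
      then show ?thesis using landau_mass_pos[of k] by (simp add: abs_divide)
    qed
    ultimately show ?thesis by simp
  qed
  have "(\<lambda>k. A * \<rho> ^ k * (9 * pi)) \<longlonglongrightarrow> A * 0 * (9 * pi)"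
    by (intro tendsto_mult tendsto_const LIMSEQ_power_zero) (use \<rho> in auto)
  then have "\<forall>\<^sub>F k in sequentially. A * \<rho> ^ k * (9 * pi) < e / 2"
    by (rule order_tendstoD) (use \<open>0 < e\<close> in simp)
  then obtain k0 where k0: "\<And>k. k \<ge> k0 \<Longrightarrow> A * \<rho> ^ k * (9 * pi) < e / 2"
    unfolding eventually_sequentially by blast
  show "\<exists>k0. \<forall>k\<ge>k0. norm (integral (cball 0 3 - Z) (\<lambda>y. \<phi> y * landau k y) / landau_mass k - L) < e"
  proof (intro exI allI impI)
    fix k assume "k0 \<le> k"
    show "norm (integral (cball 0 3 - Z) (\<lambda>y. \<phi> y * landau k y) / landau_mass k - L) < e"
      using est[of k] k0[OF \<open>k0 \<le> k\<close>] unfolding S_def real_norm_def by linarith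
  qed
qed

text \<open>One factor of the kernel is expanded in the coordinates of \<open>w\<close> and
  \<open>y\<close>: the powers of \<open>w\<close> leave the integral and those of \<open>y\<close>
  are absorbed into \<open>q\<close>. The induction therefore has to range over all
  \<open>q\<close>.\<close>

lemma landau_convolution_polynomial:
  fixes q :: "complex \<Rightarrow> real"
  assumes "continuous_on (cball 0 1) q"
  shows "real_polynomial_function (\<lambda>w. integral (cball 0 1) (\<lambda>y. q y * landau k (w - y)))"
  using assms
proof (induction k arbitrary: q)
  case 0
  then show ?case by (simp add: landau_def real_polynomial_function.intros(2))
next
  case (Suc k)
  define F where "F = (\<lambda>q w. integral (cball 0 1) (\<lambda>y. q y * landau k (w - y)))"
  have int: "(\<lambda>y. q y * landau k (w - y)) integrable_on cball 0 1" if "continuous_on (cball 0 1) q" for q w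
  proof -
    have c: "continuous_on (cball 0 1) (\<lambda>y. q y * landau k (w - y))"
      by (intro continuous_on_mult that continuous_on_compose2[OF continuous_on_landau[of UNIV]] continuous_intros) auto
    then have "bounded ((\<lambda>y. q y * landau k (w - y)) ` cball 0 1)"
      by (intro compact_imp_bounded compact_continuous_image) auto
    then obtain B where "\<forall>x\<in>(\<lambda>y. q y * landau k (w - y)) ` cball 0 1. norm x \<le> B"
      unfolding bounded_iff by blast
    then have "\<bar>q y * landau k (w - y)\<bar> \<le> B" if "y \<in> cball 0 1" for y using that by simp
    then have "(\<lambda>y. q y * landau k (w - y)) absolutely_integrable_on cball 0 1"
      by (rule bounded_continuous_absolutely_integrable[OF lmeasurable_cball c])
    then show ?thesis by (simp add: absolutely_integrable_on_def)
  qed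
  define q1 where "q1 = (\<lambda>y. - (cmod y)\<^sup>2 / 9 * q y)"
  define q2 where "q2 = (\<lambda>y. Re y * q y)"
  define q3 where "q3 = (\<lambda>y. Im y * q y)"
  have c: "continuous_on (cball 0 1) q1" "continuous_on (cball 0 1) q2" "continuous_on (cball 0 1) q3"
    unfolding q1_def q2_def q3_def by (intro continuous_intros Suc.prems; simp)+
  have "integral (cball 0 1) (\<lambda>y. q y * landau (Suc k) (w - y)) =
      (1 - (Re w * Re w + Im w * Im w) * (1/9)) * F q w + F q1 w + (2/9 * Re w) * F q2 w + (2/9 * Im w) * F q3 w" for w
  proof (rule integral_unique)
    have "q y * landau (Suc k) (w - y) = (1 - (Re w * Re w + Im w * Im w) * (1/9)) * (q y * landau k (w - y)) +
       q1 y * landau k (w - y) + (2/9 * Re w) * (q2 y * landau k (w - y)) + (2/9 * Im w) * (q3 y * landau k (w - y))" for y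
    proof -
      have "1 - (cmod (w - y))\<^sup>2 / 9 = (1 - (Re w * Re w + Im w * Im w) * (1/9)) - (cmod y)\<^sup>2 / 9 +
          2/9 * Re w * Re y + 2/9 * Im w * Im y"
        unfolding cmod_power2 by (simp add: power2_eq_square field_simps)
      moreover have "landau (Suc k) (w - y) = (1 - (cmod (w - y))\<^sup>2 / 9) * landau k (w - y)"
        by (simp add: landau_def)
      ultimately have L: "landau (Suc k) (w - y) = ((1 - (Re w * Re w + Im w * Im w) * (1/9)) - (cmod y)\<^sup>2 / 9 +
          2/9 * Re w * Re y + 2/9 * Im w * Im y) * landau k (w - y)" by simp
      show ?thesis
        unfolding L q1_def q2_def q3_def by (simp add: algebra_simps)
    qed
    then show "((\<lambda>y. q y * landau (Suc k) (w - y)) has_integral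
      (1 - (Re w * Re w + Im w * Im w) * (1/9)) * F q w + F q1 w + (2/9 * Re w) * F q2 w + (2/9 * Im w) * F q3 w) (cball 0 1)"
      unfolding F_def
      by (simp only:) (intro has_integral_add has_integral_mult_right integrable_integral int c Suc.prems)
  qed
  moreover have "real_polynomial_function (\<lambda>w. (1 - (Re w * Re w + Im w * Im w) * (1/9)) * F q w + F q1 w + (2/9 * Re w) * F q2 w + (2/9 * Im w) * F q3 w)"
    unfolding F_def
    by (intro real_polynomial_function.intros(2-4) real_polynomial_function_diff Suc.IH c Suc.prems
        real_polynomial_function.intros(1)[OF bounded_linear_Re] real_polynomial_function.intros(1)[OF bounded_linear_Im])
  ultimately show ?case by simp
qed

lemma directional_derivative_limit:
  fixes f :: "complex \<Rightarrow> real"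
  assumes "(f has_derivative D) (at w)" "t \<longlonglongrightarrow> 0" "\<And>j. t j \<noteq> (0::real)"
  shows "(\<lambda>j. (f (w + t j *\<^sub>R v) - f w) / t j) \<longlonglongrightarrow> D v"
proof -
  have "((\<lambda>s. w + s *\<^sub>R v) has_derivative (\<lambda>s. s *\<^sub>R v)) (at (0::real))"
    by (auto intro!: derivative_eq_intros)
  moreover have "(f has_derivative D) (at (w + 0 *\<^sub>R v))" using assms(1) by simp
  ultimately have "((\<lambda>s. f (w + s *\<^sub>R v)) has_derivative (\<lambda>s. D (s *\<^sub>R v))) (at 0)"
    by (rule has_derivative_compose)
  moreover have "(\<lambda>s. D (s *\<^sub>R v)) = (*) (D v)"
    using linear_cmul[OF has_derivative_linear[OF assms(1)]] by (auto simp: mult.commute)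
  ultimately have "((\<lambda>s. f (w + s *\<^sub>R v)) has_field_derivative D v) (at 0)"
    by (simp add: has_field_derivative_def)
  then have "((\<lambda>h. (f (w + (0 + h) *\<^sub>R v) - f (w + 0 *\<^sub>R v)) / h) \<longlongrightarrow> D v) (at 0)"
    unfolding DERIV_def .
  moreover have "filterlim t (at 0) sequentially"
    using assms(2,3) by (auto simp: filterlim_at)
  ultimately show ?thesis by (auto dest: filterlim_compose)
qed

text \<open>Step sizes that tend to 0 with \<open>small_steps v j * cmod v < 1\<close>, so that a
  step from the unit disc stays in the disc of radius 2, where the mollification is an integral over
  \<open>cball 0 3\<close>.\<close>

definition small_steps :: "complex \<Rightarrow> nat \<Rightarrow> real" where
  "small_steps v j = 1 / (real (Suc j) * (cmod v + 1))"

lemma small_steps: "small_steps v j \<noteq> 0" "0 < small_steps v j" "small_steps v j * cmod v < 1"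
  "small_steps v \<longlonglongrightarrow> 0"
proof -
  have p: "0 < real (Suc j) * (cmod v + 1)" by (intro mult_pos_pos add_nonneg_pos) auto
  then show 1: "0 < small_steps v j" unfolding small_steps_def by simp
  then show "small_steps v j \<noteq> 0" by simp
  have "1 * cmod v < real (Suc j) * (cmod v + 1)" by (intro mult_le_less_imp_less) auto
  then show "small_steps v j * cmod v < 1" using p by (simp add: small_steps_def)
  have "(\<lambda>j. 1 / real (Suc j) * (1 / (cmod v + 1))) \<longlonglongrightarrow> 0 * (1 / (cmod v + 1))"
    by (intro tendsto_mult tendsto_const LIMSEQ_Suc[OF lim_1_over_n])
  then show "small_steps v \<longlonglongrightarrow> 0" by (simp add: small_steps_def[abs_def])
qed

lemma derivative_bound_from_lipschitz:
  fixes f :: "complex \<Rightarrow> real"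
  assumes D: "(f has_derivative D) (at w)" and lip: "\<And>x. cmod (x - w) < 1 \<Longrightarrow> \<bar>f x - f w\<bar> \<le> M * cmod (x - w)"
  shows "\<bar>D v\<bar> \<le> M * cmod v"
proof (rule tendsto_upperbound[OF tendsto_rabs[OF directional_derivative_limit[OF D small_steps(4) small_steps(1)]]])
  show "\<forall>\<^sub>F j in sequentially. \<bar>(f (w + small_steps v j *\<^sub>R v) - f w) / small_steps v j\<bar> \<le> M * cmod v"
  proof (rule always_eventually, rule allI)
    fix j
    have "\<bar>f (w + small_steps v j *\<^sub>R v) - f w\<bar> \<le> M * (small_steps v j * cmod v)"
      using lip[of "w + small_steps v j *\<^sub>R v"] small_steps(2,3)[of v j] by simp
    then show "\<bar>(f (w + small_steps v j *\<^sub>R v) - f w) / small_steps v j\<bar> \<le> M * cmod v"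
      using small_steps(2)[of v j] by (simp add: abs_divide divide_le_eq mult.left_commute mult.commute)
  qed
qed simp

lemma bij_reflect: "bij (\<lambda>y::complex. w - y)"
  by (rule o_bij[of "\<lambda>y. w - y"]) (auto simp: fun_eq_iff)

text \<open>Reflection turns \<open>cball 0 3\<close> into \<open>cball w 3\<close>, which contains
  the unit disc as \<open>cmod w < 2\<close>; outside the unit disc \<open>p\<close>
  vanishes.\<close>

lemma landau_convolution_swap:
  fixes p :: "complex \<Rightarrow> real"
  assumes cont: "continuous_on UNIV p" and zero: "\<And>w. 1 \<le> cmod w \<Longrightarrow> p w = 0" and w: "cmod w < 2"
  shows "integral (cball 0 1) (\<lambda>y. p y * landau k (w - y)) = integral (cball 0 3) (\<lambda>y. p (w - y) * landau k y)"
    and "(\<lambda>y. p (w - y) * landau k y) integrable_on cball 0 3"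
proof -
  define \<phi> where "\<phi> = (\<lambda>y. p y * landau k (w - y))"
  have c: "continuous_on S \<phi>" for S
    unfolding \<phi>_def
    by (intro continuous_on_mult continuous_on_subset[OF cont] continuous_on_compose2[OF continuous_on_landau[of UNIV]]
        continuous_intros) auto
  have int: "\<phi> absolutely_integrable_on cball a r" for a r
  proof -
    have "bounded (\<phi> ` cball a r)" by (intro compact_imp_bounded compact_continuous_image c) auto
    then obtain B where "\<forall>x\<in>\<phi> ` cball a r. norm x \<le> B" unfolding bounded_iff by blast
    then have "\<bar>\<phi> y\<bar> \<le> B" if "y \<in> cball a r" for y using that by simp
    then show ?thesis by (rule bounded_continuous_absolutely_integrable[OF lmeasurable_cball c])
  qed
  have im: "(\<lambda>y. w - y) ` cball 0 3 = cball w 3"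
  proof (intro equalityI subsetI)
    fix z assume "z \<in> cball w 3"
    then show "z \<in> (\<lambda>y. w - y) ` cball 0 3" by (intro image_eqI[of _ _ "w - z"]) (auto simp: dist_norm norm_minus_commute)
  qed (auto simp: dist_norm)
  have der: "((\<lambda>y. w - y) has_derivative (\<lambda>v. -1 * v + 0 * cnj v)) (at x within cball 0 3)" for x
    by (auto intro!: derivative_eq_intros)
  have "(\<lambda>x. \<bar>(cmod (-1))\<^sup>2 - (cmod 0)\<^sup>2\<bar> * \<phi> (w - x)) absolutely_integrable_on cball 0 3 \<and>
     integral (cball 0 3) (\<lambda>x. \<bar>(cmod (-1))\<^sup>2 - (cmod 0)\<^sup>2\<bar> * \<phi> (w - x)) = integral (cball w 3) \<phi>"
  proof (rule absolutely_integrable_change_of_variables_complex[THEN iffD2, OF _ der])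
    show "inj_on (\<lambda>y. w - y) (cball 0 3)" by (rule inj_onI) simp
    show "\<phi> absolutely_integrable_on (\<lambda>y. w - y) ` cball 0 3 \<and>
        integral ((\<lambda>y. w - y) ` cball 0 3) \<phi> = integral (cball w 3) \<phi>"
      unfolding im using int by simp
  qed simp
  then have 1: "integral (cball 0 3) (\<lambda>y. p (w - y) * landau k y) = integral (cball w 3) \<phi>"
    and 2: "(\<lambda>y. p (w - y) * landau k y) integrable_on cball 0 3"
    by (auto simp: \<phi>_def absolutely_integrable_on_def)
  have "(\<phi> has_integral integral (cball 0 1) \<phi>) (cball w 3)"
  proof (rule has_integral_on_superset[OF integrable_integral])
    show "\<phi> integrable_on cball 0 1" using int by (simp add: absolutely_integrable_on_def)
    show "\<phi> y = 0" if "y \<notin> cball 0 1" for y using that zero[of y] by (simp add: \<phi>_def)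
    show "cball 0 1 \<subseteq> cball w 3"
    proof
      fix y :: complex assume "y \<in> cball 0 1"
      then show "y \<in> cball w 3" using w norm_triangle_ineq4[of w y] by (simp add: dist_norm)
    qed
  qed
  then have "integral (cball w 3) \<phi> = integral (cball 0 1) \<phi>" by (rule integral_unique)
  with 1 show "integral (cball 0 1) (\<lambda>y. p y * landau k (w - y)) = integral (cball 0 3) (\<lambda>y. p (w - y) * landau k y)"
    by (simp add: \<phi>_def)
  show "(\<lambda>y. p (w - y) * landau k y) integrable_on cball 0 3" by (rule 2)
qed

text \<open>Averaging preserves the Lipschitz constant, hence the bound on derivatives, and the
  averages of \<open>D\<close> converge wherever \<open>D\<close> is continuous. The bounds are
  claimed on the unit disc only, since \<open>P k\<close> is a polynomial on the whole plane and is
  an average of values of \<open>p\<close> only near that disc.\<close>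

lemma landau_mollification:
  fixes p :: "complex \<Rightarrow> real"
  assumes lip: "\<And>x y. \<bar>p x - p y\<bar> \<le> M * cmod (x - y)" and M: "0 \<le> M"
    and zero: "\<And>w. 1 \<le> cmod w \<Longrightarrow> p w = 0"
    and Z: "negligible Z" and D: "\<And>w. w \<notin> Z \<Longrightarrow> (p has_derivative D w) (at w)"
    and contD: "\<And>v. continuous_on (- Z) (\<lambda>w. D w v)"
  obtains P E where "\<And>k. real_polynomial_function (P k)" "\<And>k w. (P k has_derivative E k w) (at w)"
    "\<And>k w. cmod w < 1 \<Longrightarrow> \<bar>P k w\<bar> \<le> 2 * M" "\<And>k w v. cmod w < 1 \<Longrightarrow> \<bar>E k w v\<bar> \<le> M * cmod v"
    "\<And>w. cmod w < 1 \<Longrightarrow> (\<lambda>k. P k w) \<longlonglongrightarrow> p w"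
    "\<And>w v. cmod w < 1 \<Longrightarrow> w \<notin> Z \<Longrightarrow> (\<lambda>k. E k w v) \<longlonglongrightarrow> D w v"
proof -
  have cont: "continuous_on S p" for S
    by (rule lipschitz_continuous_on[of _ M]) (use lip in \<open>simp add: dist_norm\<close>)
  have pb: "\<bar>p w\<bar> \<le> 2 * M" for w
  proof (cases "cmod w < 1")
    case True
    \<comment> \<open>A translation by 2 leaves the unit disc, so the Lipschitz condition compares
      \<open>p w\<close> with 0.\<close>
    have "2 \<le> cmod (w + 2) + cmod w" using norm_triangle_ineq4[of "w + 2" w] by simp
    then have "p (w + 2) = 0" using True by (intro zero) linarith
    then show ?thesis using lip[of w "w + 2"] by (simp add: mult.commute)
  qed (use zero[of w] M in simp)
  define P where "P = (\<lambda>k w. 1 / landau_mass k * integral (cball 0 1) (\<lambda>y. p y * landau k (w - y)))"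
  have rp: "real_polynomial_function (P k)" for k
    unfolding P_def by (intro real_polynomial_function.intros(2,4) landau_convolution_polynomial cont)
  have "\<exists>E. \<forall>w. (P k has_derivative E w) (at w)" for k
    using real_polynomial_function_derivative[OF rp] by blast
  then obtain E where E: "\<And>k w. (P k has_derivative E k w) (at w)" by metis
  have Psw: "P k w = integral (cball 0 3) (\<lambda>y. p (w - y) * landau k y) / landau_mass k" if "cmod w < 2" for k w
    using landau_convolution_swap(1)[OF cont zero that] by (simp add: P_def)
  have int: "(\<lambda>y. p (w - y) * landau k y) integrable_on cball 0 3" if "cmod w < 2" for k w
    using landau_convolution_swap(2)[OF cont zero that] .
  have l_int: "((\<lambda>y. c * landau k y) has_integral c * landau_mass k) (cball 0 3)" for c k
    unfolding landau_mass_def using landau_integrable[of k]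
    by (intro has_integral_mult_right integrable_integral) (simp add: absolutely_integrable_on_def)
  have bound: "\<bar>integral (cball 0 3) (\<lambda>y. g y * landau k y)\<bar> \<le> B * landau_mass k"
    if "(\<lambda>y. g y * landau k y) integrable_on cball 0 3" "\<And>y. \<bar>g y\<bar> \<le> B" for g B k
  proof -
    have "norm (integral (cball 0 3) (\<lambda>y. g y * landau k y)) \<le> integral (cball 0 3) (\<lambda>y. B * landau k y)"
    proof (rule integral_norm_bound_integral[OF that(1)])
      show "(\<lambda>y. B * landau k y) integrable_on cball 0 3" using l_int by blast
      fix y :: complex assume "y \<in> cball 0 3"
      then show "norm (g y * landau k y) \<le> B * landau k y"
        using landau_nonneg[of y k] that(2)[of y] by (simp add: abs_mult mult_right_mono)
    qed
    then show ?thesis by (simp add: landau_mass_def)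
  qed
  have Pb: "\<bar>P k w\<bar> \<le> 2 * M" if "cmod w < 1" for k w
    using bound[OF int[of w k] pb] that landau_mass_pos[of k]
    by (simp add: Psw abs_divide divide_le_eq)
  have Plip: "\<bar>P k x - P k w\<bar> \<le> M * cmod (x - w)" if "cmod w < 2" "cmod x < 2" for k x w
  proof -
    have eq: "P k x - P k w = integral (cball 0 3) (\<lambda>y. (p (x - y) - p (w - y)) * landau k y) / landau_mass k"
      using that integral_diff[OF int[OF that(2), of k] int[OF that(1), of k]]
      by (simp add: Psw left_diff_distrib diff_divide_distrib)
    have "(\<lambda>y. (p (x - y) - p (w - y)) * landau k y) integrable_on cball 0 3"
      using integrable_diff[OF int[OF that(2), of k] int[OF that(1), of k]] by (simp add: left_diff_distrib)
    then have "\<bar>integral (cball 0 3) (\<lambda>y. (p (x - y) - p (w - y)) * landau k y)\<bar> \<le> (M * cmod (x - w)) * landau_mass k"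
    proof (rule bound)
      fix y show "\<bar>p (x - y) - p (w - y)\<bar> \<le> M * cmod (x - w)" using lip[of "x - y" "w - y"] by simp
    qed
    then show ?thesis unfolding eq using landau_mass_pos[of k] by (simp add: abs_divide divide_le_eq)
  qed
  have Eb: "\<bar>E k w v\<bar> \<le> M * cmod v" if "cmod w < 1" for k w v
  proof (rule derivative_bound_from_lipschitz[OF E])
    fix x assume "cmod (x - w) < 1"
    then show "\<bar>P k x - P k w\<bar> \<le> M * cmod (x - w)"
      using that norm_triangle_ineq[of "x - w" w] by (intro Plip) auto
  qed
  have Db: "\<bar>D w v\<bar> \<le> M * cmod v" if "w \<notin> Z" for w v
    by (rule derivative_bound_from_lipschitz[OF D[OF that] lip])
  have Plim: "(\<lambda>k. P k w) \<longlonglongrightarrow> p w" if w: "cmod w < 1" for w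
  proof -
    have "(\<lambda>k. integral (cball 0 3 - {}) (\<lambda>y. p (w - y) * landau k y) / landau_mass k) \<longlonglongrightarrow> p w"
    proof (rule landau_approximate_identity[OF negligible_empty, where C="2 * M"])
      show "continuous_on (cball 0 3 - {}) (\<lambda>y. p (w - y))"
        by (rule continuous_on_compose2[OF cont[of UNIV]]) (auto intro!: continuous_intros)
      fix e :: real assume e: "0 < e"
      show "\<exists>\<delta>>0. \<forall>y\<in>cball 0 3 - {}. cmod y < \<delta> \<longrightarrow> \<bar>p (w - y) - p w\<bar> \<le> e"
      proof (intro exI[of _ "e / (M + 1)"] conjI ballI impI)
        show "0 < e / (M + 1)" using e M by simp
        fix y assume "cmod y < e / (M + 1)"
        then have "M * cmod y \<le> (M + 1) * (e / (M + 1))" using M by (intro mult_mono) auto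
        then show "\<bar>p (w - y) - p w\<bar> \<le> e" using lip[of "w - y" w] M by simp
      qed
    qed (rule pb)
    then show ?thesis using w by (simp add: Psw)
  qed
  have Elim: "(\<lambda>k. E k w v) \<longlonglongrightarrow> D w v" if w: "cmod w < 1" "w \<notin> Z" for w v
  proof -
    define Zw where "Zw = (\<lambda>y. w - y) -` Z"
    have Zw: "negligible Zw" unfolding Zw_def
      by (rule negligible_lipschitz_preimage[OF bij_reflect, where M=1]) (auto simp: dist_norm norm_minus_commute Z)
    define S where "S = cball 0 3 - Zw"
    have Sm: "S \<in> lmeasurable" unfolding S_def using Zw by (intro fmeasurable_Diff) (auto simp: negligible_imp_sets)
    \<comment> \<open>The derivative of the mollification is the mollification of the derivative:
      the difference quotients of \<open>p\<close> converge off a null set and are bounded by the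
      Lipschitz constant, so bounded convergence applies.\<close>
    have Eeq: "E k w v = integral S (\<lambda>y. D (w - y) v * landau k y) / landau_mass k" for k
    proof -
      define t where "t = small_steps v"
      note t = small_steps[of v, folded t_def]
      define q where "q = (\<lambda>j y. (p (w + t j *\<^sub>R v - y) - p (w - y)) / t j * landau k y)"
      have wt: "cmod (w + t j *\<^sub>R v) < 2" for j
        using norm_triangle_ineq[of w "t j *\<^sub>R v"] t(2,3)[of j] w(1) by simp
      have w2: "cmod w < 2" using w by simp
      have hq: "(q j has_integral (integral (cball 0 3) (\<lambda>y. p (w + t j *\<^sub>R v - y) * landau k y) -
          integral (cball 0 3) (\<lambda>y. p (w - y) * landau k y)) / t j) (cball 0 3)" for j
      proof -
        have "q j = (\<lambda>y. (p (w + t j *\<^sub>R v - y) * landau k y - p (w - y) * landau k y) / t j)"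
          by (auto simp: q_def field_simps)
        then show ?thesis
          by (simp only:) (intro has_integral_divide has_integral_diff integrable_integral int wt w2)
      qed
      have lim1: "(\<lambda>j. integral S (q j)) \<longlonglongrightarrow> integral S (\<lambda>y. D (w - y) v * landau k y)"
      proof (rule bounded_convergence(2)[OF Sm, where B="M * cmod v"])
        show "q j integrable_on S" for j
          unfolding S_def using hq has_integral_Diff_negligible(1)[OF Zw] by blast
        fix j y assume y: "y \<in> S"
        have "\<bar>p (w + t j *\<^sub>R v - y) - p (w - y)\<bar> \<le> M * (t j * cmod v)"
          using lip[of "w + t j *\<^sub>R v - y" "w - y"] t(2)[of j] by simp
        then have "\<bar>(p (w + t j *\<^sub>R v - y) - p (w - y)) / t j\<bar> \<le> M * cmod v"
          using t(2)[of j] by (simp add: abs_divide divide_le_eq mult.left_commute mult.commute)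
        moreover have "0 \<le> landau k y" "landau k y \<le> 1"
          using y landau_nonneg[of y k] landau_le_1[of y k] by (auto simp: S_def)
        ultimately have "\<bar>(p (w + t j *\<^sub>R v - y) - p (w - y)) / t j\<bar> * landau k y \<le> M * cmod v * 1"
          using M by (intro mult_mono) auto
        then show "\<bar>q j y\<bar> \<le> M * cmod v" using \<open>0 \<le> landau k y\<close> by (simp add: q_def abs_mult)
      next
        fix y assume y: "y \<in> S"
        then have "w - y \<notin> Z" by (simp add: S_def Zw_def)
        from directional_derivative_limit[OF D[OF this] t(4) t(1), of v]
        have "(\<lambda>j. (p (w - y + t j *\<^sub>R v) - p (w - y)) / t j * landau k y) \<longlonglongrightarrow> D (w - y) v * landau k y"
          by (intro tendsto_mult tendsto_const)
        then show "(\<lambda>j. q j y) \<longlonglongrightarrow> D (w - y) v * landau k y"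
          by (simp add: q_def algebra_simps)
      qed
      have "integral S (q j) = (P k (w + t j *\<^sub>R v) - P k w) / t j * landau_mass k" for j
      proof -
        have "integral S (q j) = integral (cball 0 3) (q j)"
          unfolding S_def by (rule has_integral_Diff_negligible(3)[OF Zw])
        then show ?thesis
          using integral_unique[OF hq] landau_mass_pos[of k]
          by (simp add: Psw[OF wt] Psw[OF w2]) (simp add: field_simps)
      qed
      then have "(\<lambda>j. integral S (q j)) \<longlonglongrightarrow> E k w v * landau_mass k"
        using tendsto_mult[OF directional_derivative_limit[OF E t(4) t(1), of k w v] tendsto_const] by simp
      then have "E k w v * landau_mass k = integral S (\<lambda>y. D (w - y) v * landau k y)"
        using lim1 LIMSEQ_unique by blast
      then show ?thesis using landau_mass_pos[of k] by (simp add: field_simps)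
    qed
    show ?thesis
      unfolding Eeq S_def
    proof (rule landau_approximate_identity[OF Zw, where C="M * cmod v"])
      show "continuous_on (cball 0 3 - Zw) (\<lambda>y. D (w - y) v)"
        by (rule continuous_on_compose2[OF contD]) (auto simp: Zw_def intro!: continuous_intros)
      show "\<bar>D (w - y) v\<bar> \<le> M * cmod v" if "y \<in> cball 0 3 - Zw" for y
        using that by (intro Db) (simp add: Zw_def)
      fix e :: real assume "0 < e"
      then obtain d where d: "0 < d" "\<And>x. x \<in> - Z \<Longrightarrow> dist x w < d \<Longrightarrow> dist (D x v) (D w v) < e"
        using contD[of v] w(2) unfolding continuous_on_iff by (metis ComplI)
      show "\<exists>\<delta>>0. \<forall>y\<in>cball 0 3 - Zw. cmod y < \<delta> \<longrightarrow> \<bar>D (w - y) v - D w v\<bar> \<le> e"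
      proof (intro exI[of _ d] conjI ballI impI d(1))
        fix y assume "y \<in> cball 0 3 - Zw" "cmod y < d"
        then show "\<bar>D (w - y) v - D w v\<bar> \<le> e"
          using d(2)[of "w - y"] by (simp add: Zw_def dist_norm)
      qed
    qed
  qed
  show thesis by (rule that[OF rp E Pb Eb Plim Elim])
qed

subsection \<open>Quasi-convexity for Lipschitz maps\<close>

text \<open>A segment from a point of the disc to a point outside crosses the unit circle, where
  \<open>f\<close> vanishes, and the part up to the crossing is no longer than the whole
  segment.\<close>

lemma lipschitz_extension_by_zero:
  fixes f :: "complex \<Rightarrow> real"
  assumes lip: "\<And>x y. x \<in> cball 0 1 \<Longrightarrow> y \<in> cball 0 1 \<Longrightarrow> \<bar>f x - f y\<bar> \<le> M * cmod (x - y)"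
    and M: "0 \<le> M" and zero: "\<And>x. cmod x = 1 \<Longrightarrow> f x = 0"
  defines "g \<equiv> (\<lambda>x. if cmod x \<le> 1 then f x else 0)"
  shows "\<bar>g x - g y\<bar> \<le> M * cmod (x - y)"
proof -
  have mixed: "\<bar>f x\<bar> \<le> M * cmod (x - y)" if xy: "cmod x \<le> 1" "1 < cmod y" for x y
  proof -
    have "closed_segment x y \<inter> frontier (cball 0 1) \<noteq> {}"
    proof (rule connected_Int_frontier)
      have "x \<in> closed_segment x y \<inter> cball 0 1" using xy by simp
      then show "closed_segment x y \<inter> cball 0 1 \<noteq> {}" by blast
      have "y \<in> closed_segment x y - cball 0 1" using xy by simp
      then show "closed_segment x y - cball 0 1 \<noteq> {}" by blast
    qed simp
    then obtain z where z: "z \<in> closed_segment x y" "cmod z = 1" by auto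
    have "\<bar>f x - f z\<bar> \<le> M * cmod (x - z)" using xy z by (intro lip) auto
    also have "\<dots> \<le> M * cmod (x - y)"
      using segment_bound1[OF z(1)] M by (intro mult_left_mono) (simp_all add: norm_minus_commute)
    finally show ?thesis using zero[OF z(2)] by simp
  qed
  show ?thesis
  proof (cases "cmod x \<le> 1"; cases "cmod y \<le> 1")
    assume "\<not> cmod x \<le> 1" "cmod y \<le> 1"
    then show ?thesis using mixed[of y x] by (simp add: g_def norm_minus_commute)
  qed (use lip[of x y] mixed[of x y] M in \<open>auto simp: g_def\<close>)
qed

text \<open>The cutoff function \<open>1 - (cmod w) ^ (2 * m)\<close> is a polynomial, vanishes on the unit circle and tends
  to 1 inside.\<close>

definition cutoff :: "nat \<Rightarrow> complex \<Rightarrow> real" where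
  "cutoff m w = 1 - (Re w * Re w + Im w * Im w) ^ m"

definition dcutoff :: "nat \<Rightarrow> complex \<Rightarrow> complex \<Rightarrow> real" where
  "dcutoff m w v = - (real m * (2 * (Re w * Re v + Im w * Im v)) * (Re w * Re w + Im w * Im w) ^ (m - 1))"

lemma cutoff_eq: "cutoff m w = 1 - cmod w ^ (2 * m)"
proof -
  have "Re w * Re w + Im w * Im w = (cmod w)\<^sup>2" unfolding cmod_power2 by (simp add: power2_eq_square)
  then show ?thesis by (simp add: cutoff_def power_mult)
qed

lemma real_polynomial_function_cutoff: "real_polynomial_function (cutoff m)"
  unfolding cutoff_def
  by (intro real_polynomial_function.intros(2-4) real_polynomial_function_diff real_polynomial_function_power
      real_polynomial_function.intros(1)[OF bounded_linear_Re] real_polynomial_function.intros(1)[OF bounded_linear_Im])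

lemma cutoff_has_derivative: "(cutoff m has_derivative dcutoff m w) (at w)"
proof -
  have "((\<lambda>w. Re w * Re w + Im w * Im w) has_derivative (\<lambda>v. 2 * (Re w * Re v + Im w * Im v))) (at w)"
    by (auto intro!: derivative_eq_intros simp: algebra_simps)
  from has_derivative_diff[OF has_derivative_const has_derivative_power[OF this, of m], of 1]
  show ?thesis by (simp add: cutoff_def[abs_def] dcutoff_def[abs_def])
qed

lemma dcutoff_bound: "\<bar>dcutoff m w v\<bar> \<le> 2 * (real m * cmod w ^ (2 * m - 1)) * cmod v"
proof (cases m)
  case (Suc k)
  have "\<bar>Re w * Re v + Im w * Im v\<bar> = \<bar>Re (cnj w * v)\<bar>" by simp
  also have "\<dots> \<le> cmod w * cmod v" using abs_Re_le_cmod[of "cnj w * v"] by (simp add: norm_mult)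
  finally have 1: "\<bar>Re w * Re v + Im w * Im v\<bar> \<le> cmod w * cmod v" .
  have eq: "(Re w * Re w + Im w * Im w) ^ (m - 1) = cmod w ^ (2 * k)"
  proof -
    have "Re w * Re w + Im w * Im w = (cmod w)\<^sup>2" unfolding cmod_power2 by (simp add: power2_eq_square)
    then show ?thesis by (simp add: Suc power_mult)
  qed
  have "\<bar>dcutoff m w v\<bar> = 2 * (real m * cmod w ^ (2 * k)) * \<bar>Re w * Re v + Im w * Im v\<bar>"
    unfolding dcutoff_def eq by (simp only: abs_minus_cancel abs_mult) simp
  also have "\<dots> \<le> 2 * (real m * cmod w ^ (2 * k)) * (cmod w * cmod v)"
    by (intro mult_left_mono 1) auto
  finally show ?thesis by (simp add: Suc algebra_simps)
qed (simp add: dcutoff_def)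

text \<open>\<open>m * x^k * (1 - x)\<close> with \<open>m = k + 1\<close> is at most the
  telescoping geometric sum \<open>1 - x^m\<close>. Used with \<open>x = cmod w\<close>: the
  derivative of the cutoff grows with \<open>m\<close>, but it is multiplied by a function of size
  \<open>1 - cmod w\<close>.\<close>

lemma power_times_complement_le_1:
  assumes "0 \<le> x" "x \<le> (1::real)"
  shows "real m * x ^ (2 * m - 1) * (1 - x) \<le> 1"
proof (cases m)
  case (Suc k)
  have "real m * x ^ (2 * m - 1) \<le> real m * x ^ k"
    using assms by (intro mult_left_mono power_decreasing) (auto simp: Suc)
  also have "\<dots> = (\<Sum>i<m. x ^ k)" by simp
  also have "\<dots> \<le> (\<Sum>i<m. x ^ i)"
    using assms by (intro sum_mono power_decreasing) (auto simp: Suc)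
  finally have "real m * x ^ (2 * m - 1) * (1 - x) \<le> (\<Sum>i<m. x ^ i) * (1 - x)"
    using assms by (intro mult_right_mono) auto
  also have "\<dots> = 1 - x ^ m" using one_diff_power_eq[of x m] by (simp add: mult.commute)
  finally show ?thesis using assms by (smt (verit) zero_le_power)
qed simp

text \<open>Mollifying \<open>u - l\<close> destroys the boundary values, so the mollification is
  multiplied by \<open>cutoff m\<close>. The order of the limits matters: for fixed \<open>m\<close>
  the derivative of the cutoff is bounded and \<open>k\<close> can tend to infinity; afterwards
  \<open>u - l\<close> itself vanishes on the circle, which offsets the growth of
  \<open>dcutoff m\<close> and gives bounds uniform in \<open>m\<close>.\<close>

lemma quasi_convex_lipschitz:
  assumes energy: "definition_of_energy I" and qc: "quasi_convex I" and N: "norm_on_Rn n N"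
    and l: "\<And>i. i < n \<Longrightarrow> linear (l i)" and M: "0 \<le> M"
    and lip: "\<And>i x y. i < n \<Longrightarrow> x \<in> cball 0 1 \<Longrightarrow> y \<in> cball 0 1 \<Longrightarrow> \<bar>u i x - u i y\<bar> \<le> M * cmod (x - y)"
    and bd: "\<And>i z. i < n \<Longrightarrow> cmod z = 1 \<Longrightarrow> u i z = l i z"
    and Z: "closed Z" "negligible Z"
    and D: "\<And>i w. i < n \<Longrightarrow> w \<in> ball 0 1 - Z \<Longrightarrow> (u i has_derivative D i w) (at w)"
    and contD: "\<And>i v. i < n \<Longrightarrow> continuous_on (ball 0 1 - Z) (\<lambda>w. D i w v)"
  shows "(\<lambda>w. to_plane I (pull_norm n N (\<lambda>i. D i w))) integrable_on ball 0 1 - Z"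
    and "pi * to_plane I (pull_norm n N l) \<le> integral (ball 0 1 - Z) (\<lambda>w. to_plane I (pull_norm n N (\<lambda>i. D i w)))"
proof -
  interpret plane_energy "to_plane I" by (rule plane_energy_to_plane[OF energy])
  define S where "S = ball (0::complex) 1 - Z"
  have Sm: "S \<in> lmeasurable"
    unfolding S_def using Z by (intro fmeasurable_Diff) (auto simp: negligible_imp_sets)
  have "\<exists>C. \<forall>i<n. \<forall>v. \<bar>l i v\<bar> \<le> C * cmod v \<and> 0 \<le> C"
  proof -
    have "\<exists>C. \<forall>v. \<bar>l i v\<bar> \<le> C * cmod v" if "i < n" for i
      using linear_bounded[OF l[OF that]] by simp
    then obtain C where C: "\<And>i v. i < n \<Longrightarrow> \<bar>l i v\<bar> \<le> C i * cmod v" by metis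
    have "\<bar>l i v\<bar> \<le> (\<Sum>i<n. \<bar>C i\<bar>) * cmod v" if "i < n" for i v
    proof -
      have "\<bar>l i v\<bar> \<le> \<bar>C i\<bar> * cmod v" using C[OF that, of v] by (meson abs_ge_self mult_right_mono norm_ge_zero order_trans)
      also have "\<dots> \<le> (\<Sum>i<n. \<bar>C i\<bar>) * cmod v"
        using that by (intro mult_right_mono member_le_sum) auto
      finally show ?thesis .
    qed
    then show ?thesis by (intro exI[of _ "\<Sum>i<n. \<bar>C i\<bar>"]) (auto intro: sum_nonneg)
  qed
  then obtain C where C: "\<And>i v. i < n \<Longrightarrow> \<bar>l i v\<bar> \<le> C * cmod v" "\<And>i. i < n \<Longrightarrow> 0 \<le> C" by blast
  define M1 where "M1 = M + \<bar>C\<bar>"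
  have M1: "0 \<le> M1" using M by (simp add: M1_def)
  define p where "p = (\<lambda>i w. if cmod w \<le> 1 then u i w - l i w else 0)"
  have plip: "\<bar>p i x - p i y\<bar> \<le> M1 * cmod (x - y)" if i: "i < n" for i x y
    unfolding p_def
  proof (rule lipschitz_extension_by_zero[OF _ M1])
    fix x y :: complex assume xy: "x \<in> cball 0 1" "y \<in> cball 0 1"
    have "\<bar>l i x - l i y\<bar> \<le> \<bar>C\<bar> * cmod (x - y)"
      using C(1)[OF i, of "x - y"] C(2)[OF i] by (simp add: linear_diff[OF l[OF i]])
    then show "\<bar>(u i x - l i x) - (u i y - l i y)\<bar> \<le> M1 * cmod (x - y)"
      using lip[OF i xy] by (simp add: M1_def distrib_right)
  qed (use bd[OF i] in simp)
  define Z' where "Z' = Z \<union> sphere 0 1"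
  define Dp where "Dp = (\<lambda>i w v. if cmod w < 1 then D i w v - l i v else 0)"
  have Z': "negligible Z'" unfolding Z'_def using Z by (simp add: negligible_Un negligible_sphere)
  have Dp: "(p i has_derivative Dp i w) (at w)" if i: "i < n" and w: "w \<notin> Z'" for i w
  proof (cases "cmod w < 1")
    case True
    have "((\<lambda>w. u i w - l i w) has_derivative (\<lambda>v. D i w v - l i v)) (at w)"
      using D[OF i, of w] w True l[OF i]
      by (intro has_derivative_diff bounded_linear_imp_has_derivative) (auto simp: Z'_def linear_conv_bounded_linear)
    then have "(p i has_derivative (\<lambda>v. D i w v - l i v)) (at w)"
      by (rule has_derivative_transform_within_open[where s="ball 0 1"]) (use True in \<open>auto simp: p_def\<close>)
    then show ?thesis using True by (simp add: Dp_def)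
  next
    case False
    have "((\<lambda>w. 0) has_derivative (\<lambda>v. 0::real)) (at w)" by simp
    then have "(p i has_derivative (\<lambda>v. 0)) (at w)"
      by (rule has_derivative_transform_within_open[where s="- cball 0 1"])
        (use False w in \<open>auto simp: p_def Z'_def\<close>)
    then show ?thesis using False by (simp add: Dp_def[abs_def])
  qed
  have contDp: "continuous_on (- Z') (\<lambda>w. Dp i w v)" if i: "i < n" for i v
  proof -
    have "continuous_on ((ball 0 1 - Z) \<union> (- cball 0 1)) (\<lambda>w. Dp i w v)"
    proof (rule continuous_on_open_Un)
      show "open (ball 0 1 - Z)" using Z by (intro open_Diff) auto
      have "continuous_on (ball 0 1 - Z) (\<lambda>w. D i w v - l i v)" by (intro continuous_intros contD i)
      then show "continuous_on (ball 0 1 - Z) (\<lambda>w. Dp i w v)" by (rule continuous_on_eq) (simp add: Dp_def)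
      have "continuous_on (- cball 0 1) (\<lambda>w::complex. 0::real)" by simp
      then show "continuous_on (- cball 0 1) (\<lambda>w. Dp i w v)" by (rule continuous_on_eq) (simp add: Dp_def)
    qed auto
    then show ?thesis by (rule continuous_on_subset) (auto simp: Z'_def)
  qed
  \<comment> \<open>The properties of a mollifying sequence are bundled so that sequences for all
    coordinates \<open>i < n\<close> can be chosen at once.\<close>
  define \<Phi> where "\<Phi> = (\<lambda>i P E. (\<forall>k. real_polynomial_function (P k)) \<and> (\<forall>k w. (P k has_derivative E k w) (at w)) \<and>
    (\<forall>k w. cmod w < 1 \<longrightarrow> \<bar>P k w\<bar> \<le> 2 * M1) \<and> (\<forall>k w v. cmod w < 1 \<longrightarrow> \<bar>E k w v\<bar> \<le> M1 * cmod v) \<and>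
    (\<forall>w. cmod w < 1 \<longrightarrow> (\<lambda>k. P k w) \<longlonglongrightarrow> p i w) \<and>
    (\<forall>w v. cmod w < 1 \<longrightarrow> w \<notin> Z' \<longrightarrow> (\<lambda>k. E k w v) \<longlonglongrightarrow> Dp i w v))"
  have "\<exists>P E. \<Phi> i P E" if i: "i < n" for i
  proof -
    have z: "p i w = 0" if "1 \<le> cmod w" for w using that bd[OF i, of w] by (auto simp: p_def)
    show ?thesis
    proof (rule landau_mollification[OF plip[OF i] M1 z Z' Dp[OF i] contDp[OF i]])
      fix P E
      assume a: "\<And>k. real_polynomial_function (P k)" "\<And>k w. (P k has_derivative E k w) (at w)"
        "\<And>k w. cmod w < 1 \<Longrightarrow> \<bar>P k w\<bar> \<le> 2 * M1" "\<And>k w v. cmod w < 1 \<Longrightarrow> \<bar>E k w v\<bar> \<le> M1 * cmod v"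
        "\<And>w. cmod w < 1 \<Longrightarrow> (\<lambda>k. P k w) \<longlonglongrightarrow> p i w"
        "\<And>w v. cmod w < 1 \<Longrightarrow> w \<notin> Z' \<Longrightarrow> (\<lambda>k. E k w v) \<longlonglongrightarrow> Dp i w v"
      show ?thesis by (rule exI[of _ P], rule exI[of _ E]) (unfold \<Phi>_def, intro conjI allI impI a; assumption)
    qed
  qed
  then obtain P E where PE: "\<And>i. i < n \<Longrightarrow> \<Phi> i (P i) (E i)" by metis
  have P: "real_polynomial_function (P i k)" if "i < n" for i k
    using PE[OF that] unfolding \<Phi>_def by blast
  have E: "(P i k has_derivative E i k w) (at w)" if "i < n" for i k w
    using PE[OF that] unfolding \<Phi>_def by blast
  have Pb: "\<bar>P i k w\<bar> \<le> 2 * M1" if "i < n" "cmod w < 1" for i k w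
    using PE[OF that(1)] that(2) unfolding \<Phi>_def by blast
  have Eb: "\<bar>E i k w v\<bar> \<le> M1 * cmod v" if "i < n" "cmod w < 1" for i k w v
    using PE[OF that(1)] that(2) unfolding \<Phi>_def by blast
  have Pl: "(\<lambda>k. P i k w) \<longlonglongrightarrow> p i w" if "i < n" "cmod w < 1" for i w
    using PE[OF that(1)] that(2) unfolding \<Phi>_def by blast
  have El: "(\<lambda>k. E i k w v) \<longlonglongrightarrow> Dp i w v" if "i < n" "cmod w < 1" "w \<notin> Z'" for i w v
    using PE[OF that(1)] that(2,3) unfolding \<Phi>_def by blast
  \<comment> \<open>By the product rule \<open>X\<close> is the derivative of
    \<open>l i + cutoff m * P i k\<close>, and \<open>Y\<close> is its limit as \<open>k\<close>
    tends to infinity.\<close>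
  define X where "X = (\<lambda>m k w i v. l i v + (cutoff m w * E i k w v + dcutoff m w v * P i k w))"
  define Y where "Y = (\<lambda>m w i v. l i v + (cutoff m w * Dp i w v + dcutoff m w v * p i w))"
  define cN where "cN = (\<Sum>i<n. N (\<lambda>j. if j = i then 1 else 0))"
  have cut01: "0 \<le> cutoff m w" "cutoff m w \<le> 1" if "cmod w < 1" for m w
    using that by (auto simp: cutoff_eq power_le_one)
  have linE: "linear (E i k w)" if "i < n" for i k w using has_derivative_linear[OF E[OF that]] .
  have linDp: "linear (Dp i w)" if "i < n" "w \<notin> Z'" for i w using has_derivative_linear[OF Dp[OF that]] .
  have lincut: "linear (dcutoff m w)" for m w using has_derivative_linear[OF cutoff_has_derivative] .
  have linX: "linear (X m k w i)" if i: "i < n" for m k w i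
    using l[OF i] linE[OF i, of k w] lincut[of m w] unfolding X_def
    by (intro linearI) (simp_all add: linear_add linear_cmul algebra_simps)
  have linY: "linear (Y m w i)" if i: "i < n" "w \<notin> Z'" for m w i
    using l[OF i(1)] linDp[OF i] lincut[of m w] unfolding Y_def
    by (intro linearI) (simp_all add: linear_add linear_cmul algebra_simps)
  have linD: "linear (D i w)" if "i < n" "w \<in> S" for i w
    using has_derivative_linear[OF D] that by (simp add: S_def)
  have csX: "pull_norm n N (X m k w) \<in> cseminorms" for m k w by (rule pull_norm_cseminorm[OF N linX])
  have SZ': "w \<notin> Z'" "cmod w < 1" if "w \<in> S" for w using that by (auto simp: S_def Z'_def)
  have csY: "pull_norm n N (Y m w) \<in> cseminorms" if "w \<in> S" for m w by (rule pull_norm_cseminorm[OF N linY]) (use SZ'[OF that] in auto)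
  have csD: "pull_norm n N (\<lambda>i. D i w) \<in> cseminorms" if "w \<in> S" for w by (rule pull_norm_cseminorm[OF N linD]) (use that in auto)
  have Jb: "\<bar>to_plane I s\<bar> \<le> (2 * (B * cN))\<^sup>2 * to_plane I cmod"
    if "s \<in> cseminorms" "s = pull_norm n N W" "\<And>i v. i < n \<Longrightarrow> cmod v = 1 \<Longrightarrow> \<bar>W i v\<bar> \<le> B" for s W B
  proof -
    have "s 1 \<le> B * cN" "s \<i> \<le> B * cN"
      unfolding that(2) cN_def by (rule pull_norm_bound[OF N], rule that(3), auto)+
    from J_bound'[OF that(1) this] nonneg[OF that(1)] show ?thesis by simp
  qed
  have contE: "continuous_on T (\<lambda>w. E i k w v)" if i: "i < n" for i k v T
  proof -
    obtain E' where E': "\<And>w. (P i k has_derivative E' w) (at w)" "\<And>v. real_polynomial_function (\<lambda>w. E' w v)"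
      using real_polynomial_function_derivative[OF P[OF i]] by blast
    have "E i k w = E' w" for w using has_derivative_unique[OF E[OF i] E'(1)] .
    then show ?thesis
      using continuous_real_polymonial_function[OF E'(2)] by (auto intro: continuous_at_imp_continuous_on)
  qed
  have contP: "continuous_on T (P i k)" if "i < n" for i k T
    using continuous_real_polymonial_function[OF P[OF that]] by (auto intro: continuous_at_imp_continuous_on)
  have contX: "continuous_on T (\<lambda>w. to_plane I (pull_norm n N (X m k w)))" for m k T
  proof (rule continuous_on_J[OF csX])
    fix v show "continuous_on T (\<lambda>w. pull_norm n N (X m k w) v)"
      unfolding X_def
      by (intro continuous_on_pull_norm[OF N] continuous_intros contE contP) (auto simp: cutoff_def dcutoff_def intro!: continuous_intros)
  qed
  have main: "pi * to_plane I (pull_norm n N l) \<le> integral S (\<lambda>w. to_plane I (pull_norm n N (X m k w)))" if m: "0 < m" for m k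
  proof -
    have "pi * to_plane I (pull_norm n N l) \<le> integral (ball 0 1) (\<lambda>w. to_plane I (pull_norm n N (\<lambda>i. X m k w i)))"
    proof (rule quasi_convex_polynomial[OF energy qc N l, where P="\<lambda>i w. l i w + cutoff m w * P i k w"])
      fix i assume i: "i < n"
      have bl: "bounded_linear (l i)" using l[OF i] by (simp add: linear_conv_bounded_linear)
      show "real_polynomial_function (\<lambda>w. l i w + cutoff m w * P i k w)"
        by (intro real_polynomial_function.intros(3,4) real_polynomial_function_cutoff P i)
          (rule real_polynomial_function.intros(1)[OF bl])
      show "l i z + cutoff m z * P i k z = l i z" if "cmod z = 1" for z
        using that by (simp add: cutoff_eq)
      show "((\<lambda>w. l i w + cutoff m w * P i k w) has_derivative X m k z i) (at z)" for z
        unfolding X_def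
        by (intro has_derivative_add has_derivative_mult cutoff_has_derivative E i bounded_linear_imp_has_derivative bl)
    qed
    also have "\<dots> = integral S (\<lambda>w. to_plane I (pull_norm n N (X m k w)))"
      unfolding S_def using has_integral_Diff_negligible(3)[OF Z(2)] by metis
    finally show ?thesis .
  qed
  have Xb: "\<bar>X m k w i v\<bar> \<le> \<bar>C\<bar> + M1 + 4 * real m * M1" if i: "i < n" and w: "w \<in> S" and v: "cmod v = 1" for m k w i v
  proof -
    note w1 = SZ'(2)[OF w]
    have "\<bar>l i v\<bar> \<le> \<bar>C\<bar>" using C(1)[OF i, of v] v by simp
    moreover have "\<bar>cutoff m w * E i k w v\<bar> \<le> 1 * M1"
      unfolding abs_mult using cut01[OF w1, of m] Eb[OF i w1, of k v] v by (intro mult_mono) auto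
    moreover have "\<bar>dcutoff m w v * P i k w\<bar> \<le> (2 * real m) * (2 * M1)"
      unfolding abs_mult
    proof (intro mult_mono Pb[OF i w1])
      have "\<bar>dcutoff m w v\<bar> \<le> 2 * (real m * cmod w ^ (2 * m - 1))" using dcutoff_bound[of m w v] v by simp
      also have "\<dots> \<le> 2 * (real m * 1)" using w1 by (intro mult_left_mono power_le_one) auto
      finally show "\<bar>dcutoff m w v\<bar> \<le> 2 * real m" by simp
    qed auto
    ultimately show ?thesis unfolding X_def by linarith
  qed
  have conv1: "(\<lambda>w. to_plane I (pull_norm n N (Y m w))) integrable_on S"
    "(\<lambda>k. integral S (\<lambda>w. to_plane I (pull_norm n N (X m k w)))) \<longlonglongrightarrow> integral S (\<lambda>w. to_plane I (pull_norm n N (Y m w)))" for m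
  proof -
    define B where "B = (2 * ((\<bar>C\<bar> + M1 + 4 * real m * M1) * cN))\<^sup>2 * to_plane I cmod"
    have b: "\<bar>to_plane I (pull_norm n N (X m k w))\<bar> \<le> B" if "w \<in> S" for k w
      unfolding B_def by (rule Jb[OF csX refl Xb[OF _ that]])
    have int: "(\<lambda>w. to_plane I (pull_norm n N (X m k w))) integrable_on S" for k
      using bounded_continuous_absolutely_integrable[OF Sm contX b] by (simp add: absolutely_integrable_on_def)
    have pw: "(\<lambda>k. to_plane I (pull_norm n N (X m k w))) \<longlonglongrightarrow> to_plane I (pull_norm n N (Y m w))" if w: "w \<in> S" for w
    proof (rule sequentially_continuous[OF csX csY[OF w]])
      fix v show "(\<lambda>k. pull_norm n N (X m k w) v) \<longlonglongrightarrow> pull_norm n N (Y m w) v"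
        unfolding pull_norm_def X_def Y_def
        by (intro tendsto_trunc[OF N] tendsto_intros El Pl SZ'[OF w])
    qed
    show "(\<lambda>w. to_plane I (pull_norm n N (Y m w))) integrable_on S"
      by (rule bounded_convergence(1)[OF Sm int b pw])
    show "(\<lambda>k. integral S (\<lambda>w. to_plane I (pull_norm n N (X m k w)))) \<longlonglongrightarrow> integral S (\<lambda>w. to_plane I (pull_norm n N (Y m w)))"
      by (rule bounded_convergence(2)[OF Sm int b pw])
  qed
  have main2: "pi * to_plane I (pull_norm n N l) \<le> integral S (\<lambda>w. to_plane I (pull_norm n N (Y (Suc m) w)))" for m
    using LIMSEQ_le_const[OF conv1(2)[of "Suc m"]] main[of "Suc m"] by blast
  have Yb: "\<bar>Y m w i v\<bar> \<le> \<bar>C\<bar> + M1 + 2 * M1" if i: "i < n" and w: "w \<in> S" and v: "cmod v = 1" for m w i v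
  proof -
    note w1 = SZ'(2)[OF w]
    have "\<bar>l i v\<bar> \<le> \<bar>C\<bar>" using C(1)[OF i, of v] v by simp
    moreover have "\<bar>Dp i w v\<bar> \<le> M1 * cmod v"
      by (rule derivative_bound_from_lipschitz[OF Dp[OF i SZ'(1)[OF w]] plip[OF i]])
    then have "\<bar>cutoff m w * Dp i w v\<bar> \<le> 1 * M1"
      unfolding abs_mult using cut01[OF w1, of m] v by (intro mult_mono) auto
    moreover have "\<bar>dcutoff m w v * p i w\<bar> \<le> 2 * M1"
    proof -
      \<comment> \<open>The nearest point of the unit circle, at distance \<open>1 - cmod w\<close>;
        at the origin any point of the circle will do. As \<open>p i\<close> vanishes there, it is
        of size \<open>1 - cmod w\<close> at \<open>w\<close>.\<close>
      define z where "z = (if w = 0 then 1 else sgn w)"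
      have z: "cmod z = 1" by (simp add: z_def norm_sgn)
      have "cmod (w - z) = 1 - cmod w"
      proof (cases "w = 0")
        case False
        have "w - z = - ((1 - cmod w) *\<^sub>R sgn w)" using False by (simp add: z_def algebra_simps sgn_div_norm)
        then show ?thesis using False w1 by (simp add: norm_sgn)
      qed (simp add: z_def)
      moreover have "p i z = 0" using z bd[OF i z] by (simp add: p_def)
      ultimately have pw: "\<bar>p i w\<bar> \<le> M1 * (1 - cmod w)" using plip[OF i, of w z] by simp
      have "\<bar>dcutoff m w v\<bar> \<le> 2 * (real m * cmod w ^ (2 * m - 1))" using dcutoff_bound[of m w v] v by simp
      then have "\<bar>dcutoff m w v * p i w\<bar> \<le> (2 * (real m * cmod w ^ (2 * m - 1))) * (M1 * (1 - cmod w))"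
        unfolding abs_mult by (intro mult_mono pw) auto
      also have "\<dots> = 2 * M1 * (real m * cmod w ^ (2 * m - 1) * (1 - cmod w))" by simp
      also have "\<dots> \<le> 2 * M1 * 1"
        using w1 M1 by (intro mult_left_mono power_times_complement_le_1) auto
      finally show ?thesis by simp
    qed
    ultimately show ?thesis unfolding Y_def by linarith
  qed
  define B where "B = (2 * ((\<bar>C\<bar> + M1 + 2 * M1) * cN))\<^sup>2 * to_plane I cmod"
  have b: "\<bar>to_plane I (pull_norm n N (Y (Suc m) w))\<bar> \<le> B" if "w \<in> S" for m w
    unfolding B_def by (rule Jb[OF csY[OF that] refl Yb[OF _ that]])
  have pw: "(\<lambda>m. to_plane I (pull_norm n N (Y (Suc m) w))) \<longlonglongrightarrow> to_plane I (pull_norm n N (\<lambda>i. D i w))" if w: "w \<in> S" for w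
  proof (rule sequentially_continuous[OF csY[OF w] csD[OF w]])
    fix v
    note w1 = SZ'(2)[OF w]
    have "(\<lambda>m. cmod w ^ (2 * m)) \<longlonglongrightarrow> 0"
      unfolding power_mult using w1 by (intro LIMSEQ_power_zero) (simp add: abs_square_less_1)
    from tendsto_diff[OF tendsto_const[of 1] LIMSEQ_Suc[OF this]]
    have c1: "(\<lambda>m. cutoff (Suc m) w) \<longlonglongrightarrow> 1" by (simp add: cutoff_eq)
    have c2: "(\<lambda>m. dcutoff (Suc m) w v) \<longlonglongrightarrow> 0"
    proof (rule Lim_null_comparison)
      show "\<forall>\<^sub>F m in sequentially. norm (dcutoff (Suc m) w v) \<le> 2 * (real (Suc m) * cmod w ^ (2 * Suc m - 1)) * cmod v"
        unfolding real_norm_def by (intro always_eventually allI dcutoff_bound)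
      have "(\<lambda>m. real m * cmod w ^ m) \<longlonglongrightarrow> 0"
        using powser_times_n_limit_0[of "cmod w"] w1 by simp
      from LIMSEQ_Suc[OF this] have "(\<lambda>m. real (Suc m) * cmod w ^ Suc m) \<longlonglongrightarrow> 0" .
      moreover have "norm (real (Suc m) * cmod w ^ (2 * Suc m - 1)) \<le> real (Suc m) * cmod w ^ Suc m" if "m \<ge> 1" for m
        using that w1 by (auto simp: abs_mult intro!: mult_left_mono power_decreasing)
      ultimately have "(\<lambda>m. real (Suc m) * cmod w ^ (2 * Suc m - 1)) \<longlonglongrightarrow> 0"
        by (intro Lim_null_comparison[of "\<lambda>m. real (Suc m) * cmod w ^ (2 * Suc m - 1)"]) (auto simp: eventually_sequentially)
      from tendsto_mult[OF tendsto_mult[OF tendsto_const[of 2] this] tendsto_const[of "cmod v"]]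
      show "(\<lambda>m. 2 * (real (Suc m) * cmod w ^ (2 * Suc m - 1)) * cmod v) \<longlonglongrightarrow> 0" by simp
    qed
    have "(\<lambda>m. pull_norm n N (Y (Suc m) w) v) \<longlonglongrightarrow> pull_norm n N (\<lambda>i v. l i v + (1 * Dp i w v + 0 * p i w)) v"
      unfolding pull_norm_def Y_def by (intro tendsto_trunc[OF N] tendsto_intros c1 c2)
    then show "(\<lambda>m. pull_norm n N (Y (Suc m) w) v) \<longlonglongrightarrow> pull_norm n N (\<lambda>i. D i w) v"
      using w1 by (simp add: Dp_def)
  qed
  show "(\<lambda>w. to_plane I (pull_norm n N (\<lambda>i. D i w))) integrable_on ball 0 1 - Z"
    using bounded_convergence(1)[OF Sm conv1(1) b pw] by (simp add: S_def)
  show "pi * to_plane I (pull_norm n N l) \<le> integral (ball 0 1 - Z) (\<lambda>w. to_plane I (pull_norm n N (\<lambda>i. D i w)))"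
    using LIMSEQ_le_const[OF bounded_convergence(2)[OF Sm conv1(1) b pw]] main2 by (simp add: S_def)
qed

subsection \<open>The reparametrization near infinity\<close>

text \<open>In the coordinate \<open>t = 1 / w\<close> at infinity, \<open>h (1 / t) - 1 / t\<close>
  is holomorphic near 0 except at 0 and tends to 0 there by the normalization of \<open>f\<close>,
  so the singularity is removable.\<close>

lemma qcmap_inverse_asymptotics:
  assumes q: "qcmap f K Z a m"
  obtains r g where "0 < r" "g holomorphic_on ball 0 r" "g 0 = 0"
    "\<And>w. 1 / r < cmod w \<Longrightarrow> inv f w = w + g (1 / w)"
proof -
  note qc = qcmapD[OF q]
  obtain M where M: "M > 0" "\<And>x y. dist (f x) (f y) \<le> M * dist x y" "\<And>x y. dist x y \<le> M * dist (f x) (f y)"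
    using qc(2) by blast
  have inj: "inj f" and surj: "surj f" using qc(1) by (auto simp: bij_def)
  define h where "h = inv f"
  have fh: "f (h w) = w" for w using surj by (simp add: h_def surj_f_inv_f)
  have hf: "h (f z) = z" for z using inj by (simp add: h_def)
  have opK: "open (- K)" using qc(3) by (simp add: compact_imp_closed open_Compl)
  obtain h' where h': "h' holomorphic_on f ` (- K)" "\<And>z. z \<in> - K \<Longrightarrow> h' (f z) = z"
    using holomorphic_has_inverse[OF qc(7) opK inj_on_subset[OF inj subset_UNIV]] by metis
  have holh: "h holomorphic_on f ` (- K)"
    by (rule holomorphic_transform[OF h'(1)]) (use h'(2) hf in auto)
  have "bounded (f ` K)"
    by (intro compact_imp_bounded compact_continuous_image lipschitz_continuous_on[OF M(2)] qc(3))
  then obtain R where R: "0 < R" "\<And>w. w \<in> f ` K \<Longrightarrow> cmod w \<le> R" unfolding bounded_pos by blast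
  have far: "w \<in> f ` (- K)" if "R < cmod w" for w
    using fh[of w] R(2)[of w] that by (metis ComplI image_eqI not_le)
  define r where "r = 1 / R"
  have r: "0 < r" "1 / r = R" using R(1) by (auto simp: r_def)
  define g where "g = (\<lambda>t. if t = 0 then 0 else h (1 / t) - 1 / t)"
  have big: "R < cmod (1 / t)" if "t \<in> ball 0 r - {0}" for t
    using that R(1) by (auto simp: r_def norm_divide field_simps)
  have holg: "g holomorphic_on ball 0 r - {0}"
  proof (rule holomorphic_transform)
    have inv1: "(\<lambda>t. 1 / t) holomorphic_on ball 0 r - {0::complex}"
      by (auto intro!: holomorphic_intros)
    have sub: "(\<lambda>t. 1 / t) ` (ball 0 r - {0::complex}) \<subseteq> f ` (- K)"
    proof (rule image_subsetI)
      fix t :: complex assume "t \<in> ball 0 r - {0}"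
      then show "1 / t \<in> f ` (- K)" by (rule far[OF big])
    qed
    show "(\<lambda>t. h (1 / t) - 1 / t) holomorphic_on ball 0 r - {0}"
      by (rule holomorphic_on_diff[OF holomorphic_on_compose_gen[OF inv1 holh sub, unfolded o_def] inv1])
  qed (auto simp: g_def)
  have h_inf: "filterlim h at_infinity at_infinity"
    unfolding filterlim_at_infinity[OF order_refl]
  proof (intro allI impI)
    fix c :: real assume c: "0 < c"
    have *: "c \<le> cmod (h w)" if w: "M * c + cmod (f 0) + 1 \<le> cmod w" for w
    proof -
      have "cmod w - cmod (f 0) \<le> M * cmod (h w)"
        using M(2)[of "h w" 0] norm_triangle_ineq2[of w "f 0"] by (simp add: fh dist_norm)
      then have "M * c < M * cmod (h w)" using w by linarith
      then show ?thesis using M(1) by simp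
    qed
    then show "\<forall>\<^sub>F w in at_infinity. c \<le> cmod (h w)"
      unfolding eventually_at_infinity by blast
  qed
  have "((\<lambda>w. - (f (h w) - h w)) \<longlongrightarrow> - 0) at_infinity"
    by (intro tendsto_minus filterlim_compose[OF qc(14) h_inf])
  then have h0: "((\<lambda>w. h w - w) \<longlongrightarrow> 0) at_infinity" by (simp add: fh)
  have "filterlim (\<lambda>t::complex. 1 / t) at_infinity (at 0)"
    using filterlim_inverse_at_infinity[where 'a=complex] unfolding inverse_eq_divide .
  from filterlim_compose[OF h0 this] have "((\<lambda>t. h (1 / t) - 1 / t) \<longlongrightarrow> 0) (at 0)" .
  then have "(g \<longlongrightarrow> 0) (at 0)"
    by (rule Lim_transform_eventually) (auto simp: g_def eventually_at intro!: exI[of _ 1])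
  then have g0: "isCont g 0" by (simp add: isCont_def g_def)
  have "g holomorphic_on ball 0 r"
  proof (rule no_isolated_singularity[of _ _ "{0}"])
    show "continuous_on (ball 0 r) g"
    proof (rule continuous_at_imp_continuous_on, rule ballI)
      fix t :: complex assume t: "t \<in> ball 0 r"
      show "isCont g t"
      proof (cases "t = 0")
        case False
        then show ?thesis
          using holomorphic_on_imp_continuous_on[OF holg] t
          by (subst (asm) continuous_on_eq_continuous_at) auto
      qed (use g0 in simp)
    qed
  qed (use holg in auto)
  moreover have "inv f w = w + g (1 / w)" if "1 / r < cmod w" for w
    using that R(1) unfolding r(2) by (auto simp: g_def h_def)
  ultimately show thesis using that[OF r(1)] by (simp add: g_def)
qed

text \<open>Taylor expansion of order one, with bounds on the remainder and on its derivative; both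
  come from a bound on the second derivative on the disc of radius \<open>r / 2\<close>.\<close>

lemma holomorphic_quadratic_remainder:
  assumes hol: "g holomorphic_on ball 0 r" and r: "0 < r" and g0: "g 0 = 0"
  obtains C \<alpha> where "0 \<le> C"
    "\<And>t. cmod t \<le> r / 2 \<Longrightarrow> (\<lambda>t. g t - \<alpha> * t) field_differentiable at t"
    "\<And>t. cmod t \<le> r / 2 \<Longrightarrow> cmod (deriv (\<lambda>t. g t - \<alpha> * t) t) \<le> C * cmod t"
    "\<And>t. cmod t \<le> r / 2 \<Longrightarrow> cmod (g t - \<alpha> * t) \<le> C * (cmod t)\<^sup>2"
proof -
  define \<alpha> where "\<alpha> = deriv g 0"
  define G where "G = (\<lambda>t. g t - \<alpha> * t)"
  have holG: "G holomorphic_on ball 0 r" unfolding G_def by (intro holomorphic_intros hol)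
  have sub: "cball (0::complex) (r / 2) \<subseteq> ball 0 r" using r by auto
  have hol1: "deriv G holomorphic_on ball 0 r" by (rule holomorphic_deriv[OF holG open_ball])
  have hol2: "deriv (deriv G) holomorphic_on ball 0 r" by (rule holomorphic_deriv[OF hol1 open_ball])
  have "bounded (deriv (deriv G) ` cball 0 (r / 2))"
    by (intro compact_imp_bounded compact_continuous_image holomorphic_on_imp_continuous_on
        holomorphic_on_subset[OF hol2 sub]) simp
  then obtain C where C: "0 < C" "\<And>t. t \<in> cball 0 (r / 2) \<Longrightarrow> cmod (deriv (deriv G) t) \<le> C"
    unfolding bounded_pos by auto
  have dg: "(g has_field_derivative \<alpha>) (at 0)"
    unfolding \<alpha>_def by (rule holomorphic_derivI[OF hol open_ball]) (use r in simp)
  have "(G has_field_derivative \<alpha> - \<alpha> * 1) (at 0)"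
    unfolding G_def by (intro DERIV_diff dg DERIV_cmult DERIV_ident)
  then have dG0: "deriv G 0 = 0" by (simp add: DERIV_imp_deriv)
  have d1: "cmod (deriv G t) \<le> C * cmod t" if t: "cmod t \<le> r / 2" for t
  proof -
    have "cmod (deriv G t - deriv G 0) \<le> C * cmod (t - 0)"
    proof (rule field_differentiable_bound[where S="cball 0 (r / 2)" and f'="deriv (deriv G)"])
      fix v :: complex assume v: "v \<in> cball 0 (r / 2)"
      show "(deriv G has_field_derivative deriv (deriv G) v) (at v within cball 0 (r / 2))"
        by (rule has_field_derivative_at_within[OF holomorphic_derivI[OF hol1 open_ball]]) (use v sub in auto)
    qed (use C(2) t r in auto)
    then show ?thesis by (simp add: dG0)
  qed
  have d0: "cmod (G t) \<le> C * (cmod t)\<^sup>2" if t: "cmod t \<le> r / 2" for t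
  proof -
    have "cmod (G t - G 0) \<le> (C * cmod t) * cmod (t - 0)"
    proof (rule field_differentiable_bound[where S="cball 0 (cmod t)" and f'="deriv G"])
      fix v :: complex assume v: "v \<in> cball 0 (cmod t)"
      show "(G has_field_derivative deriv G v) (at v within cball 0 (cmod t))"
        by (rule has_field_derivative_at_within[OF holomorphic_derivI[OF holG open_ball]]) (use v t r in auto)
      have "cmod (deriv G v) \<le> C * cmod v" by (rule d1) (use v t in auto)
      also have "\<dots> \<le> C * cmod t" using v C(1) by simp
      finally show "cmod (deriv G v) \<le> C * cmod t" .
    qed auto
    then show ?thesis by (simp add: G_def g0 power2_eq_square mult.assoc)
  qed
  have diff: "G field_differentiable at t" if "cmod t \<le> r / 2" for t
    by (rule holomorphic_on_imp_differentiable_at[OF holG open_ball]) (use that r in auto)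
  show thesis using that[of C \<alpha>] C(1) diff d1 d0 by (simp add: G_def)
qed

text \<open>Solving \<open>a * (y + m * cnj y) = v\<close> together with its conjugate gives the
  inverse, whose determinant is \<open>1 / d\<close>. In the normalization of
  \<open>J_beltrami\<close> its coefficient is \<open>- m\<close>, the origin of the sign in
  \<open>qd s (- m z)\<close>.\<close>

lemma has_derivative_inverse_beltrami:
  assumes f: "(f has_derivative (\<lambda>v. a * (v + m * cnj v))) (at (h w))" and a: "a \<noteq> 0" and m: "cmod m < 1"
    and cont: "continuous (at w) h" and fh: "\<And>w. f (h w) = w"
  defines "d \<equiv> (cmod a)\<^sup>2 * (1 - (cmod m)\<^sup>2)"
  shows "(h has_derivative (\<lambda>v. cnj a / of_real d * v + (- (a * m) / of_real d) * cnj v)) (at w)"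
    and "0 < d" and "(cmod (cnj a / of_real d))\<^sup>2 - (cmod (- (a * m) / of_real d))\<^sup>2 = 1 / d"
    and "(- (a * m) / of_real d) / cnj (cnj a / of_real d) = - m"
proof -
  have mm: "(cmod m)\<^sup>2 < 1" using m by (simp add: abs_square_less_1)
  show d: "0 < d" using a mm by (simp add: d_def)
  have dc: "of_real d = a * cnj a * (1 - m * cnj m)"
    unfolding d_def of_real_mult of_real_diff complex_norm_square by simp
  have d0: "complex_of_real d \<noteq> 0" using d by simp
  show "(- (a * m) / of_real d) / cnj (cnj a / of_real d) = - m" using a d0 by simp
  show "(cmod (cnj a / of_real d))\<^sup>2 - (cmod (- (a * m) / of_real d))\<^sup>2 = 1 / d"
  proof -
    have "(cmod (cnj a / of_real d))\<^sup>2 - (cmod (- (a * m) / of_real d))\<^sup>2 = (cmod a)\<^sup>2 * (1 - (cmod m)\<^sup>2) / d\<^sup>2"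
      using d by (simp add: norm_divide norm_mult power_divide power_mult_distrib diff_divide_distrib right_diff_distrib)
    also have "\<dots> = d / d\<^sup>2" by (simp add: d_def)
    finally show ?thesis using d by (simp add: power2_eq_square)
  qed
  show "(h has_derivative (\<lambda>v. cnj a / of_real d * v + (- (a * m) / of_real d) * cnj v)) (at w)"
  proof (rule has_derivative_inverse_basic[OF f _ _ cont, of _ UNIV])
    show "bounded_linear (\<lambda>v. cnj a / of_real d * v + (- (a * m) / of_real d) * cnj v)"
      by (rule linear_conv_bounded_linear[THEN iffD1, OF linear_beltrami])
    show "(\<lambda>v. cnj a / of_real d * v + (- (a * m) / of_real d) * cnj v) \<circ> (\<lambda>v. a * (v + m * cnj v)) = id"
    proof
      fix v
      have "cnj a * (a * (v + m * cnj v)) - (a * m) * cnj (a * (v + m * cnj v)) = of_real d * v"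
        unfolding dc by (simp add: algebra_simps)
      then have "(cnj a * (a * (v + m * cnj v)) - (a * m) * cnj (a * (v + m * cnj v))) / of_real d = v"
        using d0 by simp
      then show "((\<lambda>v. cnj a / of_real d * v + (- (a * m) / of_real d) * cnj v) \<circ> (\<lambda>v. a * (v + m * cnj v))) v = id v"
        by (simp add: diff_divide_distrib)
    qed
  qed (use fh in auto)
qed

text \<open>In dimension at least 2 the complement of a bounded convex set is connected. It avoids
  the frontier of \<open>V\<close>, so if it met \<open>V\<close> it would be contained in
  \<open>V\<close>, although it is unbounded.\<close>

lemma bounded_subset_convex_if_frontier_subset:
  fixes V :: "'a::euclidean_space set"
  assumes dim: "2 \<le> DIM('a)" and V: "bounded V" and C: "convex C" "bounded C" and fr: "frontier V \<subseteq> C"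
  shows "V \<subseteq> C"
proof -
  have conn: "connected (- C)" using connected_complement_bounded_convex[OF C(2,1) dim] .
  have unb: "\<not> bounded (- C)" using C(2) by (simp add: cobounded_imp_unbounded)
  show ?thesis
  proof (rule ccontr)
    assume "\<not> V \<subseteq> C"
    then have "- C \<inter> V \<noteq> {}" by blast
    moreover have "- C \<inter> frontier V = {}" using fr by blast
    ultimately have "- C - V = {}" using connected_Int_frontier[OF conn] by blast
    then have "- C \<subseteq> V" by blast
    then show False using unb V bounded_subset by blast
  qed
qed

lemma qcmap_inverse_expansion:
  assumes q: "qcmap f K Z a m"
  obtains r G \<alpha> C where "0 < r" "0 \<le> C" "G holomorphic_on ball 0 r"
    "\<And>t. t \<in> ball 0 r \<Longrightarrow> cmod (deriv G t) \<le> C * cmod t"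
    "\<And>t. t \<in> ball 0 r \<Longrightarrow> cmod (G t) \<le> C * (cmod t)\<^sup>2"
    "\<And>w. 1 / r < cmod w \<Longrightarrow> inv f w = w + \<alpha> / w + G (1 / w)"
proof -
  obtain r g where r: "0 < r" and g: "g holomorphic_on ball 0 r" "g 0 = 0"
    and h: "\<And>w. 1 / r < cmod w \<Longrightarrow> inv f w = w + g (1 / w)"
    using qcmap_inverse_asymptotics[OF q] by blast
  obtain C \<alpha> where C: "0 \<le> C"
    and d: "\<And>t. cmod t \<le> r / 2 \<Longrightarrow> cmod (deriv (\<lambda>t. g t - \<alpha> * t) t) \<le> C * cmod t"
      "\<And>t. cmod t \<le> r / 2 \<Longrightarrow> cmod (g t - \<alpha> * t) \<le> C * (cmod t)\<^sup>2"
    using holomorphic_quadratic_remainder[OF g(1) r g(2)] by metis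
  have sub: "ball 0 (r / 2) \<subseteq> ball (0::complex) r" using r by auto
  show thesis
  proof (rule that)
    show "(\<lambda>t. g t - \<alpha> * t) holomorphic_on ball 0 (r / 2)"
      by (intro holomorphic_intros holomorphic_on_subset[OF g(1) sub])
    fix w assume w: "1 / (r / 2) < cmod w"
    have "1 / r < 1 / (r / 2)" using r by (simp add: field_simps)
    then show "inv f w = w + \<alpha> / w + (g (1 / w) - \<alpha> * (1 / w))" using h[of w] w by simp
  qed (use r C d in auto)
qed

text \<open>The explicit inverse \<open>(x - \<nu> * cnj x) / (1 - (cmod \<nu>)^2)\<close> has
  numerator at most \<open>3/2 * cmod x\<close> and denominator at least \<open>3/4\<close>, whence
  the factor 2.\<close>

lemma beltrami_right_inverse_bound:
  assumes \<nu>: "cmod \<nu> \<le> 1 / 2"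
  obtains y where "y + \<nu> * cnj y = x" "cmod y \<le> 2 * cmod x"
proof -
  define d where "d = 1 - (cmod \<nu>)\<^sup>2"
  have "(cmod \<nu>)\<^sup>2 \<le> (1 / 2)\<^sup>2" by (rule power_mono[OF \<nu>]) simp
  then have d: "3 / 4 \<le> d" by (simp add: d_def power2_eq_square)
  have dc: "complex_of_real d = 1 - \<nu> * cnj \<nu>"
    unfolding d_def of_real_diff complex_norm_square by simp
  have d0: "complex_of_real d \<noteq> 0" using d by auto
  define y where "y = (x - \<nu> * cnj x) / of_real d"
  have "y + \<nu> * cnj y = ((x - \<nu> * cnj x) + \<nu> * cnj (x - \<nu> * cnj x)) / of_real d"
    by (simp add: y_def add_divide_distrib)
  also have "(x - \<nu> * cnj x) + \<nu> * cnj (x - \<nu> * cnj x) = of_real d * x"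
    unfolding dc by (simp add: algebra_simps)
  finally have "y + \<nu> * cnj y = x" using d0 by simp
  moreover have "cmod y \<le> 2 * cmod x"
  proof -
    have "cmod (x - \<nu> * cnj x) \<le> cmod x + cmod \<nu> * cmod x"
      using norm_triangle_ineq4[of x "\<nu> * cnj x"] by (simp add: norm_mult)
    also have "\<dots> \<le> cmod x + 1 / 2 * cmod x" by (intro add_mono mult_right_mono \<nu>) auto
    finally have "cmod (x - \<nu> * cnj x) \<le> 3 / 2 * cmod x" by simp
    moreover have "cmod y * d = cmod (x - \<nu> * cnj x)" using d by (simp add: y_def norm_divide)
    moreover have "cmod y * (3 / 4) \<le> cmod y * d" by (intro mult_left_mono d) simp
    ultimately show ?thesis by linarith
  qed
  ultimately show thesis by (rule that)
qed

lemma measure_beltrami_image_cball: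
  assumes \<nu>: "cmod \<nu> < 1" and \<rho>: "0 \<le> \<rho>"
  defines "T \<equiv> \<lambda>v. v + \<nu> * cnj v"
  shows "T ` cball 0 \<rho> \<in> lmeasurable"
    and "measure lebesgue (T ` cball 0 \<rho>) = (1 - (cmod \<nu>)\<^sup>2) * (pi * \<rho>\<^sup>2)"
proof -
  have lin: "linear T" unfolding T_def by (rule linear_beltrami')
  have der: "(T has_derivative (\<lambda>v. 1 * v + \<nu> * cnj v)) (at x within cball 0 \<rho>)" for x
    using bounded_linear.has_derivative[OF linear_conv_bounded_linear[THEN iffD1, OF lin] has_derivative_ident]
    by (simp add: T_def)
  have "x = 0" if "T x = 0" for x
  proof (rule ccontr)
    assume "x \<noteq> 0"
    then have "cmod (\<nu> * cnj x) < cmod x" using \<nu> by (simp add: norm_mult)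
    moreover have "x = - (\<nu> * cnj x)" using that by (simp add: T_def add_eq_0_iff2)
    then have "cmod x = cmod (\<nu> * cnj x)" by (metis norm_minus_cancel)
    ultimately show False by simp
  qed
  then have inj: "inj_on T (cball 0 \<rho>)"
    using linear_injective_0[OF lin] by (blast intro: inj_on_subset)
  show m: "T ` cball 0 \<rho> \<in> lmeasurable"
    by (intro lmeasurable_compact compact_continuous_image linear_continuous_on compact_cball
        linear_conv_bounded_linear[THEN iffD1, OF lin])
  define \<kappa> where "\<kappa> = 1 - (cmod \<nu>)\<^sup>2"
  have \<kappa>: "0 < \<kappa>" using \<nu> by (simp add: \<kappa>_def abs_square_less_1)
  have "(\<lambda>x. 1::real) absolutely_integrable_on T ` cball 0 \<rho> \<and>
      integral (T ` cball 0 \<rho>) (\<lambda>x. 1::real) = \<kappa> * (pi * \<rho>\<^sup>2)"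
  proof (rule absolutely_integrable_change_of_variables_complex
        [where \<phi>="\<lambda>_. 1" and a="\<lambda>_. 1" and b="\<lambda>_. \<nu>" and g=T and S="cball 0 \<rho>", THEN iffD1])
    have "\<bar>(cmod 1)\<^sup>2 - (cmod \<nu>)\<^sup>2\<bar> = \<kappa>" using \<kappa> by (simp add: \<kappa>_def)
    moreover have "(\<lambda>x. \<kappa> * 1) absolutely_integrable_on cball (0::complex) \<rho>"
      by (intro set_integrable_mult_right absolutely_integrable_on_const lmeasurable_cball)
    moreover have "integral (cball (0::complex) \<rho>) (\<lambda>x. \<kappa> * 1) = \<kappa> * (pi * \<rho>\<^sup>2)"
      using measure_cball_complex[of \<rho> 0] \<rho> lmeasure_integral[OF lmeasurable_cball[of "0::complex" \<rho>]]
      by (subst integral_mult_right) simp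
    ultimately show "(\<lambda>x. \<bar>(cmod 1)\<^sup>2 - (cmod \<nu>)\<^sup>2\<bar> * 1) absolutely_integrable_on cball (0::complex) \<rho> \<and>
        integral (cball (0::complex) \<rho>) (\<lambda>x. \<bar>(cmod 1)\<^sup>2 - (cmod \<nu>)\<^sup>2\<bar> * 1) = \<kappa> * (pi * \<rho>\<^sup>2)"
      by simp
  qed (use der inj in simp_all)
  then show "measure lebesgue (T ` cball 0 \<rho>) = (1 - (cmod \<nu>)\<^sup>2) * (pi * \<rho>\<^sup>2)"
    using lmeasure_integral[OF m] by (simp add: \<kappa>_def)
qed

text \<open>On the circle of radius \<open>R\<close> the inverse map is, up to \<open>C / R\<^sup>2\<close>, the linear map
  \<open>v + \<nu> * cnj v\<close>, so the image of the disc lies in the image of a slightly larger disc under this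
  linear map.\<close>

lemma qcmap_inverse_image_ball:
  assumes q: "qcmap f K Z a m" and R: "0 < R" and C: "0 \<le> C" and \<alpha>: "cmod (\<alpha> / of_real (R\<^sup>2)) \<le> 1 / 2"
    and h: "\<And>w. cmod w = R \<Longrightarrow> cmod (inv f w - (w + \<alpha> / w)) \<le> C / R\<^sup>2"
  shows "open (inv f ` ball 0 R)" "inv f ` ball 0 R \<in> lmeasurable"
    "measure lebesgue (inv f ` ball 0 R) \<le> (1 - (cmod (\<alpha> / of_real (R\<^sup>2)))\<^sup>2) * (pi * (R + 2 * C / R\<^sup>2)\<^sup>2)"
proof -
  note qc = qcmapD[OF q]
  obtain M where M: "\<And>x y. dist (f x) (f y) \<le> M * dist x y" "\<And>x y. dist x y \<le> M * dist (f x) (f y)"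
    using qc(2) by blast
  have fh: "f (inv f w) = w" for w using qc(1) by (simp add: bij_is_surj surj_f_inv_f)
  have hf: "inv f (f z) = z" for z using qc(1) by (simp add: bij_is_inj)
  have hl: "dist (inv f x) (inv f y) \<le> M * dist x y" for x y using M(2)[of "inv f x" "inv f y"] by (simp add: fh)
  define V where "V = inv f ` ball 0 R"
  have "V = f -` ball 0 R" unfolding V_def
  proof (intro equalityI subsetI)
    fix z assume "z \<in> f -` ball 0 R"
    then show "z \<in> inv f ` ball 0 R" using hf[of z, symmetric] by blast
  qed (auto simp: fh)
  then have op: "open V" using open_vimage[OF open_ball lipschitz_continuous_on[OF M(1)]] by simp
  then show "open (inv f ` ball 0 R)" by (simp add: V_def)
  have cpt: "compact (inv f ` cball 0 R)"
    by (intro compact_continuous_image lipschitz_continuous_on[OF hl] compact_cball)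
  have "V \<subseteq> inv f ` cball 0 R" unfolding V_def by auto
  then have bdd: "bounded V" and cl: "closure V \<subseteq> inv f ` cball 0 R"
    by (rule bounded_subset[OF compact_imp_bounded[OF cpt]], rule closure_minimal[OF _ compact_imp_closed[OF cpt]])
  show meas: "inv f ` ball 0 R \<in> lmeasurable" using lmeasurable_open[OF bdd op] by (simp add: V_def)
  define \<nu> where "\<nu> = \<alpha> / of_real (R\<^sup>2)"
  define T where "T = (\<lambda>v. v + \<nu> * cnj v)"
  define \<rho> where "\<rho> = R + 2 * C / R\<^sup>2"
  have \<rho>: "0 \<le> \<rho>" using R C by (simp add: \<rho>_def)
  have lin: "linear T" unfolding T_def by (rule linear_beltrami')
  have \<nu>: "cmod \<nu> \<le> 1 / 2" "cmod \<nu> < 1" using \<alpha> by (auto simp: \<nu>_def)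
  have "V \<subseteq> T ` cball 0 \<rho>"
  proof (rule bounded_subset_convex_if_frontier_subset[OF _ bdd])
    show "convex (T ` cball 0 \<rho>)" by (intro convex_linear_image lin convex_cball)
    show "bounded (T ` cball 0 \<rho>)" by (intro bounded_linear_image linear_conv_bounded_linear[THEN iffD1, OF lin]) simp
    show "frontier V \<subseteq> T ` cball 0 \<rho>"
    proof
      fix z assume "z \<in> frontier V"
      then have "z \<in> inv f ` cball 0 R" "z \<notin> V" using cl op by (auto simp: frontier_def interior_open)
      then obtain w where w: "z = inv f w" "cmod w = R" by (force simp: V_def)
      \<comment> \<open>On this circle \<open>1 / w = cnj w / R^2\<close>, so the term
        \<open>\<alpha> / w\<close> becomes real-linear in \<open>w\<close>.\<close>
      have "w * cnj w = complex_of_real (R\<^sup>2)" using w(2) complex_norm_square[of w] by simp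
      moreover have "w \<noteq> 0" using w(2) R by auto
      ultimately have "\<alpha> / w = \<nu> * cnj w" unfolding \<nu>_def using R by (simp add: field_simps)
      then have "cmod (z - T w) \<le> C / R\<^sup>2" using h[OF w(2)] by (simp add: w(1) T_def)
      \<comment> \<open>The error of \<open>z\<close> is moved into the argument:
        \<open>z = T (w + y)\<close> with \<open>cmod y \<le> 2 * C / R^2\<close>, the excess of
        \<rho> over \<open>R\<close>.\<close>
      moreover obtain y where y: "T y = z - T w" "cmod y \<le> 2 * cmod (z - T w)"
        using beltrami_right_inverse_bound[OF \<nu>(1)] unfolding T_def by blast
      ultimately have "cmod (w + y) \<le> \<rho>"
        using norm_triangle_ineq[of w y] w(2) by (simp add: \<rho>_def)
      moreover have "T (w + y) = z" using y(1) by (simp add: linear_add[OF lin])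
      ultimately show "z \<in> T ` cball 0 \<rho>" by (intro image_eqI[of _ _ "w + y"]) auto
    qed
  qed simp
  then have "measure lebesgue V \<le> measure lebesgue (T ` cball 0 \<rho>)"
    using meas measure_beltrami_image_cball(1)[OF \<nu>(2) \<rho>] unfolding T_def V_def
    by (intro measure_mono_fmeasurable) (auto simp: fmeasurableD)
  also have "\<dots> = (1 - (cmod \<nu>)\<^sup>2) * (pi * \<rho>\<^sup>2)"
    unfolding T_def by (rule measure_beltrami_image_cball(2)[OF \<nu>(2) \<rho>])
  finally show "measure lebesgue (inv f ` ball 0 R) \<le> (1 - (cmod (\<alpha> / of_real (R\<^sup>2)))\<^sup>2) * (pi * (R + 2 * C / R\<^sup>2)\<^sup>2)"
    by (simp add: V_def \<nu>_def \<rho>_def)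
qed

subsection \<open>Comparison with the linear map on large discs\<close>

lemma linear_complex_expand:
  assumes "linear (g :: complex \<Rightarrow> real)" shows "g v = Re v * g 1 + Im v * g \<i>"
proof -
  have "g (Re v *\<^sub>R 1 + Im v *\<^sub>R \<i>) = Re v * g 1 + Im v * g \<i>"
    by (simp only: linear_add[OF assms] linear_cmul[OF assms] real_scaleR_def)
  moreover have "Re v *\<^sub>R 1 + Im v *\<^sub>R \<i> = v" by (simp add: complex_eq_iff)
  ultimately show ?thesis by simp
qed

text \<open>\<open>F\<close> is the competitor on the plane, equal to the linear map
  \<open>l\<close> off \<Omega>; \<open>f\<close> with \<open>K Z a m\<close> is the
  reparametrization with Lipschitz constant \<open>L\<close>; and \<open>r G C \<alpha>\<close>
  describe its inverse near infinity. By \<open>l_minimal\<close> no composition of \<open>l\<close>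
  with a map of determinant 1 has less energy than \<open>l\<close>. The lower bound
  \<open>c\<close> later converts an additive error into a multiplicative one.\<close>

locale comparison_map =
  fixes I :: "(real^2 \<Rightarrow> real) \<Rightarrow> real" and n :: nat and N :: "(nat \<Rightarrow> real) \<Rightarrow> real"
    and l :: "nat \<Rightarrow> complex \<Rightarrow> real" and F :: "nat \<Rightarrow> complex \<Rightarrow> real"
    and DF :: "nat \<Rightarrow> complex \<Rightarrow> complex \<Rightarrow> real" and \<Omega> :: "complex set" and c M :: real
    and f :: "complex \<Rightarrow> complex" and K Z :: "complex set" and a m :: "complex \<Rightarrow> complex" and L :: real
    and G :: "complex \<Rightarrow> complex" and r C :: real and \<alpha> :: complex
  assumes energy: "definition_of_energy I" and qc: "quasi_convex I" and N: "norm_on_Rn n N"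
    and l: "\<And>i. i < n \<Longrightarrow> linear (l i)" and l_bound: "\<And>i v. i < n \<Longrightarrow> \<bar>l i v\<bar> \<le> M * cmod v"
    and F_lip: "\<And>i x y. i < n \<Longrightarrow> \<bar>F i x - F i y\<bar> \<le> M * cmod (x - y)"
    and F_outside: "\<And>i z. i < n \<Longrightarrow> z \<notin> \<Omega> \<Longrightarrow> F i z = l i z"
    and DF: "\<And>i z. i < n \<Longrightarrow> z \<notin> frontier \<Omega> \<Longrightarrow> (F i has_derivative DF i z) (at z)"
    and DF_cont: "\<And>i v. i < n \<Longrightarrow> continuous_on (- frontier \<Omega>) (\<lambda>z. DF i z v)"
    and DF_outside: "\<And>i z. i < n \<Longrightarrow> z \<notin> closure \<Omega> \<Longrightarrow> DF i z = l i"
    and \<Omega>: "open \<Omega>" "bounded \<Omega>" "negligible (frontier \<Omega>)"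
    and c: "0 < c" "\<And>z v. z \<notin> frontier \<Omega> \<Longrightarrow> c * cmod v \<le> pull_norm n N (\<lambda>i. DF i z) v"
    and M: "0 \<le> M"
    and l_minimal: "plane_energy.jac (to_plane I) (pull_norm n N l) = to_plane I (pull_norm n N l)"
    and q: "qcmap f K Z a m" and K\<Omega>: "K \<subseteq> \<Omega>"
    and L: "0 < L" "\<And>x y. dist (f x) (f y) \<le> L * dist x y" "\<And>x y. dist x y \<le> L * dist (f x) (f y)"
    and r: "0 < r" and C: "0 \<le> C" and G: "G holomorphic_on ball 0 r"
    and G1: "\<And>t. t \<in> ball 0 r \<Longrightarrow> cmod (deriv G t) \<le> C * cmod t"
    and G0: "\<And>t. t \<in> ball 0 r \<Longrightarrow> cmod (G t) \<le> C * (cmod t)\<^sup>2"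
    and inv_f: "\<And>w. 1 / r < cmod w \<Longrightarrow> inv f w = w + \<alpha> / w + G (1 / w)"
    and integrable: "(\<lambda>z. plane_energy.qd (to_plane I) (pull_norm n N (\<lambda>i. DF i z)) (- m z)) absolutely_integrable_on \<Omega> - Z"
begin

sublocale plane_energy "to_plane I" by (rule plane_energy_to_plane[OF energy])

abbreviation "J \<equiv> to_plane I"
abbreviation "h \<equiv> inv f"
abbreviation "sl \<equiv> pull_norm n N l"

definition "st z = pull_norm n N (\<lambda>i. DF i z)"
definition "Zt = Z \<union> frontier \<Omega>"
definition "e z = qd (st z) (- m z)"
text \<open>\<open>b z\<close> and \<open>b' z\<close> are the coefficients of the derivative of
  \<open>h\<close> at the point \<open>f z\<close>, in the form given by
  \<open>has_derivative_inverse_beltrami\<close>.\<close>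

definition "b z = cnj (a z) / of_real ((cmod (a z))\<^sup>2 * (1 - (cmod (m z))\<^sup>2))"
definition "b' z = - (a z * m z) / of_real ((cmod (a z))\<^sup>2 * (1 - (cmod (m z))\<^sup>2))"

lemma fh: "f (h w) = w" and hf: "h (f z) = z"
  using qcmapD(1)[OF q] by (auto simp: bij_is_surj surj_f_inv_f bij_is_inj)

lemma h_lip: "cmod (h x - h y) \<le> L * cmod (x - y)"
  using L(3)[of "h x" "h y"] by (simp add: fh dist_norm)

lemma h_cont: "continuous_on S h"
  by (rule lipschitz_continuous_on[where M=L]) (use h_lip in \<open>auto simp: dist_norm\<close>)

lemma inverse_derivative:
  assumes "h w \<notin> Z"
  shows "(h has_derivative (\<lambda>v. b (h w) * v + b' (h w) * cnj v)) (at w)"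
    and "cmod (b' (h w)) < cmod (b (h w))" and "b' (h w) / cnj (b (h w)) = - m (h w)"
proof -
  note qc = qcmapD(8-10)[OF q assms]
  have cont: "continuous (at w) h"
    using h_cont[of UNIV] by (simp add: continuous_on_eq_continuous_at)
  note * = has_derivative_inverse_beltrami[where h=h and w=w, OF qc cont fh, folded b_def b'_def]
  show "(h has_derivative (\<lambda>v. b (h w) * v + b' (h w) * cnj v)) (at w)" by (rule *(1))
  show "b' (h w) / cnj (b (h w)) = - m (h w)" by (rule *(4))
  have "0 < (cmod (b (h w)))\<^sup>2 - (cmod (b' (h w)))\<^sup>2" 
    by (rule less_le_trans[OF divide_pos_pos[OF zero_less_one *(2)] eq_refl[OF *(3)[symmetric]]])
  then have "(cmod (b' (h w)))\<^sup>2 < (cmod (b (h w)))\<^sup>2" by (rule diff_gt_0_iff_gt[THEN iffD1])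
  then show "cmod (b' (h w)) < cmod (b (h w))" by (rule power2_less_imp_less[OF _ norm_ge_zero])
qed

lemma b_cont: "continuous_on (- Z) b" "continuous_on (- Z) b'"
proof -
  have "complex_of_real ((cmod (a z))\<^sup>2 * (1 - (cmod (m z))\<^sup>2)) \<noteq> 0" if "z \<in> - Z" for z
  proof -
    have "(cmod (m z))\<^sup>2 < 1" using qcmapD(10)[OF q, of z] that by (simp add: abs_square_less_1)
    then have "(cmod (a z))\<^sup>2 * (1 - (cmod (m z))\<^sup>2) \<noteq> 0" using qcmapD(9)[OF q, of z] that by simp
    then show ?thesis unfolding of_real_eq_0_iff .
  qed
  then have ne: "\<forall>z\<in>- Z. complex_of_real ((cmod (a z))\<^sup>2 * (1 - (cmod (m z))\<^sup>2)) \<noteq> 0" by blast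
  show "continuous_on (- Z) b" "continuous_on (- Z) b'"
    unfolding b_def b'_def by (rule continuous_on_divide[OF _ _ ne]; intro continuous_intros qcmapD(11,12)[OF q])+
qed

text \<open>The derivative of \<open>f\<close> inverts that of \<open>h\<close>, and its norm is at
  most the Lipschitz constant \<open>L\<close> of \<open>f\<close>.\<close>

lemma inverse_derivative_lower_bound:
  assumes "h w \<notin> Z" shows "cmod v \<le> L * cmod (b (h w) * v + b' (h w) * cnj v)"
proof -
  define v' where "v' = b (h w) * v + b' (h w) * cnj v"
  define D where "D = (\<lambda>v. a (h w) * (v + m (h w) * cnj v))"
  have D: "(f has_derivative D) (at (h w))" unfolding D_def by (rule qcmapD(8)[OF q assms])
  have "((\<lambda>w. f (h w)) has_derivative (\<lambda>v. D (b (h w) * v + b' (h w) * cnj v))) (at w)"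
    by (rule has_derivative_compose[OF inverse_derivative(1)[OF assms] D])
  then have "((\<lambda>w. w) has_derivative (\<lambda>v. D (b (h w) * v + b' (h w) * cnj v))) (at w)"
    unfolding fh .
  from fun_cong[OF has_derivative_unique[OF this has_derivative_ident], of v]
  have Dv: "D v' = v" unfolding v'_def .
  \<comment> \<open>\<open>derivative_bound_from_lipschitz\<close> concerns real-valued functions,
    so \<open>f\<close> is paired with a fixed vector, later taken to be the image of the derivative
    itself.\<close>
  have "\<bar>(cnj v \<bullet> D v')\<bar> \<le> (L * cmod v) * cmod v'" for v v'
  proof (rule derivative_bound_from_lipschitz)
    show "((\<lambda>z. cnj v \<bullet> f z) has_derivative (\<lambda>x. cnj v \<bullet> D x)) (at (h w))"
      by (intro has_derivative_inner_right D)
    fix x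
    have "\<bar>cnj v \<bullet> f x - cnj v \<bullet> f (h w)\<bar> \<le> cmod (cnj v) * cmod (f x - f (h w))"
      using Cauchy_Schwarz_ineq2[of "cnj v" "f x - f (h w)"] by (simp add: inner_diff_right)
    also have "\<dots> \<le> cmod (cnj v) * (L * cmod (x - h w))"
      using L(2)[of x "h w"] by (intro mult_left_mono) (auto simp: dist_norm)
    finally show "\<bar>cnj v \<bullet> f x - cnj v \<bullet> f (h w)\<bar> \<le> L * cmod v * cmod (x - h w)" by (simp add: mult_ac)
  qed
  from this[of "cnj v" v'] have "cmod v * cmod v \<le> cmod v * (L * cmod v')"
    by (simp add: Dv dot_square_norm power2_eq_square mult_ac)
  then have "cmod v \<le> L * cmod v'"
    by (cases "v = 0") (use L(1) in auto)
  then show ?thesis by (simp add: v'_def)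
qed

lemma st_cseminorm: "z \<notin> frontier \<Omega> \<Longrightarrow> st z \<in> cseminorms"
  unfolding st_def by (rule pull_norm_cseminorm[OF N]) (rule has_derivative_linear[OF DF])

lemma sl_cseminorm: "sl \<in> cseminorms"
  by (rule pull_norm_cseminorm[OF N l])

lemma e_outside: "z \<notin> closure \<Omega> \<Longrightarrow> e z = J sl"
proof -
  assume z: "z \<notin> closure \<Omega>"
  have "st z = sl" unfolding st_def pull_norm_def trunc_def using DF_outside z by (auto intro!: ext arg_cong[of _ _ N])
  moreover have "z \<notin> K" using K\<Omega> z closure_subset by blast
  ultimately show ?thesis using qcmapD(13)[OF q] by (simp add: e_def qd_0)
qed

lemma Zt: "closed Zt" "negligible Zt"
  unfolding Zt_def using qcmapD(4,5)[OF q] \<Omega>(3) by auto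

context
  fixes R :: real
  assumes R: "1 / r < R" "f ` \<Omega> \<subseteq> ball 0 R"
begin

text \<open>The last term of \<open>u\<close> cancels the nonlinear part of the boundary values of the first one, see
  \<open>u_boundary\<close>.\<close>

definition "u i w = F i (h (of_real R * w)) / R - l i (G (cnj w / of_real R)) / R" for i w
text \<open>In the first term the factor \<open>R\<close> of the rescaled argument cancels the
  division by \<open>R\<close>; in the second the argument \<open>cnj w / R\<close> contributes a
  second division. The two together with \<open>cmod (deriv G t) \<le> C / R\<close> make the
  correction of order \<open>1 / R^3\<close>.\<close>

definition "Du i w v = DF i (h (of_real R * w)) (b (h (of_real R * w)) * v + b' (h (of_real R * w)) * cnj v)
    - l i (deriv G (cnj w / of_real R) * cnj v) / R\<^sup>2" for i w v
definition "H = (\<lambda>w. h (of_real R * w)) -` Zt"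

lemma R_pos: "0 < R"
  using R(1) r by (smt (verit) divide_pos_pos)

lemma arg_in_ball: "w \<in> cball 0 1 \<Longrightarrow> cnj w / of_real R \<in> ball 0 r" "w \<in> cball 0 1 \<Longrightarrow> cmod (cnj w / of_real R) \<le> 1 / R"
proof -
  assume w: "w \<in> cball 0 1"
  then show le: "cmod (cnj w / of_real R) \<le> 1 / R"
    using R_pos by (simp add: norm_divide divide_right_mono)
  have "1 / R < r" using R(1) R_pos r by (simp add: field_simps)
  then show "cnj w / of_real R \<in> ball 0 r" using le by simp
qed

lemma H: "closed H" "negligible H"
proof -
  have bij: "bij (\<lambda>w. h (of_real R * w))"
  proof (rule o_bij[where g="\<lambda>z. f z / of_real R"])
    show "(\<lambda>z. f z / of_real R) \<circ> (\<lambda>w. h (of_real R * w)) = id" using R_pos by (auto simp: fh fun_eq_iff)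
    show "(\<lambda>w. h (of_real R * w)) \<circ> (\<lambda>z. f z / of_real R) = id" using R_pos by (auto simp: hf fun_eq_iff)
  qed
  have cont: "continuous_on UNIV (\<lambda>w. h (of_real R * w))"
    by (intro continuous_on_compose2[OF h_cont[of UNIV]] continuous_intros) auto
  show "closed H" unfolding H_def by (rule closed_vimage[OF Zt(1) cont])
  show "negligible H" unfolding H_def
  proof (rule negligible_lipschitz_preimage[OF bij _ Zt(2)])
    fix x y
    have "R * cmod (x - y) = cmod (of_real R * x - of_real R * y)"
      unfolding right_diff_distrib[symmetric] norm_mult using R_pos by simp
    also have "\<dots> \<le> L * dist (h (of_real R * x)) (h (of_real R * y))"
      using L(2)[of "h (of_real R * x)" "h (of_real R * y)"] by (simp add: fh dist_norm)
    finally show "dist x y \<le> (L / R) * dist (h (of_real R * x)) (h (of_real R * y))"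
      using R_pos by (simp add: dist_norm field_simps)
  qed
qed

text \<open>On the unit circle \<open>1 / (R * w) = cnj w / R\<close>, so
  \<open>G (cnj w / R)\<close> equals the remainder in the expansion of \<open>h (R * w)\<close>.
  Unlike \<open>G (1 / (R * w))\<close>, it is defined on the whole disc.\<close>

lemma u_boundary: "i < n \<Longrightarrow> cmod w = 1 \<Longrightarrow> u i w = l i (w + \<alpha> / of_real (R\<^sup>2) * cnj w)"
proof -
  assume i: "i < n" and w: "cmod w = 1"
  have "cmod (of_real R * w) = R" using w R_pos by (simp add: norm_mult)
  then have "h (of_real R * w) \<notin> \<Omega>" using R(2) fh[of "of_real R * w"] by fastforce
  moreover have "w * cnj w = 1" using w complex_norm_square[of w] by simp
  then have "1 / w = cnj w" using w by (metis nonzero_eq_divide_eq mult.commute norm_zero zero_neq_one)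
  then have inv: "1 / (of_real R * w) = cnj w / of_real R"
    by (metis divide_divide_eq_left mult.commute)
  have "\<alpha> / (of_real R * w) = \<alpha> * (1 / (of_real R * w))" by simp
  then have "h (of_real R * w) = of_real R * w + \<alpha> / of_real R * cnj w + G (cnj w / of_real R)"
    using inv_f[of "of_real R * w"] R(1) \<open>cmod (of_real R * w) = R\<close> unfolding inv by simp
  ultimately have "u i w = (l i (of_real R * w + \<alpha> / of_real R * cnj w + G (cnj w / of_real R)) - l i (G (cnj w / of_real R))) / R"
    using F_outside[OF i] by (simp add: u_def diff_divide_distrib)
  also have "\<dots> = l i (of_real R * w + \<alpha> / of_real R * cnj w) / R"
    by (simp add: linear_add[OF l[OF i]])
  also have "of_real R * w + \<alpha> / of_real R * cnj w = R *\<^sub>R (w + \<alpha> / of_real (R\<^sup>2) * cnj w)"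
    using R_pos by (simp add: scaleR_conv_of_real field_simps power2_eq_square)
  finally show ?thesis using R_pos by (simp add: linear_cmul[OF l[OF i]])
qed

lemma u_lipschitz:
  assumes i: "i < n" and xy: "x \<in> cball 0 1" "y \<in> cball 0 1"
  shows "\<bar>u i x - u i y\<bar> \<le> (M * L + M * (C / R / R / R)) * cmod (x - y)"
proof -
  have "\<bar>F i (h (of_real R * x)) - F i (h (of_real R * y))\<bar> \<le> M * cmod (h (of_real R * x) - h (of_real R * y))"
    by (rule F_lip[OF i])
  also have "\<dots> \<le> M * (L * cmod (of_real R * x - of_real R * y))"
    by (intro mult_left_mono h_lip M)
  also have "cmod (of_real R * x - of_real R * y) = R * cmod (x - y)"
    unfolding right_diff_distrib[symmetric] norm_mult using R_pos by simp
  finally have 1: "\<bar>F i (h (of_real R * x)) / R - F i (h (of_real R * y)) / R\<bar> \<le> M * L * cmod (x - y)"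
    using R_pos unfolding diff_divide_distrib[symmetric] abs_divide by (simp add: field_simps)
  have "1 / R < r" using R(1) R_pos r by (simp add: field_simps)
  then have sub: "cball 0 (1 / R) \<subseteq> ball (0::complex) r" by auto
  have "cmod (G (cnj x / of_real R) - G (cnj y / of_real R)) \<le> (C / R) * cmod (cnj x / of_real R - cnj y / of_real R)"
  proof (rule field_differentiable_bound[where S="cball 0 (1 / R)" and f'="deriv G"])
    fix t :: complex assume t: "t \<in> cball 0 (1 / R)"
    then have t': "t \<in> ball 0 r" using sub by blast
    show "(G has_field_derivative deriv G t) (at t within cball 0 (1 / R))"
      by (rule has_field_derivative_at_within[OF holomorphic_derivI[OF G open_ball t']])
    have "C * cmod t \<le> C * (1 / R)" using t by (intro mult_left_mono C) simp
    then show "cmod (deriv G t) \<le> C / R" using G1[OF t'] by simp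
  qed (use arg_in_ball(2) xy in auto)
  also have "cmod (cnj x / of_real R - cnj y / of_real R) = cmod (x - y) / R"
    unfolding diff_divide_distrib[symmetric] complex_cnj_diff[symmetric] norm_divide complex_mod_cnj using R_pos by simp
  finally have "\<bar>l i (G (cnj x / of_real R) - G (cnj y / of_real R))\<bar> \<le> M * (C / R * (cmod (x - y) / R))"
    by (intro order_trans[OF l_bound[OF i]] mult_left_mono M)
  then have "\<bar>l i (G (cnj x / of_real R)) - l i (G (cnj y / of_real R))\<bar> / R \<le> M * (C / R * (cmod (x - y) / R)) / R"
    unfolding linear_diff[OF l[OF i]] using R_pos by (intro divide_right_mono) auto
  then have 2: "\<bar>l i (G (cnj x / of_real R)) / R - l i (G (cnj y / of_real R)) / R\<bar> \<le> M * (C / R / R / R) * cmod (x - y)"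
    using R_pos unfolding diff_divide_distrib[symmetric] abs_divide by (simp add: mult_ac)
  show ?thesis using 1 2 unfolding u_def distrib_right by linarith
qed

lemma Du:
  assumes i: "i < n" and w: "w \<in> ball 0 1 - H"
  shows "(u i has_derivative Du i w) (at w)"
proof -
  have Rw: "((\<lambda>w. of_real R * w) has_derivative (\<lambda>v. of_real R * v)) (at w)"
    by (auto intro!: derivative_eq_intros)
  have hw: "h (of_real R * w) \<notin> Z" "h (of_real R * w) \<notin> frontier \<Omega>" using w by (auto simp: H_def Zt_def)
  define z where "z = h (of_real R * w)"
  note lin = has_derivative_linear[OF DF[OF i hw(2)]]
  have "((\<lambda>w. F i (h (of_real R * w))) has_derivative (\<lambda>v. DF i z (b z * (of_real R * v) + b' z * cnj (of_real R * v)))) (at w)"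
    unfolding z_def
    by (rule has_derivative_compose[OF has_derivative_compose[OF Rw inverse_derivative(1)[OF hw(1)]] DF[OF i hw(2)]])
  moreover have "b z * (of_real R * v) + b' z * cnj (of_real R * v) = R *\<^sub>R (b z * v + b' z * cnj v)" for v
    by (simp add: scaleR_conv_of_real algebra_simps)
  ultimately have "((\<lambda>w. F i (h (of_real R * w))) has_derivative (\<lambda>v. R * DF i z (b z * v + b' z * cnj v))) (at w)"
    by (simp add: linear_cmul[OF lin, folded z_def])
  from has_derivative_divide'[OF this has_derivative_const[of R]]
  have 1: "((\<lambda>w. F i (h (of_real R * w)) / R) has_derivative (\<lambda>v. DF i z (b z * v + b' z * cnj v))) (at w)"
    using R_pos by simp
  have "((\<lambda>w. cnj w / of_real R) has_derivative (\<lambda>v. cnj v / of_real R)) (at w)"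
    by (intro bounded_linear_imp_has_derivative bounded_linear_compose[OF bounded_linear_divide bounded_linear_cnj])
  from has_derivative_compose[OF this holomorphic_derivI[OF G open_ball arg_in_ball(1), of w, unfolded has_field_derivative_def]]
  have "((\<lambda>w. G (cnj w / of_real R)) has_derivative (\<lambda>v. deriv G (cnj w / of_real R) * (cnj v / of_real R))) (at w)"
    using w by simp
  from bounded_linear.has_derivative[OF linear_conv_bounded_linear[THEN iffD1, OF l[OF i]] this]
  have "((\<lambda>w. l i (G (cnj w / of_real R))) has_derivative (\<lambda>v. l i (deriv G (cnj w / of_real R) * (cnj v / of_real R)))) (at w)" .
  moreover have "deriv G (cnj w / of_real R) * (cnj v / of_real R) = (1 / R) *\<^sub>R (deriv G (cnj w / of_real R) * cnj v)" for v
    by (simp add: scaleR_conv_of_real)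
  ultimately have "((\<lambda>w. l i (G (cnj w / of_real R))) has_derivative (\<lambda>v. l i (deriv G (cnj w / of_real R) * cnj v) / R)) (at w)"
    by (simp add: linear_cmul[OF l[OF i]])
  from has_derivative_divide'[OF this has_derivative_const[of R]]
  have 2: "((\<lambda>w. l i (G (cnj w / of_real R)) / R) has_derivative (\<lambda>v. l i (deriv G (cnj w / of_real R) * cnj v) / R\<^sup>2)) (at w)"
    using R_pos by (simp add: power2_eq_square)
  show ?thesis using has_derivative_diff[OF 1 2] unfolding u_def[abs_def] Du_def[abs_def] z_def .
qed

lemma Du_cont:
  assumes i: "i < n" shows "continuous_on (ball 0 1 - H) (\<lambda>w. Du i w v)"
proof -
  let ?S = "ball 0 1 - H" and ?z = "\<lambda>w. h (of_real R * w)"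
  have z: "continuous_on ?S ?z"
    by (intro continuous_on_compose2[OF h_cont[of UNIV]] continuous_intros) auto
  have im: "?z ` ?S \<subseteq> - Z" "?z ` ?S \<subseteq> - frontier \<Omega>" by (auto simp: H_def Zt_def)
  have D: "continuous_on ?S (\<lambda>w. DF i (?z w) v)" for v
    by (rule continuous_on_compose2[OF DF_cont[OF i] z im(2)])
  let ?B = "\<lambda>w. b (?z w) * v + b' (?z w) * cnj v"
  have B: "continuous_on ?S ?B"
    by (intro continuous_intros continuous_on_compose2[OF b_cont(1) z im(1)] continuous_on_compose2[OF b_cont(2) z im(1)])
  have "continuous_on ?S (\<lambda>w. Re (?B w) * DF i (?z w) 1 + Im (?B w) * DF i (?z w) \<i>)"
    by (rule continuous_on_add[OF continuous_on_mult[OF continuous_on_Re[OF B] D]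
          continuous_on_mult[OF continuous_on_Im[OF B] D]])
  moreover have "Re (?B w) * DF i (?z w) 1 + Im (?B w) * DF i (?z w) \<i> = DF i (?z w) (?B w)" if "w \<in> ?S" for w
  proof -
    have "?z w \<notin> frontier \<Omega>" using im(2) that by blast
    from linear_complex_expand[OF has_derivative_linear[OF DF[OF i this]]] show ?thesis by (rule sym)
  qed
  ultimately have 1: "continuous_on ?S (\<lambda>w. DF i (?z w) (?B w))" by (rule continuous_on_eq)
  have "continuous_on (ball 0 r) (deriv G)"
    by (intro holomorphic_on_imp_continuous_on holomorphic_deriv[OF G open_ball])
  moreover have "(\<lambda>w. cnj w / of_real R) ` ?S \<subseteq> ball 0 r" using arg_in_ball(1) by auto
  moreover have "continuous_on ?S (\<lambda>w. cnj w / of_real R)"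
    by (intro continuous_intros) (use R_pos in auto)
  ultimately have "continuous_on ?S (\<lambda>w. deriv G (cnj w / of_real R))"
    using continuous_on_compose2 by metis
  then have "continuous_on ?S (\<lambda>w. deriv G (cnj w / of_real R) * cnj v)"
    by (rule continuous_on_mult[OF _ continuous_on_const])
  from continuous_on_compose2[OF linear_continuous_on[OF linear_conv_bounded_linear[THEN iffD1, OF l[OF i]], of UNIV]
      this subset_UNIV]
  have 2: "continuous_on ?S (\<lambda>w. l i (deriv G (cnj w / of_real R) * cnj v))" .
  have "R\<^sup>2 \<noteq> 0" using R_pos by simp
  then show ?thesis unfolding Du_def
    by (intro continuous_on_diff[OF 1] continuous_on_divide[OF 2 continuous_on_const]) blast
qed

end
end

lemma absolutely_integrable_has_integral:
  fixes \<phi> :: "'a::euclidean_space \<Rightarrow> 'b::euclidean_space"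
  assumes "\<phi> absolutely_integrable_on S \<and> integral S \<phi> = y" shows "(\<phi> has_integral y) S"
  using integrable_integral[OF set_lebesgue_integral_eq_integral(1)[OF assms[THEN conjunct1]]] assms by simp

text \<open>After division by the squared factor, the terms quadratic in \<open>R\<close> cancel and
  the rest tends to 0: a relative error \<open>1 / R^3\<close> changes \<open>R^2\<close> by order
  \<open>1 / R\<close> only. The number \<open>k\<close> depends on \<open>R\<close>, but it
  multiplies a nonpositive quantity and may be replaced by 1.\<close>

lemma nonneg_by_expansion:
  fixes j x A B \<rho> :: real
  assumes j: "0 \<le> j" and A: "0 \<le> A" and B: "0 \<le> B"
    and le: "\<And>R. \<rho> \<le> R \<Longrightarrow> \<exists>k. 0 \<le> k \<and> k \<le> 1 \<and> pi * k * j * R\<^sup>2 \<le> (1 + A / R ^ 3)\<^sup>2 * (x + j * (k * (pi * (R + B / R\<^sup>2)\<^sup>2)))"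
  shows "0 \<le> x"
proof (rule tendsto_upperbound)
  have "((\<lambda>R. R\<^sup>2 / (1 + A / R ^ 3)\<^sup>2 - (R + B / R\<^sup>2)\<^sup>2) \<longlongrightarrow> 0) at_top" by real_asymp
  from tendsto_mult_left[OF this, of "pi * j"]
  show "((\<lambda>R. pi * j * (R\<^sup>2 / (1 + A / R ^ 3)\<^sup>2 - (R + B / R\<^sup>2)\<^sup>2)) \<longlongrightarrow> 0) at_top" by simp
  show "\<forall>\<^sub>F R in at_top. pi * j * (R\<^sup>2 / (1 + A / R ^ 3)\<^sup>2 - (R + B / R\<^sup>2)\<^sup>2) \<le> x"
    using eventually_ge_at_top[of "max \<rho> 1"]
  proof eventually_elim
    case (elim R)
    then have R: "\<rho> \<le> R" "1 \<le> R" by auto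
    obtain k where k: "0 \<le> k" "k \<le> 1"
      and est: "pi * k * j * R\<^sup>2 \<le> (1 + A / R ^ 3)\<^sup>2 * (x + j * (k * (pi * (R + B / R\<^sup>2)\<^sup>2)))"
      using le[OF R(1)] by blast
    define P where "P = (1 + A / R ^ 3)\<^sup>2"
    have "1 \<le> 1 + A / R ^ 3" using A R by simp
    then have P: "1 \<le> P" unfolding P_def by (rule one_le_power)
    define D where "D = R\<^sup>2 / P - (R + B / R\<^sup>2)\<^sup>2"
    have "R\<^sup>2 / P \<le> R\<^sup>2" using P by (simp add: divide_le_eq mult_le_cancel_left1)
    also have "\<dots> \<le> (R + B / R\<^sup>2)\<^sup>2" using B R by (intro power_mono) auto
    finally have D: "D \<le> 0" by (simp add: D_def)
    have "pi * k * j * R\<^sup>2 / P \<le> x + j * (k * (pi * (R + B / R\<^sup>2)\<^sup>2))"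
      using est P unfolding P_def[symmetric] by (simp add: divide_le_eq mult.commute)
    then have "k * (pi * j * D) \<le> x" by (simp add: D_def right_diff_distrib mult_ac)
    moreover have "pi * j * D \<le> k * (pi * j * D)"
      using mult_right_mono_neg[OF k(2), of "pi * j * D"] j D by (simp add: mult_nonneg_nonpos)
    ultimately show ?case unfolding D_def P_def by linarith
  qed
qed simp

section \<open>The energy inequality on discs of large radius\<close>

context comparison_map begin

definition "B = sl 1 + sl \<i>"

lemma B_nonneg: "0 \<le> B"
  unfolding B_def by (intro add_nonneg_nonneg cseminorm_nonneg sl_cseminorm)

context
  fixes R :: real
  assumes R: "1 / r < R" "f ` \<Omega> \<subseteq> ball 0 R"
begin

lemma image_image_ball: "(\<lambda>w. h (of_real R * w)) ` (ball 0 1 - H R) = h ` ball 0 R - Zt"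
proof (intro equalityI subsetI)
  fix z assume "z \<in> (\<lambda>w. h (of_real R * w)) ` (ball 0 1 - H R)"
  then obtain w where w: "z = h (of_real R * w)" "w \<in> ball 0 1" "w \<notin> H R" by blast
  have "of_real R * w \<in> ball 0 R" using w(2) R_pos[OF R] by (simp add: norm_mult)
  then show "z \<in> h ` ball 0 R - Zt" using w by (auto simp: H_def[OF R])
next
  fix z assume z: "z \<in> h ` ball 0 R - Zt"
  then obtain w where w: "z = h w" "cmod w < R" by auto
  have "z = h (of_real R * (w / of_real R))" "w / of_real R \<in> ball 0 1"
    using w R_pos[OF R] by (auto simp: norm_divide)
  then show "z \<in> (\<lambda>w. h (of_real R * w)) ` (ball 0 1 - H R)"
    using z by (intro image_eqI[of _ _ "w / of_real R"]) (auto simp: H_def[OF R])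
qed

text \<open>The additive correction is at most \<open>B * C / R^3 * cmod v\<close>. Since
  \<open>cmod v\<close> is at most \<open>L * cmod \<beta>\<close>, and \<open>cmod \<beta>\<close>
  at most \<open>st z \<beta> / c\<close>, it is absorbed as a relative error of the main
  term.\<close>

lemma seminorm_estimate:
  assumes w: "w \<in> ball 0 1 - H R"
  defines "z \<equiv> h (of_real R * w)"
  shows "pull_norm n N (\<lambda>i. Du R i w) v \<le> (1 + B * C * L / c / R ^ 3) * st z (b z * v + b' z * cnj v)"
proof -
  have Rp: "0 < R" by (rule R_pos[OF R])
  have z: "z \<notin> Z" "z \<notin> frontier \<Omega>" using w by (auto simp: z_def H_def[OF R] Zt_def)
  define \<beta> where "\<beta> = b z * v + b' z * cnj v"
  define t where "t = cnj w / of_real R"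
  have t: "t \<in> ball 0 r" "cmod t \<le> 1 / R" unfolding t_def using arg_in_ball[OF R] w by auto
  have "pull_norm n N (\<lambda>i. Du R i w) v = N (trunc n (\<lambda>i. DF i z \<beta> + (- (1 / R\<^sup>2)) * l i (deriv G t * cnj v)))"
    by (simp add: pull_norm_def Du_def[OF R] z_def \<beta>_def t_def)
  also have "\<dots> \<le> N (trunc n (\<lambda>i. DF i z \<beta>)) + N (trunc n (\<lambda>i. (- (1 / R\<^sup>2)) * l i (deriv G t * cnj v)))"
    by (rule trunc_add[OF N])
  also have "\<dots> = st z \<beta> + (1 / R\<^sup>2) * sl (deriv G t * cnj v)"
    unfolding trunc_scale[OF N] by (simp add: st_def pull_norm_def)
  also have "sl (deriv G t * cnj v) \<le> B * cmod (deriv G t * cnj v)"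
    unfolding B_def by (rule cseminorm_bound[OF sl_cseminorm])
  also have "cmod (deriv G t * cnj v) \<le> (C * (1 / R)) * (L / c * st z \<beta>)"
    unfolding norm_mult complex_mod_cnj
  proof (intro mult_mono)
    have "cmod (deriv G t) \<le> C * cmod t" by (rule G1[OF t(1)])
    also have "\<dots> \<le> C * (1 / R)" by (intro mult_left_mono t C)
    finally show "cmod (deriv G t) \<le> C * (1 / R)" .
    have "cmod v \<le> L * cmod \<beta>" unfolding \<beta>_def z_def
      by (rule inverse_derivative_lower_bound) (use z(1) z_def in simp)
    also have "cmod \<beta> \<le> st z \<beta> / c"
      unfolding st_def using c(2)[OF z(2), of \<beta>] c(1) by (simp add: field_simps)
    finally show "cmod v \<le> L / c * st z \<beta>" using L(1) by (simp add: mult_left_mono)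
  qed (use C Rp in auto)
  finally have "pull_norm n N (\<lambda>i. Du R i w) v \<le> st z \<beta> + (1 / R\<^sup>2) * (B * ((C * (1 / R)) * (L / c * st z \<beta>)))"
    using Rp B_nonneg by (simp add: mult_left_mono divide_right_mono)
  also have "\<dots> = (1 + B * C * L / c / R ^ 3) * st z \<beta>"
    by (simp add: field_simps power2_eq_square power3_eq_cube)
  finally show ?thesis by (simp add: \<beta>_def)
qed

lemma energy_estimate:
  assumes w: "w \<in> ball 0 1 - H R"
  defines "z \<equiv> h (of_real R * w)"
  shows "J (pull_norm n N (\<lambda>i. Du R i w)) \<le>
      (1 + B * C * L / c / R ^ 3)\<^sup>2 * (((cmod (b z))\<^sup>2 - (cmod (b' z))\<^sup>2) * e z)"
    and "0 \<le> (cmod (b z))\<^sup>2 - (cmod (b' z))\<^sup>2"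
proof -
  have z: "z \<notin> Z" "z \<notin> frontier \<Omega>" using w by (auto simp: z_def H_def[OF R] Zt_def)
  note st = st_cseminorm[OF z(2)]
  note inv = inverse_derivative(2,3)[of "of_real R * w", folded z_def, OF z(1)]
  have "J (pull_norm n N (\<lambda>i. Du R i w)) \<le> (1 + B * C * L / c / R ^ 3)\<^sup>2 * J (\<lambda>v. st z (b z * v + b' z * cnj v))"
  proof (rule mono_scale)
    show "(\<lambda>v. st z (b z * v + b' z * cnj v)) \<in> cseminorms" by (rule cseminorm_linear[OF st linear_beltrami])
    show "pull_norm n N (\<lambda>i. Du R i w) \<in> cseminorms"
      by (rule pull_norm_cseminorm[OF N]) (rule has_derivative_linear[OF Du[OF R _ w]])
    show "pull_norm n N (\<lambda>i. Du R i w) v \<le> (1 + B * C * L / c / R ^ 3) * st z (b z * v + b' z * cnj v)" for v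
      unfolding z_def by (rule seminorm_estimate[OF w])
    show "0 \<le> 1 + B * C * L / c / R ^ 3" using B_nonneg C L(1) c(1) R_pos[OF R] by simp
  qed
  then show "J (pull_norm n N (\<lambda>i. Du R i w)) \<le>
      (1 + B * C * L / c / R ^ 3)\<^sup>2 * (((cmod (b z))\<^sup>2 - (cmod (b' z))\<^sup>2) * e z)"
    unfolding J_beltrami(1)[OF st inv(1)] inv(2) e_def .
  have "(cmod (b' z))\<^sup>2 \<le> (cmod (b z))\<^sup>2" by (rule power_mono) (use inv(1) in auto)
  then show "0 \<le> (cmod (b z))\<^sup>2 - (cmod (b' z))\<^sup>2" by simp
qed

lemma image_ball:
  assumes \<alpha>: "cmod (\<alpha> / of_real (R\<^sup>2)) \<le> 1 / 2"
  shows "h ` ball 0 R \<in> lmeasurable"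
    and "measure lebesgue (h ` ball 0 R) \<le> (1 - (cmod (\<alpha> / of_real (R\<^sup>2)))\<^sup>2) * (pi * (R + 2 * C / R\<^sup>2)\<^sup>2)"
proof -
  have bd: "cmod (h w - (w + \<alpha> / w)) \<le> C / R\<^sup>2" if w: "cmod w = R" for w
  proof -
    have "cmod (1 / w) = 1 / R" using w by (simp add: norm_divide)
    moreover have "1 / R < r" using R(1) R_pos[OF R] r by (simp add: field_simps)
    ultimately have "cmod (G (1 / w)) \<le> C * (1 / R)\<^sup>2" using G0[of "1 / w"] by simp
    then show ?thesis using inv_f[of w] w R(1) by (simp add: power_divide)
  qed
  note * = qcmap_inverse_image_ball[OF q R_pos[OF R] C \<alpha> bd]
  show "h ` ball 0 R \<in> lmeasurable" by (rule *(2))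
  show "measure lebesgue (h ` ball 0 R) \<le> (1 - (cmod (\<alpha> / of_real (R\<^sup>2)))\<^sup>2) * (pi * (R + 2 * C / R\<^sup>2)\<^sup>2)"
    by (rule *(3))
qed

text \<open>Off the closure of \<Omega> the competitor is \<open>l\<close> and the reparametrization
  is conformal, so the density is the constant \<open>J sl\<close> and only the area
  matters.\<close>

lemma integral_energy_density:
  assumes V: "h ` ball 0 R \<in> lmeasurable"
  shows "e absolutely_integrable_on (h ` ball 0 R - Zt)"
    and "integral (h ` ball 0 R - Zt) e =
      integral (\<Omega> - Z) e + J sl * (measure lebesgue (h ` ball 0 R) - measure lebesgue \<Omega>)"
proof -
  define V where "V = h ` ball 0 R"
  have \<Omega>V: "\<Omega> \<subseteq> V"
  proof
    fix z assume "z \<in> \<Omega>"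
    then have "f z \<in> ball 0 R" using R(2) by blast
    then show "z \<in> V" unfolding V_def using hf[of z, symmetric] by blast
  qed
  have \<Omega>m: "\<Omega> \<in> lmeasurable" using \<Omega> by (simp add: lmeasurable_open)
  have W: "V - \<Omega> \<in> lmeasurable" using V \<Omega>m by (simp add: V_def fmeasurable_Diff)
  have ZK: "Z \<subseteq> \<Omega>" using qcmapD(6)[OF q] K\<Omega> by blast
  have fr: "frontier \<Omega> = closure \<Omega> - \<Omega>" using \<Omega>(1) by (simp add: frontier_def interior_open)
  have split: "V - Zt = (\<Omega> - Z) \<union> (V - \<Omega> - frontier \<Omega>)"
    using \<Omega>V ZK closure_subset[of \<Omega>] unfolding Zt_def fr by blast
  have disj: "(\<Omega> - Z) \<inter> (V - \<Omega> - frontier \<Omega>) = {}" by blast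
  have eq: "e z = J sl" if "z \<in> V - \<Omega> - frontier \<Omega>" for z
    by (rule e_outside) (use that fr in blast)
  have const: "((\<lambda>z. J sl * 1) has_integral J sl * measure lebesgue (V - \<Omega>)) (V - \<Omega>)"
    by (intro has_integral_mult_right has_integral_measure_lebesgue W)
  then have "((\<lambda>z. J sl * 1) has_integral J sl * measure lebesgue (V - \<Omega>)) (V - \<Omega> - frontier \<Omega>)"
    by (simp only: has_integral_Diff_negligible(1)[OF \<Omega>(3)])
  then have outer: "(e has_integral J sl * measure lebesgue (V - \<Omega>)) (V - \<Omega> - frontier \<Omega>)"
    by (rule has_integral_eq[rotated]) (simp add: eq)
  have "(\<lambda>z. J sl) absolutely_integrable_on (V - \<Omega> - frontier \<Omega>)"
    unfolding has_integral_Diff_negligible(2)[OF \<Omega>(3)] by (rule absolutely_integrable_on_const[OF W])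
  then have aouter: "e absolutely_integrable_on (V - \<Omega> - frontier \<Omega>)"
    by (rule absolutely_integrable_spike[of _ _ "{}"]) (auto simp: eq)
  have ainner: "e absolutely_integrable_on (\<Omega> - Z)" using integrable unfolding e_def st_def .
  show "e absolutely_integrable_on (h ` ball 0 R - Zt)"
    using set_integrable_Un[OF ainner aouter] ainner aouter
    unfolding V_def[symmetric] split by (simp add: absolutely_integrable_Un)
  have "(e has_integral integral (\<Omega> - Z) e) (\<Omega> - Z)"
    using ainner by (simp add: integrable_integral set_lebesgue_integral_eq_integral(1))
  from has_integral_Un[OF this outer] disj
  have "integral (V - Zt) e = integral (\<Omega> - Z) e + J sl * measure lebesgue (V - \<Omega>)"
    unfolding split by (intro integral_unique) simp
  moreover have "measure lebesgue (V - \<Omega>) = measure lebesgue V - measure lebesgue \<Omega>"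
    using V \<Omega>m \<Omega>V by (intro measurable_measure_Diff) (auto simp: V_def fmeasurableD)
  ultimately show "integral (h ` ball 0 R - Zt) e =
      integral (\<Omega> - Z) e + J sl * (measure lebesgue (h ` ball 0 R) - measure lebesgue \<Omega>)"
    by (simp add: V_def)
qed

text \<open>Quasi-convexity is applied to \<open>u R\<close> on the unit disc with linear boundary
  values \<open>l i (v + \<nu> * cnj v)\<close>. The resulting integral is moved to the image of
  \<open>ball 0 R\<close> by the substitution \<open>z = h (R * w)\<close>, under which the energy
  becomes the integral of the density \<open>e\<close>.\<close>

lemma comparison_at_radius:
  assumes \<alpha>: "cmod (\<alpha> / of_real (R\<^sup>2)) \<le> 1 / 2"
  shows "pi * (1 - (cmod (\<alpha> / of_real (R\<^sup>2)))\<^sup>2) * J sl * R\<^sup>2 \<le>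
    (1 + B * C * L / c / R ^ 3)\<^sup>2 *
      (integral (\<Omega> - Z) e + J sl * (measure lebesgue (h ` ball 0 R) - measure lebesgue \<Omega>))"
proof -
  have Rp: "0 < R" by (rule R_pos[OF R])
  define \<nu> where "\<nu> = \<alpha> / of_real (R\<^sup>2)"
  define S where "S = ball 0 1 - H R"
  define g where "g = (\<lambda>w. h (of_real R * w))"
  define d where "d = (\<lambda>w. (cmod (b (g w)))\<^sup>2 - (cmod (b' (g w)))\<^sup>2)"
  define P where "P = (1 + B * C * L / c / R ^ 3)\<^sup>2"
  have \<nu>: "cmod \<nu> < 1" using \<alpha> by (simp add: \<nu>_def)
  have Sl: "S \<in> sets lebesgue"
    unfolding S_def using H(1)[OF R] by (intro sets.Diff) auto
  have inj: "inj_on g S"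
  proof (rule inj_onI)
    fix x y assume "g x = g y"
    then have "of_real R * x = of_real R * y" unfolding g_def using fh by metis
    then show "x = y" using Rp by simp
  qed
  have der: "(g has_derivative (\<lambda>v. (of_real R * b (g w)) * v + (of_real R * b' (g w)) * cnj v)) (at w within S)"
    if w: "w \<in> S" for w
  proof -
    have z: "h (of_real R * w) \<notin> Z" using w by (auto simp: S_def H_def[OF R] Zt_def)
    have Rw: "((\<lambda>w. of_real R * w) has_derivative (\<lambda>v. of_real R * v)) (at w)"
      by (auto intro!: derivative_eq_intros)
    have "(\<lambda>v. b (g w) * (of_real R * v) + b' (g w) * cnj (of_real R * v)) =
        (\<lambda>v. (of_real R * b (g w)) * v + (of_real R * b' (g w)) * cnj v)"
      by (simp add: mult_ac)
    then show ?thesis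
      using has_derivative_at_withinI[OF has_derivative_compose[OF Rw inverse_derivative(1)[OF z]]]
      unfolding g_def by simp
  qed
  have V: "h ` ball 0 R \<in> lmeasurable" by (rule image_ball(1)[OF \<alpha>])
  note cv = absolutely_integrable_change_of_variables_complex[OF Sl der inj, of e "integral (h ` ball 0 R - Zt) e", THEN iffD2]
  have gS: "g ` S = h ` ball 0 R - Zt" unfolding g_def S_def by (rule image_image_ball)
  have abs: "\<bar>(cmod (of_real R * b (g w)))\<^sup>2 - (cmod (of_real R * b' (g w)))\<^sup>2\<bar> * e (g w) = R\<^sup>2 * (d w * e (g w))"
    if "w \<in> S" for w
  proof -
    have "0 \<le> d w" unfolding d_def g_def by (rule energy_estimate(2)) (use that S_def in simp)
    moreover have "(cmod (of_real R * b (g w)))\<^sup>2 - (cmod (of_real R * b' (g w)))\<^sup>2 = R\<^sup>2 * d w"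
      by (simp add: d_def norm_mult power_mult_distrib right_diff_distrib)
    ultimately show ?thesis by simp
  qed
  let ?X = "integral (h ` ball 0 R - Zt) e"
  have "(\<lambda>w. \<bar>(cmod (of_real R * b (g w)))\<^sup>2 - (cmod (of_real R * b' (g w)))\<^sup>2\<bar> * e (g w)) absolutely_integrable_on S \<and>
      integral S (\<lambda>w. \<bar>(cmod (of_real R * b (g w)))\<^sup>2 - (cmod (of_real R * b' (g w)))\<^sup>2\<bar> * e (g w)) = ?X"
    by (rule cv) (assumption, use gS integral_energy_density(1)[OF V] in simp)
  then have "((\<lambda>w. \<bar>(cmod (of_real R * b (g w)))\<^sup>2 - (cmod (of_real R * b' (g w)))\<^sup>2\<bar> * e (g w)) has_integral ?X) S"
    by (rule absolutely_integrable_has_integral)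
  then have "((\<lambda>w. R\<^sup>2 * (d w * e (g w))) has_integral ?X) S"
    by (rule has_integral_eq[rotated]) (rule abs)
  from has_integral_mult_right[OF this, of "P / R\<^sup>2"]
  have hi: "((\<lambda>w. P * (d w * e (g w))) has_integral P / R\<^sup>2 * ?X) S"
    using Rp by simp
  have M': "0 \<le> M * L + M * (C / R / R / R)" using M L(1) C Rp by simp
  have l\<nu>: "linear (\<lambda>v. l i (v + \<nu> * cnj v))" if "i < n" for i
    using linear_compose[OF linear_beltrami' l[OF that]] by (simp add: o_def)
  note qcl = quasi_convex_lipschitz[OF energy qc N l\<nu> M' u_lipschitz[OF R] _ H[OF R] Du[OF R] Du_cont[OF R], folded S_def]
  have bd: "u R i z = l i (z + \<nu> * cnj z)" if "i < n" "cmod z = 1" for i z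
    unfolding \<nu>_def by (rule u_boundary[OF R that])
  \<comment> \<open>Here minimality of \<open>l\<close> enters:
    \<open>qd sl \<nu> \<ge> jac sl = J sl\<close>, multiplied by the determinant
    \<open>1 - (cmod \<nu>)^2\<close>.\<close>
  have "(1 - (cmod \<nu>)\<^sup>2) * J sl \<le> J (\<lambda>v. sl (v + \<nu> * cnj v))"
  proof -
    have "J sl \<le> qd sl \<nu>" using jac_le_qd[OF sl_cseminorm \<nu>] l_minimal by simp
    then show ?thesis using \<nu> by (simp add: qd_def abs_square_less_1 field_simps)
  qed
  then have "pi * ((1 - (cmod \<nu>)\<^sup>2) * J sl) \<le> pi * J (pull_norm n N (\<lambda>i v. l i (v + \<nu> * cnj v)))"
    unfolding pull_norm_def by (intro mult_left_mono) auto
  also have "\<dots> \<le> integral S (\<lambda>w. J (pull_norm n N (\<lambda>i. Du R i w)))"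
    by (rule qcl(2)) (use bd in auto)
  also have "\<dots> \<le> integral S (\<lambda>w. P * (d w * e (g w)))"
  proof (rule integral_le)
    show "(\<lambda>w. J (pull_norm n N (\<lambda>i. Du R i w))) integrable_on S" by (rule qcl(1)) (use bd in auto)
    show "(\<lambda>w. P * (d w * e (g w))) integrable_on S" using hi by blast
    show "J (pull_norm n N (\<lambda>i. Du R i w)) \<le> P * (d w * e (g w))" if "w \<in> S" for w
      unfolding P_def d_def g_def by (rule energy_estimate(1)) (use that S_def in simp)
  qed
  also have "\<dots> = P / R\<^sup>2 * ?X" by (rule integral_unique[OF hi])
  finally have "pi * ((1 - (cmod \<nu>)\<^sup>2) * J sl) * R\<^sup>2 \<le> P * ?X"
    using Rp by (simp add: field_simps)
  then show ?thesis unfolding integral_energy_density(2)[OF V] P_def \<nu>_def by (simp add: mult_ac)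
qed

end

text \<open>Both sides of \<open>comparison_at_radius\<close> contain \<open>J sl\<close> times an
  area close to \<open>pi * R^2\<close>. The bound on the area of the image makes these cancel in
  the limit, leaving the integral over \<Omega> against the area of \<Omega>.\<close>

lemma area_le_energy: "J sl * measure lebesgue \<Omega> \<le> integral (\<Omega> - Z) e"
proof -
  have "bounded (f ` closure \<Omega>)"
    using \<Omega>(2) by (intro compact_imp_bounded compact_continuous_image lipschitz_continuous_on[OF L(2)]) (simp add: compact_closure)
  then obtain R1 where R1: "\<And>z. z \<in> f ` closure \<Omega> \<Longrightarrow> cmod z \<le> R1" unfolding bounded_iff by blast
  \<comment> \<open>The three entries ensure, in this order, that the expansion at infinity holds on
    the circle, that \<open>f\<close> maps \<Omega> into the disc, and that
    \<open>cmod \<nu> \<le> 1 / 2\<close>.\<close>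
  define R0 where "R0 = max (1 / r + 1) (max (R1 + 1) (2 * cmod \<alpha> + 1))"
  have Jsl: "0 \<le> J sl" by (rule nonneg[OF sl_cseminorm])
  have "0 \<le> integral (\<Omega> - Z) e - J sl * measure lebesgue \<Omega>"
  proof (rule nonneg_by_expansion[OF Jsl, where \<rho>=R0])
    show "0 \<le> B * C * L / c" using B_nonneg C L(1) c(1) by simp
    show "0 \<le> 2 * C" using C by simp
    fix R assume "R0 \<le> R"
    then have R: "1 / r + 1 \<le> R" "R1 + 1 \<le> R" "2 * cmod \<alpha> + 1 \<le> R" by (auto simp: R0_def)
    have R': "1 / r < R" using R(1) by simp
    have im: "f ` \<Omega> \<subseteq> ball 0 R"
    proof (rule image_subsetI)
      fix z assume "z \<in> \<Omega>"
      then have "cmod (f z) \<le> R1" using closure_subset by (intro R1) blast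
      then show "f z \<in> ball 0 R" using R(2) by simp
    qed
    define \<nu> where "\<nu> = \<alpha> / of_real (R\<^sup>2)"
    have R1: "1 \<le> R" using R(3) norm_ge_zero[of \<alpha>] by linarith
    then have "R \<le> R\<^sup>2" by (simp add: power2_eq_square)
    then have "2 * cmod \<alpha> \<le> R\<^sup>2" using R(3) by linarith
    then have \<nu>: "cmod \<nu> \<le> 1 / 2" unfolding \<nu>_def norm_divide norm_of_real using R1 by (simp add: field_simps)
    define k where "k = 1 - (cmod \<nu>)\<^sup>2"
    have k: "0 \<le> k" "k \<le> 1" using \<nu> abs_square_le_1[of "cmod \<nu>"] by (auto simp: k_def)
    have "pi * k * J sl * R\<^sup>2 \<le> (1 + B * C * L / c / R ^ 3)\<^sup>2 *
      (integral (\<Omega> - Z) e + J sl * (measure lebesgue (h ` ball 0 R) - measure lebesgue \<Omega>))"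
      using comparison_at_radius[OF R' im] \<nu> unfolding k_def \<nu>_def by blast
    also have "measure lebesgue (h ` ball 0 R) \<le> k * (pi * (R + 2 * C / R\<^sup>2)\<^sup>2)"
      using image_ball(2)[OF R' im] \<nu> unfolding k_def \<nu>_def by blast
    finally have "pi * k * J sl * R\<^sup>2 \<le> (1 + B * C * L / c / R ^ 3)\<^sup>2 *
      (integral (\<Omega> - Z) e + J sl * (k * (pi * (R + 2 * C / R\<^sup>2)\<^sup>2) - measure lebesgue \<Omega>))"
      using Jsl by (simp add: mult_left_mono)
    then have "pi * k * J sl * R\<^sup>2 \<le> (1 + B * C * L / c / R ^ 3)\<^sup>2 *
      ((integral (\<Omega> - Z) e - J sl * measure lebesgue \<Omega>) + J sl * (k * (pi * (R + 2 * C / R\<^sup>2)\<^sup>2)))"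
      by (simp add: algebra_simps)
    then show "\<exists>k. 0 \<le> k \<and> k \<le> 1 \<and> pi * k * J sl * R\<^sup>2 \<le> (1 + B * C * L / c / R ^ 3)\<^sup>2 *
      ((integral (\<Omega> - Z) e - J sl * measure lebesgue \<Omega>) + J sl * (k * (pi * (R + 2 * C / R\<^sup>2)\<^sup>2)))"
      using k by blast
  qed
  then show ?thesis by simp
qed

end

text \<open>The derivative \<open>DF\<close> may jump across the frontier of \<Omega>. The field
  \<open>s\<close> continues its inner values to the closure, so that compactness can be used in
  \<open>almost_conformal_reparametrization\<close>.\<close>

lemma area_inequality:
  assumes energy: "definition_of_energy I" and qc: "quasi_convex I" and N: "norm_on_Rn n N"
    and l: "\<And>i. i < n \<Longrightarrow> linear (l i)" and l_bound: "\<And>i v. i < n \<Longrightarrow> \<bar>l i v\<bar> \<le> M * cmod v"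
    and F_lip: "\<And>i x y. i < n \<Longrightarrow> \<bar>F i x - F i y\<bar> \<le> M * cmod (x - y)"
    and F_outside: "\<And>i z. i < n \<Longrightarrow> z \<notin> \<Omega> \<Longrightarrow> F i z = l i z"
    and DF: "\<And>i z. i < n \<Longrightarrow> z \<notin> frontier \<Omega> \<Longrightarrow> (F i has_derivative DF i z) (at z)"
    and DF_cont: "\<And>i v. i < n \<Longrightarrow> continuous_on (- frontier \<Omega>) (\<lambda>z. DF i z v)"
    and DF_outside: "\<And>i z. i < n \<Longrightarrow> z \<notin> closure \<Omega> \<Longrightarrow> DF i z = l i"
    and \<Omega>: "open \<Omega>" "bounded \<Omega>" "negligible (frontier \<Omega>)"
    and c: "0 < c" "\<And>v. c * cmod v \<le> pull_norm n N l v"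
    and M: "0 \<le> M"
    and l_minimal: "plane_energy.jac (to_plane I) (pull_norm n N l) = to_plane I (pull_norm n N l)"
    and s: "\<And>z. z \<in> closure \<Omega> \<Longrightarrow> s z \<in> cseminorms" "\<And>v. continuous_on (closure \<Omega>) (\<lambda>z. s z v)"
    and s_ge: "\<And>z v. z \<in> closure \<Omega> \<Longrightarrow> c * cmod v \<le> s z v"
    and s_eq: "\<And>z. z \<in> \<Omega> \<Longrightarrow> s z = pull_norm n N (\<lambda>i. DF i z)"
  shows "to_plane I (pull_norm n N l) * measure lebesgue \<Omega> \<le> integral \<Omega> (\<lambda>z. plane_energy.jac (to_plane I) (s z))"
proof (rule field_le_epsilon)
  interpret plane_energy "to_plane I" by (rule plane_energy_to_plane[OF energy])
  fix e :: real assume e: "0 < e"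
  have norm: "0 < s z v" if "z \<in> closure \<Omega>" "v \<noteq> 0" for z v
    using s_ge[OF that(1), of v] c(1) that(2) by (smt (verit) mult_pos_pos zero_less_norm_iff)
  obtain f K Z a m where q: "qcmap f K Z a m" and K: "K \<subseteq> \<Omega>"
    and int: "(\<lambda>z. qd (s z) (- m z)) absolutely_integrable_on (\<Omega> - Z)"
    and le: "integral (\<Omega> - Z) (\<lambda>z. qd (s z) (- m z)) \<le> integral \<Omega> (\<lambda>z. jac (s z)) + e"
    using almost_conformal_reparametrization[OF \<Omega>(1,2) s norm e] by blast
  obtain L where L: "0 < L" "\<And>x y. dist (f x) (f y) \<le> L * dist x y" "\<And>x y. dist x y \<le> L * dist (f x) (f y)"
    using qcmapD(2)[OF q] by blast
  obtain r G \<alpha> C where exp: "0 < r" "0 \<le> C" "G holomorphic_on ball 0 r"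
    "\<And>t. t \<in> ball 0 r \<Longrightarrow> cmod (deriv G t) \<le> C * cmod t"
    "\<And>t. t \<in> ball 0 r \<Longrightarrow> cmod (G t) \<le> C * (cmod t)\<^sup>2"
    "\<And>w. 1 / r < cmod w \<Longrightarrow> inv f w = w + \<alpha> / w + G (1 / w)"
    using qcmap_inverse_expansion[OF q] by metis
  have eq: "qd (s z) (- m z) = qd (pull_norm n N (\<lambda>i. DF i z)) (- m z)" if "z \<in> \<Omega> - Z" for z
    using s_eq that by simp
  have int': "(\<lambda>z. qd (pull_norm n N (\<lambda>i. DF i z)) (- m z)) absolutely_integrable_on (\<Omega> - Z)"
    by (rule absolutely_integrable_spike[OF int, of "{}"]) (auto simp: eq)
  have ge: "c * cmod v \<le> pull_norm n N (\<lambda>i. DF i z) v" if z: "z \<notin> frontier \<Omega>" for z v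
  proof (cases "z \<in> \<Omega>")
    case True
    then show ?thesis using s_ge[of z v] s_eq[OF True] closure_subset[of \<Omega>] by auto
  next
    case False
    then have "z \<notin> closure \<Omega>" using z \<Omega>(1) by (auto simp: frontier_def interior_open)
    then have "pull_norm n N (\<lambda>i. DF i z) v = pull_norm n N l v"
      unfolding pull_norm_def trunc_def using DF_outside by (auto intro!: arg_cong[of _ _ N])
    then show ?thesis using c(2) by simp
  qed
  interpret comparison_map I n N l F DF \<Omega> c M f K Z a m L G r C \<alpha>
    by (rule comparison_map.intro) (fact energy qc N l l_bound F_lip F_outside DF DF_cont DF_outside \<Omega> c(1) ge M l_minimal q K L
        exp int')+
  have "integral (\<Omega> - Z) (comparison_map.e I n N DF m) = integral (\<Omega> - Z) (\<lambda>z. qd (s z) (- m z))"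
    by (rule integral_cong) (simp add: e_def st_def eq)
  then show "to_plane I (pull_norm n N l) * measure lebesgue \<Omega> \<le> integral \<Omega> (\<lambda>z. jac (s z)) + e"
    using area_le_energy le by linarith
qed

subsection \<open>Quasi-convexity of the area\<close>

text \<open>Joint continuity in the point and the vector makes the minimum over the compact set
  \<open>X \<times> sphere 0 1\<close> exist, and it is positive.\<close>

lemma cseminorm_field_lower_bound:
  fixes s :: "'x::metric_space \<Rightarrow> complex \<Rightarrow> real"
  assumes X: "compact X" and s: "\<And>x. x \<in> X \<Longrightarrow> s x \<in> cseminorms" "\<And>v. continuous_on X (\<lambda>x. s x v)"
    and norm: "\<And>x v. x \<in> X \<Longrightarrow> v \<noteq> 0 \<Longrightarrow> 0 < s x v"
  obtains c where "0 < c" "\<And>x v. x \<in> X \<Longrightarrow> c * cmod v \<le> s x v"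
proof (cases "X = {}")
  case True
  then show thesis using that[of 1] by simp
next
  case False
  have "continuous_on (X \<times> sphere 0 1) (\<lambda>p. s (fst p) (snd p))"
  proof (rule continuous_on_cseminorm_compose[where s="\<lambda>p. s (fst p)" and w=snd])
    show "continuous_on (X \<times> sphere (0::complex) 1) (\<lambda>p. s (fst p) v)" for v
      by (rule continuous_on_compose2[OF s(2)]) (auto intro: continuous_on_fst continuous_on_id)
  qed (use s(1) in \<open>auto intro: continuous_on_snd continuous_on_id\<close>)
  moreover have "compact (X \<times> sphere (0::complex) 1)" "X \<times> sphere (0::complex) 1 \<noteq> {}"
    using X False by (auto intro!: compact_Times)
  ultimately obtain p where p: "p \<in> X \<times> sphere 0 1"
    "\<And>q. q \<in> X \<times> sphere 0 1 \<Longrightarrow> s (fst p) (snd p) \<le> s (fst q) (snd q)"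
    using continuous_attains_inf[of "X \<times> sphere (0::complex) 1" "\<lambda>p. s (fst p) (snd p)"] by blast
  show thesis
  proof (rule that)
    have "fst p \<in> X" "snd p \<noteq> 0" using p(1) by auto
    then show "0 < s (fst p) (snd p)" by (rule norm)
    fix x v assume x: "x \<in> X"
    show "s (fst p) (snd p) * cmod v \<le> s x v"
    proof (cases "v = 0")
      case True
      then show ?thesis using cseminorm_zero[OF s(1)[OF x]] by simp
    next
      case False
      then have "s (fst p) (snd p) \<le> s x (sgn v)" using p(2)[of "(x, sgn v)"] x by (simp add: norm_sgn)
      then have "s (fst p) (snd p) * cmod v \<le> s x (sgn v) * cmod v" by (intro mult_right_mono) auto
      also have "\<dots> = s x (cmod v *\<^sub>R sgn v)" using cseminorm_scale[OF s(1)[OF x]] by simp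
      also have "cmod v *\<^sub>R sgn v = v" using False by (simp add: sgn_div_norm)
      finally show ?thesis .
    qed
  qed
qed

lemma lipschitz_on_disc_if_C1:
  fixes p :: "complex \<Rightarrow> real"
  assumes D: "\<And>z. z \<in> cball 0 1 \<Longrightarrow> (p has_derivative D z) (at z)"
    and cont: "\<And>v. continuous_on (cball 0 1) (\<lambda>z. D z v)"
  obtains M where "0 \<le> M" "\<And>x y. x \<in> cball 0 1 \<Longrightarrow> y \<in> cball 0 1 \<Longrightarrow> \<bar>p x - p y\<bar> \<le> M * cmod (x - y)"
proof -
  have "bounded ((\<lambda>z. \<bar>D z 1\<bar> + \<bar>D z \<i>\<bar>) ` cball 0 1)"
    by (intro compact_imp_bounded compact_continuous_image continuous_on_add continuous_on_rabs cont) simp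
  then obtain M where M: "0 < M" "\<And>z. z \<in> cball 0 1 \<Longrightarrow> \<bar>D z 1\<bar> + \<bar>D z \<i>\<bar> \<le> M"
    unfolding bounded_pos by fastforce
  have "norm (p x - p y) \<le> M * norm (x - y)" if xy: "x \<in> cball 0 1" "y \<in> cball 0 1" for x y
  proof (rule differentiable_bound[where S="cball 0 1" and f'=D])
    fix z :: complex assume z: "z \<in> cball 0 1"
    show "(p has_derivative D z) (at z within cball 0 1)" by (rule has_derivative_at_withinI[OF D[OF z]])
    show "onorm (D z) \<le> M"
    proof (rule onorm_le)
      fix v
      have "D z v = Re v * D z 1 + Im v * D z \<i>"
        by (rule linear_complex_expand[OF has_derivative_linear[OF D[OF z]]])
      then have "\<bar>D z v\<bar> \<le> \<bar>Re v\<bar> * \<bar>D z 1\<bar> + \<bar>Im v\<bar> * \<bar>D z \<i>\<bar>"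
        using abs_triangle_ineq[of "Re v * D z 1" "Im v * D z \<i>"] by (simp add: abs_mult)
      also have "\<dots> \<le> cmod v * \<bar>D z 1\<bar> + cmod v * \<bar>D z \<i>\<bar>"
        by (intro add_mono mult_right_mono abs_Re_le_cmod abs_Im_le_cmod) auto
      also have "\<dots> = cmod v * (\<bar>D z 1\<bar> + \<bar>D z \<i>\<bar>)" by (simp add: distrib_left)
      also have "\<dots> \<le> cmod v * M" by (intro mult_left_mono M z) simp
      finally show "norm (D z v) \<le> M * norm v" by (simp add: mult.commute)
    qed
  qed (use xy in auto)
  then show thesis using that[of M] M(1) by simp
qed

text \<open>Precomposition with the linear map \<open>T\<close> that realizes the infimum in \<open>jac\<close> for the linear
  boundary values makes their energy equal to their area.\<close>

lemma area_quasi_convex_plane: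
  assumes energy: "definition_of_energy I" and qc: "quasi_convex I" and N: "norm_on_Rn n N"
    and l: "\<And>i. i < n \<Longrightarrow> linear (l i)" and l_norm: "\<And>v. v \<noteq> 0 \<Longrightarrow> 0 < pull_norm n N l v"
    and D: "\<And>i z. i < n \<Longrightarrow> z \<in> cball 0 1 \<Longrightarrow> (p i has_derivative D i z) (at z)"
    and contD: "\<And>i v. i < n \<Longrightarrow> continuous_on (cball 0 1) (\<lambda>z. D i z v)"
    and bd: "\<And>i z. i < n \<Longrightarrow> cmod z = 1 \<Longrightarrow> p i z = l i z"
    and norm: "\<And>z v. z \<in> cball 0 1 \<Longrightarrow> v \<noteq> 0 \<Longrightarrow> 0 < pull_norm n N (\<lambda>i. D i z) v"
  shows "pi * plane_energy.jac (to_plane I) (pull_norm n N l) \<le>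
    integral (ball 0 1) (\<lambda>z. plane_energy.jac (to_plane I) (pull_norm n N (\<lambda>i. D i z)))"
proof -
  interpret plane_energy "to_plane I" by (rule plane_energy_to_plane[OF energy])
  define sl where "sl = pull_norm n N l"
  define sp where "sp = (\<lambda>z. pull_norm n N (\<lambda>i. D i z))"
  have sl: "sl \<in> cseminorms" unfolding sl_def by (rule pull_norm_cseminorm[OF N l])
  have sp: "sp z \<in> cseminorms" if "z \<in> cball 0 1" for z
    unfolding sp_def by (rule pull_norm_cseminorm[OF N]) (rule has_derivative_linear[OF D[OF _ that]])
  have cont_sp: "continuous_on (cball 0 1) (\<lambda>z. sp z v)" for v
    unfolding sp_def by (rule continuous_on_pull_norm[OF N contD])
  have norm_sp: "0 < sp z v" if "z \<in> cball 0 1" "v \<noteq> 0" for z v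
    unfolding sp_def by (rule norm[OF that])
  obtain \<mu> where \<mu>: "cmod \<mu> < 1" "qd sl \<mu> = jac sl"
    using jac_attained[OF sl] l_norm unfolding sl_def by metis
  \<comment> \<open>The factor normalizes \<open>v + \<mu> * cnj v\<close> to determinant 1, as in
    \<open>qd_eq_J\<close>.\<close>
  define a where "a = complex_of_real (1 / sqrt (1 - (cmod \<mu>)\<^sup>2))"
  define b where "b = a * \<mu>"
  define T where "T = (\<lambda>v. a * v + b * cnj v)"
  define S where "S = (\<lambda>v. cnj a * v + (- b) * cnj v)"
  have ab: "(cmod a)\<^sup>2 - (cmod b)\<^sup>2 = 1" and J_T: "to_plane I (\<lambda>v. sl (T v)) = jac sl"
    using qd_eq_J[OF sl \<mu>(1)] \<mu>(2) unfolding a_def b_def T_def by simp_all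
  have "a * cnj a - b * cnj b = complex_of_real ((cmod a)\<^sup>2 - (cmod b)\<^sup>2)"
    unfolding of_real_diff complex_norm_square ..
  then have abc: "a * cnj a - b * cnj b = 1" unfolding ab by simp
  have TS: "T (S v) = v" for v
  proof -
    have "T (S v) = (a * cnj a - b * cnj b) * v" by (simp add: T_def S_def algebra_simps)
    then show ?thesis unfolding abc by simp
  qed
  have ST: "S (T v) = v" for v
  proof -
    have "S (T v) = (a * cnj a - b * cnj b) * v" by (simp add: T_def S_def algebra_simps)
    then show ?thesis unfolding abc by simp
  qed
  have linT: "linear T" and linS: "linear S" unfolding T_def S_def by (rule linear_beltrami)+
  have derT: "(T has_derivative T) (at z)" and derS: "(S has_derivative S) (at z)" for z
    by (intro bounded_linear_imp_has_derivative linear_conv_bounded_linear[THEN iffD1] linT linS)+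
  have T0: "T v \<noteq> 0" if "v \<noteq> 0" for v using ST[of v] that linear_0[OF linS] by auto
  have cT: "continuous_on X T" for X by (intro linear_continuous_on linear_conv_bounded_linear[THEN iffD1] linT)
  have T_le: "cmod (T v) \<le> (cmod a + cmod b) * cmod v" for v
    using norm_triangle_ineq[of "a * v" "b * cnj v"] by (simp add: T_def norm_mult distrib_right)
  \<comment> \<open>The domain of the transformed problem is the preimage of the disc under
    \<open>T\<close>; its convexity makes its frontier negligible.\<close>
  define \<Omega> where "\<Omega> = S ` ball 0 1"
  have \<Omega>_eq: "\<Omega> = T -` ball 0 1"
    unfolding \<Omega>_def
  proof (intro equalityI subsetI)
    fix z assume "z \<in> T -` ball 0 1"
    then show "z \<in> S ` ball 0 1" using ST[of z, symmetric] by blast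
  qed (auto simp: TS)
  have op: "open \<Omega>" unfolding \<Omega>_eq by (rule open_vimage[OF open_ball cT])
  have bdd: "bounded \<Omega>" unfolding \<Omega>_def
    by (intro bounded_linear_image linear_conv_bounded_linear[THEN iffD1] linS bounded_ball)
  have negl: "negligible (frontier \<Omega>)"
    unfolding \<Omega>_def by (intro negligible_convex_frontier convex_linear_image linS convex_ball)
  have cl: "T z \<in> cball 0 1" if "z \<in> closure \<Omega>" for z
  proof -
    have "closure \<Omega> \<subseteq> T -` cball 0 1"
      unfolding \<Omega>_eq by (intro closure_minimal closed_vimage[OF closed_cball cT]) auto
    then show ?thesis using that by blast
  qed
  have injS: "inj_on S (ball 0 1)" using TS by (metis inj_onI)
  \<comment> \<open>\<open>S\<close> has determinant 1, so no Jacobian factor appears.\<close>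
  have change: "integral \<Omega> \<phi> = integral (ball 0 1) (\<lambda>w. \<phi> (S w))"
    if "(\<lambda>w. \<phi> (S w)) absolutely_integrable_on ball 0 1" for \<phi> :: "complex \<Rightarrow> real"
  proof -
    have 1: "\<bar>(cmod (cnj a))\<^sup>2 - (cmod (- b))\<^sup>2\<bar> = 1" using ab by simp
    show ?thesis
      unfolding \<Omega>_def
      using absolutely_integrable_change_of_variables_complex[where g=S and a="\<lambda>_. cnj a" and b="\<lambda>_. - b" and \<phi>=\<phi>
          and S="ball 0 1" and c="integral (ball 0 1) (\<lambda>w. \<phi> (S w))"]
        that injS has_derivative_at_withinI[OF derS] unfolding 1 S_def[symmetric] by simp
  qed
  have \<Omega>_measure: "measure lebesgue \<Omega> = pi"
  proof -
    have "(\<lambda>w::complex. 1::real) absolutely_integrable_on ball 0 1"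
      by (rule absolutely_integrable_on_const[OF lmeasurable_ball])
    from change[OF this] have "integral \<Omega> (\<lambda>_. 1::real) = measure lebesgue (ball (0::complex) 1)"
      using lmeasure_integral[OF lmeasurable_ball[of "0::complex" 1]] by simp
    moreover have "\<Omega> \<in> lmeasurable" using op bdd by (simp add: lmeasurable_open)
    ultimately show ?thesis using lmeasure_integral[of \<Omega>] measure_ball_complex[of 1 0] by simp
  qed
  define l' where "l' = (\<lambda>i v. l i (T v))"
  define F where "F = (\<lambda>i z. if T z \<in> ball 0 1 then p i (T z) else l i (T z))"
  define DF where "DF = (\<lambda>i z. if z \<in> \<Omega> then (\<lambda>v. D i (T z) (T v)) else l' i)"
  define s where "s = (\<lambda>z v. sp (T z) (T v))"
  have sl': "pull_norm n N l' = (\<lambda>v. sl (T v))" by (simp add: fun_eq_iff sl_def l'_def pull_norm_def)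
  have linl': "linear (l' i)" if "i < n" for i
    using linear_compose[OF linT l[OF that]] by (simp add: l'_def o_def)
  have bounded_each: "\<exists>M\<ge>0. (\<forall>v. \<bar>l' i v\<bar> \<le> M * cmod v) \<and> (\<forall>x y. \<bar>F i x - F i y\<bar> \<le> M * cmod (x - y))"
    if i: "i < n" for i
  proof -
    obtain A where A: "\<And>v. \<bar>l' i v\<bar> \<le> A * cmod v" using linear_bounded[OF linl'[OF i]] by auto
    have A0: "0 \<le> A" using A[of 1] by simp
    have dl: "(l i has_derivative l i) (at z)" for z
      by (intro bounded_linear_imp_has_derivative linear_conv_bounded_linear[THEN iffD1] l i)
    have d: "((\<lambda>z. p i z - l i z) has_derivative (\<lambda>v. D i z v - l i v)) (at z)" if "z \<in> cball 0 1" for z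
      by (rule has_derivative_diff[OF D[OF i that] dl])
    have c: "continuous_on (cball 0 1) (\<lambda>z. D i z v - l i v)" for v
      by (rule continuous_on_diff[OF contD[OF i] continuous_on_const])
    obtain Q where Q: "0 \<le> Q" "\<And>x y. x \<in> cball 0 1 \<Longrightarrow> y \<in> cball 0 1 \<Longrightarrow>
        \<bar>(p i x - l i x) - (p i y - l i y)\<bar> \<le> Q * cmod (x - y)"
      using lipschitz_on_disc_if_C1[OF d c] by blast
    define E where "E = (\<lambda>x. if cmod x \<le> 1 then p i x - l i x else 0)"
    have E: "\<bar>E x - E y\<bar> \<le> Q * cmod (x - y)" for x y
      unfolding E_def by (rule lipschitz_extension_by_zero[OF Q(2,1)]) (use bd[OF i] in auto)
    \<comment> \<open>The glued map is the linear map plus an extension by zero, which gives a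
      Lipschitz bound across the frontier.\<close>
    have F_E: "F i z = E (T z) + l' i z" for z
      using bd[OF i, of "T z"] by (auto simp: F_def E_def l'_def)
    have "\<bar>F i x - F i y\<bar> \<le> (Q * (cmod a + cmod b) + A) * cmod (x - y)" for x y
    proof -
      have "\<bar>F i x - F i y\<bar> \<le> \<bar>E (T x) - E (T y)\<bar> + \<bar>l' i (x - y)\<bar>"
        unfolding F_E linear_diff[OF linl'[OF i]] by linarith
      also have "\<dots> \<le> Q * cmod (T x - T y) + A * cmod (x - y)" by (intro add_mono E A)
      also have "cmod (T x - T y) \<le> (cmod a + cmod b) * cmod (x - y)"
        unfolding linear_diff[OF linT, symmetric] by (rule T_le)
      finally show ?thesis using Q(1) by (simp add: distrib_right mult_left_mono mult.assoc)
    qed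
    moreover have "\<bar>l' i v\<bar> \<le> (Q * (cmod a + cmod b) + A) * cmod v" for v
      using A[of v] Q(1) by (smt (verit) distrib_right mult_nonneg_nonneg norm_ge_zero)
    moreover have "0 \<le> Q * (cmod a + cmod b) + A" using Q(1) A0 by simp
    ultimately show ?thesis by blast
  qed
  then obtain Mi where Mi: "\<And>i. i < n \<Longrightarrow> 0 \<le> Mi i" "\<And>i v. i < n \<Longrightarrow> \<bar>l' i v\<bar> \<le> Mi i * cmod v"
      "\<And>i x y. i < n \<Longrightarrow> \<bar>F i x - F i y\<bar> \<le> Mi i * cmod (x - y)"
    by metis
  define M where "M = (\<Sum>i<n. Mi i)"
  have M: "0 \<le> M" unfolding M_def by (intro sum_nonneg) (use Mi(1) in auto)
  have Mi_le: "Mi i * x \<le> M * x" if "i < n" "0 \<le> x" for i x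
    unfolding M_def by (intro mult_right_mono that member_le_sum) (use that Mi(1) in auto)
  have fr: "frontier \<Omega> = closure \<Omega> - \<Omega>" using op by (simp add: frontier_def interior_open)
  obtain c1 where c1: "0 < c1" "\<And>v. c1 * cmod v \<le> sl (T v)"
    using cnorm_lower_bound[OF cseminorm_linear[OF sl linT]] l_norm T0 unfolding sl_def by metis
  have s_cs: "s z \<in> cseminorms" if "z \<in> closure \<Omega>" for z
    unfolding s_def by (rule cseminorm_linear[OF sp[OF cl[OF that]] linT])
  have s_cont: "continuous_on (closure \<Omega>) (\<lambda>z. s z v)" for v
    unfolding s_def by (rule continuous_on_compose2[OF cont_sp cT]) (use cl in blast)
  have s_norm: "0 < s z v" if "z \<in> closure \<Omega>" "v \<noteq> 0" for z v
    unfolding s_def by (rule norm_sp[OF cl[OF that(1)] T0[OF that(2)]])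
  have "compact (closure \<Omega>)" using bdd by (simp add: compact_closure)
  then obtain c2 where c2: "0 < c2" "\<And>z v. z \<in> closure \<Omega> \<Longrightarrow> c2 * cmod v \<le> s z v"
    using cseminorm_field_lower_bound[OF _ s_cs s_cont s_norm] by blast
  define c where "c = min c1 c2"
  have c: "0 < c" using c1(1) c2(1) by (simp add: c_def)
  have c_le: "c * cmod v \<le> c1 * cmod v" "c * cmod v \<le> c2 * cmod v" for v
    unfolding c_def by (intro mult_right_mono; simp)+
  have derF: "(F i has_derivative DF i z) (at z)" if i: "i < n" and z: "z \<notin> frontier \<Omega>" for i z
  proof (cases "z \<in> \<Omega>")
    case True
    then have Tz: "T z \<in> cball 0 1" by (auto simp: \<Omega>_eq)
    have "((\<lambda>z. p i (T z)) has_derivative (\<lambda>v. D i (T z) (T v))) (at z)"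
      by (rule has_derivative_compose[OF derT D[OF i Tz]])
    then have "(F i has_derivative (\<lambda>v. D i (T z) (T v))) (at z)"
      by (rule has_derivative_transform_within_open[OF _ op True]) (simp add: F_def \<Omega>_eq)
    then show ?thesis using True by (simp add: DF_def)
  next
    case False
    then have z': "z \<in> - closure \<Omega>" using z fr by blast
    have "(l' i has_derivative l' i) (at z)"
      by (intro bounded_linear_imp_has_derivative linear_conv_bounded_linear[THEN iffD1] linl' i)
    then have "(F i has_derivative l' i) (at z)"
    proof (rule has_derivative_transform_within_open[OF _ _ z'])
      fix x assume "x \<in> - closure \<Omega>"
      then have "x \<notin> \<Omega>" using closure_subset by blast
      then show "l' i x = F i x" by (simp add: F_def l'_def \<Omega>_eq)
    qed (simp add: open_Compl)
    then show ?thesis using False by (simp add: DF_def)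
  qed
  have contDF: "continuous_on (- frontier \<Omega>) (\<lambda>z. DF i z v)" if i: "i < n" for i v
  proof -
    have "continuous_on \<Omega> (\<lambda>z. D i (T z) (T v))"
      by (rule continuous_on_compose2[OF contD[OF i] cT]) (auto simp: \<Omega>_eq)
    then have 1: "continuous_on \<Omega> (\<lambda>z. DF i z v)" by (rule continuous_on_eq) (simp add: DF_def)
    have "continuous_on (- closure \<Omega>) (\<lambda>z. l' i v)" by (rule continuous_on_const)
    then have 2: "continuous_on (- closure \<Omega>) (\<lambda>z. DF i z v)"
      by (rule continuous_on_eq) (use closure_subset[of \<Omega>] in \<open>auto simp: DF_def\<close>)
    have "- frontier \<Omega> = \<Omega> \<union> - closure \<Omega>" using fr closure_subset[of \<Omega>] by blast
    then show ?thesis using continuous_on_open_Un[OF op _ 1 2] by (simp add: open_Compl)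
  qed
  have "to_plane I (pull_norm n N l') * measure lebesgue \<Omega> \<le> integral \<Omega> (\<lambda>z. jac (s z))"
  proof (rule area_inequality[OF energy qc N linl' _ _ _ derF contDF _ op bdd negl c _ M _ s_cs s_cont])
    show "\<bar>l' i v\<bar> \<le> M * cmod v" if "i < n" for i v using Mi(2)[OF that, of v] Mi_le[OF that, of "cmod v"] by simp
    show "\<bar>F i x - F i y\<bar> \<le> M * cmod (x - y)" if "i < n" for i x y
      using Mi(3)[OF that, of x y] Mi_le[OF that, of "cmod (x - y)"] by simp
    show "F i z = l' i z" if "z \<notin> \<Omega>" for i z using that by (simp add: F_def l'_def \<Omega>_eq)
    show "DF i z = l' i" if "z \<notin> closure \<Omega>" for i z using that closure_subset[of \<Omega>] by (auto simp: DF_def)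
    show "c * cmod v \<le> pull_norm n N l' v" for v using c1(2)[of v] c_le(1)[of v] unfolding sl' by simp
    show "jac (pull_norm n N l') = to_plane I (pull_norm n N l')"
      unfolding sl' J_T unfolding T_def by (rule jac_unimodular[OF sl ab])
    show "c * cmod v \<le> s z v" if "z \<in> closure \<Omega>" for z v using c2(2)[OF that, of v] c_le(2)[of v] by simp
    show "s z = pull_norm n N (\<lambda>i. DF i z)" if "z \<in> \<Omega>" for z using that by (simp add: fun_eq_iff s_def sp_def DF_def pull_norm_def)
  qed
  also have "integral \<Omega> (\<lambda>z. jac (s z)) = integral (ball 0 1) (\<lambda>w. jac (sp w))"
  proof -
    have eq: "jac (s (S w)) = jac (sp w)" if "w \<in> ball 0 1" for w
      unfolding s_def TS unfolding T_def by (rule jac_unimodular[OF sp ab]) (use that in simp)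
    have cont: "continuous_on (cball 0 1) (\<lambda>w. jac (sp w))" by (rule jac_continuous_on[OF sp cont_sp norm_sp])
    then have "bounded ((\<lambda>w. jac (sp w)) ` cball 0 1)" by (intro compact_imp_bounded compact_continuous_image) auto
    then obtain B where B: "\<And>w. w \<in> cball 0 1 \<Longrightarrow> \<bar>jac (sp w)\<bar> \<le> B"
      unfolding bounded_iff by (metis imageI real_norm_def)
    have "(\<lambda>w. jac (sp w)) absolutely_integrable_on ball 0 1"
      by (rule bounded_continuous_absolutely_integrable[OF lmeasurable_ball continuous_on_subset[OF cont], where B=B]) (use B in auto)
    then have "(\<lambda>w. jac (s (S w))) absolutely_integrable_on ball 0 1"
      by (rule absolutely_integrable_spike[of _ _ "{}"]) (auto simp: eq)
    from change[OF this] show ?thesis by (rule trans) (rule integral_cong[OF eq])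
  qed
  finally show ?thesis unfolding sl' J_T \<Omega>_measure by (simp add: sl_def sp_def mult.commute)
qed

section \<open>Passage between \<open>real^2\<close> and the complex plane\<close>

lemma differential_complex:
  fixes \<psi> :: "real^2 \<Rightarrow> nat \<Rightarrow> real"
  assumes \<psi>: "smooth_on_disc n \<psi>"
  defines "D \<equiv> \<lambda>i z v. differential \<psi> (xc z) (xc v) i"
  shows "z \<in> cball 0 1 \<Longrightarrow> ((\<lambda>w. \<psi> (xc w) i) has_derivative D i z) (at z)"
    and "continuous_on (cball 0 1) (\<lambda>z. D i z v)"
    and "x \<in> cball 0 1 \<Longrightarrow> trunc n (differential \<psi> x u) = differential \<psi> x u"
proof -
  obtain U where U: "open U" "cball 0 1 \<subseteq> U" and Rn: "\<And>x. x \<in> U \<Longrightarrow> \<psi> x \<in> Rn n"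
    and Ck: "\<And>i k. Ck_on k (\<lambda>x. \<psi> x i) U"
    using \<psi> unfolding smooth_on_disc_def by blast
  have diff: "(\<lambda>x. \<psi> x i) differentiable (at x)" if "x \<in> U" for i x
    using Ck[of "Suc 0" i] that by simp
  have cont: "continuous_on U (\<lambda>x. frechet_derivative (\<lambda>x. \<psi> x i) (at x) v)" for i v
    using Ck[of "Suc 0" i] by simp
  have xc1: "xc z \<in> cball 0 1" if "z \<in> cball 0 1" for z using that by simp
  show "((\<lambda>w. \<psi> (xc w) i) has_derivative D i z) (at z)" if "z \<in> cball 0 1"
  proof -
    have "xc z \<in> U" using xc1[OF that] U(2) by blast
    from has_derivative_compose[OF bounded_linear_imp_has_derivative[OF bounded_linear_xc]
        frechet_derivative_works[THEN iffD1, OF diff[OF this]]]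
    show ?thesis by (simp add: D_def differential_def)
  qed
  show "continuous_on (cball 0 1) (\<lambda>z. D i z v)"
    unfolding D_def differential_def
    by (rule continuous_on_compose2[OF cont linear_continuous_on[OF bounded_linear_xc]]) (use xc1 U(2) in blast)
  assume x: "x \<in> cball 0 1"
  then have xU: "x \<in> U" using U(2) by blast
  have "differential \<psi> x u i = 0" if i: "n \<le> i" for i
  proof -
    have "((\<lambda>x. \<psi> x i) has_derivative (\<lambda>v. 0)) (at x)"
      by (rule has_derivative_transform_within_open[OF has_derivative_const[of 0] U(1) xU])
        (use Rn i in \<open>auto simp: Rn_def\<close>)
    from fun_cong[OF frechet_derivative_at[OF this], of u] show ?thesis by (simp add: differential_def)
  qed
  then show "trunc n (differential \<psi> x u) = differential \<psi> x u" by (auto simp: trunc_def fun_eq_iff)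
qed

lemma differential_linear:
  assumes L: "linear_Rn n L" shows "differential L z v = L v"
proof
  fix i
  have "((\<lambda>x. L x i) has_derivative (\<lambda>v. L v i)) (at z)"
    using L by (intro bounded_linear_imp_has_derivative) (auto simp: linear_Rn_def linear_conv_bounded_linear)
  from fun_cong[OF frechet_derivative_at[OF this], of v]
  show "differential L z v i = L v i" unfolding differential_def by (rule sym)
qed

lemma disc_integral_complex:
  assumes "\<And>z. z \<in> ball 0 1 \<Longrightarrow> A (\<lambda>v. N (differential \<psi> (xc z) v)) = \<phi> z" "continuous_on (cball 0 1) \<phi>"
  shows "disc_integral A N \<psi> = integral (ball 0 1) \<phi>"
proof -
  have "disc_integral A N \<psi> = (LINT z:ball 0 1|lborel. \<phi> (cx z))"
    unfolding disc_integral_def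
  proof (rule set_lebesgue_integral_cong)
    show "\<forall>z. z \<in> ball 0 1 \<longrightarrow> A (\<lambda>v. N (differential \<psi> z v)) = \<phi> (cx z)"
      using assms(1)[of "cx z" for z] by simp
  qed simp
  also have "\<dots> = integral (ball 0 1) \<phi>" by (rule set_lebesgue_integral_disc[OF assms(2)])
  finally show ?thesis .
qed

theorem theorem4p2:
  fixes I :: "(real^2 \<Rightarrow> real) \<Rightarrow> real"
  assumes "definition_of_energy I"
    and "quasi_convex I"
  shows "quasi_convex (area_jacobian I)"
  unfolding quasi_convex_def
proof (intro allI impI)
  fix n N L \<psi>
  assume N: "norm_on_Rn n N" and L: "linear_Rn n L" and imm: "immersion_on_disc n \<psi>"
    and bd: "\<forall>z\<in>sphere 0 1. \<psi> z = L z"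
  interpret plane_energy "to_plane I" by (rule plane_energy_to_plane[OF assms(1)])
  define l where "l = (\<lambda>i v. L (xc v) i)"
  define D where "D = (\<lambda>i z v. differential \<psi> (xc z) (xc v) i)"
  \<comment> \<open>The normalizing constant of the Jacobian; it is nonnegative and factors out of
    both integrals.\<close>
  define \<kappa> where "\<kappa> = 1 / jac cmod"
  have smooth: "smooth_on_disc n \<psi>" using imm by (simp add: immersion_on_disc_def)
  have l: "linear (l i)" for i
    using linear_compose[OF linear_xc, of "\<lambda>z. L z i"] L by (simp add: l_def o_def linear_Rn_def)
  have D: "((\<lambda>w. \<psi> (xc w) i) has_derivative D i z) (at z)" if "z \<in> cball 0 1" for i z
    unfolding D_def by (rule differential_complex(1)[OF smooth that])
  have D_cont: "continuous_on (cball 0 1) (\<lambda>z. D i z v)" for i v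
    unfolding D_def by (rule differential_complex(2)[OF smooth])
  note D_Rn = differential_complex(3)[OF smooth]
  have \<kappa>: "0 \<le> \<kappa>" unfolding \<kappa>_def using jac_nonneg[OF cseminorm_norm] by simp
  have area: "area_jacobian I (\<lambda>v. s (cx v)) = \<kappa> * jac s" if "s \<in> cseminorms" for s
    using reduced_jacobian_eq[OF assms(1) that] reduced_jacobian_eq[OF assms(1) cseminorm_norm]
    by (simp add: area_jacobian_def \<kappa>_def)
  have sl: "pull_norm n N l \<in> cseminorms" by (rule pull_norm_cseminorm[OF N l])
  have sD: "pull_norm n N (\<lambda>i. D i z) \<in> cseminorms" if "z \<in> cball 0 1" for z
    by (rule pull_norm_cseminorm[OF N]) (rule has_derivative_linear[OF D[OF that]])
  have sD_eq: "pull_norm n N (\<lambda>i. D i z) v = N (differential \<psi> (xc z) (xc v))" if "z \<in> cball 0 1" for z v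
    using D_Rn[of "xc z" "xc v"] that by (simp add: pull_norm_def D_def)
  have norm: "0 < pull_norm n N (\<lambda>i. D i z) v" if z: "z \<in> cball 0 1" and v: "v \<noteq> 0" for z v
  proof -
    have "inj (differential \<psi> (xc z))" using imm z by (simp add: immersion_on_disc_def)
    moreover have "xc v \<noteq> 0" using v by (metis norm_xc norm_eq_zero)
    ultimately have "differential \<psi> (xc z) (xc v) \<noteq> differential \<psi> (xc z) 0" by (simp add: inj_eq)
    then obtain i where "differential \<psi> (xc z) (xc v) i \<noteq> differential \<psi> (xc z) 0 i" by blast
    moreover have "differential \<psi> (xc z) 0 i = 0"
      using linear_0[OF has_derivative_linear[OF D[OF z]], of i] linear_0[OF linear_xc] by (simp add: D_def)
    ultimately have *: "differential \<psi> (xc z) (xc v) i \<noteq> 0" by simp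
    have x: "xc z \<in> cball 0 1" using z by simp
    have "N (trunc n (differential \<psi> (xc z) (xc v))) \<noteq> 0"
    proof
      assume "N (trunc n (differential \<psi> (xc z) (xc v))) = 0"
      then have "trunc n (differential \<psi> (xc z) (xc v)) i = 0" unfolding trunc_eq_0[OF N] by (simp add: trunc_def)
      then show False using * unfolding D_Rn[OF x] by simp
    qed
    then show ?thesis using trunc_nonneg[OF N, of "differential \<psi> (xc z) (xc v)"] by (simp add: pull_norm_def D_def)
  qed
  have contD: "continuous_on (cball 0 1) (\<lambda>z. pull_norm n N (\<lambda>i. D i z) v)" for v
    by (rule continuous_on_pull_norm[OF N D_cont])
  have cont: "continuous_on (cball 0 1) (\<lambda>z. jac (pull_norm n N (\<lambda>i. D i z)))"
    by (rule jac_continuous_on[OF sD contD norm])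
  have "disc_integral (area_jacobian I) N L = integral (ball 0 1) (\<lambda>z::complex. \<kappa> * jac (pull_norm n N l))"
  proof (rule disc_integral_complex)
    have "N (L v) = pull_norm n N l (cx v)" for v
      using trunc_id[of "L v" n] L by (simp add: pull_norm_def l_def linear_Rn_def)
    then show "area_jacobian I (\<lambda>v. N (differential L (xc z) v)) = \<kappa> * jac (pull_norm n N l)" for z
      unfolding differential_linear[OF L] using area[OF sl] by simp
  qed simp
  also have "\<dots> = \<kappa> * (pi * jac (pull_norm n N l))"
    using has_integral_mult_right[OF has_integral_measure_lebesgue, of "ball (0::complex) 1" "\<kappa> * jac (pull_norm n N l)"]
    by (intro integral_unique) (simp add: measure_ball_complex[of 1 0, simplified] mult_ac)
  also have "\<dots> \<le> \<kappa> * integral (ball 0 1) (\<lambda>z. jac (pull_norm n N (\<lambda>i. D i z)))"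
  proof (rule mult_left_mono[OF _ \<kappa>])
    show "pi * jac (pull_norm n N l) \<le> integral (ball 0 1) (\<lambda>z. jac (pull_norm n N (\<lambda>i. D i z)))"
    \<comment> \<open>If the linear map has a kernel, its area is 0 and the inequality is
      nonnegativity of the other side. Otherwise its pulled back norm is a genuine norm and the
      infimum in \<open>jac\<close> is attained.\<close>
    proof (cases "\<exists>v. v \<noteq> 0 \<and> pull_norm n N l v = 0")
      case True
      then have "jac (pull_norm n N l) = 0" using jac_degenerate[OF sl] by blast
      moreover have "0 \<le> integral (ball 0 1) (\<lambda>z. jac (pull_norm n N (\<lambda>i. D i z)))"
      \<comment> \<open>In the complementary case the integral has the default value 0.\<close>
      proof (cases "(\<lambda>z. jac (pull_norm n N (\<lambda>i. D i z))) integrable_on ball 0 1")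
        case True
        then show ?thesis by (rule integral_nonneg) (rule jac_nonneg[OF sD], simp)
      qed (simp add: not_integrable_integral)
      ultimately show ?thesis by simp
    next
      case False
      then have l_norm: "0 < pull_norm n N l v" if "v \<noteq> 0" for v
        using cseminorm_nonneg[OF sl, of v] that by (smt (verit))
      show ?thesis
      proof (rule area_quasi_convex_plane[OF assms N l l_norm _ D_cont _ norm, where p="\<lambda>i z. \<psi> (xc z) i"])
        show "((\<lambda>z. \<psi> (xc z) i) has_derivative D i z) (at z)" if "z \<in> cball 0 1" for i z by (rule D[OF that])
        show "\<psi> (xc z) i = l i z" if "cmod z = 1" for i z using bd that by (simp add: l_def)
      qed
    qed
  qed
  also have "\<dots> = integral (ball 0 1) (\<lambda>z. \<kappa> * jac (pull_norm n N (\<lambda>i. D i z)))" by simp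
  also have "\<dots> = disc_integral (area_jacobian I) N \<psi>"
  proof (rule disc_integral_complex[symmetric])
    show "area_jacobian I (\<lambda>v. N (differential \<psi> (xc z) v)) = \<kappa> * jac (pull_norm n N (\<lambda>i. D i z))" if "z \<in> ball 0 1" for z
    proof -
      have "N (differential \<psi> (xc z) v) = pull_norm n N (\<lambda>i. D i z) (cx v)" for v
        using sD_eq[of z "cx v"] that by simp
      then show ?thesis using area[OF sD[of z]] that by simp
    qed
    show "continuous_on (cball 0 1) (\<lambda>z. \<kappa> * jac (pull_norm n N (\<lambda>i. D i z)))"
      by (rule continuous_on_mult[OF continuous_on_const cont])
  qed
  finally show "disc_integral (area_jacobian I) N L \<le> disc_integral (area_jacobian I) N \<psi>" .
qed

end
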